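(* Let $\lambda>0$ and let $L$ be a two-sided Lévy process such that the law of $L_1$ is self-decomposable and restricted to the positive half line, with cumulant generating function $\log E(e^{-\theta L_1})=-\int_{0+}^\infty(1-e^{-\theta x})\,\nu(dx)$, where $\nu$ is the Lévy measure, and such that the first two moments of $L_1$ exist. Denote by $\mu$ the first moment and by $V$ the variance of $L_1$. Let $$X_t=\int_{-\infty}^\infty e^{-\lambda|t-u|}\,dL_{\lambda u},$$ let $W$ be a Brownian motion, and consider the stochastic volatility model $dY_t=(\alpha+\beta X_t)\,dt+X_t^{1/2}\,dW_t$ with $\alpha=\beta=0$, i.e. $dY_t=X_t^{1/2}\,dW_t$. Let $\Delta>0$. Define for $t\ge0$ $$r(t)=\lambda te^{-\lambda t}+e^{-\lambda t},\qquad \bar r(t)=\int_0^t\int_0^u r(x)\,dx\,du,$$ and for integers $s\ge1$ $$R(\Delta s)=\bar r(\Delta(s+1))-2\bar r(\Delta s)+\bar r(\Delta(s-1)).$$ Then $$\bar r(t)=\frac1{\lambda^2}\big(\lambda te^{-\lambda t}+2\lambda t+3e^{-\lambda t}-3\big),$$ $$R(\Delta s)=\frac{1}{\lambda^2}e^{-\lambda\Delta s}\Big[(\lambda\Delta s+3)\big(e^{-\lambda\Delta}+e^{\lambda\Delta}-2\big)+\lambda\Delta\big(e^{-\lambda\Delta}-e^{\lambda\Delta}\big)\Big],$$ and for all integers $n,s\ge1$ $$\operatorname{Cov}\left(\int_{(n-1)\Delta}^{n\Delta}X_u\,du,\int_{(n+s-1)\Delta}^{(n+s)\Delta}X_u\,du\right)=V\,R(\Delta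 s),$$ $$\operatorname{Corr}\Big((Y_{n\Delta}-Y_{(n-1)\Delta})^2,(Y_{(n+s)\Delta}-Y_{(n+s-1)\Delta})^2\Big)=\frac{R(\Delta s)}{6\,\bar r(\Delta)+2\Delta^2\frac{\mu^2}{V}}.$$
   Context: The two-sided Lévy process is obtained from two independent copies $L^{(1)},L^{(2)}$ of a Lévy process on $[0,\infty)$ by $L_t=L^{(1)}_t$ for $t\ge0$ and $L_t=-L^{(2)}_{(-t)-}$ for $t<0$; $u\mapsto L_{\lambda u}$ is again a two-sided Lévy process. Integrals of deterministic functions over $\mathbb{R}$ with respect to a two-sided Lévy process $\tilde L$ are meant in the sense of Rajput and Rosinski: with $\Lambda$ the independently scattered random measure on bounded Borel sets associated with $\tilde L$ (so $\Lambda((a,b])=\tilde L_b-\tilde L_a$), a measurable $f$ is integrable if there are step functions $g_n\to f$ Lebesgue-a.e. such that $\lim_n\int_Ag_n\,d\Lambda$ exists in probability for every Borel set $A$, and then $\int_{\mathbb{R}} f\,d\tilde L_s=\lim_n\int_{\mathbb{R}} g_n\,d\Lambda$. The process $X$ is non-negative because of the support of $\nu$; it plays the role of the spot volatility process and $Y$ that of the log-price.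
   Formalization: In the Corr formula μ²/V is corrected to (2μ)²/V, since E X_t = 2μ and Var X_t = V, so the printed constant fails whenever V > 0; W is taken independent of L, as the model intends, and Corr is stated for V > 0, where it is defined. *)

theory Defs
  imports "HOL-Probability.Probability"
begin

section \<open>Covariance, correlation and convergence in probability\<close>

definition square_integrable :: "'a measure \<Rightarrow> ('a \<Rightarrow> real) \<Rightarrow> bool" where
  "square_integrable M X \<longleftrightarrow>
     X \<in> borel_measurable M \<and> integrable M (\<lambda>\<omega>. (X \<omega>)\<^sup>2)"

definition mean :: "'a measure \<Rightarrow> ('a \<Rightarrow> real) \<Rightarrow> real" where
  "mean M X = (LINT \<omega>|M. X \<omega>)"

definition covar :: "'a measure \<Rightarrow> ('a \<Rightarrow> real) \<Rightarrow> ('a \<Rightarrow> real) \<Rightarrow> real" where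
  "covar M X Y = (LINT \<omega>|M. (X \<omega> - mean M X) * (Y \<omega> - mean M Y))"

abbreviation var :: "'a measure \<Rightarrow> ('a \<Rightarrow> real) \<Rightarrow> real" where
  "var M X \<equiv> covar M X X"

text \<open>The following two relations include the existence of the quantity, which an equation
  between total functions would not express (the library integral of a non-integrable function
  is 0, and division by 0 gives 0).\<close>

definition has_covariance ::
    "'a measure \<Rightarrow> ('a \<Rightarrow> real) \<Rightarrow> ('a \<Rightarrow> real) \<Rightarrow> real \<Rightarrow> bool" where
  "has_covariance M X Y c \<longleftrightarrow>
     square_integrable M X \<and> square_integrable M Y \<and> covar M X Y = c"

definition has_correlation ::
    "'a measure \<Rightarrow> ('a \<Rightarrow> real) \<Rightarrow> ('a \<Rightarrow> real) \<Rightarrow> real \<Rightarrow> bool" where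
  "has_correlation M X Y c \<longleftrightarrow>
     square_integrable M X \<and> square_integrable M Y \<and> 0 < var M X \<and> 0 < var M Y \<and>
     covar M X Y / sqrt (var M X * var M Y) = c"

definition conv_in_prob ::
    "'a measure \<Rightarrow> (nat \<Rightarrow> 'a \<Rightarrow> real) \<Rightarrow> ('a \<Rightarrow> real) \<Rightarrow> bool" where
  "conv_in_prob M Z Z' \<longleftrightarrow>
     (\<forall>n. Z n \<in> borel_measurable M) \<and> Z' \<in> borel_measurable M \<and>
     (\<forall>\<epsilon>>0. (\<lambda>n. measure M {\<omega> \<in> space M. \<epsilon> < \<bar>Z n \<omega> - Z' \<omega>\<bar>}) \<longlonglongrightarrow> 0)"

section \<open>Levy processes\<close>

definition levy_process :: "'a measure \<Rightarrow> (real \<Rightarrow> 'a \<Rightarrow> real) \<Rightarrow> bool" where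
  "levy_process M L \<longleftrightarrow>
     (\<forall>t\<ge>0. L t \<in> borel_measurable M) \<and>
     (AE \<omega> in M. L 0 \<omega> = 0) \<and>
     (\<forall>(k::nat) t. 0 \<le> t 0 \<and> (\<forall>i<k. t i \<le> t (Suc i)) \<longrightarrow>
        prob_space.indep_vars M (\<lambda>_. borel) (\<lambda>i \<omega>. L (t (Suc i)) \<omega> - L (t i) \<omega>) {..<k}) \<and>
     (\<forall>t\<ge>0. \<forall>h\<ge>0. distr M borel (\<lambda>\<omega>. L (t + h) \<omega> - L t \<omega>) = distr M borel (L h)) \<and>
     (AE \<omega> in M.
        (\<forall>t\<ge>0. ((\<lambda>s. L s \<omega>) \<longlongrightarrow> L t \<omega>) (at_right t)) \<and>
        (\<forall>t>0. \<exists>l. ((\<lambda>s. L s \<omega>) \<longlongrightarrow> l) (at_left t)))"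

definition path_of :: "real set \<Rightarrow> (real \<Rightarrow> 'a \<Rightarrow> real) \<Rightarrow> 'a \<Rightarrow> real \<Rightarrow> real" where
  "path_of T L \<omega> = (\<lambda>t\<in>T. L t \<omega>)"

abbreviation path_space :: "real set \<Rightarrow> (real \<Rightarrow> real) measure" where
  "path_space T \<equiv> (\<Pi>\<^sub>M t\<in>T. (borel :: real measure))"

text \<open>For \<open>t < 0\<close> the limit clause says \<open>L t = - L2 ((-t)-)\<close>.\<close>

definition two_sided_levy_process :: "'a measure \<Rightarrow> (real \<Rightarrow> 'a \<Rightarrow> real) \<Rightarrow> bool" where
  "two_sided_levy_process M L \<longleftrightarrow>
     (\<forall>t. L t \<in> borel_measurable M) \<and>
     (\<exists>L1 L2. levy_process M L1 \<and> levy_process M L2 \<and>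
        distr M (path_space {0..}) (path_of {0..} L1) = distr M (path_space {0..}) (path_of {0..} L2) \<and>
        prob_space.indep_var M (path_space {0..}) (path_of {0..} L1)
                               (path_space {0..}) (path_of {0..} L2) \<and>
        (AE \<omega> in M.
           (\<forall>t\<ge>0. L t \<omega> = L1 t \<omega>) \<and>
           (\<forall>t<0. ((\<lambda>s. L2 s \<omega>) \<longlongrightarrow> - L t \<omega>) (at_left (- t)))))"

definition self_decomposable :: "real measure \<Rightarrow> bool" where
  "self_decomposable D \<longleftrightarrow>
     (\<forall>c. 0 < c \<and> c < 1 \<longrightarrow>
        (\<exists>\<rho>. real_distribution \<rho> \<and> (\<forall>z. char D z = char D (c * z) * char \<rho> z)))"

definition levy_measure :: "real measure \<Rightarrow> bool" where
  "levy_measure \<nu> \<longleftrightarrow>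
     sets \<nu> = sets borel \<and> emeasure \<nu> {0} = 0 \<and>
     (\<integral>\<^sup>+ x. ennreal (min 1 (x\<^sup>2)) \<partial>\<nu>) < \<infinity>"

definition positive_levy_cgf :: "'a measure \<Rightarrow> ('a \<Rightarrow> real) \<Rightarrow> real measure \<Rightarrow> bool" where
  "positive_levy_cgf M Z \<nu> \<longleftrightarrow>
     levy_measure \<nu> \<and> emeasure \<nu> {..0} = 0 \<and>
     (\<forall>\<theta>\<ge>0. set_integrable \<nu> {0<..} (\<lambda>x. 1 - exp (- \<theta> * x)) \<and>
        ln (LINT \<omega>|M. exp (- \<theta> * Z \<omega>)) = - (LINT x:{0<..}|\<nu>. 1 - exp (- \<theta> * x)))"

section \<open>Integrals of deterministic functions (Rajput and Rosinski)\<close>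

text \<open>The values of the random measure are only relevant on bounded Borel sets.\<close>

definition random_measure_of ::
    "'a measure \<Rightarrow> (real \<Rightarrow> 'a \<Rightarrow> real) \<Rightarrow> (real set \<Rightarrow> 'a \<Rightarrow> real) \<Rightarrow> bool" where
  "random_measure_of M L \<Lambda> \<longleftrightarrow>
     (\<forall>A. A \<in> sets borel \<and> bounded A \<longrightarrow> \<Lambda> A \<in> borel_measurable M) \<and>
     (\<forall>A :: nat \<Rightarrow> real set.
        (\<forall>n. A n \<in> sets borel \<and> bounded (A n)) \<and> disjoint_family A \<longrightarrow>
        prob_space.indep_vars M (\<lambda>_. borel) (\<lambda>n. \<Lambda> (A n)) UNIV \<and>
        (bounded (\<Union>n. A n) \<longrightarrow>
           (AE \<omega> in M. (\<lambda>n. \<Lambda> (A n) \<omega>) sums \<Lambda> (\<Union>n. A n) \<omega>))) \<and>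
     (\<forall>a b. a \<le> b \<longrightarrow> (AE \<omega> in M. \<Lambda> {a<..b} \<omega> = L b \<omega> - L a \<omega>))"

definition step_function :: "(real \<Rightarrow> real) \<Rightarrow> bool" where
  "step_function g \<longleftrightarrow>
     g \<in> borel_measurable borel \<and> finite (range g) \<and> bounded {x. g x \<noteq> 0}"

definition step_integral ::
    "(real set \<Rightarrow> 'a \<Rightarrow> real) \<Rightarrow> real set \<Rightarrow> (real \<Rightarrow> real) \<Rightarrow> 'a \<Rightarrow> real" where
  "step_integral \<Lambda> A g \<omega> = (\<Sum>y \<in> range g - {0}. y * \<Lambda> (A \<inter> g -` {y}) \<omega>)"

text \<open>\<open>has_levy_integral M L f Z\<close>: \<open>f\<close> is integrable over the real line with respect to \<open>L\<close>,
  and \<open>Z\<close> is a version of the integral.\<close>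

definition has_levy_integral ::
    "'a measure \<Rightarrow> (real \<Rightarrow> 'a \<Rightarrow> real) \<Rightarrow> (real \<Rightarrow> real) \<Rightarrow> ('a \<Rightarrow> real) \<Rightarrow> bool" where
  "has_levy_integral M L f Z \<longleftrightarrow>
     f \<in> borel_measurable borel \<and>
     (\<exists>\<Lambda> g. random_measure_of M L \<Lambda> \<and>
        (\<forall>n. step_function (g n)) \<and>
        (AE x in lborel. (\<lambda>n. g n x) \<longlonglongrightarrow> f x) \<and>
        (\<forall>A \<in> sets borel. \<exists>Z'. conv_in_prob M (\<lambda>n. step_integral \<Lambda> A (g n)) Z') \<and>
        conv_in_prob M (\<lambda>n. step_integral \<Lambda> UNIV (g n)) Z)"

section \<open>Brownian motion and the Ito integral\<close>

text \<open>Only the time set \<open>[0,\<infinity>)\<close> matters; the filtrations are indexed by all reals because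
  the library locale \<^locale>\<open>filtration\<close> is stated over an index type.\<close>

definition brownian_motion ::
    "'a measure \<Rightarrow> (real \<Rightarrow> 'a measure) \<Rightarrow> (real \<Rightarrow> 'a \<Rightarrow> real) \<Rightarrow> bool" where
  "brownian_motion M F W \<longleftrightarrow>
     (AE \<omega> in M. W 0 \<omega> = 0) \<and>
     (\<forall>t\<ge>0. W t \<in> borel_measurable (F t)) \<and>
     (\<forall>s t. 0 \<le> s \<and> s < t \<longrightarrow>
        prob_space.indep_set M (sets (F s))
          {(\<lambda>\<omega>. W t \<omega> - W s \<omega>) -` B \<inter> space M | B. B \<in> sets borel} \<and>
        distributed M lborel (\<lambda>\<omega>. W t \<omega> - W s \<omega>) (normal_density 0 (sqrt (t - s)))) \<and>
     (AE \<omega> in M. continuous_on {0..} (\<lambda>t. W t \<omega>))"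

definition progressive :: "(real \<Rightarrow> 'a measure) \<Rightarrow> (real \<Rightarrow> 'a \<Rightarrow> real) \<Rightarrow> bool" where
  "progressive F H \<longleftrightarrow>
     (\<forall>T\<ge>0. (\<lambda>(s, \<omega>). H s \<omega>) \<in> borel_measurable (restrict_space borel {0..T} \<Otimes>\<^sub>M F T))"

definition simple_process ::
    "(real \<Rightarrow> 'a measure) \<Rightarrow> nat \<Rightarrow> (nat \<Rightarrow> real) \<Rightarrow> (nat \<Rightarrow> 'a \<Rightarrow> real) \<Rightarrow> bool" where
  "simple_process F k p \<xi> \<longleftrightarrow>
     0 \<le> p 0 \<and> (\<forall>i<k. p i \<le> p (Suc i)) \<and>
     (\<forall>i<k. \<xi> i \<in> borel_measurable (F (p i)) \<and> (\<exists>C. \<forall>\<omega> \<in> space (F (p i)). \<bar>\<xi> i \<omega>\<bar> \<le> C))"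

definition simple_value ::
    "nat \<Rightarrow> (nat \<Rightarrow> real) \<Rightarrow> (nat \<Rightarrow> 'a \<Rightarrow> real) \<Rightarrow> real \<Rightarrow> 'a \<Rightarrow> real" where
  "simple_value k p \<xi> s \<omega> = (\<Sum>i<k. \<xi> i \<omega> * indicator {p i<..p (Suc i)} s)"

definition simple_ito ::
    "(real \<Rightarrow> 'a \<Rightarrow> real) \<Rightarrow> nat \<Rightarrow> (nat \<Rightarrow> real) \<Rightarrow> (nat \<Rightarrow> 'a \<Rightarrow> real) \<Rightarrow> real \<Rightarrow> 'a \<Rightarrow> real" where
  "simple_ito W k p \<xi> T \<omega> =
     (\<Sum>i<k. \<xi> i \<omega> * (W (min T (p (Suc i))) \<omega> - W (min T (p i)) \<omega>))"

text \<open>\<open>has_ito_integral M F W H T I\<close>: \<open>H\<close> is progressive, almost surely square integrable on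
  \<open>[0,T]\<close>, and \<open>I\<close> is a version of the Ito integral of \<open>H\<close> over \<open>[0,T]\<close>. Square integrability
  follows from the approximation by bounded integrands.\<close>

definition has_ito_integral ::
    "'a measure \<Rightarrow> (real \<Rightarrow> 'a measure) \<Rightarrow> (real \<Rightarrow> 'a \<Rightarrow> real) \<Rightarrow> (real \<Rightarrow> 'a \<Rightarrow> real) \<Rightarrow>
     real \<Rightarrow> ('a \<Rightarrow> real) \<Rightarrow> bool" where
  "has_ito_integral M F W H T I \<longleftrightarrow>
     progressive F H \<and>
     (\<exists>k p \<xi>.
        (\<forall>n. simple_process F (k n) (p n) (\<xi> n)) \<and>
        (\<forall>\<epsilon>>0. (\<lambda>n. measure M {\<omega> \<in> space M. ennreal \<epsilon> <
            (\<integral>\<^sup>+ s \<in> {0..T}. ennreal ((simple_value (k n) (p n) (\<xi> n) s \<omega> - H s \<omega>)\<^sup>2) \<partial>lborel)})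
          \<longlonglongrightarrow> 0) \<and>
        conv_in_prob M (\<lambda>n. simple_ito W (k n) (p n) (\<xi> n) T) I)"

text \<open>\<open>dY = (\<alpha> + \<beta> X) dt + X\<^sup>1\<^sup>/\<^sup>2 dW\<close> on \<open>[0,\<infinity>)\<close>.\<close>

definition stochastic_volatility_model ::
    "'a measure \<Rightarrow> (real \<Rightarrow> 'a measure) \<Rightarrow> (real \<Rightarrow> 'a \<Rightarrow> real) \<Rightarrow> real \<Rightarrow> real \<Rightarrow>
     (real \<Rightarrow> 'a \<Rightarrow> real) \<Rightarrow> (real \<Rightarrow> 'a \<Rightarrow> real) \<Rightarrow> bool" where
  "stochastic_volatility_model M F W \<alpha> \<beta> X Y \<longleftrightarrow>
     (\<forall>t\<ge>0. Y t \<in> borel_measurable M \<and>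
        (AE \<omega> in M. set_integrable lborel {0..t} (\<lambda>u. \<alpha> + \<beta> * X u \<omega>)) \<and>
        (\<exists>I. has_ito_integral M F W (\<lambda>u \<omega>. sqrt (X u \<omega>)) t I \<and>
           (AE \<omega> in M. Y t \<omega> = Y 0 \<omega> + (LBINT u:{0..t}. \<alpha> + \<beta> * X u \<omega>) + I \<omega>)))"

section \<open>The autocorrelation function and its integrals\<close>

definition acf :: "real \<Rightarrow> real \<Rightarrow> real" where
  "acf lam t = lam * t * exp (- lam * t) + exp (- lam * t)"

definition acf_bar :: "real \<Rightarrow> real \<Rightarrow> real" where
  "acf_bar lam t = integral {0..t} (\<lambda>u. integral {0..u} (acf lam))"

text \<open>\<open>acf_diff lam \<Delta> s\<close> is \<open>R(\<Delta> s)\<close>.\<close>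

definition acf_diff :: "real \<Rightarrow> real \<Rightarrow> nat \<Rightarrow> real" where
  "acf_diff lam \<Delta> s =
     acf_bar lam (\<Delta> * (real s + 1)) - 2 * acf_bar lam (\<Delta> * real s) + acf_bar lam (\<Delta> * (real s - 1))"

end

theory Submission
  imports Defs "HOL-Real_Asymp.Real_Asymp"
begin

text \<open>Characteristic functions and a Dynkin class argument show that \<open>\<Lambda>(A)\<close> has the law of
  \<open>L\<close> at time \<open>\<lambda> |A|\<close>, so integrals of step functions are orthogonal up to their means. Because the
  Rajput-Rosinski limits exist over all Borel sets, a gliding hump argument shows that the approximating
  sequence may be replaced by discretizations of the kernel itself, and
  \<open>X t\<close> is a mean-square limit with \<open>E X t = 2 \<mu>\<close> and \<open>Cov (X s, X t) = V r(|t - s|)\<close>. The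
  covariance of integrated volatility follows by Fubini's theorem.

  For the squared returns, a Lenglart inequality makes the Ito integral independent of the
  approximating sequence, so that it is the limit of the Riemann sums with coefficients
  \<open>sqrt X\<close> on dyadic grids. These coefficients are functionals of the path of \<open>L\<close>, hence independent
  of \<open>W\<close>, and the Gaussian moments give \<open>E Z\<^sup>4 = 3 E I\<^sup>2\<close> and \<open>E Z\<^sup>2 Z'\<^sup>2 = E I I'\<close> for the
  returns \<open>Z, Z'\<close> over disjoint periods with integrated volatilities \<open>I, I'\<close>.\<close>

section \<open>The integrated autocorrelation function\<close>

text \<open>Both integrals are given only as limits in probability of unspecified approximations,
  and moments do not pass through such limits. The proof therefore works with explicit sequences
  that are Cauchy in L2 or L4 and identifies their limits afterwards. The rates come from one fact:
  \<open>acf\<close> has no linear term at 0, so X is Lipschitz in mean square. On the Ito side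
  \<open>sqrt X\<close> is unbounded and X is known to have only two moments. This suffices: the
  fourth moment of a Brownian sum with independent coefficients depends on them only through the
  second moment of their summed squares, and (sqrt x - sqrt y)^2 is at most |x - y|. Nonnegativity
  of L bounds first moments of integrals by L1 norms of the integrands and makes moments of L grow
  linearly in time. Constants: the kernel has mass 2/lam and the clock of L runs at speed lam, so X
  has mean 2 mu. With m = 2 mu Delta, a squared return has variance 3 (2 V rbar(Delta) + m^2) - m^2,
  whence the 6 rbar(Delta) and the 2 Delta^2 (2 mu)^2 / V in the correlation.\<close>

definition acf_int :: "real \<Rightarrow> real \<Rightarrow> real" where
  "acf_int lam t = 2 / lam - (t + 2 / lam) * exp (- lam * t)"

text \<open>\<open>acf_int\<close> and \<open>acf_dint\<close> are the first and second
  antiderivatives of \<open>acf\<close> that vanish at 0; the second is the closed form which the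
  theorem claims for \<open>acf_bar\<close>.\<close>

definition acf_dint :: "real \<Rightarrow> real \<Rightarrow> real" where
  "acf_dint lam t = 1 / lam\<^sup>2 * (lam * t * exp (- lam * t) + 2 * lam * t + 3 * exp (- lam * t) - 3)"

lemma DERIV_acf_int:
  assumes "lam > 0"
  shows "(acf_int lam has_real_derivative acf lam t) (at t within S)"
  unfolding acf_int_def acf_def using assms
  by (auto intro!: derivative_eq_intros simp: field_simps)

lemma DERIV_acf_dint:
  assumes "lam > 0"
  shows "(acf_dint lam has_real_derivative acf_int lam t) (at t within S)"
  unfolding acf_int_def acf_dint_def using assms
  by (auto intro!: derivative_eq_intros simp: field_simps power2_eq_square)

lemma acf_int_0 [simp]: "lam > 0 \<Longrightarrow> acf_int lam 0 = 0"
  and acf_dint_0 [simp]: "acf_dint lam 0 = 0"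
  by (auto simp: acf_int_def acf_dint_def)

lemma continuous_on_acf [continuous_intros]: "continuous_on S (acf lam)"
  unfolding acf_def by (intro continuous_intros)

lemma acf_bar_eq:
  assumes "lam > 0" "t \<ge> 0"
  shows "acf_bar lam t = acf_dint lam t"
proof -
  have *: "integral {0..u} (acf lam) = acf_int lam u" if "u \<ge> 0" for u
    using fundamental_theorem_of_calculus[of 0 u "acf_int lam" "acf lam"] that assms
    by (auto simp: has_real_derivative_iff_has_vector_derivative[symmetric] DERIV_acf_int
        intro!: integral_unique)
  have "integral {0..t} (\<lambda>u. integral {0..u} (acf lam)) = integral {0..t} (acf_int lam)"
    by (intro integral_cong) (auto simp: *)
  also have "\<dots> = acf_dint lam t"
    using fundamental_theorem_of_calculus[of 0 t "acf_dint lam" "acf_int lam"] assms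
    by (auto simp: has_real_derivative_iff_has_vector_derivative[symmetric] DERIV_acf_dint
        intro!: integral_unique)
  finally show ?thesis unfolding acf_bar_def .
qed

text \<open>The condition \<open>s \<ge> 1\<close> keeps the last argument nonnegative, which is the
  range where \<open>acf_bar_eq\<close> applies.\<close>

lemma acf_diff_eq_acf_dint:
  assumes "lam > 0" "\<Delta> > 0" "s \<ge> 1"
  shows "acf_diff lam \<Delta> s =
     acf_dint lam (\<Delta> * (real s + 1)) - 2 * acf_dint lam (\<Delta> * real s) + acf_dint lam (\<Delta> * (real s - 1))"
  using assms by (simp add: acf_diff_def acf_bar_eq)

text \<open>The affine part of \<open>acf_dint\<close> cancels in a second difference, so only terms
  with the common factor \<open>exp (- lam * \<Delta> * real s)\<close> remain.\<close>

lemma acf_diff_eq: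
  assumes "lam > 0" "\<Delta> > 0" "s \<ge> 1"
  shows "acf_diff lam \<Delta> s =
            1 / lam\<^sup>2 * exp (- lam * \<Delta> * real s) *
              ((lam * \<Delta> * real s + 3) * (exp (- lam * \<Delta>) + exp (lam * \<Delta>) - 2)
                + lam * \<Delta> * (exp (- lam * \<Delta>) - exp (lam * \<Delta>)))"
proof -
  let ?e = "exp (- lam * \<Delta> * real s)" and ?p = "exp (lam * \<Delta>)" and ?m = "exp (- lam * \<Delta>)"
  have e: "exp (- lam * (\<Delta> * (real s + 1))) = ?e * ?m" "exp (- lam * (\<Delta> * (real s - 1))) = ?e * ?p"
    "exp (- lam * (\<Delta> * real s)) = ?e"
    by (simp_all add: exp_add[symmetric] algebra_simps)
  show ?thesis
    unfolding acf_diff_eq_acf_dint[OF assms] acf_dint_def e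
    using assms by (simp add: algebra_simps)
qed

text \<open>With x = lam t this is (1 + x) exp(-x) against (1 + x)(1 - x). The missing linear term
  is what makes X Lipschitz in mean square and drives every later rate of convergence.\<close>

lemma acf_ge: "lam > 0 \<Longrightarrow> t \<ge> 0 \<Longrightarrow> 1 - (lam * t)\<^sup>2 \<le> acf lam t"
proof -
  assume *: "lam > 0" "t \<ge> 0"
  have "(1 + lam * t) * (1 - lam * t) \<le> (1 + lam * t) * exp (- (lam * t))"
    using * exp_ge_add_one_self[of "- (lam * t)"] by (intro mult_left_mono) auto
  then show ?thesis by (simp add: acf_def algebra_simps power2_eq_square)
qed

section \<open>Integrals of the autocorrelation over intervals and rectangles\<close>

lemma set_integral_acf_later:
  assumes "lam > 0" "a \<le> b" "b \<le> v"
  shows "(LBINT u:{a..b}. acf lam \<bar>u - v\<bar>) = acf_int lam (v - a) - acf_int lam (v - b)"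
proof -
  have "(LBINT u:{a..b}. acf lam \<bar>u - v\<bar>) = (LBINT u:{a..b}. acf lam (v - u))"
    using assms by (intro set_lebesgue_integral_cong) auto
  also have "\<dots> = (\<integral>u. acf lam (v - u) * indicator {a..b} u \<partial>lborel)"
    by (simp add: set_lebesgue_integral_def mult.commute)
  also have "\<dots> = - acf_int lam (v - b) - (- acf_int lam (v - a))"
  proof (rule integral_FTC_Icc_real)
    fix x
    have "((\<lambda>x. - acf_int lam (v - x)) has_real_derivative - (acf lam (v - x) * (0 - 1))) (at x)"
      by (intro DERIV_minus DERIV_chain2[OF DERIV_acf_int] DERIV_diff DERIV_const DERIV_ident assms)
    then show "((\<lambda>x. - acf_int lam (v - x)) has_real_derivative acf lam (v - x)) (at x)" by simp
    show "isCont (\<lambda>x. acf lam (v - x)) x" unfolding acf_def by (intro continuous_intros)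
  qed (use assms in auto)
  finally show ?thesis by simp
qed

lemma set_integral_acf_earlier:
  assumes "lam > 0" "a \<le> b" "v \<le> a"
  shows "(LBINT u:{a..b}. acf lam \<bar>u - v\<bar>) = acf_int lam (b - v) - acf_int lam (a - v)"
proof -
  have "(LBINT u:{a..b}. acf lam \<bar>u - v\<bar>) = (LBINT u:{a..b}. acf lam (u - v))"
    using assms by (intro set_lebesgue_integral_cong) auto
  also have "\<dots> = (\<integral>u. acf lam (u - v) * indicator {a..b} u \<partial>lborel)"
    by (simp add: set_lebesgue_integral_def mult.commute)
  also have "\<dots> = acf_int lam (b - v) - acf_int lam (a - v)"
  proof (rule integral_FTC_Icc_real)
    fix x
    have "((\<lambda>x. acf_int lam (x - v)) has_real_derivative (acf lam (x - v) * (1 - 0))) (at x)"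
      by (intro DERIV_minus DERIV_chain2[OF DERIV_acf_int] DERIV_diff DERIV_const DERIV_ident assms)
    then show "((\<lambda>x. acf_int lam (x - v)) has_real_derivative acf lam (x - v)) (at x)" by simp
    show "isCont (\<lambda>x. acf lam (x - v)) x" unfolding acf_def by (intro continuous_intros)
  qed (use assms in auto)
  finally show ?thesis by simp
qed

lemma set_integrable_acf_abs: "set_integrable lborel {a..b} (\<lambda>u. acf lam \<bar>u - v\<bar>)"
  unfolding acf_def by (intro borel_integrable_atLeastAtMost') (intro continuous_intros)

lemma set_integral_acf_inside:
  assumes "lam > 0" "a \<le> v" "v \<le> b"
  shows "(LBINT u:{a..b}. acf lam \<bar>u - v\<bar>) = acf_int lam (v - a) + acf_int lam (b - v)"
proof -
  have "(LBINT u:{a..b}. acf lam \<bar>u - v\<bar>) = (LBINT u:{a..v} \<union> {v<..b}. acf lam \<bar>u - v\<bar>)"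
    using assms by (auto simp: ivl_disj_un)
  also have "\<dots> = (LBINT u:{a..v}. acf lam \<bar>u - v\<bar>) + (LBINT u:{v<..b}. acf lam \<bar>u - v\<bar>)"
    by (intro set_integral_Un) (auto intro: set_integrable_acf_abs set_integrable_subset[OF set_integrable_acf_abs[of v b]])
  also have "(LBINT u:{v<..b}. acf lam \<bar>u - v\<bar>) = (LBINT u:{v..b}. acf lam \<bar>u - v\<bar>)"
  proof (rule set_integral_cong_set)
    show "AE x in lborel. (x \<in> {v..b}) = (x \<in> {v<..b})"
      using AE_lborel_singleton[of v] by eventually_elim auto
  qed (auto simp: set_borel_measurable_def acf_def)
  finally show ?thesis
    using set_integral_acf_later[of lam a v v] set_integral_acf_earlier[of lam v b v] assms by simp
qed

lemma set_integral_acf_int: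
  assumes "lam > 0" "a \<le> b"
  shows "(LBINT v:{a..b}. acf_int lam (v - c)) = acf_dint lam (b - c) - acf_dint lam (a - c)"
    and "(LBINT v:{a..b}. acf_int lam (c - v)) = acf_dint lam (c - a) - acf_dint lam (c - b)"
    and "set_integrable lborel {a..b} (\<lambda>v. acf_int lam (v - c))"
    and "set_integrable lborel {a..b} (\<lambda>v. acf_int lam (c - v))"
proof -
  have "(LBINT v:{a..b}. acf_int lam (v - c)) = (\<integral>u. acf_int lam (u - c) * indicator {a..b} u \<partial>lborel)"
    by (simp add: set_lebesgue_integral_def mult.commute)
  also have "\<dots> = acf_dint lam (b - c) - acf_dint lam (a - c)"
  proof (rule integral_FTC_Icc_real)
    fix x
    have "((\<lambda>x. acf_dint lam (x - c)) has_real_derivative (acf_int lam (x - c) * (1 - 0))) (at x)"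
      by (intro DERIV_minus DERIV_chain2[OF DERIV_acf_dint] DERIV_diff DERIV_const DERIV_ident assms)
    then show "((\<lambda>x. acf_dint lam (x - c)) has_real_derivative acf_int lam (x - c)) (at x)" by simp
    show "isCont (\<lambda>x. acf_int lam (x - c)) x" unfolding acf_int_def by (intro continuous_intros)
  qed (use assms in auto)
  finally show "(LBINT v:{a..b}. acf_int lam (v - c)) = acf_dint lam (b - c) - acf_dint lam (a - c)" .
  have "(LBINT v:{a..b}. acf_int lam (c - v)) = (\<integral>u. acf_int lam (c - u) * indicator {a..b} u \<partial>lborel)"
    by (simp add: set_lebesgue_integral_def mult.commute)
  also have "\<dots> = - acf_dint lam (c - b) - (- acf_dint lam (c - a))"
  proof (rule integral_FTC_Icc_real)
    fix x
    have "((\<lambda>x. - acf_dint lam (c - x)) has_real_derivative - (acf_int lam (c - x) * (0 - 1))) (at x)"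
      by (intro DERIV_minus DERIV_chain2[OF DERIV_acf_dint] DERIV_diff DERIV_const DERIV_ident assms)
    then show "((\<lambda>x. - acf_dint lam (c - x)) has_real_derivative acf_int lam (c - x)) (at x)" by simp
    show "isCont (\<lambda>x. acf_int lam (c - x)) x" unfolding acf_int_def by (intro continuous_intros)
  qed (use assms in auto)
  finally show "(LBINT v:{a..b}. acf_int lam (c - v)) = acf_dint lam (c - a) - acf_dint lam (c - b)" by simp
  show "set_integrable lborel {a..b} (\<lambda>v. acf_int lam (v - c))"
    "set_integrable lborel {a..b} (\<lambda>v. acf_int lam (c - v))"
    unfolding acf_int_def by (intro borel_integrable_atLeastAtMost' continuous_intros)+
qed

text \<open>The triangles u < v and u > v contribute \<open>acf_dint lam (b - a)\<close> each. This
  is the factor 2 in the variance of the integrated volatility.\<close>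

lemma double_integral_acf_same:
  assumes "lam > 0" "a \<le> b"
  shows "(LBINT v:{a..b}. LBINT u:{a..b}. acf lam \<bar>u - v\<bar>) = 2 * acf_dint lam (b - a)"
proof -
  have "(LBINT v:{a..b}. LBINT u:{a..b}. acf lam \<bar>u - v\<bar>) =
      (LBINT v:{a..b}. acf_int lam (v - a) + acf_int lam (b - v))"
    using assms by (intro set_lebesgue_integral_cong) (auto simp: set_integral_acf_inside)
  then show ?thesis
    using assms by (simp add: set_integral_add set_integral_acf_int)
qed

text \<open>For two periods of length \<open>\<Delta>\<close> that are \<open>s\<close> periods
  apart, the two middle terms coincide and the four values form the second difference
  \<open>acf_diff\<close>.\<close>

lemma double_integral_acf_later:
  assumes "lam > 0" "a \<le> b" "b \<le> c" "c \<le> d"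
  shows "(LBINT v:{c..d}. LBINT u:{a..b}. acf lam \<bar>u - v\<bar>) =
    acf_dint lam (d - a) - acf_dint lam (c - a) - (acf_dint lam (d - b) - acf_dint lam (c - b))"
proof -
  have "(LBINT v:{c..d}. LBINT u:{a..b}. acf lam \<bar>u - v\<bar>) =
      (LBINT v:{c..d}. acf_int lam (v - a) - acf_int lam (v - b))"
    using assms by (intro set_lebesgue_integral_cong) (auto simp: set_integral_acf_later)
  then show ?thesis
    using assms by (simp add: set_integral_diff set_integral_acf_int)
qed

section \<open>Mass and overlap of the exponential kernel\<close>

lemma has_bochner_integral_exp_tail:
  assumes "c > (0::real)"
  shows "has_bochner_integral lborel (\<lambda>u. indicator {a..} u * exp (- c * (u - a))) (1 / c)"
proof -
  have "(\<integral>\<^sup>+u. ennreal (exp (- c * (u - a))) * indicator {a..} u \<partial>lborel) = ennreal (0 - (- exp (- c * (a - a)) / c))"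
  proof (rule nn_integral_FTC_atLeast[where F = "\<lambda>u. - exp (- c * (u - a)) / c"])
    show "((\<lambda>u. - exp (- c * (u - a)) / c) \<longlongrightarrow> 0) at_top"
      using assms by real_asymp
    fix x show "((\<lambda>u. - exp (- c * (u - a)) / c) has_real_derivative exp (- c * (x - a))) (at x)"
      using assms by (auto intro!: derivative_eq_intros)
  qed auto
  moreover have "ennreal (exp (- c * (u - a))) * indicator {a..} u = ennreal (indicator {a..} u * exp (- c * (u - a)))" for u
    by (auto split: split_indicator)
  ultimately have "(\<integral>\<^sup>+u. ennreal (indicator {a..} u * exp (- c * (u - a))) \<partial>lborel) = ennreal (1 / c)"
    by simp
  then show ?thesis
    using assms by (intro has_bochner_integral_nn_integral) auto
qed

lemma has_bochner_integral_exp_head: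
  assumes "c > (0::real)"
  shows "has_bochner_integral lborel (\<lambda>u. indicator {..a} u * exp (- c * (a - u))) (1 / c)"
proof -
  have "has_bochner_integral lborel (\<lambda>x. indicator {-a..} (0 + (-1) * x) * exp (- c * (0 + (-1) * x - (- a)))) ((1 / c) /\<^sub>R \<bar>-1\<bar>)"
    using lborel_has_bochner_integral_real_affine_iff[of "-1" "\<lambda>u. indicator {-a..} u * exp (- c * (u - (-a)))" "1/c" 0]
      has_bochner_integral_exp_tail[OF assms, of "-a"] by simp
  moreover have "indicator {-a..} (0 + (-1) * x) = (indicator {..a} x :: real)" for x by (auto simp: indicator_def)
  ultimately show ?thesis by (simp add: algebra_simps)
qed

text \<open>Left of \<open>s\<close> and right of \<open>t\<close> the product is an exponential
  tail of rate 2c, each contributing exp(-c(t - s)) / (2c); between them it is constant. Multiplied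
  by \<open>c\<close> the value is \<open>acf c (t - s)\<close>, which is where the autocorrelation
  r comes from.\<close>

lemma has_bochner_integral_kernel_product:
  assumes "c > (0::real)" "s \<le> t"
  shows "has_bochner_integral lborel (\<lambda>u. exp (- c * \<bar>s - u\<bar>) * exp (- c * \<bar>t - u\<bar>))
    ((1 / c + (t - s)) * exp (- c * (t - s)))"
proof -
  let ?e = "exp (- c * (t - s))"
  have mid: "has_bochner_integral lborel (\<lambda>u. indicator {s..t} u * ?e) (measure lborel {s..t} * ?e)"
    by (intro has_bochner_integral_mult_left has_bochner_integral_real_indicator) (use assms in auto)
  have "has_bochner_integral lborel (\<lambda>u. ?e * (indicator {..s} u * exp (- (2 * c) * (s - u)))
      + indicator {s..t} u * ?e + ?e * (indicator {t..} u * exp (- (2 * c) * (u - t))))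
      (?e * (1 / (2 * c)) + measure lborel {s..t} * ?e + ?e * (1 / (2 * c)))"
    using assms by (intro has_bochner_integral_add has_bochner_integral_mult_right mid
      has_bochner_integral_exp_head has_bochner_integral_exp_tail) auto
  also have "(?e * (1 / (2 * c)) + measure lborel {s..t} * ?e + ?e * (1 / (2 * c))) = (1 / c + (t - s)) * ?e"
    using assms by (simp add: field_simps)
  finally show ?thesis
  proof (rule has_bochner_integral_cong_AE[THEN iffD1, rotated -1])
    \<comment> \<open>The three pieces overlap at \<open>s\<close> and at \<open>t\<close>, so the
      identity can fail there and is claimed almost everywhere only.\<close>
    show "AE u in lborel. ?e * (indicator {..s} u * exp (- (2 * c) * (s - u)))
      + indicator {s..t} u * ?e + ?e * (indicator {t..} u * exp (- (2 * c) * (u - t))) =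
        exp (- c * \<bar>s - u\<bar>) * exp (- c * \<bar>t - u\<bar>)"
      using AE_lborel_singleton[of s] AE_lborel_singleton[of t]
    proof eventually_elim
      case (elim u)
      consider "u < s" | "s < u" "u < t" | "t < u" using elim by linarith
      then show ?case
        using assms by cases (auto simp: exp_add[symmetric] algebra_simps)
    qed
  qed auto
qed

text \<open>The kernel of rate \<open>c\<close> is the square of the kernel of rate
  \<open>c / 2\<close>, so this is the overlap formula with coinciding centres.\<close>

lemma has_bochner_integral_kernel:
  assumes "c > (0::real)"
  shows "has_bochner_integral lborel (\<lambda>u. exp (- c * \<bar>t - u\<bar>)) (2 / c)"
  using has_bochner_integral_kernel_product[of "c / 2" t t] assms
  by (simp add: exp_add[symmetric])

section \<open>Mean-square convergence and convergence in probability\<close>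

lemma Cauchy_Schwarz_integral:
  fixes f g :: "'a \<Rightarrow> real"
  assumes [measurable]: "f \<in> borel_measurable M" "g \<in> borel_measurable M"
    and f: "integrable M (\<lambda>x. (f x)\<^sup>2)" and g: "integrable M (\<lambda>x. (g x)\<^sup>2)"
  shows "integrable M (\<lambda>x. f x * g x)" "(\<integral>x. \<bar>f x * g x\<bar> \<partial>M)\<^sup>2 \<le> (\<integral>x. (f x)\<^sup>2 \<partial>M) * (\<integral>x. (g x)\<^sup>2 \<partial>M)"
    "(\<integral>x. f x * g x \<partial>M)\<^sup>2 \<le> (\<integral>x. (f x)\<^sup>2 \<partial>M) * (\<integral>x. (g x)\<^sup>2 \<partial>M)"
proof -
  have am: "\<bar>a * b\<bar> \<le> a\<^sup>2 + b\<^sup>2" for a b :: real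
  proof -
    have "2 * (\<bar>a\<bar> * \<bar>b\<bar>) \<le> a\<^sup>2 + b\<^sup>2"
      using zero_le_power2[of "\<bar>a\<bar> - \<bar>b\<bar>"] by (simp add: power2_diff)
    then show ?thesis unfolding abs_mult using mult_nonneg_nonneg[of "\<bar>a\<bar>" "\<bar>b\<bar>"] by linarith
  qed
  show I: "integrable M (\<lambda>x. f x * g x)"
    by (rule Bochner_Integration.integrable_bound[OF Bochner_Integration.integrable_add[OF f g]])
      (auto intro!: AE_I2 am[THEN order_trans])
  let ?A = "\<integral>x. (f x)\<^sup>2 \<partial>M" and ?B = "\<integral>x. (g x)\<^sup>2 \<partial>M" and ?C = "\<integral>x. \<bar>f x * g x\<bar> \<partial>M"
  have q: "0 \<le> ?A * t\<^sup>2 - 2 * ?C * t + ?B" for t :: real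
  proof -
    have "0 \<le> (\<integral>x. (t * \<bar>f x\<bar> - \<bar>g x\<bar>)\<^sup>2 \<partial>M)" by simp
    also have "\<dots> = (\<integral>x. t\<^sup>2 * (f x)\<^sup>2 - 2 * t * \<bar>f x * g x\<bar> + (g x)\<^sup>2 \<partial>M)"
      by (intro Bochner_Integration.integral_cong refl)
        (auto simp: power2_diff power_mult_distrib abs_mult)
    also have "\<dots> = t\<^sup>2 * ?A - 2 * t * ?C + ?B"
      using f g I by simp
    finally show ?thesis by (simp add: mult_ac)
  qed
  have nn: "0 \<le> ?A" "0 \<le> ?B" by simp_all
  show C: "?C\<^sup>2 \<le> ?A * ?B"
  proof (cases "?A = 0")
    case True
    have "AE x in M. (f x)\<^sup>2 = 0"
      using True integral_nonneg_eq_0_iff_AE[OF f] by simp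
    then have "?C = (\<integral>x. 0 \<partial>M)" by (intro integral_cong_AE) auto
    then show ?thesis using True by simp
  next
    case False
    then have "?A > 0" using nn by linarith
    then show ?thesis
      using q[of "?C / ?A"] by (simp add: field_simps power2_eq_square)
  qed
  have "\<bar>\<integral>x. f x * g x \<partial>M\<bar> \<le> ?C" by (rule integral_abs_bound)
  then have "(\<integral>x. f x * g x \<partial>M)\<^sup>2 \<le> ?C\<^sup>2" by (metis abs_ge_zero power2_abs power_mono)
  with C show "(\<integral>x. f x * g x \<partial>M)\<^sup>2 \<le> ?A * ?B" by linarith
qed

lemma square_integrableD:
  assumes "square_integrable M X"
  shows "X \<in> borel_measurable M" "integrable M (\<lambda>\<omega>. (X \<omega>)\<^sup>2)"
  using assms by (auto simp: square_integrable_def)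

lemma square_integrable_mult:
  "square_integrable M X \<Longrightarrow> square_integrable M Y \<Longrightarrow> integrable M (\<lambda>\<omega>. X \<omega> * Y \<omega>)"
  by (intro Cauchy_Schwarz_integral) (auto simp: square_integrable_def)

lemma square_integrable_scale:
  "square_integrable M X \<Longrightarrow> square_integrable M (\<lambda>\<omega>. c * X \<omega>)"
  by (auto simp: square_integrable_def power_mult_distrib)

lemma square_integrable_add:
  assumes "square_integrable M X" "square_integrable M Y"
  shows "square_integrable M (\<lambda>\<omega>. X \<omega> + Y \<omega>)"
  using assms square_integrable_mult[OF assms]
  by (auto simp: square_integrable_def power2_sum mult.assoc)

lemma square_integrable_diff:
  assumes "square_integrable M X" "square_integrable M Y"
  shows "square_integrable M (\<lambda>\<omega>. X \<omega> - Y \<omega>)"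
  using square_integrable_add[OF assms(1) square_integrable_scale[OF assms(2), of "-1"]] by simp

lemma square_integrable_cong_AE:
  assumes "square_integrable M X" "Y \<in> borel_measurable M" "AE \<omega> in M. X \<omega> = Y \<omega>"
  shows "square_integrable M Y"
  using assms unfolding square_integrable_def
  by (auto intro!: integrable_cong_AE_imp[of M "\<lambda>\<omega>. (X \<omega>)\<^sup>2"])

lemma (in finite_measure) square_integrable_const: "square_integrable M (\<lambda>_. c)"
  by (auto simp: square_integrable_def)

lemma square_integrable_sum:
  assumes "\<And>i. i \<in> I \<Longrightarrow> square_integrable M (X i)"
  shows "square_integrable M (\<lambda>\<omega>. \<Sum>i\<in>I. X i \<omega>)"
proof (cases "finite I")
  case True
  then show ?thesis using assms
    by (induction I rule: finite_induct) (auto intro!: square_integrable_add simp: square_integrable_def[of _ "\<lambda>_. 0"])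
qed (auto simp: square_integrable_def)

lemma (in finite_measure) square_integrable_imp_integrable:
  "square_integrable M X \<Longrightarrow> integrable M X"
  using square_integrable_mult[OF _ square_integrable_const[of 1]] by simp

lemma (in prob_space) abs_expectation_le_sqrt:
  assumes "square_integrable M X"
  shows "(\<integral>\<omega>. \<bar>X \<omega>\<bar> \<partial>M) \<le> sqrt (\<integral>\<omega>. (X \<omega>)\<^sup>2 \<partial>M)"
  using Cauchy_Schwarz_integral(2)[of X M "\<lambda>_. 1"] assms
  by (auto simp: square_integrable_def prob_space intro: real_le_rsqrt)

section \<open>Limits in mean square\<close>

definition l2_tendsto :: "'a measure \<Rightarrow> (nat \<Rightarrow> 'a \<Rightarrow> real) \<Rightarrow> ('a \<Rightarrow> real) \<Rightarrow> bool" where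
  "l2_tendsto M U u \<longleftrightarrow> (\<forall>n. square_integrable M (U n)) \<and> square_integrable M u \<and>
     (\<lambda>n. \<integral>\<omega>. (U n \<omega> - u \<omega>)\<^sup>2 \<partial>M) \<longlonglongrightarrow> 0"

lemma tendsto_of_square_le:
  fixes a :: "nat \<Rightarrow> real"
  assumes "\<And>n. (a n - l)\<^sup>2 \<le> b n" "b \<longlonglongrightarrow> 0"
  shows "a \<longlonglongrightarrow> l"
proof -
  have "(\<lambda>n. (a n - l)\<^sup>2) \<longlonglongrightarrow> 0"
    by (rule tendsto_sandwich[OF _ _ tendsto_const assms(2)]) (auto simp: assms)
  then have "(\<lambda>n. sqrt ((a n - l)\<^sup>2)) \<longlonglongrightarrow> sqrt 0" by (rule tendsto_real_sqrt)
  then show ?thesis by (simp add: LIM_zero_iff tendsto_rabs_zero_iff)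
qed

text \<open>Expanding around the limits leaves three error terms, each containing a factor
  \<open>U n - u\<close> or \<open>V n - v\<close>, and Cauchy-Schwarz kills them. All second
  moments and covariances of limits below are obtained through this lemma.\<close>

lemma l2_tendsto_mult:
  assumes U: "l2_tendsto M U u" and V: "l2_tendsto M V v"
  shows "(\<lambda>n. \<integral>\<omega>. U n \<omega> * V n \<omega> \<partial>M) \<longlonglongrightarrow> (\<integral>\<omega>. u \<omega> * v \<omega> \<partial>M)"
proof -
  have si: "square_integrable M (U n)" "square_integrable M (V n)" "square_integrable M u" "square_integrable M v" for n
    using U V by (auto simp: l2_tendsto_def)
  have c1: "(\<lambda>n. \<integral>\<omega>. (U n \<omega> - u \<omega>) * x \<omega> \<partial>M) \<longlonglongrightarrow> 0" if x: "square_integrable M x" and "l2_tendsto M U u" for x U u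
  proof (rule tendsto_of_square_le)
    fix n show "((\<integral>\<omega>. (U n \<omega> - u \<omega>) * x \<omega> \<partial>M) - 0)\<^sup>2 \<le> (\<integral>\<omega>. (U n \<omega> - u \<omega>)\<^sup>2 \<partial>M) * (\<integral>\<omega>. (x \<omega>)\<^sup>2 \<partial>M)"
      using Cauchy_Schwarz_integral(3)[OF square_integrableD(1)[OF square_integrable_diff] square_integrableD(1)[OF x]
          square_integrableD(2)[OF square_integrable_diff] square_integrableD(2)[OF x], of "U n" u] that
      by (auto simp: l2_tendsto_def)
    show "(\<lambda>n. (\<integral>\<omega>. (U n \<omega> - u \<omega>)\<^sup>2 \<partial>M) * (\<integral>\<omega>. (x \<omega>)\<^sup>2 \<partial>M)) \<longlonglongrightarrow> 0"
      using that by (auto simp: l2_tendsto_def intro!: tendsto_mult_left_zero)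
  qed
  have c2: "(\<lambda>n. \<integral>\<omega>. (U n \<omega> - u \<omega>) * (V n \<omega> - v \<omega>) \<partial>M) \<longlonglongrightarrow> 0"
  proof (rule tendsto_of_square_le)
    fix n show "((\<integral>\<omega>. (U n \<omega> - u \<omega>) * (V n \<omega> - v \<omega>) \<partial>M) - 0)\<^sup>2 \<le> (\<integral>\<omega>. (U n \<omega> - u \<omega>)\<^sup>2 \<partial>M) * (\<integral>\<omega>. (V n \<omega> - v \<omega>)\<^sup>2 \<partial>M)"
      using Cauchy_Schwarz_integral(3)[of "\<lambda>\<omega>. U n \<omega> - u \<omega>" M "\<lambda>\<omega>. V n \<omega> - v \<omega>"]
        square_integrable_diff[OF si(1,3)] square_integrable_diff[OF si(2,4)]
      by (auto simp: square_integrable_def)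
    show "(\<lambda>n. (\<integral>\<omega>. (U n \<omega> - u \<omega>)\<^sup>2 \<partial>M) * (\<integral>\<omega>. (V n \<omega> - v \<omega>)\<^sup>2 \<partial>M)) \<longlonglongrightarrow> 0"
      using U V tendsto_mult[of _ 0 _ _ 0] by (fastforce simp: l2_tendsto_def)
  qed
  have "(\<lambda>n. (\<integral>\<omega>. (U n \<omega> - u \<omega>) * (V n \<omega> - v \<omega>) \<partial>M) + (\<integral>\<omega>. (U n \<omega> - u \<omega>) * v \<omega> \<partial>M) + (\<integral>\<omega>. (V n \<omega> - v \<omega>) * u \<omega> \<partial>M)
     + (\<integral>\<omega>. u \<omega> * v \<omega> \<partial>M)) \<longlonglongrightarrow> 0 + 0 + 0 + (\<integral>\<omega>. u \<omega> * v \<omega> \<partial>M)"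
    by (intro tendsto_add tendsto_const c1 c2 U V si)
  moreover have "(\<integral>\<omega>. (U n \<omega> - u \<omega>) * (V n \<omega> - v \<omega>) \<partial>M) + (\<integral>\<omega>. (U n \<omega> - u \<omega>) * v \<omega> \<partial>M) + (\<integral>\<omega>. (V n \<omega> - v \<omega>) * u \<omega> \<partial>M)
     + (\<integral>\<omega>. u \<omega> * v \<omega> \<partial>M) = (\<integral>\<omega>. U n \<omega> * V n \<omega> \<partial>M)" for n
  proof -
    note i = square_integrable_mult
    note d = square_integrable_diff
    have "(\<integral>\<omega>. (U n \<omega> - u \<omega>) * (V n \<omega> - v \<omega>) \<partial>M) + (\<integral>\<omega>. (U n \<omega> - u \<omega>) * v \<omega> \<partial>M) + (\<integral>\<omega>. (V n \<omega> - v \<omega>) * u \<omega> \<partial>M)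
     + (\<integral>\<omega>. u \<omega> * v \<omega> \<partial>M) = (\<integral>\<omega>. (U n \<omega> - u \<omega>) * (V n \<omega> - v \<omega>) + (U n \<omega> - u \<omega>) * v \<omega> + (V n \<omega> - v \<omega>) * u \<omega> + u \<omega> * v \<omega> \<partial>M)"
      by (subst Bochner_Integration.integral_add | intro Bochner_Integration.integrable_add i d si refl)+
    then show ?thesis by (simp add: algebra_simps)
  qed
  ultimately show ?thesis by simp
qed

lemma (in prob_space) l2_tendsto_const: "square_integrable M u \<Longrightarrow> l2_tendsto M (\<lambda>_. u) u"
  by (simp add: l2_tendsto_def)

lemma (in prob_space) l2_tendsto_mean:
  assumes "l2_tendsto M U u"
  shows "(\<lambda>n. \<integral>\<omega>. U n \<omega> \<partial>M) \<longlonglongrightarrow> (\<integral>\<omega>. u \<omega> \<partial>M)"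
  using l2_tendsto_mult[OF assms l2_tendsto_const[OF square_integrable_const, of 1]] by simp

section \<open>Convergence in probability\<close>

lemma (in prob_space) integrable_min_1:
  "Z \<in> borel_measurable M \<Longrightarrow> integrable M (\<lambda>\<omega>. min 1 \<bar>Z \<omega>\<bar> :: real)"
  by (intro integrable_const_bound[where B=1]) auto

text \<open>Replaces the family of tail probabilities by one expectation, the usual metric of
  convergence in probability. Later limits can then be obtained by domination, and an almost surely
  convergent subsequence by the L1 result of the library.\<close>

lemma (in prob_space) conv_in_prob_iff:
  "conv_in_prob M Z Z' \<longleftrightarrow> (\<forall>n. Z n \<in> borel_measurable M) \<and> Z' \<in> borel_measurable M \<and>
     (\<lambda>n. \<integral>\<omega>. min 1 \<bar>Z n \<omega> - Z' \<omega>\<bar> \<partial>M) \<longlonglongrightarrow> 0"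
proof (cases "(\<forall>n. Z n \<in> borel_measurable M) \<and> Z' \<in> borel_measurable M")
  case True
  then have [measurable]: "\<And>n. Z n \<in> borel_measurable M" "Z' \<in> borel_measurable M" by auto
  let ?E = "\<lambda>n. \<integral>\<omega>. min 1 \<bar>Z n \<omega> - Z' \<omega>\<bar> \<partial>M"
  let ?P = "\<lambda>\<epsilon> n. measure M {\<omega> \<in> space M. \<epsilon> < \<bar>Z n \<omega> - Z' \<omega>\<bar>}"
  have le1: "?E n \<le> \<epsilon> + ?P \<epsilon> n" if "\<epsilon> > 0" for \<epsilon> n
  proof -
    have "?E n \<le> (\<integral>\<omega>. \<epsilon> + indicator {\<omega> \<in> space M. \<epsilon> < \<bar>Z n \<omega> - Z' \<omega>\<bar>} \<omega> \<partial>M)"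
      using that by (intro integral_mono integrable_min_1 Bochner_Integration.integrable_add) (auto split: split_indicator simp: less_top[symmetric])
    also have "\<dots> = \<epsilon> + ?P \<epsilon> n"
      by (subst Bochner_Integration.integral_add) (auto simp: prob_space less_top[symmetric])
    finally show ?thesis .
  qed
  have le2: "?P \<epsilon> n \<le> ?E n / min \<epsilon> 1" if "\<epsilon> > 0" for \<epsilon> n
  proof -
    have "?P \<epsilon> n = (\<integral>\<omega>. indicator {\<omega> \<in> space M. \<epsilon> < \<bar>Z n \<omega> - Z' \<omega>\<bar>} \<omega> \<partial>M)" by simp
    also have "\<dots> \<le> (\<integral>\<omega>. min 1 \<bar>Z n \<omega> - Z' \<omega>\<bar> / min \<epsilon> 1 \<partial>M)"
      using that by (intro integral_mono integrable_min_1 integrable_divide) (auto split: split_indicator simp: less_top[symmetric] min_def)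
    finally show ?thesis by simp
  qed
  have "(\<forall>\<epsilon>>0. ?P \<epsilon> \<longlonglongrightarrow> 0) \<longleftrightarrow> ?E \<longlonglongrightarrow> 0"
  proof safe
    assume *: "\<forall>\<epsilon>>0. ?P \<epsilon> \<longlonglongrightarrow> 0"
    show "?E \<longlonglongrightarrow> 0"
    proof (rule LIMSEQ_I)
      fix r :: real assume "0 < r"
      then have "eventually (\<lambda>n. ?P (r / 2) n < r / 2) sequentially"
        using *[rule_format, of "r / 2"] order_tendstoD(2)[of "?P (r / 2)" 0 sequentially "r / 2"] by simp
      then obtain N where N: "\<And>n. n \<ge> N \<Longrightarrow> ?P (r / 2) n < r / 2" by (auto simp: eventually_sequentially)
      have "norm (?E n - 0) < r" if "n \<ge> N" for n
        using le1[of "r/2" n] N[OF that] \<open>0 < r\<close> by simp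
      then show "\<exists>no. \<forall>n\<ge>no. norm (?E n - 0) < r" by blast
    qed
  next
    fix \<epsilon> :: real assume "\<epsilon> > 0" and *: "?E \<longlonglongrightarrow> 0"
    show "?P \<epsilon> \<longlonglongrightarrow> 0"
    proof (rule tendsto_sandwich[OF _ _ tendsto_const])
      show "(\<lambda>n. ?E n / min \<epsilon> 1) \<longlonglongrightarrow> 0"
        using tendsto_divide[OF * tendsto_const, of "min \<epsilon> 1"] \<open>\<epsilon> > 0\<close> by simp
    qed (use le2 \<open>\<epsilon> > 0\<close> in auto)
  qed
  then show ?thesis using True by (simp add: conv_in_prob_def)
qed (auto simp: conv_in_prob_def)

lemma (in prob_space) conv_in_prob_AE_subseq:
  assumes "conv_in_prob M Z Z'"
  shows "\<exists>r::nat\<Rightarrow>nat. strict_mono r \<and> (AE \<omega> in M. (\<lambda>n. Z (r n) \<omega>) \<longlonglongrightarrow> Z' \<omega>)"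
proof -
  have [measurable]: "\<And>n. Z n \<in> borel_measurable M" "Z' \<in> borel_measurable M"
    using assms by (auto simp: conv_in_prob_iff)
  obtain r :: "nat \<Rightarrow> nat" where r: "strict_mono r" "AE \<omega> in M. (\<lambda>n. min 1 \<bar>Z (r n) \<omega> - Z' \<omega>\<bar>) \<longlonglongrightarrow> 0"
    using tendsto_L1_AE_subseq[of M "\<lambda>n \<omega>. min 1 \<bar>Z n \<omega> - Z' \<omega>\<bar>"] assms
    by (auto simp: conv_in_prob_iff integrable_min_1)
  from r(2) have "AE \<omega> in M. (\<lambda>n. Z (r n) \<omega>) \<longlonglongrightarrow> Z' \<omega>"
  proof eventually_elim
    case (elim \<omega>)
    have "eventually (\<lambda>n. min 1 \<bar>Z (r n) \<omega> - Z' \<omega>\<bar> < 1) sequentially"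
      using elim by (rule order_tendstoD) auto
    then have "eventually (\<lambda>n. min 1 \<bar>Z (r n) \<omega> - Z' \<omega>\<bar> = \<bar>Z (r n) \<omega> - Z' \<omega>\<bar>) sequentially"
      by eventually_elim auto
    then have "(\<lambda>n. \<bar>Z (r n) \<omega> - Z' \<omega>\<bar>) \<longlonglongrightarrow> 0"
      using elim by (rule Lim_transform_eventually[rotated])
    then show ?case by (simp add: tendsto_rabs_zero_iff LIM_zero_iff)
  qed
  with r show ?thesis by blast
qed

lemma conv_in_prob_subseq:
  "conv_in_prob M Z Z' \<Longrightarrow> strict_mono (r :: nat \<Rightarrow> nat) \<Longrightarrow> conv_in_prob M (\<lambda>n. Z (r n)) Z'"
  using LIMSEQ_subseq_LIMSEQ[of _ 0 r] by (auto simp: conv_in_prob_def o_def)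

text \<open>The function \<open>min 1 \<bar>x\<bar>\<close> is monotone in the absolute value and
  subadditive. Two dominating sequences are allowed so that differences and almost sure
  modifications are both special cases.\<close>

lemma (in prob_space) conv_in_prob_dominated:
  assumes Z: "conv_in_prob M Z Z'" and [measurable]: "\<And>n. U n \<in> borel_measurable M" "u \<in> borel_measurable M"
    and V: "conv_in_prob M V V'"
    and le: "\<And>n. AE \<omega> in M. \<bar>U n \<omega> - u \<omega>\<bar> \<le> \<bar>Z n \<omega> - Z' \<omega>\<bar> + \<bar>V n \<omega> - V' \<omega>\<bar>"
  shows "conv_in_prob M U u"
proof -
  have [measurable]: "\<And>n. Z n \<in> borel_measurable M" "Z' \<in> borel_measurable M" "\<And>n. V n \<in> borel_measurable M" "V' \<in> borel_measurable M"
    using Z V by (auto simp: conv_in_prob_def)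
  have "(\<lambda>n. \<integral>\<omega>. min 1 \<bar>U n \<omega> - u \<omega>\<bar> \<partial>M) \<longlonglongrightarrow> 0"
  proof (rule tendsto_sandwich[OF _ _ tendsto_const])
    show "(\<lambda>n. (\<integral>\<omega>. min 1 \<bar>Z n \<omega> - Z' \<omega>\<bar> \<partial>M) + (\<integral>\<omega>. min 1 \<bar>V n \<omega> - V' \<omega>\<bar> \<partial>M)) \<longlonglongrightarrow> 0"
      using tendsto_add[of _ 0 _ _ 0] Z V by (auto simp: conv_in_prob_iff)
    show "\<forall>\<^sub>F n in sequentially. (\<integral>\<omega>. min 1 \<bar>U n \<omega> - u \<omega>\<bar> \<partial>M) \<le> (\<integral>\<omega>. min 1 \<bar>Z n \<omega> - Z' \<omega>\<bar> \<partial>M) + (\<integral>\<omega>. min 1 \<bar>V n \<omega> - V' \<omega>\<bar> \<partial>M)"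
    proof (intro always_eventually allI)
      fix n
      have "(\<integral>\<omega>. min 1 \<bar>U n \<omega> - u \<omega>\<bar> \<partial>M) \<le> (\<integral>\<omega>. min 1 \<bar>Z n \<omega> - Z' \<omega>\<bar> + min 1 \<bar>V n \<omega> - V' \<omega>\<bar> \<partial>M)"
        by (intro integral_mono_AE integrable_min_1 Bochner_Integration.integrable_add)
          (use le[of n] in \<open>auto elim!: eventually_mono\<close>)
      then show "(\<integral>\<omega>. min 1 \<bar>U n \<omega> - u \<omega>\<bar> \<partial>M) \<le> (\<integral>\<omega>. min 1 \<bar>Z n \<omega> - Z' \<omega>\<bar> \<partial>M) + (\<integral>\<omega>. min 1 \<bar>V n \<omega> - V' \<omega>\<bar> \<partial>M)"
        by (subst (asm) Bochner_Integration.integral_add) (auto intro: integrable_min_1)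
    qed
  qed auto
  then show ?thesis by (simp add: conv_in_prob_iff)
qed

lemma (in prob_space) conv_in_prob_diff:
  assumes "conv_in_prob M Z Z'" "conv_in_prob M V V'"
  shows "conv_in_prob M (\<lambda>n \<omega>. Z n \<omega> - V n \<omega>) (\<lambda>\<omega>. Z' \<omega> - V' \<omega>)"
proof (rule conv_in_prob_dominated[OF assms(1) _ _ assms(2)])
  have [measurable]: "\<And>n. Z n \<in> borel_measurable M" "Z' \<in> borel_measurable M" "\<And>n. V n \<in> borel_measurable M" "V' \<in> borel_measurable M"
    using assms by (auto simp: conv_in_prob_def)
  show "\<And>n. (\<lambda>\<omega>. Z n \<omega> - V n \<omega>) \<in> borel_measurable M" "(\<lambda>\<omega>. Z' \<omega> - V' \<omega>) \<in> borel_measurable M" by auto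
qed auto

lemma (in prob_space) conv_in_prob_cong_AE:
  assumes "conv_in_prob M Z Z'" "\<And>n. U n \<in> borel_measurable M" "u \<in> borel_measurable M"
    "\<And>n. AE \<omega> in M. U n \<omega> = Z n \<omega>" "AE \<omega> in M. u \<omega> = Z' \<omega>"
  shows "conv_in_prob M U u"
proof (rule conv_in_prob_dominated[OF assms(1-3) assms(1)])
  fix n show "AE \<omega> in M. \<bar>U n \<omega> - u \<omega>\<bar> \<le> \<bar>Z n \<omega> - Z' \<omega>\<bar> + \<bar>Z n \<omega> - Z' \<omega>\<bar>"
    using assms(4)[of n] assms(5) by eventually_elim auto
qed

lemma (in prob_space) conv_in_prob_L1:
  assumes I: "\<And>n. integrable M (Z n)" "integrable M Z'" and "(\<lambda>n. \<integral>\<omega>. \<bar>Z n \<omega> - Z' \<omega>\<bar> \<partial>M) \<longlonglongrightarrow> 0"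
  shows "conv_in_prob M Z Z'"
proof -
  have [measurable]: "\<And>n. Z n \<in> borel_measurable M" "Z' \<in> borel_measurable M" using I by auto
  have "(\<lambda>n. \<integral>\<omega>. min 1 \<bar>Z n \<omega> - Z' \<omega>\<bar> \<partial>M) \<longlonglongrightarrow> 0"
    by (rule tendsto_sandwich[OF _ _ tendsto_const assms(3)])
      (auto intro!: always_eventually integral_mono integrable_min_1 I)
  then show ?thesis by (simp add: conv_in_prob_iff)
qed

lemma (in prob_space) l2_tendsto_imp_conv_in_prob:
  assumes "l2_tendsto M U u"
  shows "conv_in_prob M U u"
proof (rule conv_in_prob_L1)
  have si: "square_integrable M (U n)" "square_integrable M u" for n
    using assms by (auto simp: l2_tendsto_def)
  then show "\<And>n. integrable M (U n)" "integrable M u" by (auto intro: square_integrable_imp_integrable)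
  show "(\<lambda>n. \<integral>\<omega>. \<bar>U n \<omega> - u \<omega>\<bar> \<partial>M) \<longlonglongrightarrow> 0"
  proof (rule tendsto_sandwich[OF _ _ tendsto_const])
    show "(\<lambda>n. sqrt (\<integral>\<omega>. (U n \<omega> - u \<omega>)\<^sup>2 \<partial>M)) \<longlonglongrightarrow> 0"
      using tendsto_real_sqrt assms by (fastforce simp: l2_tendsto_def)
  qed (auto intro!: always_eventually abs_expectation_le_sqrt square_integrable_diff si)
qed

text \<open>For \<open>p = 2\<close> and \<open>p = 4\<close>: by Fatou's lemma a Cauchy sequence in \<open>L\<^sup>p\<close> that has a subsequence
  converging in probability converges in \<open>L\<^sup>p\<close> to the same limit.\<close>

lemma (in prob_space) Cauchy_moment_tendsto:
  assumes [measurable]: "\<And>n. S n \<in> borel_measurable M" and "even p"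
    and Cauchy: "\<And>e. e > 0 \<Longrightarrow> \<exists>N. \<forall>n\<ge>N. \<forall>m\<ge>N. (\<integral>\<^sup>+\<omega>. ennreal ((S n \<omega> - S m \<omega>) ^ p) \<partial>M) \<le> ennreal e"
    and r: "strict_mono (r :: nat \<Rightarrow> nat)" and conv: "conv_in_prob M (\<lambda>n. S (r n)) Z"
  shows "\<And>e. e > 0 \<Longrightarrow> \<exists>N. \<forall>n\<ge>N. (\<integral>\<^sup>+\<omega>. ennreal ((S n \<omega> - Z \<omega>) ^ p) \<partial>M) \<le> ennreal e"
proof -
  fix e :: real assume "e > 0"
  have [measurable]: "Z \<in> borel_measurable M" using conv by (auto simp: conv_in_prob_def)
  obtain q :: "nat \<Rightarrow> nat" where q: "strict_mono q" "AE \<omega> in M. (\<lambda>n. S (r (q n)) \<omega>) \<longlonglongrightarrow> Z \<omega>"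
    using conv_in_prob_AE_subseq[OF conv] by blast
  obtain N where N: "\<And>n m. n \<ge> N \<Longrightarrow> m \<ge> N \<Longrightarrow> (\<integral>\<^sup>+\<omega>. ennreal ((S n \<omega> - S m \<omega>) ^ p) \<partial>M) \<le> ennreal e"
    using Cauchy[OF \<open>e > 0\<close>] by blast
  have "(\<integral>\<^sup>+\<omega>. ennreal ((S n \<omega> - Z \<omega>) ^ p) \<partial>M) \<le> ennreal e" if "n \<ge> N" for n
  proof -
    have "(\<integral>\<^sup>+\<omega>. ennreal ((S n \<omega> - Z \<omega>) ^ p) \<partial>M) = (\<integral>\<^sup>+\<omega>. liminf (\<lambda>k. ennreal ((S n \<omega> - S (r (q k)) \<omega>) ^ p)) \<partial>M)"
    proof (rule nn_integral_cong_AE)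
      show "AE \<omega> in M. ennreal ((S n \<omega> - Z \<omega>) ^ p) = liminf (\<lambda>k. ennreal ((S n \<omega> - S (r (q k)) \<omega>) ^ p))"
        using q(2)
      proof eventually_elim
        case (elim \<omega>)
        have "(\<lambda>k. ennreal ((S n \<omega> - S (r (q k)) \<omega>) ^ p)) \<longlonglongrightarrow> ennreal ((S n \<omega> - Z \<omega>) ^ p)"
          by (intro tendsto_intros elim tendsto_ennrealI)
        then show ?case by (simp add: lim_imp_Liminf)
      qed
    qed
    also have "\<dots> \<le> liminf (\<lambda>k. \<integral>\<^sup>+\<omega>. ennreal ((S n \<omega> - S (r (q k)) \<omega>) ^ p) \<partial>M)"
      by (rule nn_integral_liminf) simp
    also have "\<dots> \<le> liminf (\<lambda>k. ennreal e)"
    proof (rule Liminf_mono)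
      have "r (q k) \<ge> N" if "k \<ge> N" for k
        using that seq_suble[OF q(1), of k] seq_suble[OF r, of "q k"] by linarith
      then show "\<forall>\<^sub>F k in sequentially. (\<integral>\<^sup>+\<omega>. ennreal ((S n \<omega> - S (r (q k)) \<omega>) ^ p) \<partial>M) \<le> ennreal e"
        using N[OF that] unfolding eventually_sequentially by blast
    qed
    finally show ?thesis by (simp add: Liminf_const)
  qed
  then show "\<exists>N. \<forall>n\<ge>N. (\<integral>\<^sup>+\<omega>. ennreal ((S n \<omega> - Z \<omega>) ^ p) \<partial>M) \<le> ennreal e" by blast
qed

lemma tendsto_integral_nonneg_0:
  assumes [measurable]: "\<And>n. U n \<in> borel_measurable M" and nn: "\<And>n \<omega>. 0 \<le> U n \<omega>"
    and "\<And>e. e > 0 \<Longrightarrow> \<exists>N. \<forall>n\<ge>N. (\<integral>\<^sup>+\<omega>. ennreal (U n \<omega>) \<partial>M) \<le> ennreal e"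
  shows "(\<lambda>n. \<integral>\<omega>. U n \<omega> \<partial>M) \<longlonglongrightarrow> (0::real)"
proof (rule LIMSEQ_I)
  fix r :: real assume "r > 0"
  obtain N where N: "\<And>n. n \<ge> N \<Longrightarrow> (\<integral>\<^sup>+\<omega>. ennreal (U n \<omega>) \<partial>M) \<le> ennreal (r / 2)"
    using assms(3)[of "r / 2"] \<open>r > 0\<close> by auto
  have "(\<integral>\<omega>. U n \<omega> \<partial>M) \<le> r / 2" if "n \<ge> N" for n
    using enn2real_leI[OF _ N[OF that]] nn \<open>r > 0\<close> by (subst integral_eq_nn_integral) auto
  then show "\<exists>no. \<forall>n\<ge>no. norm ((\<integral>\<omega>. U n \<omega> \<partial>M) - 0) < r"
    using \<open>r > 0\<close> nn by (intro exI[of _ N]) (fastforce simp: integral_nonneg_AE)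
qed

lemma (in prob_space) Cauchy_l2_tendsto:
  assumes S: "\<And>n. square_integrable M (S n)"
    and Cauchy: "\<And>e. e > 0 \<Longrightarrow> \<exists>N. \<forall>n\<ge>N. \<forall>m\<ge>N. (\<integral>\<omega>. (S n \<omega> - S m \<omega>)\<^sup>2 \<partial>M) \<le> e"
    and r: "strict_mono (r :: nat \<Rightarrow> nat)" and conv: "conv_in_prob M (\<lambda>n. S (r n)) Z"
  shows "l2_tendsto M S Z"
proof -
  have [measurable]: "\<And>n. S n \<in> borel_measurable M" "Z \<in> borel_measurable M"
    using S conv by (auto simp: square_integrable_def conv_in_prob_def)
  have *: "\<exists>N. \<forall>n\<ge>N. (\<integral>\<^sup>+\<omega>. ennreal ((S n \<omega> - Z \<omega>)\<^sup>2) \<partial>M) \<le> ennreal e" if "e > 0" for e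
  proof (rule Cauchy_moment_tendsto[OF _ _ _ r conv])
    fix e :: real assume "e > 0"
    then obtain N where "\<forall>n\<ge>N. \<forall>m\<ge>N. (\<integral>\<omega>. (S n \<omega> - S m \<omega>)\<^sup>2 \<partial>M) \<le> e" using Cauchy by blast
    moreover have "(\<integral>\<^sup>+\<omega>. ennreal ((S n \<omega> - S m \<omega>)\<^sup>2) \<partial>M) = ennreal (\<integral>\<omega>. (S n \<omega> - S m \<omega>)\<^sup>2 \<partial>M)" for n m
      using square_integrable_diff[OF S S] by (intro nn_integral_eq_integral) (auto simp: square_integrable_def)
    ultimately show "\<exists>N. \<forall>n\<ge>N. \<forall>m\<ge>N. (\<integral>\<^sup>+\<omega>. ennreal ((S n \<omega> - S m \<omega>)\<^sup>2) \<partial>M) \<le> ennreal e"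
      using \<open>e > 0\<close> by (auto simp: ennreal_leI)
  qed (use that in auto)
  obtain N where N: "(\<integral>\<^sup>+\<omega>. ennreal ((S N \<omega> - Z \<omega>)\<^sup>2) \<partial>M) \<le> ennreal 1"
    using *[of 1] by auto
  then have "square_integrable M (\<lambda>\<omega>. S N \<omega> - Z \<omega>)"
    unfolding square_integrable_def
    by (auto intro!: integrableI_bounded le_less_trans[OF N])
  from square_integrable_diff[OF S[of N] this] have "square_integrable M Z" by simp
  moreover have "(\<lambda>n. \<integral>\<omega>. (S n \<omega> - Z \<omega>)\<^sup>2 \<partial>M) \<longlonglongrightarrow> 0"
    by (rule tendsto_integral_nonneg_0) (use * in auto)
  ultimately show ?thesis using S by (simp add: l2_tendsto_def)
qed

text \<open>By S^2 - Z^2 = (S - Z)(S + Z) and Cauchy-Schwarz, the mean-square distance of the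
  squares is controlled by the fourth moment of S - Z, while that of S + Z stays bounded. This is
  why the return approximations are studied in L4.\<close>

lemma (in prob_space) Cauchy_l4_imp_l2_tendsto_square:
  assumes S: "\<And>n. S n \<in> borel_measurable M" "\<And>n. integrable M (\<lambda>\<omega>. (S n \<omega>) ^ 4)"
    and Cauchy: "\<And>e. e > 0 \<Longrightarrow> \<exists>N. \<forall>n\<ge>N. \<forall>m\<ge>N. (\<integral>\<^sup>+\<omega>. ennreal ((S n \<omega> - S m \<omega>) ^ 4) \<partial>M) \<le> ennreal e"
    and conv: "conv_in_prob M S Z"
  shows "l2_tendsto M (\<lambda>n \<omega>. (S n \<omega>)\<^sup>2) (\<lambda>\<omega>. (Z \<omega>)\<^sup>2)"
proof -
  have [measurable]: "\<And>n. S n \<in> borel_measurable M" "Z \<in> borel_measurable M"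
    using S conv by (auto simp: square_integrable_def conv_in_prob_def)
  have *: "\<exists>N. \<forall>n\<ge>N. (\<integral>\<^sup>+\<omega>. ennreal ((S n \<omega> - Z \<omega>) ^ 4) \<partial>M) \<le> ennreal e" if "e > 0" for e
    by (rule Cauchy_moment_tendsto[OF S(1) _ Cauchy strict_mono_id]) (use that conv in auto)
  have si4: "square_integrable M (\<lambda>\<omega>. (U \<omega>)\<^sup>2) \<longleftrightarrow> integrable M (\<lambda>\<omega>. (U \<omega>) ^ 4)"
    if "U \<in> borel_measurable M" for U :: "'a \<Rightarrow> real" using that by (simp add: square_integrable_def)
  obtain N where N: "\<And>n. n \<ge> N \<Longrightarrow> (\<integral>\<^sup>+\<omega>. ennreal ((S n \<omega> - Z \<omega>) ^ 4) \<partial>M) \<le> ennreal 1"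
    using *[of 1] by auto
  have d4: "integrable M (\<lambda>\<omega>. (S n \<omega> - Z \<omega>) ^ 4)" if "n \<ge> N" for n
    by (rule integrableI_bounded) (auto intro!: le_less_trans[OF N[OF that]])
  have pow4: "(a + b) ^ 4 \<le> 8 * a ^ 4 + 8 * b ^ 4" for a b :: real
  proof -
    have "(a + b)\<^sup>2 \<le> 2 * a\<^sup>2 + 2 * b\<^sup>2" using zero_le_power2[of "a - b"] by (simp add: power2_eq_square algebra_simps)
    then have "((a + b)\<^sup>2)\<^sup>2 \<le> (2 * a\<^sup>2 + 2 * b\<^sup>2)\<^sup>2" by (intro power_mono) auto
    also have "\<dots> \<le> 8 * (a\<^sup>2)\<^sup>2 + 8 * (b\<^sup>2)\<^sup>2"
      using zero_le_power2[of "2 * a\<^sup>2 - 2 * b\<^sup>2"] by (simp add: power2_eq_square algebra_simps)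
    finally show ?thesis by simp
  qed
  have bnd: "integrable M (\<lambda>\<omega>. (U \<omega> + V \<omega>) ^ 4)" if [measurable]: "U \<in> borel_measurable M" "V \<in> borel_measurable M"
    and "integrable M (\<lambda>\<omega>. (U \<omega>) ^ 4)" "integrable M (\<lambda>\<omega>. (V \<omega>) ^ 4)" for U V :: "'a \<Rightarrow> real"
    by (rule Bochner_Integration.integrable_bound[of M "\<lambda>\<omega>. 8 * (U \<omega>) ^ 4 + 8 * (V \<omega>) ^ 4"]) (use that pow4 in auto)
  have Z4: "integrable M (\<lambda>\<omega>. (Z \<omega>) ^ 4)"
    using bnd[OF _ _ S(2)[of N], of "\<lambda>\<omega>. - (S N \<omega> - Z \<omega>)"] d4[of N]
    by (simp only: power_minus_even[of 4] even_numeral) simp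
  have D4: "integrable M (\<lambda>\<omega>. (S n \<omega> - Z \<omega>) ^ 4)" for n
    using bnd[OF _ _ S(2)[of n], of "\<lambda>\<omega>. - Z \<omega>"] Z4 by simp
  let ?D = "\<lambda>n. \<integral>\<omega>. (S n \<omega> - Z \<omega>) ^ 4 \<partial>M"
  have D0: "?D \<longlonglongrightarrow> 0"
    by (rule tendsto_integral_nonneg_0) (use * in auto)
  let ?z = "\<integral>\<omega>. (Z \<omega>) ^ 4 \<partial>M"
  \<comment> \<open>The 8 is that of \<open>pow4\<close>, applied to S + Z = (S - Z) + 2Z; the 128
    is 8 times 2^4.\<close>
  have E: "((\<integral>\<omega>. ((S n \<omega>)\<^sup>2 - (Z \<omega>)\<^sup>2)\<^sup>2 \<partial>M) - 0)\<^sup>2 \<le> ?D n * (8 * ?D n + 128 * ?z)" for n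
  proof -
    have P4: "integrable M (\<lambda>\<omega>. (S n \<omega> + Z \<omega>) ^ 4)" by (rule bnd) (use S Z4 in auto)
    have "(\<integral>\<omega>. ((S n \<omega>)\<^sup>2 - (Z \<omega>)\<^sup>2)\<^sup>2 \<partial>M) = (\<integral>\<omega>. (S n \<omega> - Z \<omega>)\<^sup>2 * (S n \<omega> + Z \<omega>)\<^sup>2 \<partial>M)"
      by (simp add: power_mult_distrib[symmetric] power2_eq_square algebra_simps)
    then have "((\<integral>\<omega>. ((S n \<omega>)\<^sup>2 - (Z \<omega>)\<^sup>2)\<^sup>2 \<partial>M) - 0)\<^sup>2 \<le> ?D n * (\<integral>\<omega>. (S n \<omega> + Z \<omega>) ^ 4 \<partial>M)"
      using Cauchy_Schwarz_integral(3)[of "\<lambda>\<omega>. (S n \<omega> - Z \<omega>)\<^sup>2" M "\<lambda>\<omega>. (S n \<omega> + Z \<omega>)\<^sup>2"] D4 P4 by simp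
    also have "(\<integral>\<omega>. (S n \<omega> + Z \<omega>) ^ 4 \<partial>M) \<le> (\<integral>\<omega>. 8 * (S n \<omega> - Z \<omega>) ^ 4 + 128 * (Z \<omega>) ^ 4 \<partial>M)"
    proof (rule integral_mono[OF P4])
      fix \<omega> show "(S n \<omega> + Z \<omega>) ^ 4 \<le> 8 * (S n \<omega> - Z \<omega>) ^ 4 + 128 * (Z \<omega>) ^ 4"
        using pow4[of "S n \<omega> - Z \<omega>" "2 * Z \<omega>"] by (simp add: power_mult_distrib add.commute)
    qed (use D4 Z4 in auto)
    finally show ?thesis using D4 Z4 by (simp add: mult_left_mono)
  qed
  have "(\<lambda>n. \<integral>\<omega>. ((S n \<omega>)\<^sup>2 - (Z \<omega>)\<^sup>2)\<^sup>2 \<partial>M) \<longlonglongrightarrow> 0"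
    by (rule tendsto_of_square_le[OF E]) (use D0 in \<open>auto intro!: tendsto_eq_intros\<close>)
  then show ?thesis using S Z4 by (simp add: l2_tendsto_def si4)
qed

section \<open>One-sided Levy processes\<close>

lemma eq_distr_imp:
  fixes X Y :: "'a \<Rightarrow> real"
  assumes "distr M borel X = distr M borel Y" and [measurable]: "X \<in> borel_measurable M" "Y \<in> borel_measurable M"
  shows eq_distr_AE: "{x. P x} \<in> sets borel \<Longrightarrow> (AE \<omega> in M. P (X \<omega>)) \<longleftrightarrow> (AE \<omega> in M. P (Y \<omega>))"
    and eq_distr_integrable: "f \<in> borel_measurable borel \<Longrightarrow>
      integrable M (\<lambda>\<omega>. f (X \<omega>) :: real) \<longleftrightarrow> integrable M (\<lambda>\<omega>. f (Y \<omega>))"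
    and eq_distr_integral: "f \<in> borel_measurable borel \<Longrightarrow>
      (\<integral>\<omega>. f (X \<omega>) \<partial>M) = (\<integral>\<omega>. f (Y \<omega>) \<partial>M)"
proof -
  show "(AE \<omega> in M. P (X \<omega>)) \<longleftrightarrow> (AE \<omega> in M. P (Y \<omega>))" if "{x. P x} \<in> sets borel"
  proof -
    have "(AE x in distr M borel X. P x) \<longleftrightarrow> (AE \<omega> in M. P (X \<omega>))" "(AE x in distr M borel Y. P x) \<longleftrightarrow> (AE \<omega> in M. P (Y \<omega>))"
      using that by (auto intro!: AE_distr_iff)
    then show ?thesis by (simp only: assms(1))
  qed
  show "integrable M (\<lambda>\<omega>. f (X \<omega>) :: real) \<longleftrightarrow> integrable M (\<lambda>\<omega>. f (Y \<omega>))" if "f \<in> borel_measurable borel"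
    using integrable_distr_eq[of X M borel f] integrable_distr_eq[of Y M borel f] assms that by simp
  show "(\<integral>\<omega>. f (X \<omega>) \<partial>M) = (\<integral>\<omega>. f (Y \<omega>) \<partial>M)" if "f \<in> borel_measurable borel"
    using integral_distr[of X M borel f] integral_distr[of Y M borel f] assms that by simp
qed

lemma eq_distr_square_integrable:
  assumes "distr M borel X = distr M borel Y" "X \<in> borel_measurable M" "Y \<in> borel_measurable M"
  shows "square_integrable M X \<longleftrightarrow> square_integrable M Y"
  unfolding square_integrable_def
  using eq_distr_integrable[OF assms, of "\<lambda>x. x\<^sup>2"] assms by simp

lemma (in prob_space) eq_distr_of_char:
  assumes [measurable]: "X \<in> borel_measurable M" "Y \<in> borel_measurable M"
    and "\<And>z. char (distr M borel X) z = char (distr M borel Y) z"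
  shows "distr M borel X = distr M borel Y"
  by (rule Levy_uniqueness) (auto simp: assms intro!: real_distribution_distr)

lemma (in prob_space) char_distr_eq:
  assumes [measurable]: "X \<in> borel_measurable M"
  shows "char (distr M borel X) z = (CLINT \<omega>|M. iexp (z * X \<omega>))"
  unfolding char_def by (subst integral_distr) auto

lemma (in prob_space) char_tendsto:
  assumes [measurable]: "\<And>n. X n \<in> borel_measurable M" "X0 \<in> borel_measurable M"
    and lim: "AE \<omega> in M. (\<lambda>n. X n \<omega>) \<longlonglongrightarrow> X0 \<omega>"
  shows "(\<lambda>n. char (distr M borel (X n)) z) \<longlonglongrightarrow> char (distr M borel X0) z"
  unfolding char_distr_eq[OF assms(1)] char_distr_eq[OF assms(2)]
proof (rule integral_dominated_convergence[where w = "\<lambda>_. 1"])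
  show "AE \<omega> in M. (\<lambda>n. iexp (z * X n \<omega>)) \<longlonglongrightarrow> iexp (z * X0 \<omega>)"
    using lim by eventually_elim (intro tendsto_intros)
qed auto

lemma (in prob_space) char_cong_AE:
  assumes "X \<in> borel_measurable M" "Y \<in> borel_measurable M" "AE \<omega> in M. X \<omega> = Y \<omega>"
  shows "char (distr M borel X) z = char (distr M borel Y) z"
  using distr_cong_AE[OF refl refl assms(3,1,2)] by simp

lemma (in prob_space) char_const_0:
  assumes "X \<in> borel_measurable M" "AE \<omega> in M. X \<omega> = 0"
  shows "char (distr M borel X) z = 1"
proof -
  have "char (distr M borel X) z = char (distr M borel (\<lambda>_. 0)) z"
    using assms by (intro char_cong_AE) auto
  then show ?thesis by (simp add: char_distr_eq prob_space del: distr_const)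
qed

section \<open>Laws of a one-sided Levy process through characteristic functions\<close>

lemma levy_process_measurable: "levy_process M L \<Longrightarrow> t \<ge> 0 \<Longrightarrow> L t \<in> borel_measurable M"
  by (simp add: levy_process_def)

lemma levy_process_increment:
  "levy_process M L \<Longrightarrow> t \<ge> 0 \<Longrightarrow> h \<ge> 0 \<Longrightarrow> distr M borel (\<lambda>\<omega>. L (t + h) \<omega> - L t \<omega>) = distr M borel (L h)"
  by (simp add: levy_process_def)

text \<open>\<open>X\<close> is the increment \<open>L s - L 0\<close>, since independence is given
  for increments and \<open>L 0\<close> vanishes only almost surely. The identifications with
  \<open>L s\<close> and \<open>L (s + h)\<close> therefore hold almost surely.\<close>

lemma (in prob_space) levy_process_split:
  assumes L: "levy_process M L" and st: "s \<ge> 0" "h \<ge> 0"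
  obtains X Y where "indep_var borel X borel Y" "AE \<omega> in M. X \<omega> = L s \<omega>" "distr M borel Y = distr M borel (L h)"
    "AE \<omega> in M. L (s + h) \<omega> = X \<omega> + Y \<omega>"
proof -
  define t :: "nat \<Rightarrow> real" where "t i = (if i = 0 then 0 else if i = 1 then s else s + h)" for i
  have "indep_vars (\<lambda>_. borel) (\<lambda>i \<omega>. L (t (Suc i)) \<omega> - L (t i) \<omega>) {..<2}"
  proof -
    have "0 \<le> t 0 \<and> (\<forall>i<2. t i \<le> t (Suc i))" using st by (auto simp: t_def less_2_cases_iff)
    then show ?thesis using L unfolding levy_process_def by blast
  qed
  moreover have "{..<2::nat} = insert 0 {1}" by auto
  ultimately have "indep_var borel (\<lambda>\<omega>. L (t (Suc 0)) \<omega> - L (t 0) \<omega>) borel (\<lambda>\<omega>. \<Sum>i\<in>{1}. L (t (Suc i)) \<omega> - L (t i) \<omega>)"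
    by (intro indep_vars_sum) auto
  then have i: "indep_var borel (\<lambda>\<omega>. L s \<omega> - L 0 \<omega>) borel (\<lambda>\<omega>. L (s + h) \<omega> - L s \<omega>)" by (simp add: t_def)
  have "AE \<omega> in M. L 0 \<omega> = 0" using L by (simp add: levy_process_def)
  then show ?thesis
    by (intro that[OF i]) (auto simp: levy_process_increment[OF L st] elim!: eventually_mono)
qed

lemma (in prob_space) levy_char_add:
  assumes L: "levy_process M L" and st: "s \<ge> 0" "h \<ge> 0"
  shows "char (distr M borel (L (s + h))) z = char (distr M borel (L s)) z * char (distr M borel (L h)) z"
proof -
  obtain X Y where XY: "indep_var borel X borel Y" "AE \<omega> in M. X \<omega> = L s \<omega>" "distr M borel Y = distr M borel (L h)"
    "AE \<omega> in M. L (s + h) \<omega> = X \<omega> + Y \<omega>"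
    using levy_process_split[OF assms] by blast
  have [measurable]: "X \<in> borel_measurable M" "Y \<in> borel_measurable M" "L s \<in> borel_measurable M" "L (s + h) \<in> borel_measurable M"
    using XY(1) L st by (auto intro: indep_var_rv1 indep_var_rv2 levy_process_measurable)
  have "char (distr M borel (L (s + h))) z = char (distr M borel (\<lambda>\<omega>. X \<omega> + Y \<omega>)) z"
    by (intro char_cong_AE XY) auto
  also have "\<dots> = char (distr M borel X) z * char (distr M borel Y) z"
    by (rule char_distr_add) fact
  finally show ?thesis using char_cong_AE[OF _ _ XY(2)] XY(3) by simp
qed

lemma levy_process_right_tendsto:
  assumes L: "levy_process M L" and t: "t \<ge> 0" "\<And>n. s n > t" "s \<longlonglongrightarrow> t"
  shows "AE \<omega> in M. (\<lambda>n. L (s n) \<omega>) \<longlonglongrightarrow> L t \<omega>"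
proof -
  have "filterlim s (at_right t) sequentially"
    using t by (auto simp: filterlim_at intro!: always_eventually)
  moreover have "AE \<omega> in M. ((\<lambda>s. L s \<omega>) \<longlongrightarrow> L t \<omega>) (at_right t)"
  proof -
    have "AE \<omega> in M. \<forall>t\<ge>0. ((\<lambda>s. L s \<omega>) \<longlongrightarrow> L t \<omega>) (at_right t)"
      using L by (simp add: levy_process_def)
    then show ?thesis using t(1) by (auto elim: AE_mp)
  qed
  ultimately show ?thesis
    by (auto elim!: eventually_mono intro: filterlim_compose)
qed

lemma (in prob_space) levy_char_0:
  assumes "levy_process M L"
  shows "char (distr M borel (L 0)) z = 1"
  using assms by (intro char_const_0) (auto simp: levy_process_def)

lemma (in prob_space) levy_char_tendsto_1:
  assumes L: "levy_process M L" and h: "\<And>n. h n \<ge> 0" "h \<longlonglongrightarrow> 0"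
  shows "(\<lambda>n. char (distr M borel (L (h n))) z) \<longlonglongrightarrow> 1"
proof -
  \<comment> \<open>Right limits only see strictly positive times, so shift by \<open>1 / (n + 1)\<close>.\<close>
  let ?c = "\<lambda>t. char (distr M borel (L t)) z"
  have pos: "(\<lambda>n. ?c (s n)) \<longlonglongrightarrow> 1" if s: "\<And>n. s n > 0" "s \<longlonglongrightarrow> 0" for s :: "nat \<Rightarrow> real"
  proof -
    have "(\<lambda>n. ?c (s n)) \<longlonglongrightarrow> ?c 0"
      using levy_process_right_tendsto[OF L _ s] less_imp_le[OF s(1)]
      by (intro char_tendsto levy_process_measurable[OF L]) auto
    then show ?thesis by (simp add: levy_char_0[OF L])
  qed
  have e: "(\<lambda>n. 1 / (real n + 1)) \<longlonglongrightarrow> 0" by real_asymp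
  have 1: "(\<lambda>n. ?c (h n + 1 / (real n + 1))) \<longlonglongrightarrow> 1"
    using tendsto_add[OF h(2) e] by (intro pos) (auto intro!: add_nonneg_pos h)
  have 2: "(\<lambda>n. ?c (1 / (real n + 1))) \<longlonglongrightarrow> 1"
    by (rule pos) (use e in auto)
  \<comment> \<open>The characteristic function is multiplicative in time, so dividing by its value
    at the shift removes the shift; numerator and denominator both tend to 1 by
    \<open>pos\<close>.\<close>
  have "(\<lambda>n. ?c (h n + 1 / (real n + 1)) / ?c (1 / (real n + 1))) \<longlonglongrightarrow> 1 / 1"
    by (intro tendsto_divide 1 2) auto
  moreover have "eventually (\<lambda>n. ?c (1 / (real n + 1)) \<noteq> 0) sequentially"
    using tendsto_imp_eventually_ne[OF 2, of 0] by simp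
  then have "eventually (\<lambda>n. ?c (h n + 1 / (real n + 1)) / ?c (1 / (real n + 1)) = ?c (h n)) sequentially"
    by eventually_elim (simp add: levy_char_add[OF L] h)
  ultimately show ?thesis by (simp add: Lim_transform_eventually)
qed

text \<open>The value at \<open>t\<close> is the (n+1)-st power of the value at
  \<open>t / (n + 1)\<close>, which is close to 1 for large n. Nonvanishing permits the
  cancellations needed for left limits in time and for differences of sets.\<close>

lemma (in prob_space) levy_char_nonzero:
  assumes L: "levy_process M L" and "t \<ge> 0"
  shows "char (distr M borel (L t)) z \<noteq> 0"
proof -
  let ?c = "\<lambda>t. char (distr M borel (L t)) z"
  have pow: "?c (real n * s) = ?c s ^ n" if "s \<ge> 0" for s n
  proof (induction n)
    case (Suc n)
    have "?c (real (Suc n) * s) = ?c (s + real n * s)" by (simp add: algebra_simps)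
    also have "\<dots> = ?c s * ?c (real n * s)" using that by (intro levy_char_add[OF L]) auto
    finally show ?case by (simp add: Suc.IH)
  qed (simp add: levy_char_0[OF L])
  have "(\<lambda>n. ?c (t / (real n + 1))) \<longlonglongrightarrow> 1"
    using assms by (intro levy_char_tendsto_1[OF L]) (auto, real_asymp)
  then have "eventually (\<lambda>n. ?c (t / (real n + 1)) \<noteq> 0) sequentially"
    by (rule tendsto_imp_eventually_ne) simp
  then obtain n where "?c (t / (real n + 1)) \<noteq> 0"
    using eventually_happens'[OF sequentially_bot] by blast
  moreover have "?c t = ?c (t / (real n + 1)) ^ (Suc n)"
  proof -
    have "real n + 1 \<noteq> 0" by linarith
    then have "real (Suc n) * (t / (real n + 1)) = t" by (simp add: field_simps)
    then show ?thesis using assms pow[of "t / (real n + 1)" "Suc n"] by (simp del: of_nat_Suc)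
  qed
  ultimately show ?thesis by simp
qed

text \<open>Paths are only right-continuous, but in law there is continuity from the left as well:
  the value at \<open>s\<close> is the value at \<open>t\<close> divided by that at
  \<open>t - s\<close>, and \<open>t - s\<close> tends to 0.\<close>

lemma (in prob_space) levy_char_left_tendsto:
  assumes L: "levy_process M L" and "t \<ge> 0" "\<And>n. 0 \<le> s n" "\<And>n. s n \<le> t" "s \<longlonglongrightarrow> t"
  shows "(\<lambda>n. char (distr M borel (L (s n))) z) \<longlonglongrightarrow> char (distr M borel (L t)) z"
proof -
  let ?c = "\<lambda>t. char (distr M borel (L t)) z"
  have 1: "(\<lambda>n. ?c (t - s n)) \<longlonglongrightarrow> 1"
    using assms tendsto_diff[OF tendsto_const assms(5), of t] by (intro levy_char_tendsto_1[OF L]) auto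
  have "(\<lambda>n. ?c t / ?c (t - s n)) \<longlonglongrightarrow> ?c t / 1"
    by (intro tendsto_divide 1 tendsto_const) auto
  moreover have "?c t / ?c (t - s n) = ?c (s n)" for n
    using levy_char_add[OF L, of "s n" "t - s n" z] levy_char_nonzero[OF L, of "t - s n" z] assms(3,4)[of n]
    by (simp add: field_simps)
  ultimately show ?thesis by simp
qed

text \<open>In Cauchy's functional equation nonnegativity yields monotonicity, which takes the place
  of continuity. Squeezing \<open>n * t\<close> between consecutive integers bounds the defect of
  linearity at \<open>t\<close> by \<open>f 1 / n\<close> for every positive n.\<close>

lemma additive_nonneg_linear:
  fixes f :: "real \<Rightarrow> real"
  assumes add: "\<And>s t. s \<ge> 0 \<Longrightarrow> t \<ge> 0 \<Longrightarrow> f (s + t) = f s + f t" and nn: "\<And>t. t \<ge> 0 \<Longrightarrow> f t \<ge> 0"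
    and "t \<ge> 0"
  shows "f t = t * f 1"
proof (rule ccontr)
  assume ne: "f t \<noteq> t * f 1"
  have f0: "f 0 = 0" using add[of 0 0] by simp
  have mult: "f (real n * s) = real n * f s" if "s \<ge> 0" for n s
    using that by (induction n) (auto simp: f0 distrib_right add)
  have mono: "f s \<le> f u" if "0 \<le> s" "s \<le> u" for s u
    using add[of s "u - s"] nn[of "u - s"] that by simp
  have bound: "real n * \<bar>f t - t * f 1\<bar> \<le> f 1" for n
  proof -
    define k where "k = nat \<lfloor>real n * t\<rfloor>"
    have k: "real k \<le> real n * t" "real n * t \<le> real (Suc k)"
      using \<open>t \<ge> 0\<close> by (auto simp: k_def) linarith
    have "real k * f 1 \<le> real n * f t" "real n * f t \<le> real (Suc k) * f 1"
      using mono[OF _ k(1)] mono[OF _ k(2)] mult[of 1 k] mult[of 1 "Suc k"] mult[of t n] \<open>t \<ge> 0\<close> by (auto simp del: of_nat_Suc)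
    moreover have "real k * f 1 \<le> real n * t * f 1" "real n * t * f 1 \<le> real (Suc k) * f 1"
      using k nn[of 1] by (auto intro!: mult_right_mono simp del: of_nat_Suc)
    ultimately have "\<bar>real n * f t - real n * t * f 1\<bar> \<le> f 1" by (auto simp: algebra_simps abs_le_iff)
    moreover have "real n * \<bar>f t - t * f 1\<bar> = \<bar>real n * f t - real n * t * f 1\<bar>"
    proof -
      have "\<bar>real n * (f t - t * f 1)\<bar> = real n * \<bar>f t - t * f 1\<bar>" by (simp add: abs_mult)
      then show ?thesis by (simp add: right_diff_distrib mult.assoc)
    qed
    ultimately show ?thesis by simp
  qed
  obtain n where "f 1 < real n * \<bar>f t - t * f 1\<bar>"
    using reals_Archimedean3[of "\<bar>f t - t * f 1\<bar>"] ne by auto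
  with bound[of n] show False by simp
qed

text \<open>If \<open>L t \<ge> 0\<close>, the two independent, equally distributed halves cannot
  both be negative with positive probability; that probability is a square, so each half is
  nonnegative. Halving and adding reach the dyadic times, right-continuity the others.\<close>

lemma (in prob_space) levy_nonneg:
  assumes L: "levy_process M L" and pos: "AE \<omega> in M. 0 \<le> L 1 \<omega>" and "t \<ge> 0"
  shows "AE \<omega> in M. 0 \<le> L t \<omega>"
proof -
  let ?P = "\<lambda>t. t \<ge> 0 \<and> (AE \<omega> in M. 0 \<le> L t \<omega>)"
  have half: "?P (t / 2)" if Pt: "?P t" for t
  proof -
    obtain X Y where XY: "indep_var borel X borel Y" "AE \<omega> in M. X \<omega> = L (t / 2) \<omega>" "distr M borel Y = distr M borel (L (t / 2))"
      "AE \<omega> in M. L (t / 2 + t / 2) \<omega> = X \<omega> + Y \<omega>"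
      by (rule levy_process_split[OF L, of "t / 2" "t / 2"]) (use Pt in auto)
    have [measurable]: "X \<in> borel_measurable M" "Y \<in> borel_measurable M" "L (t / 2) \<in> borel_measurable M"
      using XY(1) L Pt by (auto intro: indep_var_rv1 indep_var_rv2 levy_process_measurable)
    have "prob (\<Inter>i\<in>{True, False}. (case_bool X Y i) -` {..<0} \<inter> space M) = (\<Prod>i\<in>{True, False}. prob ((case_bool X Y i) -` {..<0} \<inter> space M))"
      using XY(1) unfolding indep_var_def by (intro indep_varsD) (auto split: bool.splits)
    then have 1: "prob {\<omega> \<in> space M. X \<omega> < 0 \<and> Y \<omega> < 0} = prob {\<omega> \<in> space M. X \<omega> < 0} * prob {\<omega> \<in> space M. Y \<omega> < 0}"
      by (simp add: vimage_def Int_def conj_ac)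
    have "AE \<omega> in M. 0 \<le> L t \<omega>" using Pt by simp
    then have "AE \<omega> in M. \<not> (X \<omega> < 0 \<and> Y \<omega> < 0)"
      using XY(4) by eventually_elim auto
    then have "prob {\<omega> \<in> space M. X \<omega> < 0 \<and> Y \<omega> < 0} = 0"
      by (subst prob_eq_0) (auto elim!: eventually_mono)
    with 1 have "prob {\<omega> \<in> space M. X \<omega> < 0} = 0 \<or> prob {\<omega> \<in> space M. Y \<omega> < 0} = 0" by simp
    then have "(AE \<omega> in M. 0 \<le> X \<omega>) \<or> (AE \<omega> in M. 0 \<le> Y \<omega>)"
      by (auto simp: prob_eq_0 not_less)
    moreover have "AE \<omega> in M. 0 \<le> L (t / 2) \<omega>" if "AE \<omega> in M. 0 \<le> X \<omega>"
      using that XY(2) by eventually_elim auto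
    moreover have "(AE \<omega> in M. 0 \<le> Y \<omega>) \<longleftrightarrow> (AE \<omega> in M. 0 \<le> L (t / 2) \<omega>)"
      by (rule eq_distr_AE[OF XY(3)]) auto
    ultimately have "AE \<omega> in M. 0 \<le> L (t / 2) \<omega>" by blast
    then show ?thesis using Pt by simp
  qed
  have add: "?P (s + t)" if Pst: "?P s" "?P t" for s t
  proof -
    obtain X Y where XY: "indep_var borel X borel Y" "AE \<omega> in M. X \<omega> = L s \<omega>" "distr M borel Y = distr M borel (L t)"
      "AE \<omega> in M. L (s + t) \<omega> = X \<omega> + Y \<omega>"
      by (rule levy_process_split[OF L, of s t]) (use Pst in auto)
    have [measurable]: "Y \<in> borel_measurable M" "L t \<in> borel_measurable M"
      using XY(1) L Pst by (auto intro: indep_var_rv1 indep_var_rv2 levy_process_measurable)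
    have "AE \<omega> in M. 0 \<le> Y \<omega>"
      using eq_distr_AE[OF XY(3), of "\<lambda>x. 0 \<le> x"] Pst by auto
    moreover have "AE \<omega> in M. 0 \<le> L s \<omega>" using Pst by auto
    ultimately have "AE \<omega> in M. 0 \<le> L (s + t) \<omega>" using XY(2,4) by eventually_elim auto
    then show ?thesis using Pst by simp
  qed
  have pow: "?P (1 / 2 ^ k)" for k :: nat
  proof (induction k)
    case (Suc k)
    from half[OF this] show ?case by (simp add: mult.commute)
  qed (use pos in auto)
  have dyadic: "?P (real m / 2 ^ k)" for m k :: nat
  proof (induction m)
    case 0
    have "AE \<omega> in M. L 0 \<omega> = 0" using L by (simp add: levy_process_def)
    then show ?case by (auto elim!: eventually_mono)
  next
    case (Suc m)
    from add[OF this pow[of k]] show ?case by (simp add: add_divide_distrib add.commute)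
  qed
  \<comment> \<open>The \<open>+ 1\<close> makes these dyadic times strictly larger than
    \<open>t\<close>, as the right limit requires.\<close>
  define s :: "nat \<Rightarrow> real" where "s n = real (nat \<lfloor>t * 2 ^ n\<rfloor> + 1) / 2 ^ n" for n
  have s: "t < s n" "s n \<le> t + 1 / 2 ^ n" for n
    using \<open>t \<ge> 0\<close> by (auto simp: s_def field_simps) linarith
  have "s \<longlonglongrightarrow> t"
  proof (rule tendsto_sandwich[of "\<lambda>_. t"])
    have "(\<lambda>n. t + 1 / 2 ^ n) \<longlonglongrightarrow> t + 0" by (intro tendsto_intros) real_asymp
    then show "(\<lambda>n. t + 1 / 2 ^ n) \<longlonglongrightarrow> t" by simp
  qed (use s in \<open>auto intro!: always_eventually less_imp_le\<close>)
  from levy_process_right_tendsto[OF L \<open>t \<ge> 0\<close> s(1) this]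
  have "AE \<omega> in M. (\<lambda>n. L (s n) \<omega>) \<longlonglongrightarrow> L t \<omega>" .
  moreover have "AE \<omega> in M. \<forall>n. 0 \<le> L (s n) \<omega>"
    unfolding AE_all_countable s_def using dyadic by blast
  ultimately show ?thesis
    by eventually_elim (auto intro: LIMSEQ_le_const)
qed

text \<open>Additivity of mean and variance over independent increments becomes linearity by
  \<open>additive_nonneg_linear\<close>. For the mean, its nonnegativity hypothesis is supplied by
  \<open>levy_nonneg\<close>.\<close>

lemma (in prob_space) levy_moments:
  assumes L: "levy_process M L" and pos: "AE \<omega> in M. 0 \<le> L 1 \<omega>" and si: "square_integrable M (L 1)" and "t \<ge> 0"
  shows "square_integrable M (L t)" "expectation (L t) = t * expectation (L 1)"
    "variance (L t) = t * variance (L 1)"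
proof -
  have split: "\<exists>X Y. indep_var borel X borel Y \<and> (AE \<omega> in M. L s \<omega> = X \<omega>) \<and> distr M borel Y = distr M borel (L h) \<and>
    (AE \<omega> in M. L (s + h) \<omega> = X \<omega> + Y \<omega>) \<and> (AE \<omega> in M. 0 \<le> X \<omega>) \<and> (AE \<omega> in M. 0 \<le> Y \<omega>) \<and> X \<in> borel_measurable M \<and> Y \<in> borel_measurable M"
    if st: "s \<ge> 0" "h \<ge> 0" for s h
  proof -
    obtain X Y where XY: "indep_var borel X borel Y" "AE \<omega> in M. X \<omega> = L s \<omega>" "distr M borel Y = distr M borel (L h)"
      "AE \<omega> in M. L (s + h) \<omega> = X \<omega> + Y \<omega>"
      using levy_process_split[OF L st] by blast
    have [measurable]: "Y \<in> borel_measurable M" "X \<in> borel_measurable M" "L h \<in> borel_measurable M"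
      using XY(1) L st by (auto intro: indep_var_rv1 indep_var_rv2 levy_process_measurable)
    have "AE \<omega> in M. 0 \<le> Y \<omega>"
      using eq_distr_AE[OF XY(3), of "\<lambda>x. 0 \<le> x"] levy_nonneg[OF L pos st(2)] by auto
    moreover have "AE \<omega> in M. 0 \<le> X \<omega>" using XY(2) levy_nonneg[OF L pos st(1)] by eventually_elim auto
    moreover have "AE \<omega> in M. L s \<omega> = X \<omega>" using XY(2) by eventually_elim auto
    ultimately show ?thesis using XY by (intro exI[of _ X] exI[of _ Y]) simp
  qed
  \<comment> \<open>Both summands of \<open>L (s + h)\<close> are nonnegative, so
    \<open>L (s + h)\<close> dominates \<open>L s\<close>. Square integrability thus descends from
    integer times, which are reached by repeated addition, to all smaller ones.\<close>
  have down: "square_integrable M (L s)" if st: "s \<ge> 0" "h \<ge> 0" and sq: "square_integrable M (L (s + h))" for s h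
  proof -
    obtain X Y where XY: "AE \<omega> in M. L s \<omega> = X \<omega>" "AE \<omega> in M. L (s + h) \<omega> = X \<omega> + Y \<omega>"
      "AE \<omega> in M. 0 \<le> X \<omega>" "AE \<omega> in M. 0 \<le> Y \<omega>"
      using split[OF st] by blast
    have [measurable]: "L s \<in> borel_measurable M" using L st by (auto intro: levy_process_measurable)
    have "integrable M (\<lambda>\<omega>. (L s \<omega>)\<^sup>2)"
    proof (rule Bochner_Integration.integrable_bound)
      show "integrable M (\<lambda>\<omega>. (L (s + h) \<omega>)\<^sup>2)" using sq by (simp add: square_integrable_def)
      show "AE \<omega> in M. norm ((L s \<omega>)\<^sup>2) \<le> norm ((L (s + h) \<omega>)\<^sup>2)"
        using XY by eventually_elim (auto intro: power_mono)
    qed simp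
    then show ?thesis by (simp add: square_integrable_def)
  qed
  have up: "square_integrable M (L (s + h))" if "s \<ge> 0" "h \<ge> 0" "square_integrable M (L s)" "square_integrable M (L h)" for s h
  proof -
    have [measurable]: "L s \<in> borel_measurable M" "L h \<in> borel_measurable M" "L (s + h) \<in> borel_measurable M"
      using L that by (auto intro: levy_process_measurable)
    have "square_integrable M (\<lambda>\<omega>. L (s + h) \<omega> - L s \<omega>)"
      using eq_distr_square_integrable[OF levy_process_increment[OF L that(1,2)]] that by simp
    from square_integrable_add[OF this that(3)] show ?thesis by simp
  qed
  have nat: "square_integrable M (L (real (Suc n)))" for n
  proof (induction n)
    case (Suc n)
    show ?case using up[of "real (Suc n)" 1, OF _ _ Suc si] by (simp add: add.commute)
  qed (use si in simp)
  have SI: "square_integrable M (L s)" if "s \<ge> 0" for s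
  proof -
    obtain n where "s \<le> real n" using real_arch_simple by blast
    then show ?thesis using down[of s "real (Suc n) - s"] nat[of n] that by simp
  qed
  show "square_integrable M (L t)" by (rule SI) fact
  have ve: "variance (L s) = expectation (\<lambda>\<omega>. (L s \<omega>)\<^sup>2) - (expectation (L s))\<^sup>2" if "s \<ge> 0" for s
    using SI[OF that] by (intro variance_eq) (auto intro: square_integrable_imp_integrable square_integrableD)
  have add: "expectation (L (s + h)) = expectation (L s) + expectation (L h)"
     "variance (L (s + h)) = variance (L s) + variance (L h)" if st: "s \<ge> 0" "h \<ge> 0" for s h
  proof -
    obtain X Y where XY: "indep_var borel X borel Y" "AE \<omega> in M. L s \<omega> = X \<omega>" "distr M borel Y = distr M borel (L h)"
      "AE \<omega> in M. L (s + h) \<omega> = X \<omega> + Y \<omega>" and [measurable]: "X \<in> borel_measurable M" "Y \<in> borel_measurable M"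
      using split[OF st] by blast
    have [measurable]: "L s \<in> borel_measurable M" "L h \<in> borel_measurable M" "L (s + h) \<in> borel_measurable M"
      using L st by (auto intro: levy_process_measurable)
    have sX: "square_integrable M X" by (rule square_integrable_cong_AE[OF SI[OF st(1)]]) (use XY in auto)
    have sY: "square_integrable M Y" using eq_distr_square_integrable[OF XY(3)] SI[OF st(2)] by simp
    note iX = square_integrable_imp_integrable[OF sX] and iY = square_integrable_imp_integrable[OF sY]
    have eX: "expectation (L s) = expectation X" "expectation (\<lambda>\<omega>. (L s \<omega>)\<^sup>2) = expectation (\<lambda>\<omega>. (X \<omega>)\<^sup>2)"
      using XY(2) by (auto intro!: integral_cong_AE)
    have eY: "expectation (L h) = expectation Y" "expectation (\<lambda>\<omega>. (L h \<omega>)\<^sup>2) = expectation (\<lambda>\<omega>. (Y \<omega>)\<^sup>2)"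
      by (intro eq_distr_integral[OF XY(3), symmetric, of "\<lambda>x. x"] eq_distr_integral[OF XY(3), symmetric, of "\<lambda>x. x\<^sup>2"]; simp)+
    have "expectation (L (s + h)) = expectation (\<lambda>\<omega>. X \<omega> + Y \<omega>)"
      using XY(4) by (intro integral_cong_AE) auto
    also have "\<dots> = expectation X + expectation Y" using iX iY by simp
    finally show 1: "expectation (L (s + h)) = expectation (L s) + expectation (L h)" using eX eY by simp
    have "expectation (\<lambda>\<omega>. (L (s + h) \<omega>)\<^sup>2) = expectation (\<lambda>\<omega>. (X \<omega>)\<^sup>2 + (Y \<omega>)\<^sup>2 + 2 * (X \<omega> * Y \<omega>))"
      using XY(4) by (intro integral_cong_AE) (auto simp: power2_sum elim!: eventually_mono)
    also have "\<dots> = expectation (\<lambda>\<omega>. (X \<omega>)\<^sup>2) + expectation (\<lambda>\<omega>. (Y \<omega>)\<^sup>2) + 2 * (expectation X * expectation Y)"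
      using sX sY indep_var_integrable[OF XY(1) iX iY] indep_var_lebesgue_integral[OF XY(1) iX iY] by (simp add: square_integrable_def)
    finally show "variance (L (s + h)) = variance (L s) + variance (L h)"
      unfolding ve[OF st(1)] ve[OF st(2)] ve[OF add_nonneg_nonneg[OF st]]
      by (simp add: 1 eX eY power2_sum)
  qed
  show "expectation (L t) = t * expectation (L 1)"
    by (rule additive_nonneg_linear[where f = "\<lambda>t. expectation (L t)"])
      (auto simp: add \<open>t \<ge> 0\<close> intro!: integral_nonneg_AE levy_nonneg[OF L pos])
  show "variance (L t) = t * variance (L 1)"
    by (rule additive_nonneg_linear[where f = "\<lambda>t. variance (L t)"])
      (auto simp only: add(2) intro!: \<open>t \<ge> 0\<close> integral_nonneg_AE AE_I2 zero_le_power2)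
qed

section \<open>The random measure of a two-sided Levy process\<close>

text \<open>Bounded sets are not closed under complements, so the Dynkin class argument is run for
  the traces on a fixed window containing \<open>A\<close>. Complements then turn into proper
  differences inside the window, hence the case \<open>diff\<close>.\<close>

lemma bounded_borel_induct [consumes 2, case_names interval empty diff union]:
  fixes A :: "real set"
  assumes "A \<in> sets borel" "bounded A"
    and interval: "\<And>a b. a \<le> b \<Longrightarrow> P {a<..b}"
    and empty: "P {}"
    and diff: "\<And>A B. A \<in> sets borel \<Longrightarrow> B \<in> sets borel \<Longrightarrow> bounded B \<Longrightarrow> A \<subseteq> B \<Longrightarrow> P A \<Longrightarrow> P B \<Longrightarrow> P (B - A)"
    and union: "\<And>A. (\<And>n::nat. A n \<in> sets borel) \<Longrightarrow> disjoint_family A \<Longrightarrow> bounded (\<Union>n. A n) \<Longrightarrow> (\<And>n. P (A n)) \<Longrightarrow> P (\<Union>n. A n)"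
  shows "P A"
proof -
  let ?G = "range (\<lambda>(a, b). {a<..b::real})"
  obtain N where N: "A \<subseteq> {-N<..N}" "N > 0"
  proof -
    obtain B where "\<And>x. x \<in> A \<Longrightarrow> norm x \<le> B" using \<open>bounded A\<close> by (auto simp: bounded_iff)
    then have "A \<subseteq> {-(\<bar>B\<bar> + 1)<..\<bar>B\<bar> + 1}" by (force simp: abs_le_iff)
    then show ?thesis by (intro that[of "\<bar>B\<bar> + 1"]) auto
  qed
  let ?I = "{-N<..N}"
  have bdd: "bounded (B \<inter> ?I)" for B by (rule bounded_subset[of "{-N..N}"]) auto
  have borel: "sigma_sets UNIV ?G = sets borel"
    by (metis borel_sigma_sets_Ioc sets_measure_of_conv top_greatest Pow_UNIV)
  have ivl: "P ({a<..b} \<inter> ?I)" for a b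
  proof (cases "max a (-N) \<le> min b N")
    case True
    have "{a<..b} \<inter> ?I = {max a (-N)<..min b N}" by auto
    with interval[OF True] show ?thesis by simp
  next
    case False
    then have "{a<..b} \<inter> ?I = {}" by auto
    then show ?thesis using empty by (simp only:)
  qed
  have "Int_stable ?G"
    unfolding Int_stable_def
  proof safe
    fix a b c d :: real
    have "{a<..b} \<inter> {c<..d} = {max a c<..min b d}" by auto
    then show "{a<..b} \<inter> {c<..d} \<in> ?G" by auto
  qed
  moreover have "?G \<subseteq> Pow UNIV" by simp
  moreover have "A \<in> sigma_sets UNIV ?G" using assms borel by simp
  ultimately have "P (A \<inter> ?I)"
  proof (induction rule: sigma_sets_induct_disjoint)
    case (basic A)
    then show ?case using ivl by auto
  next
    case (compl A)
    have "(UNIV - A) \<inter> ?I = ?I - (A \<inter> ?I)" by auto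
    then show ?case
      using diff[of "A \<inter> ?I" ?I] compl borel interval[of "-N" N] N bdd[of ?I] by auto
  next
    case (union A)
    have "P (\<Union>n. A n \<inter> ?I)"
    proof (rule assms(6))
      show "disjoint_family (\<lambda>n. A n \<inter> ?I)" using union(1) by (auto simp: disjoint_family_on_def)
      show "bounded (\<Union>n. A n \<inter> ?I)" using bdd[of "\<Union>n. A n"] by simp
    qed (use union borel in auto)
    then show ?case by simp
  qed (use empty in auto)
  moreover have "A \<inter> ?I = A" using N by auto
  ultimately show ?thesis by simp
qed

lemma (in prob_space) eq_distr_path:
  assumes "distr M (path_space T) (path_of T L1) = distr M (path_space T) (path_of T L2)"
    and [measurable]: "path_of T L1 \<in> measurable M (path_space T)" "path_of T L2 \<in> measurable M (path_space T)" and "t \<in> T"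
  shows "distr M borel (L1 t) = distr M borel (L2 t)"
proof -
  have c[measurable]: "(\<lambda>f. f t) \<in> measurable (path_space T) borel"
    using \<open>t \<in> T\<close> by (rule measurable_component_singleton)
  have "distr (distr M (path_space T) (path_of T L)) borel (\<lambda>f. f t) = distr M borel (L t)"
    if "path_of T L \<in> measurable M (path_space T)" for L :: "real \<Rightarrow> 'a \<Rightarrow> real"
    using that \<open>t \<in> T\<close> by (subst distr_distr[OF c]) (auto simp: o_def path_of_def)
  from this[of L1] this[of L2] show ?thesis using assms by simp
qed

text \<open>For negative times the values of L are left limits of the second copy, so an increment
  is a limit of increments of that copy and its law follows from continuity in law. Intervals
  straddling 0 are left out; they are handled later by splitting at 0 and using the independence of
  the random measure.\<close>

lemma (in prob_space) two_sided_levy_increments: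
  assumes "two_sided_levy_process M L"
  obtains L1 where "levy_process M L1" "AE \<omega> in M. \<forall>t\<ge>0. L t \<omega> = L1 t \<omega>"
    "\<And>a b z. a \<le> b \<Longrightarrow> 0 \<le> a \<or> b \<le> 0 \<Longrightarrow>
       char (distr M borel (\<lambda>\<omega>. L b \<omega> - L a \<omega>)) z = char (distr M borel (L1 (b - a))) z"
proof -
  from assms obtain L1 L2 where L1: "levy_process M L1" and L2: "levy_process M L2" and
    eq: "distr M (path_space {0..}) (path_of {0..} L1) = distr M (path_space {0..}) (path_of {0..} L2)" and
    ind: "indep_var (path_space {0..}) (path_of {0..} L1) (path_space {0..}) (path_of {0..} L2)" and
    AE: "AE \<omega> in M. (\<forall>t\<ge>0. L t \<omega> = L1 t \<omega>) \<and> (\<forall>t<0. ((\<lambda>s. L2 s \<omega>) \<longlongrightarrow> - L t \<omega>) (at_left (- t)))" and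
    [measurable]: "\<And>t. L t \<in> borel_measurable M"
    unfolding two_sided_levy_process_def by blast
  have pos: "AE \<omega> in M. \<forall>t\<ge>0. L t \<omega> = L1 t \<omega>" using AE by eventually_elim auto
  have neg: "AE \<omega> in M. \<forall>t<0. ((\<lambda>s. L2 s \<omega>) \<longlongrightarrow> - L t \<omega>) (at_left (- t))" using AE by eventually_elim auto
  note [measurable] = levy_process_measurable[OF L1] levy_process_measurable[OF L2]
  let ?c = "\<lambda>t z. char (distr M borel (L1 t)) z"
  have L2c: "char (distr M borel (L2 t)) z = ?c t z" if "t \<ge> 0" for t z
    using eq_distr_path[OF eq indep_var_rv1[OF ind] indep_var_rv2[OF ind], of t] that by simp
  have left: "filterlim (\<lambda>n. t - e / (real n + 1)) (at_left t) sequentially" if "e > 0" for t e :: real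
  proof -
    have "(\<lambda>n. t - e / (real n + 1)) \<longlonglongrightarrow> t" by real_asymp
    then show ?thesis using that by (auto simp: filterlim_at intro!: always_eventually divide_pos_pos)
  qed
  have "char (distr M borel (\<lambda>\<omega>. L b \<omega> - L a \<omega>)) z = ?c (b - a) z"
    if ab: "a \<le> b" "0 \<le> a \<or> b \<le> 0" for a b z
  proof (cases "0 \<le> a")
    case True
    have "char (distr M borel (\<lambda>\<omega>. L b \<omega> - L a \<omega>)) z = char (distr M borel (\<lambda>\<omega>. L1 (a + (b - a)) \<omega> - L1 a \<omega>)) z"
      using pos ab True by (intro char_cong_AE) (auto elim!: eventually_mono)
    also have "\<dots> = ?c (b - a) z"
      using levy_process_increment[OF L1, of a "b - a"] ab True by simp
    finally show ?thesis .
  next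
    case False
    then have "a < 0" "b \<le> 0" using ab by auto
    show ?thesis
    proof (cases "b = 0")
      case True
      \<comment> \<open>Here \<open>L b\<close> is the value \<open>L1 0\<close>, which vanishes,
        and not a left limit of \<open>L2\<close>. Only \<open>L a\<close> has to be approximated,
        by times just below \<open>- a\<close>.\<close>
      define s where "s n = - a - (- a) / (real n + 1)" for n :: nat
      have sn: "0 \<le> s n" "s n \<le> - a" for n
        using \<open>a < 0\<close> by (auto simp: s_def field_simps mult_nonpos_nonneg)
      have "AE \<omega> in M. (\<lambda>n. L2 (s n) \<omega>) \<longlonglongrightarrow> L b \<omega> - L a \<omega>"
      proof -
        have "AE \<omega> in M. L1 0 \<omega> = 0" using L1 by (simp add: levy_process_def)
        with neg pos show ?thesis
        proof eventually_elim
          case (elim \<omega>)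
          have "(\<lambda>n. L2 (s n) \<omega>) \<longlonglongrightarrow> - L a \<omega>"
            unfolding s_def using elim(1) \<open>a < 0\<close> by (intro filterlim_compose[OF _ left]) auto
          then show ?case using elim True by simp
        qed
      qed
      then have "(\<lambda>n. char (distr M borel (L2 (s n))) z) \<longlonglongrightarrow> char (distr M borel (\<lambda>\<omega>. L b \<omega> - L a \<omega>)) z"
        using sn by (intro char_tendsto) auto
      moreover have "(\<lambda>n. ?c (s n) z) \<longlonglongrightarrow> ?c (- a) z"
      proof (rule levy_char_left_tendsto[OF L1])
        show "s \<longlonglongrightarrow> - a" unfolding s_def by real_asymp
      qed (use sn \<open>a < 0\<close> in auto)
      ultimately show ?thesis using True sn LIMSEQ_unique by (fastforce simp: L2c)
    next
      case False
      then have "b < 0" using \<open>b \<le> 0\<close> by simp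
      \<comment> \<open>Both times are lowered by the same amount, so the approximating increments
        all have length \<open>b - a\<close> and a law independent of n. The bound
        \<open>e n \<le> - b\<close> keeps the times nonnegative.\<close>
      define e where "e n = (- b) / (real n + 1)" for n :: nat
      have e: "0 < e n" "e n \<le> - b" for n
        using \<open>b < 0\<close> by (auto simp: e_def field_simps mult_nonpos_nonneg)
      have nn: "0 \<le> - b - e n" "0 \<le> - b - e n + (b - a)" for n
        using e[of n] ab by linarith+
      have "AE \<omega> in M. (\<lambda>n. L2 (- b - e n + (b - a)) \<omega> - L2 (- b - e n) \<omega>) \<longlonglongrightarrow> L b \<omega> - L a \<omega>"
        using neg
      proof eventually_elim
        case (elim \<omega>)
        have "(\<lambda>n. L2 (- a - e n) \<omega>) \<longlonglongrightarrow> - L a \<omega>"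
          unfolding e_def using elim(1) \<open>a < 0\<close> \<open>b < 0\<close> by (intro filterlim_compose[OF _ left]) auto
        moreover have "(\<lambda>n. L2 (- b - e n) \<omega>) \<longlonglongrightarrow> - L b \<omega>"
          unfolding e_def using elim(1) \<open>b < 0\<close> by (intro filterlim_compose[OF _ left]) auto
        ultimately have "(\<lambda>n. L2 (- a - e n) \<omega> - L2 (- b - e n) \<omega>) \<longlonglongrightarrow> - L a \<omega> - (- L b \<omega>)"
          by (rule tendsto_diff)
        then show ?case by (simp add: algebra_simps)
      qed
      then have "(\<lambda>n. char (distr M borel (\<lambda>\<omega>. L2 (- b - e n + (b - a)) \<omega> - L2 (- b - e n) \<omega>)) z) \<longlonglongrightarrow> char (distr M borel (\<lambda>\<omega>. L b \<omega> - L a \<omega>)) z"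
        by (intro char_tendsto borel_measurable_diff levy_process_measurable[OF L2] nn) simp_all
      moreover have "char (distr M borel (\<lambda>\<omega>. L2 (- b - e n + (b - a)) \<omega> - L2 (- b - e n) \<omega>)) z = ?c (b - a) z" for n
        using levy_process_increment[OF L2, of "- b - e n" "b - a"] L2c[of "b - a" z] nn[of n] ab by simp
      ultimately show ?thesis by (simp add: LIMSEQ_const_iff)
    qed
  qed
  with L1 pos show ?thesis by (rule that)
qed

section \<open>Law, uniqueness and path dependence of the random measure\<close>

context
  fixes M :: "'a measure" and L :: "real \<Rightarrow> 'a \<Rightarrow> real" and \<Lambda> :: "real set \<Rightarrow> 'a \<Rightarrow> real"
  assumes M: "prob_space M" and \<Lambda>: "random_measure_of M L \<Lambda>"
begin

interpretation prob_space M by fact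

lemma random_measure_measurable: "A \<in> sets borel \<Longrightarrow> bounded A \<Longrightarrow> \<Lambda> A \<in> borel_measurable M"
  using \<Lambda> by (simp add: random_measure_of_def)

lemma random_measure_interval: "a \<le> b \<Longrightarrow> AE \<omega> in M. \<Lambda> {a<..b} \<omega> = L b \<omega> - L a \<omega>"
  using \<Lambda> by (simp add: random_measure_of_def)

lemma random_measure_sums:
  assumes "\<And>n::nat. A n \<in> sets borel" "disjoint_family A" "bounded (\<Union>n. A n)"
  shows "AE \<omega> in M. (\<lambda>n. \<Lambda> (A n) \<omega>) sums \<Lambda> (\<Union>n. A n) \<omega>" "indep_vars (\<lambda>_. borel) (\<lambda>n. \<Lambda> (A n)) UNIV"
proof -
  have "bounded (A n)" for n by (rule bounded_subset[OF assms(3)]) auto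
  then show "AE \<omega> in M. (\<lambda>n. \<Lambda> (A n) \<omega>) sums \<Lambda> (\<Union>n. A n) \<omega>" "indep_vars (\<lambda>_. borel) (\<lambda>n. \<Lambda> (A n)) UNIV"
    using \<Lambda> assms unfolding random_measure_of_def by blast+
qed

text \<open>Applied to empty sets only, countable additivity gives a convergent series with constant
  terms.\<close>

lemma random_measure_empty: "AE \<omega> in M. \<Lambda> {} \<omega> = 0"
proof -
  have "AE \<omega> in M. (\<lambda>n::nat. \<Lambda> {} \<omega>) sums \<Lambda> (\<Union>n::nat. {}) \<omega>"
    by (rule random_measure_sums) (auto simp: disjoint_family_on_def)
  then show ?thesis
    by eventually_elim (auto dest!: sums_summable summable_LIMSEQ_zero simp: LIMSEQ_const_iff)
qed

lemma random_measure_disjoint: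
  assumes AB: "A \<in> sets borel" "B \<in> sets borel" "bounded A" "bounded B" "A \<inter> B = {}"
  shows "AE \<omega> in M. \<Lambda> (A \<union> B) \<omega> = \<Lambda> A \<omega> + \<Lambda> B \<omega>" "indep_var borel (\<Lambda> A) borel (\<Lambda> B)"
proof -
  define C where "C n = (if n = 0 then A else if n = 1 then B else {})" for n :: nat
  have U: "(\<Union>n. C n) = A \<union> B" by (auto simp: C_def split: if_splits)
  have C: "\<And>n. C n \<in> sets borel" "disjoint_family C" "bounded (\<Union>n. C n)"
    using AB unfolding U by (auto simp: C_def disjoint_family_on_def)
  have "AE \<omega> in M. (\<lambda>n. \<Lambda> (C n) \<omega>) sums \<Lambda> (A \<union> B) \<omega>"
    using random_measure_sums(1)[OF C] unfolding U .
  with random_measure_empty show "AE \<omega> in M. \<Lambda> (A \<union> B) \<omega> = \<Lambda> A \<omega> + \<Lambda> B \<omega>"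
  proof eventually_elim
    case (elim \<omega>)
    have "(\<lambda>n. \<Lambda> (C n) \<omega>) sums (\<Sum>n\<in>{0, 1}. \<Lambda> (C n) \<omega>)"
      by (rule sums_finite) (auto simp: C_def elim)
    then show ?case using elim(2) sums_unique2 by (fastforce simp: C_def)
  qed
  have "indep_vars (\<lambda>_. borel) (\<lambda>n. \<Lambda> (C n)) (insert 0 {1})"
    by (rule indep_vars_subset[OF random_measure_sums(2)[OF C]]) auto
  then have "indep_var borel (\<Lambda> (C 0)) borel (\<lambda>\<omega>. \<Sum>n\<in>{1}. \<Lambda> (C n) \<omega>)"
    by (intro indep_vars_sum) auto
  then show "indep_var borel (\<Lambda> A) borel (\<Lambda> B)" by (simp add: C_def)
qed

text \<open>Every \<open>X t\<close> comes with a random measure of its own, and joint moments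
  require a common one. The additivity of the second measure is a hypothesis because the facts of
  this context are available for \<open>\<Lambda>\<close> alone; callers supply them by
  symmetry.\<close>

lemma random_measure_AE_unique:
  assumes \<Lambda>': "random_measure_of M L \<Lambda>'" and A: "A \<in> sets borel" "bounded A"
    and other: "\<And>A B. A \<in> sets borel \<Longrightarrow> B \<in> sets borel \<Longrightarrow> bounded A \<Longrightarrow> bounded B \<Longrightarrow> A \<inter> B = {} \<Longrightarrow>
       AE \<omega> in M. \<Lambda>' (A \<union> B) \<omega> = \<Lambda>' A \<omega> + \<Lambda>' B \<omega>" "AE \<omega> in M. \<Lambda>' {} \<omega> = 0"
  shows "AE \<omega> in M. \<Lambda> A \<omega> = \<Lambda>' A \<omega>"
  using A
proof (induction rule: bounded_borel_induct)
  case (interval a b)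
  have "AE \<omega> in M. \<Lambda>' {a<..b} \<omega> = L b \<omega> - L a \<omega>"
    using \<Lambda>' interval by (simp add: random_measure_of_def)
  with random_measure_interval[OF interval] show ?case by eventually_elim simp
next
  case empty
  show ?case using other(2) random_measure_empty by eventually_elim simp
next
  case (diff A B)
  have b: "bounded A" "bounded (B - A)" using diff by (auto intro: bounded_subset)
  have "A \<union> (B - A) = B" using diff by auto
  then have "AE \<omega> in M. \<Lambda> B \<omega> = \<Lambda> A \<omega> + \<Lambda> (B - A) \<omega>" "AE \<omega> in M. \<Lambda>' B \<omega> = \<Lambda>' A \<omega> + \<Lambda>' (B - A) \<omega>"
    using random_measure_disjoint(1)[of A "B - A"] other(1)[of A "B - A"] diff b by auto
  with diff(5,6) show ?case by eventually_elim simp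
next
  case (union A)
  have "bounded (A n)" for n by (rule bounded_subset[OF union(3)]) auto
  then have "AE \<omega> in M. (\<lambda>n. \<Lambda>' (A n) \<omega>) sums \<Lambda>' (\<Union>n. A n) \<omega>"
    using \<Lambda>' union unfolding random_measure_of_def by blast
  moreover have "AE \<omega> in M. \<forall>n. \<Lambda> (A n) \<omega> = \<Lambda>' (A n) \<omega>"
    using union(4) by (simp add: AE_all_countable)
  ultimately show ?case using random_measure_sums(1)[OF union(1-3)]
    by eventually_elim (auto dest: sums_unique2)
qed

text \<open>The law of \<open>\<Lambda> A\<close> depends on \<open>A\<close> only through its
  Lebesgue measure. In the difference step a characteristic function is cancelled, which is possible
  as it never vanishes; in the union step the measures increase to their limit, so left continuity
  in law is what is needed.\<close>

lemma random_measure_char: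
  assumes L1: "levy_process M L1" and lam: "lam \<ge> 0"
    and inc: "\<And>a b z. a \<le> b \<Longrightarrow> 0 \<le> a \<or> b \<le> 0 \<Longrightarrow>
       char (distr M borel (\<lambda>\<omega>. L b \<omega> - L a \<omega>)) z = char (distr M borel (L1 (lam * (b - a)))) z"
    and meas: "\<And>t. L t \<in> borel_measurable M"
    and A: "A \<in> sets borel" "bounded A"
  shows "char (distr M borel (\<Lambda> A)) z = char (distr M borel (L1 (lam * measure lborel A))) z"
proof -
  let ?c = "\<lambda>t. char (distr M borel (L1 t)) z" and ?d = "\<lambda>A. char (distr M borel (\<Lambda> A)) z"
  note [measurable] = random_measure_measurable meas
  have un: "?d (A \<union> B) = ?d A * ?d B" if "A \<in> sets borel" "B \<in> sets borel" "bounded A" "bounded B" "A \<inter> B = {}" for A B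
  proof -
    have "?d (A \<union> B) = char (distr M borel (\<lambda>\<omega>. \<Lambda> A \<omega> + \<Lambda> B \<omega>)) z"
      using that by (intro char_cong_AE random_measure_disjoint) auto
    also have "\<dots> = ?d A * ?d B" by (rule char_distr_add[OF random_measure_disjoint(2)[OF that]])
    finally show ?thesis .
  qed
  have fin: "emeasure lborel A < \<infinity>" if "bounded A" for A :: "real set"
    using emeasure_bounded_finite[OF that] by simp
  have add: "measure lborel (A \<union> B) = measure lborel A + measure lborel B"
    if "A \<in> sets borel" "B \<in> sets borel" "bounded A" "bounded B" "A \<inter> B = {}" for A B :: "real set"
    using that fin[of A] fin[of B] by (intro measure_Union) auto
  have same: "?d {a<..b} = ?c (lam * (b - a))" if "a \<le> b" "0 \<le> a \<or> b \<le> 0" for a b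
  proof -
    have "?d {a<..b} = char (distr M borel (\<lambda>\<omega>. L b \<omega> - L a \<omega>)) z"
      by (intro char_cong_AE random_measure_interval that random_measure_measurable) auto
    with inc[OF that] show ?thesis by simp
  qed
  show ?thesis
    using A
  proof (induction rule: bounded_borel_induct)
    case (interval a b)
    have "?d {a<..b} = ?c (lam * (b - a))"
    proof (cases "0 \<le> a \<or> b \<le> 0")
      \<comment> \<open>An interval around 0 is split there, and \<open>un\<close> supplies the
        independence of the two parts.\<close>
      case False
      then have ab: "a < 0" "0 < b" by auto
      then have "{a<..b} = {a<..0} \<union> {0<..b}" by auto
      then have "?d {a<..b} = ?d {a<..0} * ?d {0<..b}" using un[of "{a<..0}" "{0<..b}"] by auto
      also have "\<dots> = ?c (lam * (0 - a)) * ?c (lam * (b - 0))" using ab by (simp add: same del: diff_0 diff_0_right)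
      also have "\<dots> = ?c (lam * (0 - a) + lam * (b - 0))"
        using ab lam by (intro levy_char_add[OF L1, symmetric]) (auto simp: mult_nonneg_nonpos)
      finally show ?thesis by (simp add: algebra_simps)
    qed (use same interval in auto)
    then show ?case using interval by simp
  next
    case empty
    show ?case
      using char_const_0[OF _ random_measure_empty] random_measure_measurable[of "{}"] levy_char_0[OF L1] by simp
  next
    case (diff A B)
    have b: "bounded A" "bounded (B - A)" using diff by (auto intro: bounded_subset)
    have eq: "A \<union> (B - A) = B" using diff by auto
    have 1: "?d B = ?d A * ?d (B - A)" using un[of A "B - A"] diff b unfolding eq by auto
    have 2: "measure lborel B = measure lborel A + measure lborel (B - A)" using add[of A "B - A"] diff b unfolding eq by auto
    have "?c (lam * measure lborel B) = ?c (lam * measure lborel A) * ?c (lam * measure lborel (B - A))"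
      unfolding 2 distrib_left using lam by (intro levy_char_add[OF L1]) auto
    moreover have "?c (lam * measure lborel A) \<noteq> 0" using lam by (intro levy_char_nonzero[OF L1]) auto
    ultimately show ?case using 1 diff by simp
  next
    case (union A)
    have bA: "bounded (A n)" "bounded (\<Union>i<n. A i)" for n by (rule bounded_subset[OF union(3)], auto)+
    have disj: "(\<Union>i<n. A i) \<inter> A n = {}" for n
    proof -
      have "A i \<inter> A n = {}" if "i < n" for i
        using union(2) that by (intro disjoint_family_onD) auto
      then show ?thesis by blast
    qed
    have UB: "(\<Union>i<n. A i) \<in> sets borel" for n using union(1) by (intro sets.countable_UN') auto
    have part: "?d (\<Union>i<n. A i) = ?c (lam * measure lborel (\<Union>i<n. A i))" for n
    proof (induction n)
      case 0
      show ?case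
        using char_const_0[OF _ random_measure_empty] random_measure_measurable[of "{}"] levy_char_0[OF L1] by simp
    next
      case (Suc n)
      have eq: "(\<Union>i<Suc n. A i) = (\<Union>i<n. A i) \<union> A n" by (auto simp: less_Suc_eq)
      have "?c (lam * (measure lborel (\<Union>i<n. A i) + measure lborel (A n))) =
          ?c (lam * measure lborel (\<Union>i<n. A i)) * ?c (lam * measure lborel (A n))"
        unfolding distrib_left using lam by (intro levy_char_add[OF L1]) auto
      then show ?case
        unfolding eq un[OF UB union(1) bA(2,1) disj] add[OF UB union(1) bA(2,1) disj] Suc.IH union(4) by simp
    qed
    have lim: "AE \<omega> in M. (\<lambda>n. \<Lambda> (\<Union>i<n. A i) \<omega>) \<longlonglongrightarrow> \<Lambda> (\<Union>n. A n) \<omega>"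
    proof -
      have "AE \<omega> in M. \<Lambda> (\<Union>i<n. A i) \<omega> = (\<Sum>i<n. \<Lambda> (A i) \<omega>)" for n
      proof (induction n)
        case 0 then show ?case using random_measure_empty by simp
      next
        case (Suc n)
        have eq: "(\<Union>i<Suc n. A i) = (\<Union>i<n. A i) \<union> A n" by (auto simp: less_Suc_eq)
        have "AE \<omega> in M. \<Lambda> ((\<Union>i<n. A i) \<union> A n) \<omega> = \<Lambda> (\<Union>i<n. A i) \<omega> + \<Lambda> (A n) \<omega>"
          by (rule random_measure_disjoint(1)[OF UB union(1) bA(2,1) disj])
        with Suc show ?case unfolding eq by eventually_elim simp
      qed
      then have "AE \<omega> in M. \<forall>n. \<Lambda> (\<Union>i<n. A i) \<omega> = (\<Sum>i<n. \<Lambda> (A i) \<omega>)" by (simp add: AE_all_countable)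
      with random_measure_sums(1)[OF union(1-3)] show ?thesis
        by eventually_elim (simp add: sums_def)
    qed
    have 1: "(\<lambda>n. ?d (\<Union>i<n. A i)) \<longlonglongrightarrow> ?d (\<Union>n. A n)"
      using union(1,3) by (intro char_tendsto lim random_measure_measurable UB bA) auto
    have UU: "(\<Union>n. \<Union>i<n. A i) = (\<Union>n. A n)" by blast
    have "(\<lambda>n. measure lborel (\<Union>i<n. A i)) \<longlonglongrightarrow> measure lborel (\<Union>n. \<Union>i<n. A i)"
    proof (rule Lim_measure_incseq)
      show "incseq (\<lambda>n. \<Union>i<n. A i)" by (force simp: incseq_def)
      show "emeasure lborel (\<Union>n. \<Union>i<n. A i) \<noteq> \<infinity>" unfolding UU using fin[OF union(3)] by simp
    qed (use UB in auto)
    then have m: "(\<lambda>n. measure lborel (\<Union>i<n. A i)) \<longlonglongrightarrow> measure lborel (\<Union>n. A n)" by (simp only: UU)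
    have mono: "measure lborel (\<Union>i<n. A i) \<le> measure lborel (\<Union>n. A n)" for n
      using union(1) fin[OF union(3)] by (intro measure_mono_fmeasurable) (auto simp: fmeasurable_def)
    have 2: "(\<lambda>n. ?c (lam * measure lborel (\<Union>i<n. A i))) \<longlonglongrightarrow> ?c (lam * measure lborel (\<Union>n. A n))"
      using lam by (intro levy_char_left_tendsto[OF L1] tendsto_mult tendsto_const m mult_left_mono mono) auto
    show ?case using LIMSEQ_unique[OF 1] 2 by (simp add: part)
  qed
qed

text \<open>Independence from the Brownian motion is assumed for the path of the Levy process, so
  everything built from it must be exhibited as a functional of that path. The hypothesis on
  \<open>L'\<close> allows for the time change \<open>u \<mapsto> lam * u\<close>.\<close>

lemma random_measure_path_measurable:
  assumes A: "A \<in> sets borel" "bounded A" and P: "\<And>t. \<exists>s\<in>T. L t = L' s" and [measurable]: "path_of T L' \<in> measurable M (path_space T)"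
  shows "\<exists>\<Phi>\<in>borel_measurable (path_space T). AE \<omega> in M. \<Lambda> A \<omega> = \<Phi> (path_of T L' \<omega>)"
  using A
proof (induction rule: bounded_borel_induct)
  case (interval a b)
  obtain s t where st: "s \<in> T" "t \<in> T" "L a = L' s" "L b = L' t" using P[of a] P[of b] by auto
  have "(\<lambda>f. f t - f s) \<in> borel_measurable (path_space T)"
    using st by (intro borel_measurable_diff measurable_component_singleton) auto
  moreover have "AE \<omega> in M. \<Lambda> {a<..b} \<omega> = path_of T L' \<omega> t - path_of T L' \<omega> s"
    using random_measure_interval[OF interval] by eventually_elim (auto simp: path_of_def st)
  ultimately show ?case by (intro bexI[of _ "\<lambda>f. f t - f s"])
next
  case empty
  show ?case using random_measure_empty by (intro bexI[of _ "\<lambda>_. 0"]) auto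
next
  case (diff A B)
  then obtain \<Phi> \<Psi> where [measurable]: "\<Phi> \<in> borel_measurable (path_space T)" "\<Psi> \<in> borel_measurable (path_space T)"
    and AE: "AE \<omega> in M. \<Lambda> A \<omega> = \<Phi> (path_of T L' \<omega>)" "AE \<omega> in M. \<Lambda> B \<omega> = \<Psi> (path_of T L' \<omega>)" by blast
  have b: "bounded A" "bounded (B - A)" using diff by (auto intro: bounded_subset)
  have "A \<union> (B - A) = B" using diff by auto
  then have "AE \<omega> in M. \<Lambda> B \<omega> = \<Lambda> A \<omega> + \<Lambda> (B - A) \<omega>"
    using random_measure_disjoint(1)[of A "B - A"] diff b by auto
  with AE have "AE \<omega> in M. \<Lambda> (B - A) \<omega> = \<Psi> (path_of T L' \<omega>) - \<Phi> (path_of T L' \<omega>)"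
    by eventually_elim simp
  then show ?case by (intro bexI[of _ "\<lambda>x. \<Psi> x - \<Phi> x"]) auto
next
  case (union A)
  then have "\<forall>n. \<exists>\<Phi>. \<Phi> \<in> borel_measurable (path_space T) \<and> (AE \<omega> in M. \<Lambda> (A n) \<omega> = \<Phi> (path_of T L' \<omega>))" by blast
  then obtain \<Phi> where \<Phi>[measurable]: "\<And>n. \<Phi> n \<in> borel_measurable (path_space T)"
    and AE: "\<And>n. AE \<omega> in M. \<Lambda> (A n) \<omega> = \<Phi> n (path_of T L' \<omega>)" by metis
  have "AE \<omega> in M. \<forall>n. \<Lambda> (A n) \<omega> = \<Phi> n (path_of T L' \<omega>)" using AE by (simp add: AE_all_countable)
  with random_measure_sums(1)[OF union(1-3)]
  have "AE \<omega> in M. \<Lambda> (\<Union>n. A n) \<omega> = (\<Sum>n. \<Phi> n (path_of T L' \<omega>))"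
    by eventually_elim (auto dest: sums_unique)
  then show ?case by (intro bexI[of _ "\<lambda>x. \<Sum>n. \<Phi> n x"]) auto
qed

end

section \<open>Integrals of step functions\<close>

text \<open>The functions tend to 0 almost everywhere but possibly not in L1. Where they are not
  small they form humps, and along a sparse subsequence each function has little mass on all later
  humps. Collecting the humps of even index in \<open>A\<close> makes the even functions small off
  \<open>A\<close> and the odd ones small on \<open>A\<close>.\<close>

lemma gliding_hump:
  fixes h :: "nat \<Rightarrow> real \<Rightarrow> real"
  assumes h: "\<And>n. integrable lborel (h n)" and lim: "AE x in lborel. (\<lambda>n. h n x) \<longlonglongrightarrow> 0"
  obtains r :: "nat \<Rightarrow> nat" and A where "strict_mono r" "A \<in> sets borel"
    "(\<lambda>k. LBINT x:-A. \<bar>h (r (2 * k)) x\<bar>) \<longlonglongrightarrow> 0" "(\<lambda>k. LBINT x:A. \<bar>h (r (2 * k + 1)) x\<bar>) \<longlonglongrightarrow> 0"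
proof -
  have [measurable]: "\<And>n. h n \<in> borel_measurable borel" using borel_measurable_integrable[OF h] by simp
  \<comment> \<open>Lebesgue measure is infinite, so the threshold that defines a hump has to be an
    integrable positive function and not a constant. Its mass is 2.\<close>
  define w :: "real \<Rightarrow> real" where "w = (\<lambda>x. exp (- 1 * \<bar>0 - x\<bar>))"
  have w: "has_bochner_integral lborel w 2" "\<And>x. w x > 0"
    using has_bochner_integral_kernel[of 1 0] by (auto simp: w_def)
  have [measurable]: "w \<in> borel_measurable borel" by (simp add: w_def)
  define E where "E n k = {x. (1/2) ^ k * w x < \<bar>h n x\<bar>}" for n k :: nat
  have [measurable]: "E n k \<in> sets borel" for n k unfolding E_def by measurable
  have small: "(\<lambda>n. \<integral>x. indicator (E n k) x * \<bar>h j x\<bar> \<partial>lborel) \<longlonglongrightarrow> 0" for k j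
  proof -
    have "(\<lambda>n. \<integral>x. indicator (E n k) x * \<bar>h j x\<bar> \<partial>lborel) \<longlonglongrightarrow> (\<integral>x. 0 \<partial>(lborel :: real measure))"
    proof (rule integral_dominated_convergence[where w = "\<lambda>x. \<bar>h j x\<bar>" and f = "\<lambda>x. 0"
        and s = "\<lambda>n x. indicator (E n k) x * \<bar>h j x\<bar>"])
      show "AE x in lborel. (\<lambda>n. indicator (E n k) x * \<bar>h j x\<bar>) \<longlonglongrightarrow> 0"
        using lim
      proof eventually_elim
        case (elim x)
        have "(\<lambda>n. \<bar>h n x\<bar>) \<longlonglongrightarrow> 0" using elim by (rule tendsto_rabs_zero)
        then have "eventually (\<lambda>n. \<bar>h n x\<bar> < (1/2) ^ k * w x) sequentially"
          using w(2)[of x] by (intro order_tendstoD) auto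
        then have "eventually (\<lambda>n. 0 = indicator (E n k) x * \<bar>h j x\<bar>) sequentially"
          by eventually_elim (auto simp: E_def indicator_def)
        then show ?case by (rule Lim_transform_eventually[OF tendsto_const])
      qed
    qed (use h in \<open>auto split: split_indicator\<close>)
    then show ?thesis by simp
  qed
  \<comment> \<open>The next index is taken so late that every function up to the current index has
    mass at most \<open>(1/2) ^ Suc k\<close> on the new hump; the masses on all later humps are
    then summable.\<close>
  have "\<exists>n'>n. \<forall>j\<le>n. (\<integral>x. indicator (E n' (Suc k)) x * \<bar>h j x\<bar> \<partial>lborel) \<le> (1/2) ^ Suc k" for n k
  proof -
    have "\<forall>\<^sub>F n' in sequentially. \<forall>j\<in>{..n}. (\<integral>x. indicator (E n' (Suc k)) x * \<bar>h j x\<bar> \<partial>lborel) < (1/2) ^ Suc k"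
      using small by (intro eventually_ball_finite ballI order_tendstoD(2)) auto
    then have "\<forall>\<^sub>F n' in sequentially. n < n' \<and> (\<forall>j\<in>{..n}. (\<integral>x. indicator (E n' (Suc k)) x * \<bar>h j x\<bar> \<partial>lborel) < (1/2) ^ Suc k)"
      using eventually_gt_at_top[of n] by eventually_elim simp
    from eventually_happens'[OF sequentially_bot this] obtain n' where
      "n < n'" "\<forall>j\<in>{..n}. (\<integral>x. indicator (E n' (Suc k)) x * \<bar>h j x\<bar> \<partial>lborel) < (1/2) ^ Suc k" by blast
    then show ?thesis by (intro exI[of _ n']) (auto intro: less_imp_le simp del: power_Suc)
  qed
  then have ex: "\<exists>y. True \<and> (x < y \<and> (\<forall>j\<le>x. (\<integral>t. indicator (E y (Suc k)) t * \<bar>h j t\<bar> \<partial>lborel) \<le> (1/2) ^ Suc k))" for x k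
    by blast
  obtain r where "\<forall>k. True \<and> (r k < r (Suc k) \<and> (\<forall>j\<le>r k. (\<integral>x. indicator (E (r (Suc k)) (Suc k)) x * \<bar>h j x\<bar> \<partial>lborel) \<le> (1/2) ^ Suc k))"
    using dependent_nat_choice[of "\<lambda>_ _. True" "\<lambda>k n n'. n < n' \<and> (\<forall>j\<le>n. (\<integral>x. indicator (E n' (Suc k)) x * \<bar>h j x\<bar> \<partial>lborel) \<le> (1/2) ^ Suc k)",
      OF _ ex] by blast
  then have r: "\<And>k. r k < r (Suc k)"
    "\<And>k j. j \<le> r k \<Longrightarrow> (\<integral>x. indicator (E (r (Suc k)) (Suc k)) x * \<bar>h j x\<bar> \<partial>lborel) \<le> (1/2) ^ Suc k"
    by blast+
  have mono: "strict_mono r" using r(1) by (simp add: strict_mono_Suc_iff)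
  define F where "F k = E (r k) k" for k
  define T where "T k = (\<Union>j. F (Suc k + j))" for k
  have [measurable]: "F k \<in> sets borel" "T k \<in> sets borel" for k by (auto simp: F_def T_def)
  have Fle: "(\<integral>\<^sup>+x. indicator (F k) x * ennreal \<bar>h (r i) x\<bar> \<partial>lborel) \<le> ennreal ((1/2) ^ k)" if ik: "i < k" for i k
  proof -
    obtain k' where k: "k = Suc k'" using ik by (cases k) auto
    have "r i \<le> r k'" using ik k by (intro strict_mono_leD[OF mono]) simp
    have "(\<integral>\<^sup>+x. indicator (F k) x * ennreal \<bar>h (r i) x\<bar> \<partial>lborel) = (\<integral>\<^sup>+x. ennreal (indicator (F k) x * \<bar>h (r i) x\<bar>) \<partial>lborel)"
      by (intro nn_integral_cong) (auto split: split_indicator)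
    also have "\<dots> = ennreal (\<integral>x. indicator (F k) x * \<bar>h (r i) x\<bar> \<partial>lborel)"
      using integrable_mult_indicator[of "F k" lborel "\<lambda>x. \<bar>h (r i) x\<bar>"] h by (intro nn_integral_eq_integral) auto
    also have "\<dots> \<le> ennreal ((1/2) ^ k)"
      unfolding F_def k by (rule ennreal_leI[OF r(2)[OF \<open>r i \<le> r k'\<close>]])
    finally show ?thesis .
  qed
  have Tle: "(\<integral>\<^sup>+x. indicator (T k) x * ennreal \<bar>h (r k) x\<bar> \<partial>lborel) \<le> ennreal ((1/2) ^ k)" for k
  proof -
    have "(\<integral>\<^sup>+x. indicator (T k) x * ennreal \<bar>h (r k) x\<bar> \<partial>lborel) \<le>
        (\<integral>\<^sup>+x. (\<Sum>j. indicator (F (Suc k + j)) x * ennreal \<bar>h (r k) x\<bar>) \<partial>lborel)"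
    proof (rule nn_integral_mono)
      fix x
      show "indicator (T k) x * ennreal \<bar>h (r k) x\<bar> \<le> (\<Sum>j. indicator (F (Suc k + j)) x * ennreal \<bar>h (r k) x\<bar>)"
      proof (cases "x \<in> T k")
        case True
        then obtain j where "x \<in> F (Suc k + j)" by (auto simp: T_def)
        then have "indicator (T k) x * ennreal \<bar>h (r k) x\<bar> = (\<Sum>i\<in>{j}. indicator (F (Suc k + i)) x * ennreal \<bar>h (r k) x\<bar>)"
          using True by simp
        also have "\<dots> \<le> (\<Sum>j. indicator (F (Suc k + j)) x * ennreal \<bar>h (r k) x\<bar>)"
          by (rule sum_le_suminf) auto
        finally show ?thesis .
      qed simp
    qed
    also have "\<dots> = (\<Sum>j. \<integral>\<^sup>+x. indicator (F (Suc k + j)) x * ennreal \<bar>h (r k) x\<bar> \<partial>lborel)"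
      by (rule nn_integral_suminf) measurable
    also have "\<dots> \<le> (\<Sum>j. ennreal ((1/2) ^ (Suc k + j)))"
      by (intro suminf_le Fle) auto
    also have "\<dots> = ennreal ((1/2) ^ k)"
    proof (rule suminf_ennreal_eq)
      have "(\<lambda>j. (1/2) ^ Suc k * (1/2) ^ j :: real) sums ((1/2) ^ Suc k * (1 / (1 - 1/2)))"
        by (intro sums_mult geometric_sums) simp
      then show "(\<lambda>j. (1/2) ^ (Suc k + j) :: real) sums (1/2) ^ k" by (simp add: power_add)
    qed simp
    finally show ?thesis .
  qed
  \<comment> \<open>Off its own hump the function is below \<open>(1/2) ^ k * w\<close>, which has
    mass \<open>2 * (1/2) ^ k\<close>; on the union \<open>T k\<close> of the later humps it has
    mass at most \<open>(1/2) ^ k\<close>.\<close>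
  have bound: "(LBINT x:S. \<bar>h (r k) x\<bar>) \<le> 3 * (1/2) ^ k" if [measurable]: "S \<in> sets borel" and S: "S \<subseteq> - F k \<union> T k" for S k
  proof -
    have "(\<integral>\<^sup>+x. ennreal (indicator S x * \<bar>h (r k) x\<bar>) \<partial>lborel) \<le> (\<integral>\<^sup>+x. ennreal ((1/2)^k * w x) + indicator (T k) x * ennreal \<bar>h (r k) x\<bar> \<partial>lborel)"
    proof (rule nn_integral_mono)
      fix x
      show "ennreal (indicator S x * \<bar>h (r k) x\<bar>) \<le> ennreal ((1/2)^k * w x) + indicator (T k) x * ennreal \<bar>h (r k) x\<bar>"
      proof (cases "x \<in> S")
        case True
        then consider "x \<in> T k" | "x \<notin> F k" "x \<notin> T k" using S by auto
        then show ?thesis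
          using True by cases (auto simp: F_def E_def not_less ennreal_leI)
      qed simp
    qed
    also have "\<dots> = (\<integral>\<^sup>+x. ennreal ((1/2)^k * w x) \<partial>lborel) + (\<integral>\<^sup>+x. indicator (T k) x * ennreal \<bar>h (r k) x\<bar> \<partial>lborel)"
      by (rule nn_integral_add) measurable
    also have "\<dots> \<le> ennreal ((1/2)^k * 2) + ennreal ((1/2)^k)"
    proof (intro add_mono Tle)
      have "has_bochner_integral lborel (\<lambda>x. (1/2)^k * w x) ((1/2)^k * 2)"
        by (intro has_bochner_integral_mult_right w)
      then show "(\<integral>\<^sup>+x. ennreal ((1/2)^k * w x) \<partial>lborel) \<le> ennreal ((1/2)^k * 2)"
        using w(2) by (subst nn_integral_eq_integral) (auto simp: has_bochner_integral_iff less_imp_le)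
    qed
    also have "\<dots> = ennreal (3 * (1/2)^k)" by (subst ennreal_plus[symmetric]) (auto simp: mult_ac)
    finally have "enn2real (\<integral>\<^sup>+x. ennreal (indicator S x * \<bar>h (r k) x\<bar>) \<partial>lborel) \<le> 3 * (1/2) ^ k"
      by (intro enn2real_leI) auto
    then show ?thesis
      unfolding set_lebesgue_integral_def by (subst integral_eq_nn_integral) auto
  qed
  have TF: "F (Suc k + j) \<subseteq> T k" for k j unfolding T_def by blast
  \<comment> \<open>Removing \<open>T\<close> from each even hump is what controls the odd
    functions: a point of \<open>A\<close> that comes from an earlier even hump avoids the odd hump,
    and one from a later even hump lies in the tail of the odd index.\<close>
  define A where "A = (\<Union>k. F (2 * k) - T (2 * k))"
  have [measurable]: "A \<in> sets borel" unfolding A_def by measurable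
  have z: "(\<lambda>k. 3 * (1/2::real) ^ (2 * k)) \<longlonglongrightarrow> 0" "(\<lambda>k. 3 * (1/2::real) ^ (2 * k + 1)) \<longlonglongrightarrow> 0"
    by real_asymp+
  show ?thesis
  proof (rule that[OF mono, of A])
    have "- A \<subseteq> - F (2 * k) \<union> T (2 * k)" for k unfolding A_def by auto
    then show "(\<lambda>k. LBINT x:-A. \<bar>h (r (2 * k)) x\<bar>) \<longlonglongrightarrow> 0"
      by (intro tendsto_sandwich[OF _ _ tendsto_const z(1)] always_eventually allI bound)
        (auto simp: set_lebesgue_integral_def intro!: integral_nonneg_AE)
    have "A \<subseteq> - F (2 * k + 1) \<union> T (2 * k + 1)" for k
    proof
      fix x assume "x \<in> A"
      then obtain j where j: "x \<in> F (2 * j)" "x \<notin> T (2 * j)" by (auto simp: A_def)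
      show "x \<in> - F (2 * k + 1) \<union> T (2 * k + 1)"
      proof (cases "j \<le> k")
        case True
        then have "2 * k + 1 = Suc (2 * j) + (2 * k - 2 * j)" by simp
        then have "F (2 * k + 1) \<subseteq> T (2 * j)" by (metis TF)
        then show ?thesis using j by blast
      next
        case False
        then have "2 * j = Suc (2 * k + 1) + (2 * j - 2 * k - 2)" by simp
        then have "F (2 * j) \<subseteq> T (2 * k + 1)" by (metis TF)
        then show ?thesis using j by blast
      qed
    qed
    then show "(\<lambda>k. LBINT x:A. \<bar>h (r (2 * k + 1)) x\<bar>) \<longlonglongrightarrow> 0"
      by (intro tendsto_sandwich[OF _ _ tendsto_const z(2)] always_eventually allI bound)
        (auto simp: set_lebesgue_integral_def intro!: integral_nonneg_AE)
  qed simp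
qed

section \<open>Step functions and their integrals against orthogonal measures\<close>

lemma step_functionD:
  assumes "step_function g"
  shows "g \<in> borel_measurable borel" "finite (range g)" "bounded {x. g x \<noteq> 0}"
    "y \<noteq> 0 \<Longrightarrow> bounded (A \<inter> g -` {y})" "A \<in> sets borel \<Longrightarrow> A \<inter> g -` {y} \<in> sets borel"
proof -
  show 1: "g \<in> borel_measurable borel" "finite (range g)" "bounded {x. g x \<noteq> 0}"
    using assms by (auto simp: step_function_def)
  show "bounded (A \<inter> g -` {y})" if "y \<noteq> 0" by (rule bounded_subset[OF 1(3)]) (use that in auto)
  show "A \<inter> g -` {y} \<in> sets borel" if "A \<in> sets borel"
    using that measurable_sets[OF 1(1), of "{y}"] by auto
qed

lemma step_function_linear:
  assumes "step_function f" "step_function g"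
  shows "step_function (\<lambda>x. a * f x + b * g x)"
  unfolding step_function_def
proof safe
  note f = step_functionD[OF assms(1)] and g = step_functionD[OF assms(2)]
  show "(\<lambda>x. a * f x + b * g x) \<in> borel_measurable borel" using f g by measurable
  show "finite (range (\<lambda>x. a * f x + b * g x))"
    by (rule finite_subset[of _ "(\<lambda>(y, z). a * y + b * z) ` (range f \<times> range g)"]) (use f g in auto)
  show "bounded {x. a * f x + b * g x \<noteq> 0}"
    by (rule bounded_subset[OF bounded_Un[THEN iffD2, OF conjI[OF f(3) g(3)]]]) auto
qed

text \<open>The level set of 0 is unbounded and missing from the sum; the condition
  \<open>\<phi> 0 = 0\<close> accounts for it.\<close>

lemma has_bochner_integral_step:
  assumes g: "step_function g" and A: "A \<in> sets borel" and "\<phi> 0 = 0"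
  shows "has_bochner_integral lborel (\<lambda>x. indicator A x * \<phi> (g x) :: real)
    (\<Sum>y\<in>range g - {0}. \<phi> y * measure lborel (A \<inter> g -` {y}))"
proof -
  note gD = step_functionD[OF g]
  have "has_bochner_integral lborel (\<lambda>x. \<Sum>y\<in>range g - {0}. \<phi> y * indicator (A \<inter> g -` {y}) x)
    (\<Sum>y\<in>range g - {0}. \<phi> y * measure lborel (A \<inter> g -` {y}))"
  proof (intro has_bochner_integral_sum has_bochner_integral_mult_right has_bochner_integral_real_indicator)
    fix y assume "y \<in> range g - {0}"
    then show "A \<inter> g -` {y} \<in> sets lborel" "emeasure lborel (A \<inter> g -` {y}) < \<infinity>"
      using gD(5)[OF A] emeasure_bounded_finite[OF gD(4)] by auto
  qed
  also have "(\<lambda>x. \<Sum>y\<in>range g - {0}. \<phi> y * indicator (A \<inter> g -` {y}) x) = (\<lambda>x. indicator A x * \<phi> (g x))"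
  proof
    fix x
    have "(\<Sum>y\<in>range g - {0}. \<phi> y * indicator (A \<inter> g -` {y}) x) = (\<Sum>y\<in>range g - {0}. if y = g x then indicator A x * \<phi> (g x) else 0)"
      by (intro sum.cong) (auto simp: indicator_def)
    also have "\<dots> = indicator A x * \<phi> (g x)" using gD(2) \<open>\<phi> 0 = 0\<close> by (auto simp: sum.delta)
    finally show "(\<Sum>y\<in>range g - {0}. \<phi> y * indicator (A \<inter> g -` {y}) x) = indicator A x * \<phi> (g x)" .
  qed
  finally show ?thesis .
qed

lemma integrable_step:
  assumes g: "step_function g"
  shows "integrable lborel g"
  using has_bochner_integral_step[OF g, of UNIV "\<lambda>x. x"] by (simp add: has_bochner_integral_iff)

text \<open>What is kept of the Levy structure once the laws are known: mean \<open>m\<close> and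
  variance \<open>v\<close> per unit length, uncorrelated values on disjoint sets, nonnegativity and
  finite additivity. All integrals of step functions are treated on this basis.\<close>

locale orthogonal_measure = prob_space M for M :: "'a measure" +
  fixes \<Lambda> :: "real set \<Rightarrow> 'a \<Rightarrow> real" and m v :: real
  assumes si: "A \<in> sets borel \<Longrightarrow> bounded A \<Longrightarrow> square_integrable M (\<Lambda> A)"
    and mean_eq: "A \<in> sets borel \<Longrightarrow> bounded A \<Longrightarrow> expectation (\<Lambda> A) = m * measure lborel A"
    and square_eq: "A \<in> sets borel \<Longrightarrow> bounded A \<Longrightarrow>
      expectation (\<lambda>\<omega>. (\<Lambda> A \<omega>)\<^sup>2) = v * measure lborel A + (m * measure lborel A)\<^sup>2"
    and mult_eq: "A \<in> sets borel \<Longrightarrow> bounded A \<Longrightarrow> B \<in> sets borel \<Longrightarrow> bounded B \<Longrightarrow> A \<inter> B = {} \<Longrightarrow>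
      expectation (\<lambda>\<omega>. \<Lambda> A \<omega> * \<Lambda> B \<omega>) = (m * measure lborel A) * (m * measure lborel B)"
    and nonneg: "A \<in> sets borel \<Longrightarrow> bounded A \<Longrightarrow> AE \<omega> in M. 0 \<le> \<Lambda> A \<omega>"
    and union: "A \<in> sets borel \<Longrightarrow> bounded A \<Longrightarrow> B \<in> sets borel \<Longrightarrow> bounded B \<Longrightarrow> A \<inter> B = {} \<Longrightarrow>
      AE \<omega> in M. \<Lambda> (A \<union> B) \<omega> = \<Lambda> A \<omega> + \<Lambda> B \<omega>"
begin

lemma measurable_\<Lambda> [measurable]: "A \<in> sets borel \<Longrightarrow> bounded A \<Longrightarrow> \<Lambda> A \<in> borel_measurable M"
  using si by (simp add: square_integrable_def)

lemma empty: "AE \<omega> in M. \<Lambda> {} \<omega> = 0"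
  using union[of "{}" "{}"] by simp

lemma finite_union:
  assumes "finite T" and "\<And>z. z \<in> T \<Longrightarrow> C z \<in> sets borel" "\<And>z. z \<in> T \<Longrightarrow> bounded (C z)" "disjoint_family_on C T"
  shows "AE \<omega> in M. \<Lambda> (\<Union>z\<in>T. C z) \<omega> = (\<Sum>z\<in>T. \<Lambda> (C z) \<omega>)"
  using assms
proof (induction T rule: finite_induct)
  case (insert z T)
  have "AE \<omega> in M. \<Lambda> (C z \<union> (\<Union>z\<in>T. C z)) \<omega> = \<Lambda> (C z) \<omega> + \<Lambda> (\<Union>z\<in>T. C z) \<omega>"
  proof (rule union)
    show "(\<Union>z\<in>T. C z) \<in> sets borel" using insert by (intro sets.finite_UN) auto
    show "bounded (\<Union>z\<in>T. C z)" using insert by (intro bounded_UN) auto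
    have "C z \<inter> C y = {}" if "y \<in> T" for y
      using insert that by (intro disjoint_family_onD[OF insert.prems(3)]) auto
    then show "C z \<inter> (\<Union>z\<in>T. C z) = {}" by blast
  qed (use insert in auto)
  moreover have "AE \<omega> in M. \<Lambda> (\<Union>z\<in>T. C z) \<omega> = (\<Sum>z\<in>T. \<Lambda> (C z) \<omega>)"
    using insert by (intro insert.IH) (auto simp: disjoint_family_on_def)
  ultimately show ?case using insert(1,2) by (auto elim!: eventually_elim2)
qed (use empty in simp)

text \<open>\<open>step_integral\<close> groups points by the value of the integrand, and a sum of
  two step functions can take one value on several cells. A labelling \<open>k\<close> finer than
  the integrand gives sums over a common index set, from which linearity can be read off.\<close>

lemma step_integral_refine:
  fixes k :: "real \<Rightarrow> 'b" and \<phi> :: "'b \<Rightarrow> real"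
  assumes A: "A \<in> sets borel" and S: "finite S" "S \<subseteq> range k"
    and k: "\<And>z. z \<in> S \<Longrightarrow> k -` {z} \<in> sets borel" "\<And>z. z \<in> S \<Longrightarrow> bounded (k -` {z})"
    and 0: "\<And>x. k x \<notin> S \<Longrightarrow> \<phi> (k x) = 0" and fin: "finite (range (\<lambda>x. \<phi> (k x)))"
  shows "AE \<omega> in M. step_integral \<Lambda> A (\<lambda>x. \<phi> (k x)) \<omega> = (\<Sum>z\<in>S. \<phi> z * \<Lambda> (A \<inter> k -` {z}) \<omega>)"
proof -
  let ?h = "\<lambda>x. \<phi> (k x)"
  let ?R = "range ?h - {0}"
  have "AE \<omega> in M. \<forall>y\<in>?R. \<Lambda> (A \<inter> ?h -` {y}) \<omega> = (\<Sum>z\<in>{z\<in>S. \<phi> z = y}. \<Lambda> (A \<inter> k -` {z}) \<omega>)"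
  proof (rule AE_finite_allI)
    fix y assume y: "y \<in> ?R"
    have "k x \<in> S" if "\<phi> (k x) \<noteq> 0" for x using 0[of x] that by blast
    then have "A \<inter> ?h -` {y} = (\<Union>z\<in>{z\<in>S. \<phi> z = y}. A \<inter> k -` {z})" using y by auto
    moreover have "AE \<omega> in M. \<Lambda> (\<Union>z\<in>{z\<in>S. \<phi> z = y}. A \<inter> k -` {z}) \<omega> = (\<Sum>z\<in>{z\<in>S. \<phi> z = y}. \<Lambda> (A \<inter> k -` {z}) \<omega>)"
      by (rule finite_union) (use S A k in \<open>auto simp: disjoint_family_on_def intro: bounded_subset\<close>)
    ultimately show "AE \<omega> in M. \<Lambda> (A \<inter> ?h -` {y}) \<omega> = (\<Sum>z\<in>{z\<in>S. \<phi> z = y}. \<Lambda> (A \<inter> k -` {z}) \<omega>)" by simp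
  qed (use fin in auto)
  then show ?thesis
  proof eventually_elim
    case (elim \<omega>)
    have "step_integral \<Lambda> A ?h \<omega> = (\<Sum>y\<in>?R. \<Sum>z\<in>{z\<in>S. \<phi> z = y}. \<phi> z * \<Lambda> (A \<inter> k -` {z}) \<omega>)"
      unfolding step_integral_def using elim by (intro sum.cong) (auto simp: sum_distrib_left intro!: sum.cong)
    also have "\<dots> = (\<Sum>y\<in>?R. \<Sum>z\<in>{z\<in>{z\<in>S. \<phi> z \<noteq> 0}. \<phi> z = y}. \<phi> z * \<Lambda> (A \<inter> k -` {z}) \<omega>)"
      by (intro sum.cong) auto
    also have "\<dots> = (\<Sum>z\<in>{z\<in>S. \<phi> z \<noteq> 0}. \<phi> z * \<Lambda> (A \<inter> k -` {z}) \<omega>)"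
      by (rule sum.group) (use S fin in auto)
    also have "\<dots> = (\<Sum>z\<in>S. \<phi> z * \<Lambda> (A \<inter> k -` {z}) \<omega>)"
      using S by (intro sum.mono_neutral_left) auto
    finally show ?case .
  qed
qed

lemma step_integral_linear:
  assumes A: "A \<in> sets borel" and f: "step_function f" and g: "step_function g"
  shows "AE \<omega> in M. step_integral \<Lambda> A (\<lambda>x. a * f x + b * g x) \<omega> = a * step_integral \<Lambda> A f \<omega> + b * step_integral \<Lambda> A g \<omega>"
proof -
  note fD = step_functionD[OF f] and gD = step_functionD[OF g]
  \<comment> \<open>The labels are pairs of values. The pair \<open>(0, 0)\<close> is dropped since
    its cell is unbounded; every other cell is bounded because one of its coordinates is
    nonzero.\<close>
  define k where "k x = (f x, g x)" for x
  define S where "S = range k - {(0, 0)}"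
  have S: "finite S"
    by (rule finite_subset[of _ "range f \<times> range g"]) (use fD(2) gD(2) in \<open>auto simp: S_def k_def\<close>)
  have vim: "k -` {z} = (UNIV \<inter> f -` {fst z}) \<inter> (UNIV \<inter> g -` {snd z})" for z by (auto simp: k_def)
  have kb: "k -` {z} \<in> sets borel" for z unfolding vim by (rule sets.Int[OF fD(5) gD(5)]) simp_all
  have kc: "bounded (k -` {z})" if "z \<in> S" for z
  proof -
    have "fst z \<noteq> 0 \<or> snd z \<noteq> 0" using that by (auto simp: S_def prod_eq_iff)
    then show ?thesis unfolding vim using fD(4)[of "fst z" UNIV] gD(4)[of "snd z" UNIV] by (auto intro: bounded_Int)
  qed
  have R: "AE \<omega> in M. step_integral \<Lambda> A (\<lambda>x. \<phi> (k x)) \<omega> = (\<Sum>z\<in>S. \<phi> z * \<Lambda> (A \<inter> k -` {z}) \<omega>)"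
    if "\<phi> (0, 0) = 0" "step_function (\<lambda>x. \<phi> (k x))" for \<phi>
    by (rule step_integral_refine[OF A S]) (use that kb kc in \<open>auto simp: S_def step_function_def\<close>)
  have "AE \<omega> in M. step_integral \<Lambda> A f \<omega> = (\<Sum>z\<in>S. fst z * \<Lambda> (A \<inter> k -` {z}) \<omega>)"
    "AE \<omega> in M. step_integral \<Lambda> A g \<omega> = (\<Sum>z\<in>S. snd z * \<Lambda> (A \<inter> k -` {z}) \<omega>)"
    "AE \<omega> in M. step_integral \<Lambda> A (\<lambda>x. a * f x + b * g x) \<omega> = (\<Sum>z\<in>S. (a * fst z + b * snd z) * \<Lambda> (A \<inter> k -` {z}) \<omega>)"
    using R[of fst] R[of snd] R[of "\<lambda>z. a * fst z + b * snd z"] f g step_function_linear[OF f g, of a b] by (simp_all add: k_def)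
  then show ?thesis
    by eventually_elim (simp add: distrib_right sum.distrib sum_distrib_left mult.assoc)
qed

lemma step_integral_diff:
  assumes A: "A \<in> sets borel" and f: "step_function f" and g: "step_function g"
  shows "AE \<omega> in M. step_integral \<Lambda> A (\<lambda>x. f x - g x) \<omega> = step_integral \<Lambda> A f \<omega> - step_integral \<Lambda> A g \<omega>"
  using step_integral_linear[OF assms, of 1 "-1"] by simp

lemma step_function_diff: "step_function f \<Longrightarrow> step_function g \<Longrightarrow> step_function (\<lambda>x. f x - g x)"
  using step_function_linear[of f g 1 "-1"] by simp

lemma step_integral_Compl:
  assumes A: "A \<in> sets borel" and g: "step_function g"
  shows "AE \<omega> in M. step_integral \<Lambda> UNIV g \<omega> = step_integral \<Lambda> A g \<omega> + step_integral \<Lambda> (- A) g \<omega>"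
proof -
  note gD = step_functionD[OF g]
  have "AE \<omega> in M. \<forall>y\<in>range g - {0}. \<Lambda> (UNIV \<inter> g -` {y}) \<omega> = \<Lambda> (A \<inter> g -` {y}) \<omega> + \<Lambda> (- A \<inter> g -` {y}) \<omega>"
  proof (rule AE_finite_allI)
    fix y assume y: "y \<in> range g - {0}"
    have "UNIV \<inter> g -` {y} = (A \<inter> g -` {y}) \<union> (- A \<inter> g -` {y})" by auto
    then show "AE \<omega> in M. \<Lambda> (UNIV \<inter> g -` {y}) \<omega> = \<Lambda> (A \<inter> g -` {y}) \<omega> + \<Lambda> (- A \<inter> g -` {y}) \<omega>"
      using union[of "A \<inter> g -` {y}" "- A \<inter> g -` {y}"] gD(4,5) A y by auto
  qed (use gD in auto)
  then show ?thesis
    by eventually_elim (simp add: step_integral_def sum.distrib[symmetric] distrib_left)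
qed

text \<open>Mixed terms factor into products of means and only the diagonal contributes
  \<open>v\<close>. The last bound uses nonnegativity of the measure: it needs smallness of the
  integrand in L1 only, which is all that the gliding hump provides.\<close>

lemma step_integral_moments:
  assumes A: "A \<in> sets borel" and g: "step_function g"
  shows "square_integrable M (step_integral \<Lambda> A g)"
    "expectation (step_integral \<Lambda> A g) = m * (LBINT x:A. g x)"
    "expectation (\<lambda>\<omega>. (step_integral \<Lambda> A g \<omega>)\<^sup>2) = v * (LBINT x:A. (g x)\<^sup>2) + (m * (LBINT x:A. g x))\<^sup>2"
    "expectation (\<lambda>\<omega>. \<bar>step_integral \<Lambda> A g \<omega>\<bar>) \<le> m * (LBINT x:A. \<bar>g x\<bar>)"
proof -
  note gD = step_functionD[OF g]
  let ?R = "range g - {0}" and ?C = "\<lambda>y. A \<inter> g -` {y}"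
  have C: "?C y \<in> sets borel" "bounded (?C y)" if "y \<in> ?R" for y using gD(4,5) that A by auto
  have sC: "square_integrable M (\<lambda>\<omega>. y * \<Lambda> (?C y) \<omega>)" if "y \<in> ?R" for y
    using C[OF that] by (intro square_integrable_scale si)
  have iC: "integrable M (\<Lambda> (?C y))" if "y \<in> ?R" for y
    using C[OF that] by (intro square_integrable_imp_integrable si)
  have int: "(LBINT x:A. \<phi> (g x)) = (\<Sum>y\<in>?R. \<phi> y * measure lborel (?C y))" if "\<phi> 0 = 0" for \<phi> :: "real \<Rightarrow> real"
    using has_bochner_integral_step[OF g A, of \<phi>] that by (auto simp: set_lebesgue_integral_def has_bochner_integral_iff)
  show S: "square_integrable M (step_integral \<Lambda> A g)"
    unfolding step_integral_def using sC by (intro square_integrable_sum) auto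
  show E: "expectation (step_integral \<Lambda> A g) = m * (LBINT x:A. g x)"
    unfolding step_integral_def using int[of "\<lambda>x. x"] iC C
    by (simp add: mean_eq sum_distrib_left mult_ac)
  have "expectation (\<lambda>\<omega>. (step_integral \<Lambda> A g \<omega>)\<^sup>2) =
      expectation (\<lambda>\<omega>. \<Sum>y\<in>?R. \<Sum>z\<in>?R. (y * \<Lambda> (?C y) \<omega>) * (z * \<Lambda> (?C z) \<omega>))"
    by (simp add: step_integral_def power2_eq_square sum_product)
  also have "\<dots> = (\<Sum>y\<in>?R. \<Sum>z\<in>?R. expectation (\<lambda>\<omega>. (y * \<Lambda> (?C y) \<omega>) * (z * \<Lambda> (?C z) \<omega>)))"
  proof -
    have I: "integrable M (\<lambda>\<omega>. (y * \<Lambda> (?C y) \<omega>) * (z * \<Lambda> (?C z) \<omega>))" if "y \<in> ?R" "z \<in> ?R" for y z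
      by (intro square_integrable_mult sC that)
    show ?thesis
      by (subst Bochner_Integration.integral_sum, (rule Bochner_Integration.integrable_sum, rule I; assumption),
        intro sum.cong refl Bochner_Integration.integral_sum, rule I; assumption)
  qed
  also have "\<dots> = (\<Sum>y\<in>?R. \<Sum>z\<in>?R. (y * (m * measure lborel (?C y))) * (z * (m * measure lborel (?C z))) + (if y = z then y\<^sup>2 * (v * measure lborel (?C y)) else 0))"
  proof (intro sum.cong refl)
    fix y z assume yz: "y \<in> ?R" "z \<in> ?R"
    have "expectation (\<lambda>\<omega>. (y * \<Lambda> (?C y) \<omega>) * (z * \<Lambda> (?C z) \<omega>)) = y * z * expectation (\<lambda>\<omega>. \<Lambda> (?C y) \<omega> * \<Lambda> (?C z) \<omega>)"
      by (subst integral_mult_right_zero[symmetric]) (simp add: mult_ac)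
    also have "\<dots> = (y * (m * measure lborel (?C y))) * (z * (m * measure lborel (?C z))) + (if y = z then y\<^sup>2 * (v * measure lborel (?C y)) else 0)"
    proof (cases "y = z")
      case True
      then show ?thesis using square_eq[OF C[OF yz(1)]] by (simp add: power2_eq_square algebra_simps)
    next
      case False
      then have "?C y \<inter> ?C z = {}" by auto
      then show ?thesis using mult_eq[OF C[OF yz(1)] C[OF yz(2)]] False by simp
    qed
    finally show "expectation (\<lambda>\<omega>. (y * \<Lambda> (?C y) \<omega>) * (z * \<Lambda> (?C z) \<omega>)) = \<dots>" .
  qed
  also have "\<dots> = (\<Sum>y\<in>?R. y * (m * measure lborel (?C y)))\<^sup>2 + (\<Sum>y\<in>?R. y\<^sup>2 * (v * measure lborel (?C y)))"
    using gD(2) by (simp add: sum.distrib power2_eq_square sum_product)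
  also have "\<dots> = v * (LBINT x:A. (g x)\<^sup>2) + (m * (LBINT x:A. g x))\<^sup>2"
    using int[of "\<lambda>x. x"] int[of "\<lambda>x. x\<^sup>2"] by (simp add: sum_distrib_left mult_ac)
  finally show "expectation (\<lambda>\<omega>. (step_integral \<Lambda> A g \<omega>)\<^sup>2) = v * (LBINT x:A. (g x)\<^sup>2) + (m * (LBINT x:A. g x))\<^sup>2" .
  have "expectation (\<lambda>\<omega>. \<bar>step_integral \<Lambda> A g \<omega>\<bar>) \<le> expectation (\<lambda>\<omega>. \<Sum>y\<in>?R. \<bar>y\<bar> * \<Lambda> (?C y) \<omega>)"
  proof (rule integral_mono_AE)
    show "integrable M (\<lambda>\<omega>. \<bar>step_integral \<Lambda> A g \<omega>\<bar>)" using square_integrable_imp_integrable[OF S] by simp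
    show "integrable M (\<lambda>\<omega>. \<Sum>y\<in>?R. \<bar>y\<bar> * \<Lambda> (?C y) \<omega>)"
      by (intro Bochner_Integration.integrable_sum integrable_mult_right iC)
    have "AE \<omega> in M. \<forall>y\<in>?R. 0 \<le> \<Lambda> (?C y) \<omega>" using nonneg C gD(2) by (intro AE_finite_allI) auto
    then show "AE \<omega> in M. \<bar>step_integral \<Lambda> A g \<omega>\<bar> \<le> (\<Sum>y\<in>?R. \<bar>y\<bar> * \<Lambda> (?C y) \<omega>)"
    proof eventually_elim
      case (elim \<omega>)
      have "\<bar>step_integral \<Lambda> A g \<omega>\<bar> \<le> (\<Sum>y\<in>?R. \<bar>y * \<Lambda> (?C y) \<omega>\<bar>)" unfolding step_integral_def by (rule sum_abs)
      also have "\<dots> = (\<Sum>y\<in>?R. \<bar>y\<bar> * \<Lambda> (?C y) \<omega>)" using elim by (intro sum.cong) (auto simp: abs_mult)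
      finally show ?case .
    qed
  qed
  also have "\<dots> = m * (LBINT x:A. \<bar>g x\<bar>)"
    using int[of abs] iC C by (simp add: mean_eq sum_distrib_left mult_ac)
  finally show "expectation (\<lambda>\<omega>. \<bar>step_integral \<Lambda> A g \<omega>\<bar>) \<le> m * (LBINT x:A. \<bar>g x\<bar>)" .
qed

lemma step_integral_nonneg:
  assumes g: "step_function g" and "\<And>x. 0 \<le> g x"
  shows "AE \<omega> in M. 0 \<le> step_integral \<Lambda> UNIV g \<omega>"
proof -
  note gD = step_functionD[OF g]
  have "AE \<omega> in M. \<forall>y\<in>range g - {0}. 0 \<le> \<Lambda> (UNIV \<inter> g -` {y}) \<omega>"
  proof (rule AE_finite_allI)
    fix y assume "y \<in> range g - {0}"
    then show "AE \<omega> in M. 0 \<le> \<Lambda> (UNIV \<inter> g -` {y}) \<omega>" by (intro nonneg gD) auto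
  qed (use gD in auto)
  then show ?thesis
    by eventually_elim (use assms in \<open>auto simp: step_integral_def intro!: sum_nonneg mult_nonneg_nonneg\<close>)
qed

end

section \<open>The moving average process\<close>

text \<open>Rounding down and truncating keep the approximation between 0 and \<open>f\<close>, so
  that \<open>f\<close> itself serves as dominating function throughout. For \<open>n = 0\<close>
  division by zero makes it 0.\<close>

definition kernel_step :: "(real \<Rightarrow> real) \<Rightarrow> nat \<Rightarrow> real \<Rightarrow> real" where
  "kernel_step f n x = (if \<bar>x\<bar> \<le> real n then of_int \<lfloor>real n * f x\<rfloor> / real n else 0)"

context
  fixes f :: "real \<Rightarrow> real"
  assumes f: "f \<in> borel_measurable borel" "\<And>x. 0 \<le> f x" "\<And>x. f x \<le> 1" and int: "integrable lborel f"
begin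

lemma kernel_step_bounds: "0 \<le> kernel_step f n x" "kernel_step f n x \<le> f x"
proof -
  have "of_int \<lfloor>real n * f x\<rfloor> / real n \<le> f x"
  proof (cases "n = 0")
    case False
    have "of_int \<lfloor>real n * f x\<rfloor> / real n \<le> real n * f x / real n"
      by (intro divide_right_mono) auto
    then show ?thesis using False by simp
  qed (use f in simp)
  then show "kernel_step f n x \<le> f x" using f by (simp add: kernel_step_def)
  show "0 \<le> kernel_step f n x" using f by (simp add: kernel_step_def)
qed

lemma step_function_kernel_step: "step_function (kernel_step f n)"
  unfolding step_function_def
proof (intro conjI)
  show "kernel_step f n \<in> borel_measurable borel"
    using f(1) unfolding kernel_step_def[abs_def] by measurable
  have "range (kernel_step f n) \<subseteq> (\<lambda>k. of_int k / real n) ` {0..int n}"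
  proof safe
    fix x
    have "\<lfloor>real n * f x\<rfloor> \<le> int n" using mult_left_mono[OF f(3)[of x], of "real n"] by linarith
    then have "\<lfloor>real n * f x\<rfloor> \<in> {0..int n}" using f(2)[of x] by auto
    then show "kernel_step f n x \<in> (\<lambda>k. of_int k / real n) ` {0..int n}"
      by (cases "\<bar>x\<bar> \<le> real n") (auto simp: kernel_step_def intro: image_eqI[of _ _ 0])
  qed
  then show "finite (range (kernel_step f n))" by (rule finite_subset) simp
  show "bounded {x. kernel_step f n x \<noteq> 0}"
    by (rule bounded_subset[of "{- real n..real n}"]) (auto simp: kernel_step_def split: if_splits)
qed

lemma kernel_step_tendsto: "(\<lambda>n. kernel_step f n x) \<longlonglongrightarrow> f x"
proof (rule tendsto_sandwich)
  obtain N where N: "\<bar>x\<bar> \<le> real N" using real_arch_simple by blast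
  show "\<forall>\<^sub>F n in sequentially. f x - 1 / real n \<le> kernel_step f n x"
    using eventually_ge_at_top[of "Suc N"]
  proof eventually_elim
    case (elim n)
    have "real n * f x - 1 \<le> of_int \<lfloor>real n * f x\<rfloor>" by linarith
    then have "(real n * f x - 1) / real n \<le> of_int \<lfloor>real n * f x\<rfloor> / real n"
      by (intro divide_right_mono) auto
    then show ?case using elim N by (simp add: kernel_step_def diff_divide_distrib)
  qed
  have "(\<lambda>n. f x - 1 / real n) \<longlonglongrightarrow> f x - 0" by (intro tendsto_intros lim_1_over_n)
  then show "(\<lambda>n. f x - 1 / real n) \<longlonglongrightarrow> f x" by simp
qed (use kernel_step_bounds in auto)

lemma integrable_dominated_by_kernel:
  assumes "h \<in> borel_measurable borel" "\<And>x. \<bar>h x\<bar> \<le> f x"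
  shows "integrable lborel h"
  using assms by (intro Bochner_Integration.integrable_bound[OF int]) (auto intro: order_trans[OF _ abs_ge_self])

lemma kernel_step_L1_L2:
  "(\<lambda>n. LBINT x. \<bar>kernel_step f n x - f x\<bar>) \<longlonglongrightarrow> 0" "(\<lambda>n. LBINT x. (kernel_step f n x - f x)\<^sup>2) \<longlonglongrightarrow> 0"
  "(\<lambda>n. LBINT x. kernel_step f n x) \<longlonglongrightarrow> (LBINT x. f x)"
proof -
  have [measurable]: "f \<in> borel_measurable borel" "\<And>n. kernel_step f n \<in> borel_measurable borel"
    using f step_function_kernel_step by (auto simp: step_function_def)
  have le: "\<bar>kernel_step f n x - f x\<bar> \<le> f x" for n x using kernel_step_bounds[of n x] by auto
  \<comment> \<open>Since \<open>f\<close> takes values in [0,1], its square is below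
    \<open>f\<close>, so one majorant serves for L1 and for L2.\<close>
  have le2: "(kernel_step f n x - f x)\<^sup>2 \<le> f x" for n x
  proof -
    have "(kernel_step f n x - f x)\<^sup>2 \<le> (f x)\<^sup>2" using le[of n x] f(2)[of x] by (metis abs_le_square_iff abs_of_nonneg)
    also have "\<dots> \<le> f x" using mult_left_le[OF f(3) f(2), of x x] by (simp add: power2_eq_square)
    finally show ?thesis .
  qed
  have lim: "(\<lambda>n. kernel_step f n x - f x) \<longlonglongrightarrow> 0" for x
    using kernel_step_tendsto[of x] by (simp add: LIM_zero_iff)
  have "(\<lambda>n. LBINT x. \<bar>kernel_step f n x - f x\<bar>) \<longlonglongrightarrow> (LBINT x::real. 0)"
    by (rule integral_dominated_convergence[where w = f])
      (use int le tendsto_rabs_zero[OF lim] in auto)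
  then show "(\<lambda>n. LBINT x. \<bar>kernel_step f n x - f x\<bar>) \<longlonglongrightarrow> 0" by simp
  have "(\<lambda>n. LBINT x. (kernel_step f n x - f x)\<^sup>2) \<longlonglongrightarrow> (LBINT x::real. 0)"
    by (rule integral_dominated_convergence[where w = f])
      (use int le2 tendsto_power[OF lim, of _ 2] in auto)
  then show "(\<lambda>n. LBINT x. (kernel_step f n x - f x)\<^sup>2) \<longlonglongrightarrow> 0" by simp
  show "(\<lambda>n. LBINT x. kernel_step f n x) \<longlonglongrightarrow> (LBINT x. f x)"
    by (rule integral_dominated_convergence[where w = f])
      (use int kernel_step_bounds kernel_step_tendsto in auto)
qed

end

lemma kernel_step_product_tendsto:
  fixes f g :: "real \<Rightarrow> real"
  assumes f: "f \<in> borel_measurable borel" "\<And>x. 0 \<le> f x" "\<And>x. f x \<le> 1" "integrable lborel f"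
    and g: "g \<in> borel_measurable borel" "\<And>x. 0 \<le> g x" "\<And>x. g x \<le> 1" "integrable lborel g"
  shows "(\<lambda>n. LBINT x. kernel_step f n x * kernel_step g n x) \<longlonglongrightarrow> (LBINT x. f x * g x)"
proof (rule integral_dominated_convergence[where w = f])
  have [measurable]: "f \<in> borel_measurable borel" "g \<in> borel_measurable borel"
    "\<And>n. kernel_step f n \<in> borel_measurable borel" "\<And>n. kernel_step g n \<in> borel_measurable borel"
    using f g by (auto simp: kernel_step_def[abs_def])
  show "(\<lambda>x. f x * g x) \<in> borel_measurable lborel" "\<And>n. (\<lambda>x. kernel_step f n x * kernel_step g n x) \<in> borel_measurable lborel"
    by measurable
  show "AE x in lborel. (\<lambda>n. kernel_step f n x * kernel_step g n x) \<longlonglongrightarrow> f x * g x"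
    using kernel_step_tendsto[OF f] kernel_step_tendsto[OF g] by (intro AE_I2 tendsto_mult) auto
  fix n
  have "kernel_step f n x * kernel_step g n x \<le> f x * 1" for x
    using kernel_step_bounds[OF f, of n x] kernel_step_bounds[OF g, of n x] g(3)[of x]
    by (intro mult_mono) (auto intro: f)
  then show "AE x in lborel. norm (kernel_step f n x * kernel_step g n x) \<le> f x"
    using kernel_step_bounds(1)[OF f] kernel_step_bounds(1)[OF g] by (auto simp: abs_mult)
qed (use f in auto)

context orthogonal_measure
begin

lemma step_integral_measurable:
  assumes "A \<in> sets borel" "step_function g"
  shows "step_integral \<Lambda> A g \<in> borel_measurable M"
  using step_integral_moments(1)[OF assms] by (simp add: square_integrable_def)

text \<open>Polarization: the second moment formula is applied to \<open>f\<close>, to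
  \<open>g\<close> and to their sum.\<close>

lemma step_integral_product:
  assumes f: "step_function f" and g: "step_function g"
  shows "expectation (\<lambda>\<omega>. step_integral \<Lambda> UNIV f \<omega> * step_integral \<Lambda> UNIV g \<omega>) =
    v * (LBINT x. f x * g x) + (m * (LBINT x. f x)) * (m * (LBINT x. g x))"
proof -
  let ?I = "step_integral \<Lambda> UNIV"
  note mom = step_integral_moments[OF sets.top[of borel, unfolded space_borel]]
  note [measurable] = step_integral_measurable[OF _ f] step_integral_measurable[OF _ g]
  have fg: "step_function (\<lambda>x. f x + g x)" using step_function_linear[OF f g, of 1 1] by simp
  note [measurable] = step_integral_measurable[OF _ fg]
  have "AE \<omega> in M. ?I (\<lambda>x. f x + g x) \<omega> = ?I f \<omega> + ?I g \<omega>"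
    using step_integral_linear[OF _ f g, of UNIV 1 1] by simp
  then have "expectation (\<lambda>\<omega>. (?I (\<lambda>x. f x + g x) \<omega>)\<^sup>2) = expectation (\<lambda>\<omega>. (?I f \<omega>)\<^sup>2 + (?I g \<omega>)\<^sup>2 + 2 * (?I f \<omega> * ?I g \<omega>))"
    by (intro integral_cong_AE) (auto simp: power2_sum elim!: eventually_mono)
  also have "\<dots> = expectation (\<lambda>\<omega>. (?I f \<omega>)\<^sup>2) + expectation (\<lambda>\<omega>. (?I g \<omega>)\<^sup>2) + 2 * expectation (\<lambda>\<omega>. ?I f \<omega> * ?I g \<omega>)"
    using mom(1)[OF f] mom(1)[OF g] square_integrable_mult[OF mom(1)[OF f] mom(1)[OF g]] by (simp add: square_integrable_def)
  finally have 1: "v * (LBINT x. (f x + g x)\<^sup>2) + (m * (LBINT x. f x + g x))\<^sup>2 =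
      v * (LBINT x. (f x)\<^sup>2) + (m * (LBINT x. f x))\<^sup>2 + (v * (LBINT x. (g x)\<^sup>2) + (m * (LBINT x. g x))\<^sup>2) + 2 * expectation (\<lambda>\<omega>. ?I f \<omega> * ?I g \<omega>)"
    using mom(3)[OF f] mom(3)[OF g] mom(3)[OF fg] by (simp add: set_lebesgue_integral_def)
  have sq: "integrable lborel (\<lambda>x. (h x)\<^sup>2)" if "step_function h" for h
    using has_bochner_integral_step[OF that, of UNIV "\<lambda>x. x\<^sup>2"] by (simp add: has_bochner_integral_iff)
  have sf: "square_integrable lborel h" if "step_function h" for h
    using sq[OF that] step_functionD(1)[OF that] by (simp add: square_integrable_def)
  note ii = integrable_step[OF f] integrable_step[OF g] sq[OF f] sq[OF g] square_integrable_mult[OF sf[OF f] sf[OF g]]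
  have "(LBINT x. (f x + g x)\<^sup>2) = (LBINT x. (f x)\<^sup>2 + (g x)\<^sup>2 + 2 * (f x * g x))"
    by (intro Bochner_Integration.integral_cong) (auto simp: power2_sum)
  then have 2: "(LBINT x. (f x + g x)\<^sup>2) = (LBINT x. (f x)\<^sup>2) + (LBINT x. (g x)\<^sup>2) + 2 * (LBINT x. f x * g x)"
    using ii by simp
  have 3: "(LBINT x. f x + g x) = (LBINT x. f x) + (LBINT x. g x)" using ii by simp
  from 1 show ?thesis unfolding 2 3 by (simp add: power2_eq_square algebra_simps)
qed

lemma step_integral_tendsto_0:
  assumes A: "\<And>n. A n \<in> sets borel" and g: "\<And>n. step_function (g n)" and "(\<lambda>n. LBINT x:A n. \<bar>g n x\<bar>) \<longlonglongrightarrow> 0"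
  shows "conv_in_prob M (\<lambda>n. step_integral \<Lambda> (A n) (g n)) (\<lambda>_. 0)"
proof (rule conv_in_prob_L1)
  show "integrable M (step_integral \<Lambda> (A n) (g n))" for n
    by (intro square_integrable_imp_integrable step_integral_moments A g)
  show "(\<lambda>n. expectation (\<lambda>\<omega>. \<bar>step_integral \<Lambda> (A n) (g n) \<omega> - 0\<bar>)) \<longlonglongrightarrow> 0"
  proof (rule tendsto_sandwich[OF _ _ tendsto_const])
    show "(\<lambda>n. m * (LBINT x:A n. \<bar>g n x\<bar>)) \<longlonglongrightarrow> 0" using tendsto_mult_right_zero[OF assms(3)] .
  qed (use step_integral_moments(4)[OF A g] in auto)
qed simp

text \<open>The approximating step functions in the definition of the integral are arbitrary, so their
  integrals must first be related to those of \<^const>\<open>kernel_step\<close>; this is where the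
  existence of the limits over all Borel sets is needed.\<close>

lemma levy_integral_conv_in_prob:
  fixes f :: "real \<Rightarrow> real"
  assumes f: "f \<in> borel_measurable borel" "\<And>x. 0 \<le> f x" "\<And>x. f x \<le> 1" "integrable lborel f"
    and g: "\<And>n. step_function (g n)" "AE x in lborel. (\<lambda>n. g n x) \<longlonglongrightarrow> f x"
    and ex: "\<And>A. A \<in> sets borel \<Longrightarrow> \<exists>Z'. conv_in_prob M (\<lambda>n. step_integral \<Lambda> A (g n)) Z'"
    and Z: "conv_in_prob M (\<lambda>n. step_integral \<Lambda> UNIV (g n)) Z"
  shows "\<exists>r::nat \<Rightarrow> nat. strict_mono r \<and> conv_in_prob M (\<lambda>n. step_integral \<Lambda> UNIV (kernel_step f (r n))) Z"
proof -
  let ?f = "kernel_step f"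
  have sf: "step_function (?f n)" for n by (rule step_function_kernel_step[OF f])
  define h where "h n x = g n x - ?f n x" for n x
  have h: "step_function (h n)" for n unfolding h_def[abs_def] using g(1) sf by (rule step_function_diff)
  have hd: "AE \<omega> in M. step_integral \<Lambda> B (h n) \<omega> = step_integral \<Lambda> B (g n) \<omega> - step_integral \<Lambda> B (?f n) \<omega>"
    if "B \<in> sets borel" for B n
    using step_integral_diff[OF that g(1) sf, of n n] by (simp add: h_def[abs_def])
  have "AE x in lborel. (\<lambda>n. h n x) \<longlonglongrightarrow> 0"
    using g(2)
  proof eventually_elim
    case (elim x)
    show ?case using tendsto_diff[OF elim kernel_step_tendsto[OF f, of x]] by (simp add: h_def)
  qed
  then obtain r :: "nat \<Rightarrow> nat" and A where r: "strict_mono r" and A[measurable]: "A \<in> sets borel" and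
    hr: "(\<lambda>k. LBINT x:-A. \<bar>h (r (2 * k)) x\<bar>) \<longlonglongrightarrow> 0" "(\<lambda>k. LBINT x:A. \<bar>h (r (2 * k + 1)) x\<bar>) \<longlonglongrightarrow> 0"
    by (rule gliding_hump[OF integrable_step[OF h]])
  define p q where "p k = r (2 * k)" and "q k = r (2 * k + 1)" for k
  have pq: "strict_mono p" "strict_mono q"
    using r by (auto simp: p_def q_def strict_mono_def)
  have mA: "- A \<in> sets borel" by measurable
  obtain Z' where Z': "conv_in_prob M (\<lambda>n. step_integral \<Lambda> A (g n)) Z'" using ex[OF A] by blast
  note [measurable] = step_integral_measurable[OF _ sf] step_integral_measurable[OF _ h] step_integral_measurable[OF _ g(1)]
  have [measurable]: "Z \<in> borel_measurable M" using Z by (simp add: conv_in_prob_def)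
  let ?I = "step_integral \<Lambda>"
  \<comment> \<open>The limit over the set \<open>A\<close> is used here: the even and the odd
    subsequence have the same limit in probability, whatever it is.\<close>
  have G: "conv_in_prob M (\<lambda>k \<omega>. ?I A (g (p k)) \<omega> - ?I A (g (q k)) \<omega>) (\<lambda>\<omega>. 0)"
    using conv_in_prob_diff[OF conv_in_prob_subseq[OF Z' pq(1)] conv_in_prob_subseq[OF Z' pq(2)]] by simp
  have F: "conv_in_prob M (\<lambda>k. ?I A (\<lambda>x. ?f (p k) x - ?f (q k) x)) (\<lambda>\<omega>. 0)"
  proof (rule step_integral_tendsto_0)
    show "step_function (\<lambda>x. ?f (p k) x - ?f (q k) x)" for k by (intro step_function_diff sf)
    show "(\<lambda>k. LBINT x:A. \<bar>?f (p k) x - ?f (q k) x\<bar>) \<longlonglongrightarrow> 0"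
    proof (rule tendsto_sandwich[OF _ _ tendsto_const])
      have [measurable]: "?f n \<in> borel_measurable borel" for n using sf by (simp add: step_function_def)
      have "(\<lambda>k. (LBINT x. \<bar>?f (p k) x - f x\<bar>) + (LBINT x. \<bar>?f (q k) x - f x\<bar>)) \<longlonglongrightarrow> 0 + 0"
        using LIMSEQ_subseq_LIMSEQ[OF kernel_step_L1_L2(1)[OF f] pq(1)] LIMSEQ_subseq_LIMSEQ[OF kernel_step_L1_L2(1)[OF f] pq(2)]
        by (intro tendsto_add) (auto simp: o_def)
      then show "(\<lambda>k. (LBINT x. \<bar>?f (p k) x - f x\<bar>) + (LBINT x. \<bar>?f (q k) x - f x\<bar>)) \<longlonglongrightarrow> 0" by simp
      have i: "integrable lborel (\<lambda>x. \<bar>?f n x - f x\<bar>)" for n using integrable_step[OF sf] f(4) by simp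
      show "\<forall>\<^sub>F k in sequentially. (LBINT x:A. \<bar>?f (p k) x - ?f (q k) x\<bar>) \<le> (LBINT x. \<bar>?f (p k) x - f x\<bar>) + (LBINT x. \<bar>?f (q k) x - f x\<bar>)"
      proof (intro always_eventually allI)
        fix k
        have "(LBINT x:A. \<bar>?f (p k) x - ?f (q k) x\<bar>) \<le> (LBINT x. \<bar>?f (p k) x - f x\<bar> + \<bar>?f (q k) x - f x\<bar>)"
          unfolding set_lebesgue_integral_def
        proof (rule integral_mono)
          show "integrable lborel (\<lambda>x. indicator A x *\<^sub>R \<bar>?f (p k) x - ?f (q k) x\<bar>)"
            using integrable_step[OF sf] by (intro integrable_mult_indicator) auto
          show "integrable lborel (\<lambda>x. \<bar>?f (p k) x - f x\<bar> + \<bar>?f (q k) x - f x\<bar>)" using i by simp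
        qed (auto split: split_indicator)
        then show "(LBINT x:A. \<bar>?f (p k) x - ?f (q k) x\<bar>) \<le> (LBINT x. \<bar>?f (p k) x - f x\<bar>) + (LBINT x. \<bar>?f (q k) x - f x\<bar>)"
          using i by simp
      qed
    qed (auto simp: set_lebesgue_integral_def)
  qed simp
  have H1: "conv_in_prob M (\<lambda>k. ?I A (h (q k))) (\<lambda>_. 0)"
    by (rule step_integral_tendsto_0) (use hr(2) h in \<open>auto simp: q_def\<close>)
  have H2: "conv_in_prob M (\<lambda>k. ?I (- A) (h (p k))) (\<lambda>_. 0)"
    by (rule step_integral_tendsto_0) (use hr(1) h mA in \<open>auto simp: p_def\<close>)
  \<comment> \<open>On \<open>A\<close> one has h_p = (g_p - g_q) - (f_p - f_q) + h_q, where f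
    stands for \<open>kernel_step f\<close>. The three terms vanish in the limit by
    \<open>G\<close>, \<open>F\<close> and \<open>H1\<close>, and the part of h_p off
    \<open>A\<close> does so by \<open>H2\<close>. The zeros only bring the sum into the form of
    repeated differences.\<close>
  have H3: "conv_in_prob M (\<lambda>k \<omega>. ?I UNIV (h (p k)) \<omega> - 0) (\<lambda>\<omega>. 0 - 0)"
  proof -
    have "conv_in_prob M (\<lambda>k \<omega>. (?I A (g (p k)) \<omega> - ?I A (g (q k)) \<omega>) - ?I A (\<lambda>x. ?f (p k) x - ?f (q k) x) \<omega>
        - (0 - ?I A (h (q k)) \<omega>) - (0 - ?I (- A) (h (p k)) \<omega>)) (\<lambda>\<omega>. 0 - 0 - (0 - 0) - (0 - 0))"
      by (intro conv_in_prob_diff G F H1 H2) (simp_all add: conv_in_prob_def)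
    then show ?thesis
    proof (rule conv_in_prob_cong_AE)
      fix k
      show "AE \<omega> in M. ?I UNIV (h (p k)) \<omega> - 0 = (?I A (g (p k)) \<omega> - ?I A (g (q k)) \<omega>) - ?I A (\<lambda>x. ?f (p k) x - ?f (q k) x) \<omega>
        - (0 - ?I A (h (q k)) \<omega>) - (0 - ?I (- A) (h (p k)) \<omega>)"
        using hd[OF A, of "p k"] hd[OF A, of "q k"]
          step_integral_diff[OF A sf sf, of "p k" "q k"] step_integral_Compl[OF A h, of "p k"]
        by eventually_elim simp
    qed simp_all
  qed
  have "conv_in_prob M (\<lambda>k \<omega>. ?I UNIV (g (p k)) \<omega> - (?I UNIV (h (p k)) \<omega> - 0)) (\<lambda>\<omega>. Z \<omega> - (0 - 0))"
    by (intro conv_in_prob_diff conv_in_prob_subseq[OF Z pq(1)] H3)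
  then have "conv_in_prob M (\<lambda>k. ?I UNIV (?f (p k))) Z"
  proof (rule conv_in_prob_cong_AE)
    fix k
    show "AE \<omega> in M. ?I UNIV (?f (p k)) \<omega> = ?I UNIV (g (p k)) \<omega> - (?I UNIV (h (p k)) \<omega> - 0)"
      using hd[of UNIV "p k", simplified]
      by eventually_elim simp
  qed simp_all
  with pq(1) show ?thesis by blast
qed

text \<open>The mean-square distance of two discretized integrals is \<open>v\<close> times the
  squared L2 distance of the integrands plus the square of \<open>m\<close> times the difference of
  their Lebesgue integrals, hence small. The limit in probability, known along a subsequence only,
  then is the limit of the whole sequence.\<close>

lemma levy_integral_l2:
  fixes f :: "real \<Rightarrow> real"
  assumes f: "f \<in> borel_measurable borel" "\<And>x. 0 \<le> f x" "\<And>x. f x \<le> 1" "integrable lborel f"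
    and r: "strict_mono (r::nat \<Rightarrow> nat)" and conv: "conv_in_prob M (\<lambda>n. step_integral \<Lambda> UNIV (kernel_step f (r n))) Z"
  shows "l2_tendsto M (\<lambda>n. step_integral \<Lambda> UNIV (kernel_step f n)) Z"
proof (rule Cauchy_l2_tendsto[OF _ _ r conv])
  let ?f = "kernel_step f" and ?I = "step_integral \<Lambda> UNIV"
  have sf: "step_function (?f n)" for n by (rule step_function_kernel_step[OF f])
  note [measurable] = step_integral_measurable[OF _ sf]
  have [measurable]: "?f n \<in> borel_measurable borel" for n using sf by (simp add: step_function_def)
  note [measurable] = f(1)
  show "square_integrable M (?I (?f n))" for n by (intro step_integral_moments sf) simp
  define d e where "d n = (LBINT x. (?f n x - f x)\<^sup>2)" and "e n = (LBINT x. \<bar>?f n x - f x\<bar>)" for n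
  have d0: "d \<longlonglongrightarrow> 0" and e0: "e \<longlonglongrightarrow> 0" using kernel_step_L1_L2[OF f] by (simp_all add: d_def[abs_def] e_def[abs_def])
  have i1: "integrable lborel (\<lambda>x. \<bar>?f n x - f x\<bar>)" for n using integrable_step[OF sf] f(4) by simp
  have i2: "integrable lborel (\<lambda>x. (?f n x - f x)\<^sup>2)" for n
  proof (rule integrable_dominated_by_kernel[OF f])
    fix x
    have "\<bar>?f n x - f x\<bar> \<le> f x" using kernel_step_bounds[OF f, of n x] by auto
    then have "(?f n x - f x)\<^sup>2 \<le> (f x)\<^sup>2" using f(2)[of x] by (metis abs_le_square_iff abs_of_nonneg)
    also have "\<dots> \<le> f x" using mult_left_le[OF f(3) f(2), of x x] by (simp add: power2_eq_square)
    finally show "\<bar>(?f n x - f x)\<^sup>2\<bar> \<le> f x" by simp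
  qed simp
  \<comment> \<open>The locale does not state the sign of \<open>v\<close>; it is the variance of
    the measure of a unit interval.\<close>
  have v: "0 \<le> v"
  proof -
    have I: "{0<..1::real} \<in> sets borel" "bounded {0<..1::real}" by auto
    have "variance (\<Lambda> {0<..1}) = v"
      using square_eq[OF I] mean_eq[OF I] si[OF I]
      by (subst variance_eq) (auto intro: square_integrable_imp_integrable square_integrableD)
    moreover have "0 \<le> variance (\<Lambda> {0<..1})" by simp
    ultimately show ?thesis by simp
  qed
  have bound: "expectation (\<lambda>\<omega>. (?I (?f n) \<omega> - ?I (?f k) \<omega>)\<^sup>2) \<le> v * (2 * d n + 2 * d k) + (m * (e n + e k))\<^sup>2" for n k
  proof -
    have s: "step_function (\<lambda>x. ?f n x - ?f k x)" by (intro step_function_diff sf)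
    note [measurable] = step_integral_measurable[OF _ s]
    have "expectation (\<lambda>\<omega>. (?I (?f n) \<omega> - ?I (?f k) \<omega>)\<^sup>2) = expectation (\<lambda>\<omega>. (?I (\<lambda>x. ?f n x - ?f k x) \<omega>)\<^sup>2)"
      using step_integral_diff[OF _ sf sf, of UNIV n k] by (intro integral_cong_AE) (auto elim!: eventually_mono)
    also have "\<dots> = v * (LBINT x. (?f n x - ?f k x)\<^sup>2) + (m * (LBINT x. ?f n x - ?f k x))\<^sup>2"
      using step_integral_moments(3)[OF _ s, of UNIV] by (simp add: set_lebesgue_integral_def)
    also have "\<dots> \<le> v * (2 * d n + 2 * d k) + (m * (e n + e k))\<^sup>2"
    proof (intro add_mono mult_left_mono v)
      have "(LBINT x. (?f n x - ?f k x)\<^sup>2) \<le> (LBINT x. 2 * (?f n x - f x)\<^sup>2 + 2 * (?f k x - f x)\<^sup>2)"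
      proof (rule integral_mono)
        have "square_integrable lborel (\<lambda>x. (?f n x - f x) - (?f k x - f x))"
          by (rule square_integrable_diff) (use i2 in \<open>auto simp: square_integrable_def\<close>)
        then show "integrable lborel (\<lambda>x. (?f n x - ?f k x)\<^sup>2)" by (simp add: square_integrable_def)
        show "integrable lborel (\<lambda>x. 2 * (?f n x - f x)\<^sup>2 + 2 * (?f k x - f x)\<^sup>2)" using i2 by simp
        fix x show "(?f n x - ?f k x)\<^sup>2 \<le> 2 * (?f n x - f x)\<^sup>2 + 2 * (?f k x - f x)\<^sup>2"
          using zero_le_power2[of "?f n x + ?f k x - 2 * f x"] by (simp add: power2_eq_square algebra_simps)
      qed
      then show "(LBINT x. (?f n x - ?f k x)\<^sup>2) \<le> 2 * d n + 2 * d k" using i2 by (simp add: d_def)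
      have "\<bar>LBINT x. ?f n x - ?f k x\<bar> \<le> (LBINT x. \<bar>?f n x - ?f k x\<bar>)" by (rule integral_abs_bound)
      also have "\<dots> \<le> (LBINT x. \<bar>?f n x - f x\<bar> + \<bar>?f k x - f x\<bar>)"
        using integrable_step[OF sf] i1 by (intro integral_mono) auto
      also have "\<dots> = e n + e k" using i1 by (simp add: e_def)
      finally have le: "\<bar>LBINT x. ?f n x - ?f k x\<bar> \<le> e n + e k" .
      then have "\<bar>m * (LBINT x. ?f n x - ?f k x)\<bar> \<le> \<bar>m * (e n + e k)\<bar>"
        unfolding abs_mult by (intro mult_left_mono) auto
      then show "(m * (LBINT x. ?f n x - ?f k x))\<^sup>2 \<le> (m * (e n + e k))\<^sup>2" by (simp add: abs_le_square_iff)
    qed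
    finally show ?thesis .
  qed
  fix \<epsilon> :: real assume "\<epsilon> > 0"
  have de: "(\<lambda>n. 4 * v * d n) \<longlonglongrightarrow> 4 * v * 0" "(\<lambda>n. 2 * \<bar>m\<bar> * e n) \<longlonglongrightarrow> 2 * \<bar>m\<bar> * 0"
    by (intro tendsto_mult tendsto_const d0 e0)+
  have "\<forall>\<^sub>F n in sequentially. 4 * v * d n < \<epsilon> / 2 \<and> 2 * \<bar>m\<bar> * e n < sqrt (\<epsilon> / 2)"
    using \<open>\<epsilon> > 0\<close> by (intro eventually_conj order_tendstoD(2)[OF de(1)] order_tendstoD(2)[OF de(2)]) auto
  then obtain N where N: "\<And>n. n \<ge> N \<Longrightarrow> 4 * v * d n < \<epsilon> / 2 \<and> 2 * \<bar>m\<bar> * e n < sqrt (\<epsilon> / 2)"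
    by (auto simp: eventually_sequentially)
  have "expectation (\<lambda>\<omega>. (?I (?f n) \<omega> - ?I (?f k) \<omega>)\<^sup>2) \<le> \<epsilon>" if "n \<ge> N" "k \<ge> N" for n k
  proof -
    have "0 \<le> e n" "0 \<le> e k" by (simp_all add: e_def)
    then have "0 \<le> \<bar>m\<bar> * (e n + e k)" by simp
    moreover have "\<bar>m\<bar> * (e n + e k) \<le> sqrt (\<epsilon> / 2)" using N[OF that(1)] N[OF that(2)] by (simp add: distrib_left)
    ultimately have "(\<bar>m\<bar> * (e n + e k))\<^sup>2 \<le> (sqrt (\<epsilon> / 2))\<^sup>2" by (intro power_mono) auto
    then have "(m * (e n + e k))\<^sup>2 \<le> \<epsilon> / 2" using \<open>\<epsilon> > 0\<close> by (simp add: power_mult_distrib)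
    moreover have "v * (2 * d n + 2 * d k) \<le> \<epsilon> / 2" using N[OF that(1)] N[OF that(2)] by (simp add: distrib_left)
    ultimately show ?thesis using bound[of n k] by linarith
  qed
  then show "\<exists>N. \<forall>n\<ge>N. \<forall>k\<ge>N. expectation (\<lambda>\<omega>. (?I (?f n) \<omega> - ?I (?f k) \<omega>)\<^sup>2) \<le> \<epsilon>" by blast
qed

end

lemma l2_tendsto_cong_AE:
  assumes U: "l2_tendsto M U u" and [measurable]: "\<And>n. V n \<in> borel_measurable M" and eq: "\<And>n. AE \<omega> in M. U n \<omega> = V n \<omega>"
  shows "l2_tendsto M V u"
proof -
  have [measurable]: "\<And>n. U n \<in> borel_measurable M" "u \<in> borel_measurable M"
    using U by (auto simp: l2_tendsto_def square_integrable_def)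
  have "(\<integral>\<omega>. (V n \<omega> - u \<omega>)\<^sup>2 \<partial>M) = (\<integral>\<omega>. (U n \<omega> - u \<omega>)\<^sup>2 \<partial>M)" for n
    using eq[of n] by (intro integral_cong_AE) (auto elim!: eventually_mono)
  moreover have "square_integrable M (V n)" for n
    using U eq[of n] by (intro square_integrable_cong_AE[of M "U n" "V n"]) (auto simp: l2_tendsto_def)
  ultimately show ?thesis using U by (simp add: l2_tendsto_def)
qed

lemma (in prob_space) random_measure_orthogonal:
  assumes L: "two_sided_levy_process M L" and pos: "AE \<omega> in M. 0 \<le> L 1 \<omega>" and si: "square_integrable M (L 1)"
    and lam: "lam > 0" and \<Lambda>: "random_measure_of M (\<lambda>u. L (lam * u)) \<Lambda>"
  shows "orthogonal_measure M \<Lambda> (lam * expectation (L 1)) (lam * variance (L 1))"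
proof -
  obtain L1 where L1: "levy_process M L1" and AE: "AE \<omega> in M. \<forall>t\<ge>0. L t \<omega> = L1 t \<omega>"
    and inc: "\<And>a b z. a \<le> b \<Longrightarrow> 0 \<le> a \<or> b \<le> 0 \<Longrightarrow>
       char (distr M borel (\<lambda>\<omega>. L b \<omega> - L a \<omega>)) z = char (distr M borel (L1 (b - a))) z"
    using two_sided_levy_increments[OF L] by blast
  have Lm[measurable]: "\<And>t. L t \<in> borel_measurable M" using L by (auto simp: two_sided_levy_process_def)
  note [measurable] = levy_process_measurable[OF L1]
  have eq1: "AE \<omega> in M. L 1 \<omega> = L1 1 \<omega>" using AE by eventually_elim simp
  have e1: "expectation (L1 1) = expectation (L 1)" "variance (L1 1) = variance (L 1)"
  proof -
    show *: "expectation (L1 1) = expectation (L 1)"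
      using eq1 by (intro integral_cong_AE) (auto elim!: eventually_mono)
    show "variance (L1 1) = variance (L 1)"
      unfolding * using eq1 by (intro integral_cong_AE) (auto elim!: eventually_mono)
  qed
  have si1: "square_integrable M (L1 1)" by (rule square_integrable_cong_AE[OF si _ eq1]) simp
  have pos1: "AE \<omega> in M. 0 \<le> L1 1 \<omega>" using pos eq1 by eventually_elim simp
  note mom = levy_moments[OF L1 pos1 si1]
  note R = random_measure_measurable[OF prob_space_axioms \<Lambda>] random_measure_disjoint[OF prob_space_axioms \<Lambda>]
  let ?\<tau> = "\<lambda>A. lam * measure lborel A"
  have law: "distr M borel (\<Lambda> A) = distr M borel (L1 (?\<tau> A))" if A: "A \<in> sets borel" "bounded A" for A
  proof (rule eq_distr_of_char)
    fix z
    show "char (distr M borel (\<Lambda> A)) z = char (distr M borel (L1 (?\<tau> A))) z"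
    proof (rule random_measure_char[OF prob_space_axioms \<Lambda> L1 _ _ _ A])
      fix a b z :: real assume ab: "a \<le> b" "0 \<le> a \<or> b \<le> 0"
      have "lam * a \<le> lam * b" "0 \<le> lam * a \<or> lam * b \<le> 0"
        using ab lam by (auto simp: mult_le_0_iff zero_le_mult_iff)
      from inc[OF this, of z] show "char (distr M borel (\<lambda>\<omega>. L (lam * b) \<omega> - L (lam * a) \<omega>)) z = char (distr M borel (L1 (lam * (b - a)))) z"
        by (simp add: right_diff_distrib)
    qed (use lam in auto)
  qed (use R(1) A lam in auto)
  have tau: "0 \<le> ?\<tau> A" for A using lam by simp
  have mt: "L1 (?\<tau> A) \<in> borel_measurable M" for A by (rule levy_process_measurable[OF L1 tau])
  have S: "square_integrable M (\<Lambda> A)" if A: "A \<in> sets borel" "bounded A" for A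
    using eq_distr_square_integrable[OF law[OF A] R(1)[OF A] mt[of A]] mom(1)[OF tau, of A] by simp
  have E: "expectation (\<Lambda> A) = lam * expectation (L 1) * measure lborel A" if A: "A \<in> sets borel" "bounded A" for A
    using eq_distr_integral[OF law[OF A] R(1)[OF A] mt[of A], of "\<lambda>x. x"] mom(2)[OF tau, of A] e1 by (simp add: mult_ac)
  show ?thesis
  proof (rule orthogonal_measure.intro[OF prob_space_axioms orthogonal_measure_axioms.intro])
    fix A :: "real set" assume A: "A \<in> sets borel" "bounded A"
    show "square_integrable M (\<Lambda> A)" by (rule S[OF A])
    show "expectation (\<Lambda> A) = lam * expectation (L 1) * measure lborel A" by (rule E[OF A])
    have "expectation (\<lambda>\<omega>. (L1 (?\<tau> A) \<omega>)\<^sup>2) = variance (L1 (?\<tau> A)) + (expectation (L1 (?\<tau> A)))\<^sup>2"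
      using mom(1)[OF tau] by (subst variance_eq) (auto intro: square_integrable_imp_integrable square_integrableD)
    then show "expectation (\<lambda>\<omega>. (\<Lambda> A \<omega>)\<^sup>2) = lam * variance (L 1) * measure lborel A + (lam * expectation (L 1) * measure lborel A)\<^sup>2"
      using eq_distr_integral[OF law[OF A] R(1)[OF A] mt[of A], of "\<lambda>x. x\<^sup>2"] mom(2,3)[OF tau, of A] e1 by (simp add: mult_ac)
    show "AE \<omega> in M. 0 \<le> \<Lambda> A \<omega>"
      using eq_distr_AE[OF law[OF A] R(1)[OF A] mt[of A], of "\<lambda>x. 0 \<le> x"] levy_nonneg[OF L1 pos1 tau[of A]] by simp
    fix B :: "real set" assume B: "B \<in> sets borel" "bounded B" "A \<inter> B = {}"
    show "AE \<omega> in M. \<Lambda> (A \<union> B) \<omega> = \<Lambda> A \<omega> + \<Lambda> B \<omega>" using A B by (intro R(2))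
    have "expectation (\<lambda>\<omega>. \<Lambda> A \<omega> * \<Lambda> B \<omega>) = expectation (\<Lambda> A) * expectation (\<Lambda> B)"
      using A B by (intro indep_var_lebesgue_integral R(3) square_integrable_imp_integrable S)
    then show "expectation (\<lambda>\<omega>. \<Lambda> A \<omega> * \<Lambda> B \<omega>) = lam * expectation (L 1) * measure lborel A * (lam * expectation (L 1) * measure lborel B)"
      using E A B by simp
  qed
qed

text \<open>An almost surely convergent subsequence turns the limit into the pointwise
  \<open>lim\<close> of the functionals, which is measurable on the whole path space.\<close>

lemma (in prob_space) lim_path_measurable:
  assumes U: "\<And>n. \<exists>\<Phi>\<in>borel_measurable P. AE \<omega> in M. U n \<omega> = (\<Phi> (p \<omega>) :: real)" and conv: "conv_in_prob M U u"
  shows "\<exists>\<Phi>\<in>borel_measurable P. AE \<omega> in M. u \<omega> = \<Phi> (p \<omega>)"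
proof -
  obtain r :: "nat \<Rightarrow> nat" where r: "AE \<omega> in M. (\<lambda>n. U (r n) \<omega>) \<longlonglongrightarrow> u \<omega>"
    using conv_in_prob_AE_subseq[OF conv] by blast
  obtain \<Phi> where \<Phi>[measurable]: "\<And>n. \<Phi> n \<in> borel_measurable P" and eq: "\<And>n. AE \<omega> in M. U n \<omega> = \<Phi> n (p \<omega>)"
    using U by metis
  have "AE \<omega> in M. \<forall>n. U (r n) \<omega> = \<Phi> (r n) (p \<omega>)" using eq by (simp add: AE_all_countable)
  with r have "AE \<omega> in M. u \<omega> = lim (\<lambda>n. \<Phi> (r n) (p \<omega>))"
    by eventually_elim (auto dest: limI)
  moreover have "(\<lambda>x. lim (\<lambda>n. \<Phi> (r n) x)) \<in> borel_measurable P" by measurable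
  ultimately show ?thesis by (intro bexI[of _ "\<lambda>x. lim (\<lambda>n. \<Phi> (r n) x)"])
qed

text \<open>With \<open>m = lam * \<mu>\<close> and \<open>v = lam * V\<close> for the time-changed
  process, kernel mass 2/lam gives the mean 2 mu, and the overlap (1/lam + d) exp(-lam d) with d =
  |s - t| gives the covariance \<open>V * acf lam d\<close>.\<close>

lemma (in prob_space) moving_average_moments:
  assumes L: "two_sided_levy_process M L" and pos: "AE \<omega> in M. 0 \<le> L 1 \<omega>" and si: "square_integrable M (L 1)"
    and lam: "lam > 0"
    and X: "\<And>t. has_levy_integral M (\<lambda>u. L (lam * u)) (\<lambda>u. exp (- lam * \<bar>t - u\<bar>)) (X t)"
    and path: "path_of UNIV L \<in> measurable M (path_space UNIV)"
  shows "square_integrable M (X t)" "AE \<omega> in M. 0 \<le> X t \<omega>" "expectation (X t) = 2 * expectation (L 1)"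
    "expectation (\<lambda>\<omega>. X s \<omega> * X t \<omega>) = variance (L 1) * acf lam \<bar>s - t\<bar> + (2 * expectation (L 1))\<^sup>2"
    "\<exists>\<Phi>\<in>borel_measurable (path_space UNIV). AE \<omega> in M. X t \<omega> = \<Phi> (path_of UNIV L \<omega>)"
proof -
  define f where "f t u = exp (- lam * \<bar>t - u\<bar>)" for t u :: real
  have f: "f t \<in> borel_measurable borel" "\<And>x. 0 \<le> f t x" "\<And>x. f t x \<le> 1" "integrable lborel (f t)"
    and If: "(LBINT u. f t u) = 2 / lam" for t
    using has_bochner_integral_kernel[OF lam, of t] lam by (auto simp: f_def[abs_def] has_bochner_integral_iff)
  have Iff_le: "(LBINT u. f s u * f t u) = (1 / lam + \<bar>s - t\<bar>) * exp (- lam * \<bar>s - t\<bar>)" if "s \<le> t" for s t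
    using has_bochner_integral_kernel_product[OF lam that] that by (simp add: f_def has_bochner_integral_iff)
  have Iff: "(LBINT u. f s u * f t u) = (1 / lam + \<bar>s - t\<bar>) * exp (- lam * \<bar>s - t\<bar>)" for s t
    using Iff_le[of s t] Iff_le[of t s] by (cases "s \<le> t") (auto simp: mult.commute abs_minus_commute)
  let ?L = "\<lambda>u. L (lam * u)"
  let ?m = "lam * expectation (L 1)" and ?v = "lam * variance (L 1)"
  have sf: "step_function (kernel_step (f t) n)" for t n by (rule step_function_kernel_step[OF f])
  obtain \<Lambda> where \<Lambda>: "random_measure_of M ?L \<Lambda>" using X[of 0] by (auto simp: has_levy_integral_def)
  interpret O: orthogonal_measure M \<Lambda> ?m ?v by (rule random_measure_orthogonal[OF L pos si lam \<Lambda>])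
  let ?I = "\<lambda>t n. step_integral \<Lambda> UNIV (kernel_step (f t) n)"
  \<comment> \<open>The random measure behind \<open>X t\<close> may depend on \<open>t\<close>. The
    convergence is proved for that measure and then carried over to the fixed
    \<open>\<Lambda>\<close>, so that \<open>X s\<close> and \<open>X t\<close> become limits of
    integrals against the same measure.\<close>
  have l2: "l2_tendsto M (?I t) (X t)" for t
  proof -
    obtain \<Lambda>' g where \<Lambda>': "random_measure_of M ?L \<Lambda>'" and g: "\<And>n. step_function (g n)" "AE x in lborel. (\<lambda>n. g n x) \<longlonglongrightarrow> f t x"
      and ex: "\<And>A. A \<in> sets borel \<Longrightarrow> \<exists>Z'. conv_in_prob M (\<lambda>n. step_integral \<Lambda>' A (g n)) Z'"
      and conv: "conv_in_prob M (\<lambda>n. step_integral \<Lambda>' UNIV (g n)) (X t)"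
      using X[of t] unfolding has_levy_integral_def f_def by blast
    interpret O': orthogonal_measure M \<Lambda>' ?m ?v by (rule random_measure_orthogonal[OF L pos si lam \<Lambda>'])
    obtain r :: "nat \<Rightarrow> nat" where "strict_mono r" "conv_in_prob M (\<lambda>n. step_integral \<Lambda>' UNIV (kernel_step (f t) (r n))) (X t)"
      using O'.levy_integral_conv_in_prob[OF f g ex conv] by blast
    then have "l2_tendsto M (\<lambda>n. step_integral \<Lambda>' UNIV (kernel_step (f t) n)) (X t)"
      by (rule O'.levy_integral_l2[OF f])
    then show ?thesis
    proof (rule l2_tendsto_cong_AE)
      fix n
      show "?I t n \<in> borel_measurable M" using sf by (intro O.step_integral_measurable) auto
      let ?k = "kernel_step (f t) n"
      have "AE \<omega> in M. \<forall>y\<in>range ?k - {0}. \<Lambda>' (UNIV \<inter> ?k -` {y}) \<omega> = \<Lambda> (UNIV \<inter> ?k -` {y}) \<omega>"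
      proof (rule AE_finite_allI)
        fix y assume "y \<in> range ?k - {0}"
        then show "AE \<omega> in M. \<Lambda>' (UNIV \<inter> ?k -` {y}) \<omega> = \<Lambda> (UNIV \<inter> ?k -` {y}) \<omega>"
          by (intro random_measure_AE_unique[OF prob_space_axioms \<Lambda>' \<Lambda>] step_functionD[OF sf]
              random_measure_disjoint(1)[OF prob_space_axioms \<Lambda>] random_measure_empty[OF prob_space_axioms \<Lambda>]) auto
      qed (use step_functionD(2)[OF sf] in auto)
      then show "AE \<omega> in M. step_integral \<Lambda>' UNIV ?k \<omega> = step_integral \<Lambda> UNIV ?k \<omega>"
        by eventually_elim (simp add: step_integral_def)
    qed
  qed
  show "square_integrable M (X t)" using l2 by (simp add: l2_tendsto_def)
  have "(\<lambda>n. expectation (?I t n)) \<longlonglongrightarrow> expectation (X t)" by (rule l2_tendsto_mean[OF l2])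
  moreover have "(\<lambda>n. expectation (?I t n)) \<longlonglongrightarrow> ?m * (2 / lam)"
    using tendsto_mult[OF tendsto_const kernel_step_L1_L2(3)[OF f], of ?m t] O.step_integral_moments(2)[OF _ sf, of UNIV]
    by (simp add: set_lebesgue_integral_def If)
  ultimately show "expectation (X t) = 2 * expectation (L 1)"
    using LIMSEQ_unique lam by fastforce
  have "(\<lambda>n. expectation (\<lambda>\<omega>. ?I s n \<omega> * ?I t n \<omega>)) \<longlonglongrightarrow> expectation (\<lambda>\<omega>. X s \<omega> * X t \<omega>)"
    by (rule l2_tendsto_mult[OF l2 l2])
  moreover have "(\<lambda>n. expectation (\<lambda>\<omega>. ?I s n \<omega> * ?I t n \<omega>)) \<longlonglongrightarrow>
      ?v * ((1 / lam + \<bar>s - t\<bar>) * exp (- lam * \<bar>s - t\<bar>)) + (?m * (2 / lam)) * (?m * (2 / lam))"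
  proof -
    have "(\<lambda>n. ?v * (LBINT u. kernel_step (f s) n u * kernel_step (f t) n u)
        + (?m * (LBINT u. kernel_step (f s) n u)) * (?m * (LBINT u. kernel_step (f t) n u))) \<longlonglongrightarrow>
      ?v * (LBINT u. f s u * f t u) + (?m * (LBINT u. f s u)) * (?m * (LBINT u. f t u))"
      by (intro tendsto_intros kernel_step_product_tendsto f kernel_step_L1_L2(3))
    then show ?thesis by (simp only: O.step_integral_product[OF sf sf] Iff If)
  qed
  ultimately have "expectation (\<lambda>\<omega>. X s \<omega> * X t \<omega>) = ?v * ((1 / lam + \<bar>s - t\<bar>) * exp (- lam * \<bar>s - t\<bar>)) + (?m * (2 / lam)) * (?m * (2 / lam))"
    by (rule LIMSEQ_unique)
  moreover have "lam * v * ((1 / lam + d) * e) + (lam * a * (2 / lam)) * (lam * a * (2 / lam)) = v * (lam * d * e + e) + (2 * a)\<^sup>2" for v d e a :: real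
    using lam by (simp add: power2_eq_square field_simps)
  ultimately show "expectation (\<lambda>\<omega>. X s \<omega> * X t \<omega>) = variance (L 1) * acf lam \<bar>s - t\<bar> + (2 * expectation (L 1))\<^sup>2"
    unfolding acf_def by (simp only:)
  have conv: "conv_in_prob M (?I t) (X t)" by (rule l2_tendsto_imp_conv_in_prob[OF l2])
  obtain r :: "nat \<Rightarrow> nat" where r: "AE \<omega> in M. (\<lambda>n. ?I t (r n) \<omega>) \<longlonglongrightarrow> X t \<omega>"
    using conv_in_prob_AE_subseq[OF conv] by blast
  have "AE \<omega> in M. \<forall>n. 0 \<le> ?I t n \<omega>"
    unfolding AE_all_countable using O.step_integral_nonneg[OF sf kernel_step_bounds(1)[OF f]] by blast
  with r show "AE \<omega> in M. 0 \<le> X t \<omega>"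
    by eventually_elim (auto intro: LIMSEQ_le_const)
  show "\<exists>\<Phi>\<in>borel_measurable (path_space UNIV). AE \<omega> in M. X t \<omega> = \<Phi> (path_of UNIV L \<omega>)"
  proof (rule lim_path_measurable[OF _ conv])
    fix n
    let ?k = "kernel_step (f t) n"
    have "\<exists>\<Phi>\<in>borel_measurable (path_space UNIV). AE \<omega> in M. \<Lambda> (UNIV \<inter> ?k -` {y}) \<omega> = \<Phi> (path_of UNIV L \<omega>)"
      if "y \<in> range ?k - {0}" for y
      using that by (intro random_measure_path_measurable[OF prob_space_axioms \<Lambda>] step_functionD[OF sf] path) auto
    then obtain \<Phi> where \<Phi>: "\<And>y. y \<in> range ?k - {0} \<Longrightarrow> \<Phi> y \<in> borel_measurable (path_space UNIV)"
       "\<And>y. y \<in> range ?k - {0} \<Longrightarrow> AE \<omega> in M. \<Lambda> (UNIV \<inter> ?k -` {y}) \<omega> = \<Phi> y (path_of UNIV L \<omega>)"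
      by metis
    have "AE \<omega> in M. \<forall>y\<in>range ?k - {0}. \<Lambda> (UNIV \<inter> ?k -` {y}) \<omega> = \<Phi> y (path_of UNIV L \<omega>)"
      using \<Phi>(2) step_functionD(2)[OF sf] by (intro AE_finite_allI) auto
    then have "AE \<omega> in M. ?I t n \<omega> = (\<Sum>y\<in>range ?k - {0}. y * \<Phi> y (path_of UNIV L \<omega>))"
      by eventually_elim (simp add: step_integral_def)
    moreover have "(\<lambda>p. \<Sum>y\<in>range ?k - {0}. y * \<Phi> y p) \<in> borel_measurable (path_space UNIV)"
      by (intro borel_measurable_sum borel_measurable_times borel_measurable_const \<Phi>(1))
    ultimately show "\<exists>\<Phi>\<in>borel_measurable (path_space UNIV). AE \<omega> in M. ?I t n \<omega> = \<Phi> (path_of UNIV L \<omega>)"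
      by (intro bexI[of _ "\<lambda>p. \<Sum>y\<in>range ?k - {0}. y * \<Phi> y p"])
  qed
qed

section \<open>Brownian motion and the Ito integral\<close>

locale brownian = prob_space M for M :: "'a measure" +
  fixes F :: "real \<Rightarrow> 'a measure" and W :: "real \<Rightarrow> 'a \<Rightarrow> real"
  assumes filt: "filtration (space M) F" and sub: "\<And>t. subalgebra M (F t)" and bm: "brownian_motion M F W"
begin

lemma F_mono: "U \<in> borel_measurable (F s) \<Longrightarrow> s \<le> t \<Longrightarrow> U \<in> borel_measurable (F t)"
  using filtration.sets_F_mono[OF filt, of s t] filtration.space_F[OF filt]
  by (auto simp: measurable_def)

lemma F_M: "U \<in> borel_measurable (F s) \<Longrightarrow> U \<in> borel_measurable M"
  by (rule measurable_from_subalg[OF sub])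

lemma W_F: "0 \<le> t \<Longrightarrow> W t \<in> borel_measurable (F t)"
  using bm by (simp add: brownian_motion_def)

lemma W_M [measurable]: "0 \<le> t \<Longrightarrow> W t \<in> borel_measurable M"
  by (rule F_M[OF W_F])

lemma increment_indep:
  assumes st: "0 \<le> s" "s < t" and U: "U \<in> borel_measurable (F s)"
  shows "indep_var borel U borel (\<lambda>\<omega>. W t \<omega> - W s \<omega>)"
proof -
  let ?G = "\<lambda>\<omega>. W t \<omega> - W s \<omega>"
  have G[measurable]: "?G \<in> borel_measurable M" using st by (intro borel_measurable_diff W_M) auto
  have i: "indep_set (sets (F s)) {?G -` B \<inter> space M | B. B \<in> sets borel}"
    using bm st by (simp add: brownian_motion_def)
  have 1: "sigma_sets (space M) {U -` A \<inter> space M | A. A \<in> sets borel} \<subseteq> sets (F s)"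
  proof -
    have "{U -` A \<inter> space M | A. A \<in> sets borel} \<subseteq> sets (F s)"
      using measurable_sets[OF U] filtration.space_F[OF filt, of s] by auto
    then show ?thesis using sets.sigma_sets_subset[of _ "F s"] filtration.space_F[OF filt, of s] by simp
  qed
  have 2: "sigma_sets (space M) {?G -` A \<inter> space M | A. A \<in> sets borel} = {?G -` A \<inter> space M | A. A \<in> sets borel}"
    using sigma_sets_vimage_commute[of ?G "space M" UNIV "sets borel"] sets.sigma_sets_eq[of "borel :: real measure"] by simp
  show ?thesis
    unfolding indep_var_eq 2
  proof (intro conjI)
    show "indep_set (sigma_sets (space M) {U -` A \<inter> space M | A. A \<in> sets borel}) {?G -` A \<inter> space M | A. A \<in> sets borel}"
      using i 1 unfolding indep_sets2_eq by blast
  qed (use F_M[OF U] in auto)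
qed

text \<open>The law of an increment is prescribed for \<open>s < t\<close> only; for
  \<open>s = t\<close> the increment is the constant 0.\<close>

lemma increment_moments:
  assumes st: "0 \<le> s" "s \<le> t"
  shows "integrable M (\<lambda>\<omega>. (W t \<omega> - W s \<omega>) ^ k)"
    "expectation (\<lambda>\<omega>. W t \<omega> - W s \<omega>) = 0"
    "expectation (\<lambda>\<omega>. (W t \<omega> - W s \<omega>)\<^sup>2) = t - s"
    "expectation (\<lambda>\<omega>. (W t \<omega> - W s \<omega>) ^ 3) = 0"
    "expectation (\<lambda>\<omega>. (W t \<omega> - W s \<omega>) ^ 4) = 3 * (t - s)\<^sup>2"
proof -
  have "integrable M (\<lambda>\<omega>. (W t \<omega> - W s \<omega>) ^ k) \<and>
    expectation (\<lambda>\<omega>. W t \<omega> - W s \<omega>) = 0 \<and>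
    expectation (\<lambda>\<omega>. (W t \<omega> - W s \<omega>)\<^sup>2) = t - s \<and>
    expectation (\<lambda>\<omega>. (W t \<omega> - W s \<omega>) ^ 3) = 0 \<and>
    expectation (\<lambda>\<omega>. (W t \<omega> - W s \<omega>) ^ 4) = 3 * (t - s)\<^sup>2"
  proof (cases "s = t")
  case True
  then show "integrable M (\<lambda>\<omega>. (W t \<omega> - W s \<omega>) ^ k) \<and>
    expectation (\<lambda>\<omega>. W t \<omega> - W s \<omega>) = 0 \<and>
    expectation (\<lambda>\<omega>. (W t \<omega> - W s \<omega>)\<^sup>2) = t - s \<and>
    expectation (\<lambda>\<omega>. (W t \<omega> - W s \<omega>) ^ 3) = 0 \<and>
    expectation (\<lambda>\<omega>. (W t \<omega> - W s \<omega>) ^ 4) = 3 * (t - s)\<^sup>2"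
    by (simp add: power_0_left)
next
  case False
  let ?G = "\<lambda>\<omega>. W t \<omega> - W s \<omega>" and ?\<sigma> = "sqrt (t - s)"
  have lt: "s < t" "0 < ?\<sigma>" using False st by auto
  have d: "distributed M lborel ?G (\<lambda>x. ennreal (normal_density 0 ?\<sigma> x))"
    using bm st lt by (simp add: brownian_motion_def)
  have I: "integrable M (\<lambda>\<omega>. ?G \<omega> ^ k)" for k
    using distributed_integrable[OF d, of "\<lambda>x. x ^ k"] integrable_normal_moment[OF lt(2), of 0 k] by simp
  have E: "expectation (\<lambda>\<omega>. ?G \<omega> ^ k) = (LBINT x. normal_density 0 ?\<sigma> x * (x - 0) ^ k)" for k
    using distributed_integral[OF d, of "\<lambda>x. x ^ k"] by simp
  have "expectation (\<lambda>\<omega>. ?G \<omega> ^ 1) = 0" "expectation (\<lambda>\<omega>. ?G \<omega> ^ 3) = 0"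
    "expectation (\<lambda>\<omega>. ?G \<omega> ^ 2) = t - s" "expectation (\<lambda>\<omega>. ?G \<omega> ^ 4) = 3 * (t - s)\<^sup>2"
    unfolding E
    using integral_normal_moment_odd[OF lt(2), of 0 0] integral_normal_moment_odd[OF lt(2), of 0 1]
      integral_normal_moment_even[OF lt(2), of 0 1] integral_normal_moment_even[OF lt(2), of 0 2] st lt
    by (simp_all add: fact_numeral field_simps power4_eq_xxxx power3_eq_cube power2_eq_square)
  then show "integrable M (\<lambda>\<omega>. (W t \<omega> - W s \<omega>) ^ k) \<and>
    expectation (\<lambda>\<omega>. W t \<omega> - W s \<omega>) = 0 \<and>
    expectation (\<lambda>\<omega>. (W t \<omega> - W s \<omega>)\<^sup>2) = t - s \<and>
    expectation (\<lambda>\<omega>. (W t \<omega> - W s \<omega>) ^ 3) = 0 \<and>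
    expectation (\<lambda>\<omega>. (W t \<omega> - W s \<omega>) ^ 4) = 3 * (t - s)\<^sup>2"
    using I by simp
  qed
  then show "integrable M (\<lambda>\<omega>. (W t \<omega> - W s \<omega>) ^ k)"
    "expectation (\<lambda>\<omega>. W t \<omega> - W s \<omega>) = 0"
    "expectation (\<lambda>\<omega>. (W t \<omega> - W s \<omega>)\<^sup>2) = t - s"
    "expectation (\<lambda>\<omega>. (W t \<omega> - W s \<omega>) ^ 3) = 0"
    "expectation (\<lambda>\<omega>. (W t \<omega> - W s \<omega>) ^ 4) = 3 * (t - s)\<^sup>2" by auto
qed

lemma increment_product:
  assumes st: "0 \<le> s" "s \<le> t" and U: "U \<in> borel_measurable (F s)" "integrable M U"
  shows "integrable M (\<lambda>\<omega>. U \<omega> * (W t \<omega> - W s \<omega>) ^ k)"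
    "expectation (\<lambda>\<omega>. U \<omega> * (W t \<omega> - W s \<omega>) ^ k) = expectation U * expectation (\<lambda>\<omega>. (W t \<omega> - W s \<omega>) ^ k)"
proof -
  have "integrable M (\<lambda>\<omega>. U \<omega> * (W t \<omega> - W s \<omega>) ^ k) \<and>
    expectation (\<lambda>\<omega>. U \<omega> * (W t \<omega> - W s \<omega>) ^ k) = expectation U * expectation (\<lambda>\<omega>. (W t \<omega> - W s \<omega>) ^ k)"
  proof (cases "s = t")
    case True
    then show ?thesis using U by (cases "k = 0") (simp_all add: power_0_left prob_space)
  next
    case False
    have "indep_var borel ((\<lambda>x. x) \<circ> U) borel ((\<lambda>x. x ^ k) \<circ> (\<lambda>\<omega>. W t \<omega> - W s \<omega>))"
      using False st by (intro indep_var_compose[OF increment_indep[OF _ _ U(1)]]) auto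
    then have i: "indep_var borel U borel (\<lambda>\<omega>. (W t \<omega> - W s \<omega>) ^ k)" by (simp add: o_def)
    show ?thesis
      using indep_var_lebesgue_integral[OF i U(2) increment_moments(1)[OF st]]
        indep_var_integrable[OF i U(2) increment_moments(1)[OF st]] by simp
  qed
  then show "integrable M (\<lambda>\<omega>. U \<omega> * (W t \<omega> - W s \<omega>) ^ k)"
    "expectation (\<lambda>\<omega>. U \<omega> * (W t \<omega> - W s \<omega>) ^ k) = expectation U * expectation (\<lambda>\<omega>. (W t \<omega> - W s \<omega>) ^ k)" by auto
qed

lemma sum_measurable_F:
  assumes c: "0 \<le> c 0" "\<And>i. i < K \<Longrightarrow> c i \<le> c (Suc i)" and \<kappa>: "\<And>i. i < K \<Longrightarrow> \<kappa> i \<in> borel_measurable (F (c i))"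
  shows "k \<le> K \<Longrightarrow> 0 \<le> c k"
    "k \<le> K \<Longrightarrow> (\<lambda>\<omega>. \<Sum>i<k. \<kappa> i \<omega> * (W (c (Suc i)) \<omega> - W (c i) \<omega>)) \<in> borel_measurable (F (c k))"
proof -
  have nn: "0 \<le> c k" if "k \<le> K" for k
    using that by (induction k) (use c in \<open>auto intro: order_trans\<close>)
  then show "k \<le> K \<Longrightarrow> 0 \<le> c k" .
  show "k \<le> K \<Longrightarrow> (\<lambda>\<omega>. \<Sum>i<k. \<kappa> i \<omega> * (W (c (Suc i)) \<omega> - W (c i) \<omega>)) \<in> borel_measurable (F (c k))"
  proof (induction k)
    case (Suc k)
    have le: "c k \<le> c (Suc k)" "0 \<le> c k" "0 \<le> c (Suc k)" using c(2)[of k] nn[of k] nn[of "Suc k"] Suc.prems by auto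
    have "\<kappa> k \<in> borel_measurable (F (c (Suc k)))" "W (c k) \<in> borel_measurable (F (c (Suc k)))" "W (c (Suc k)) \<in> borel_measurable (F (c (Suc k)))"
      "(\<lambda>\<omega>. \<Sum>i<k. \<kappa> i \<omega> * (W (c (Suc i)) \<omega> - W (c i) \<omega>)) \<in> borel_measurable (F (c (Suc k)))"
      using Suc \<kappa>[of k] le W_F[of "c k"] W_F[of "c (Suc k)"] by (auto intro: F_mono)
    then show ?case by (simp del: sum.lessThan_Suc add: sum.lessThan_Suc[abs_def]) measurable
  qed simp
qed

text \<open>The Ito isometry. The boundedness condition involves the product with the step length
  because that is what truncation at a level of the quadratic sum yields; on a step of length 0 the
  coefficient may be unbounded, but the increment vanishes.\<close>

lemma bounded_sum_second_moment:
  assumes c: "0 \<le> c 0" "\<And>i. i < K \<Longrightarrow> c i \<le> c (Suc i)" and \<kappa>: "\<And>i. i < K \<Longrightarrow> \<kappa> i \<in> borel_measurable (F (c i))"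
    and bound: "\<And>i \<omega>. i < K \<Longrightarrow> (\<kappa> i \<omega>)\<^sup>2 * (c (Suc i) - c i) \<le> \<delta>"
  shows "k \<le> K \<Longrightarrow> square_integrable M (\<lambda>\<omega>. \<Sum>i<k. \<kappa> i \<omega> * (W (c (Suc i)) \<omega> - W (c i) \<omega>)) \<and>
    expectation (\<lambda>\<omega>. (\<Sum>i<k. \<kappa> i \<omega> * (W (c (Suc i)) \<omega> - W (c i) \<omega>))\<^sup>2) =
    expectation (\<lambda>\<omega>. \<Sum>i<k. (\<kappa> i \<omega>)\<^sup>2 * (c (Suc i) - c i))"
proof (induction k)
  case 0
  show ?case by (simp add: square_integrable_const)
next
  case (Suc k)
  let ?S = "\<lambda>\<omega>. \<Sum>i<k. \<kappa> i \<omega> * (W (c (Suc i)) \<omega> - W (c i) \<omega>)"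
  let ?G = "\<lambda>\<omega>. W (c (Suc k)) \<omega> - W (c k) \<omega>" and ?h = "c (Suc k) - c k"
  let ?q = "\<lambda>\<omega>. \<Sum>i<k. (\<kappa> i \<omega>)\<^sup>2 * (c (Suc i) - c i)"
  have IH: "square_integrable M ?S" "expectation (\<lambda>\<omega>. (?S \<omega>)\<^sup>2) = expectation ?q" using Suc by auto
  have ck: "0 \<le> c k" "c k \<le> c (Suc k)" using sum_measurable_F(1)[OF c \<kappa>, of k] c(2)[of k] Suc.prems by auto
  have SF: "?S \<in> borel_measurable (F (c k))" using Suc.prems by (intro sum_measurable_F(2)[OF c \<kappa>]) auto
  show ?case
  proof (cases "?h = 0")
    case True
    then have "c (Suc k) = c k" by simp
    then show ?thesis using IH by simp
  next
    case False
    then have h: "?h > 0" using ck by simp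
    have \<kappa>F: "\<kappa> k \<in> borel_measurable (F (c k))" using \<kappa> Suc.prems by simp
    have [measurable]: "\<kappa> k \<in> borel_measurable M" by (rule F_M[OF \<kappa>F])
    have [measurable]: "?S \<in> borel_measurable M" by (rule F_M[OF SF])
    have [measurable]: "?G \<in> borel_measurable M" using ck by (intro borel_measurable_diff W_M) auto
    have kb: "(\<kappa> k \<omega>)\<^sup>2 \<le> \<delta> / ?h" for \<omega>
      using bound[of k \<omega>] h Suc.prems by (simp add: pos_le_divide_eq)
    have i\<kappa>: "integrable M (\<lambda>\<omega>. (\<kappa> k \<omega>)\<^sup>2)"
      by (rule integrable_const_bound[where B = "\<delta> / ?h"]) (use kb in auto)
    then have s\<kappa>: "square_integrable M (\<kappa> k)" by (simp add: square_integrable_def)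
    have S\<kappa>: "integrable M (\<lambda>\<omega>. ?S \<omega> * \<kappa> k \<omega>)" by (rule square_integrable_mult[OF IH(1) s\<kappa>])
    have S\<kappa>F: "(\<lambda>\<omega>. ?S \<omega> * \<kappa> k \<omega>) \<in> borel_measurable (F (c k))" "(\<lambda>\<omega>. (\<kappa> k \<omega>)\<^sup>2) \<in> borel_measurable (F (c k))"
      using SF \<kappa>F by measurable
    note p1 = increment_product[OF ck S\<kappa>F(1) S\<kappa>, of 1] and p2 = increment_product[OF ck S\<kappa>F(2) i\<kappa>, of 2]
    have "(a + b * g)\<^sup>2 = a\<^sup>2 + 2 * (a * b * g ^ 1) + b\<^sup>2 * g ^ 2" for a b g :: real
      by (simp add: power2_sum power_mult_distrib)
    then have eq: "(?S \<omega> + \<kappa> k \<omega> * ?G \<omega>)\<^sup>2 = (?S \<omega>)\<^sup>2 + 2 * (?S \<omega> * \<kappa> k \<omega> * ?G \<omega> ^ 1) + (\<kappa> k \<omega>)\<^sup>2 * ?G \<omega> ^ 2" for \<omega>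
      by blast
    have i2: "integrable M (\<lambda>\<omega>. (?S \<omega> + \<kappa> k \<omega> * ?G \<omega>)\<^sup>2)"
      unfolding eq using p1(1) p2(1) IH(1) by (auto simp: square_integrable_def)
    have iq: "integrable M ?q"
    proof (rule Bochner_Integration.integrable_sum)
      fix i assume "i \<in> {..<k}"
      then have i: "i < K" using Suc.prems by simp
      have [measurable]: "\<kappa> i \<in> borel_measurable M" by (rule F_M[OF \<kappa>[OF i]])
      show "integrable M (\<lambda>\<omega>. (\<kappa> i \<omega>)\<^sup>2 * (c (Suc i) - c i))"
        by (rule integrable_const_bound[where B = \<delta>]) (use bound[OF i] c(2)[OF i] in auto)
    qed
    have "expectation (\<lambda>\<omega>. (?S \<omega> + \<kappa> k \<omega> * ?G \<omega>)\<^sup>2) =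
        expectation (\<lambda>\<omega>. (?S \<omega>)\<^sup>2) + 2 * expectation (\<lambda>\<omega>. ?S \<omega> * \<kappa> k \<omega> * ?G \<omega> ^ 1) + expectation (\<lambda>\<omega>. (\<kappa> k \<omega>)\<^sup>2 * ?G \<omega> ^ 2)"
      unfolding eq using p1(1) p2(1) IH(1) by (simp add: square_integrable_def)
    also have "\<dots> = expectation ?q + expectation (\<lambda>\<omega>. (\<kappa> k \<omega>)\<^sup>2) * ?h"
      unfolding p1(2) p2(2) IH(2) using increment_moments(2,3)[OF ck] by simp
    also have "\<dots> = expectation (\<lambda>\<omega>. ?q \<omega> + (\<kappa> k \<omega>)\<^sup>2 * ?h)"
      using iq i\<kappa> by simp
    finally show ?thesis using i2 by (simp add: square_integrable_def)
  qed
qed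

text \<open>Lenglart's inequality for sums, by switching off the coefficients once the sum of their
  weighted squares exceeds \<open>\<delta>\<close>.\<close>

lemma sum_prob_bound:
  assumes c: "0 \<le> c 0" "\<And>i. i < K \<Longrightarrow> c i \<le> c (Suc i)" and \<kappa>: "\<And>i. i < K \<Longrightarrow> \<kappa> i \<in> borel_measurable (F (c i))"
    and "\<delta> > 0" "\<epsilon> > 0"
  shows "prob {\<omega>\<in>space M. \<epsilon> < \<bar>\<Sum>i<K. \<kappa> i \<omega> * (W (c (Suc i)) \<omega> - W (c i) \<omega>)\<bar>} \<le>
    \<delta> / \<epsilon>\<^sup>2 + prob {\<omega>\<in>space M. \<delta> < (\<Sum>i<K. (\<kappa> i \<omega>)\<^sup>2 * (c (Suc i) - c i))}"
proof -
  define q where "q k \<omega> = (\<Sum>i<k. (\<kappa> i \<omega>)\<^sup>2 * (c (Suc i) - c i))" for k \<omega>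
  \<comment> \<open>The switch looks at the sum up to and including term \<open>i\<close>. It is
    still known at time \<open>c i\<close>, as the step lengths are deterministic, and the retained
    sum never overshoots \<open>\<delta>\<close>.\<close>
  define \<kappa>' where "\<kappa>' i \<omega> = (if q (Suc i) \<omega> \<le> \<delta> then \<kappa> i \<omega> else 0)" for i \<omega>
  define S where "S \<omega> = (\<Sum>i<K. \<kappa>' i \<omega> * (W (c (Suc i)) \<omega> - W (c i) \<omega>))" for \<omega>
  have term_nn: "0 \<le> (\<kappa> i \<omega>)\<^sup>2 * (c (Suc i) - c i)" if "i < K" for i \<omega> using c(2)[OF that] by simp
  have q_mono: "q k \<omega> \<le> q l \<omega>" if "k \<le> l" "l \<le> K" for k l \<omega>
    unfolding q_def using that term_nn by (intro sum_mono2) auto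
  have c_mono: "c i \<le> c j" if "i \<le> j" "j \<le> K" for i j
    using that
  proof (induction j rule: dec_induct)
    case (step n)
    then show ?case using c(2)[of n] by simp
  qed simp
  have qF: "q (Suc i) \<in> borel_measurable (F (c i))" if "i < K" for i
    unfolding q_def[abs_def]
  proof (intro borel_measurable_sum borel_measurable_times borel_measurable_power borel_measurable_const)
    fix j assume "j \<in> {..<Suc i}"
    then show "\<kappa> j \<in> borel_measurable (F (c i))" using that by (intro F_mono[OF \<kappa> c_mono]) auto
  qed
  have \<kappa>'F: "\<kappa>' i \<in> borel_measurable (F (c i))" if "i < K" for i
    unfolding \<kappa>'_def[abs_def] using qF[OF that] \<kappa>[OF that] by measurable
  have q'_le: "(\<Sum>i<k. (\<kappa>' i \<omega>)\<^sup>2 * (c (Suc i) - c i)) \<le> min \<delta> (q k \<omega>)" if "k \<le> K" for k \<omega>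
    using that
  proof (induction k)
    case 0
    show ?case using \<open>\<delta> > 0\<close> by (simp add: q_def)
  next
    case (Suc k)
    show ?case
    proof (cases "q (Suc k) \<omega> \<le> \<delta>")
      case True
      then show ?thesis using Suc by (simp add: \<kappa>'_def q_def)
    next
      case False
      then show ?thesis using Suc q_mono[of k "Suc k" \<omega>] by (auto simp: \<kappa>'_def)
    qed
  qed
  have bound: "(\<kappa>' i \<omega>)\<^sup>2 * (c (Suc i) - c i) \<le> \<delta>" if "i < K" for i \<omega>
  proof -
    have "(\<kappa>' i \<omega>)\<^sup>2 * (c (Suc i) - c i) \<le> (\<Sum>i<Suc i. (\<kappa>' i \<omega>)\<^sup>2 * (c (Suc i) - c i))"
      using that c(2) by (intro member_le_sum[of i "{..<Suc i}" "\<lambda>i. (\<kappa>' i \<omega>)\<^sup>2 * (c (Suc i) - c i)"]) auto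
    also have "\<dots> \<le> \<delta>" using q'_le[of "Suc i" \<omega>] that by simp
    finally show ?thesis .
  qed
  have SI: "square_integrable M S" and ES: "expectation (\<lambda>\<omega>. (S \<omega>)\<^sup>2) = expectation (\<lambda>\<omega>. \<Sum>i<K. (\<kappa>' i \<omega>)\<^sup>2 * (c (Suc i) - c i))"
    using bounded_sum_second_moment[OF c \<kappa>'F bound, of K] unfolding S_def by auto
  have [measurable]: "S \<in> borel_measurable M" using SI by (simp add: square_integrable_def)
  have \<kappa>M: "\<kappa> i \<in> borel_measurable M" "\<kappa>' i \<in> borel_measurable M" if "i < K" for i
    using F_M[OF \<kappa>[OF that]] F_M[OF \<kappa>'F[OF that]] by auto
  have "expectation (\<lambda>\<omega>. \<Sum>i<K. (\<kappa>' i \<omega>)\<^sup>2 * (c (Suc i) - c i)) \<le> expectation (\<lambda>\<omega>. \<delta>)"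
  proof (rule integral_mono)
    show "integrable M (\<lambda>\<omega>. \<Sum>i<K. (\<kappa>' i \<omega>)\<^sup>2 * (c (Suc i) - c i))"
    proof (rule integrable_const_bound[where B = \<delta>])
      show "AE \<omega> in M. norm (\<Sum>i<K. (\<kappa>' i \<omega>)\<^sup>2 * (c (Suc i) - c i)) \<le> \<delta>"
      proof (rule AE_I2)
        fix \<omega>
        have "0 \<le> (\<Sum>i<K. (\<kappa>' i \<omega>)\<^sup>2 * (c (Suc i) - c i))" using c(2) by (intro sum_nonneg) auto
        then show "norm (\<Sum>i<K. (\<kappa>' i \<omega>)\<^sup>2 * (c (Suc i) - c i)) \<le> \<delta>" using q'_le[of K \<omega>] by simp
      qed
    qed (use \<kappa>M in auto)
    fix \<omega> show "(\<Sum>i<K. (\<kappa>' i \<omega>)\<^sup>2 * (c (Suc i) - c i)) \<le> \<delta>" using q'_le[of K \<omega>] by simp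
  qed simp
  then have ES': "expectation (\<lambda>\<omega>. (S \<omega>)\<^sup>2) \<le> \<delta>" using ES by (simp add: prob_space)
  let ?T = "\<lambda>\<omega>. \<Sum>i<K. \<kappa> i \<omega> * (W (c (Suc i)) \<omega> - W (c i) \<omega>)"
  have [measurable]: "?T \<in> borel_measurable M" by (rule F_M[OF sum_measurable_F(2)[OF c \<kappa> order_refl]])
  have [measurable]: "q K \<in> borel_measurable M" unfolding q_def[abs_def] using \<kappa>M by measurable
  \<comment> \<open>As long as the full sum of weighted squares stays below \<open>\<delta>\<close>,
    no coefficient is switched off and \<open>S\<close> is the original sum; Markov's inequality for
    its square does the rest.\<close>
  have "{\<omega>\<in>space M. \<epsilon> < \<bar>?T \<omega>\<bar>} \<subseteq> {\<omega>\<in>space M. \<epsilon>\<^sup>2 \<le> (S \<omega>)\<^sup>2} \<union> {\<omega>\<in>space M. \<delta> < q K \<omega>}"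
  proof (safe, rule ccontr)
    fix \<omega> assume \<omega>: "\<epsilon> < \<bar>?T \<omega>\<bar>" "\<not> \<epsilon>\<^sup>2 \<le> (S \<omega>)\<^sup>2" "\<not> \<delta> < q K \<omega>"
    have "\<kappa>' i \<omega> = \<kappa> i \<omega>" if "i < K" for i
      using \<omega>(3) q_mono[of "Suc i" K \<omega>] that by (auto simp: \<kappa>'_def)
    then have "S \<omega> = ?T \<omega>" unfolding S_def by (intro sum.cong) auto
    with \<omega>(1) have "\<epsilon>\<^sup>2 \<le> \<bar>S \<omega>\<bar>\<^sup>2" using \<open>\<epsilon> > 0\<close> by (intro power_mono) auto
    with \<omega>(2) show False by simp
  qed
  then have "prob {\<omega>\<in>space M. \<epsilon> < \<bar>?T \<omega>\<bar>} \<le> prob ({\<omega>\<in>space M. \<epsilon>\<^sup>2 \<le> (S \<omega>)\<^sup>2} \<union> {\<omega>\<in>space M. \<delta> < q K \<omega>})"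
    by (intro finite_measure_mono) auto
  also have "\<dots> \<le> prob {\<omega>\<in>space M. \<epsilon>\<^sup>2 \<le> (S \<omega>)\<^sup>2} + prob {\<omega>\<in>space M. \<delta> < q K \<omega>}"
    by (intro measure_Un_le) auto
  also have "prob {\<omega>\<in>space M. \<epsilon>\<^sup>2 \<le> (S \<omega>)\<^sup>2} \<le> expectation (\<lambda>\<omega>. (S \<omega>)\<^sup>2) / \<epsilon>\<^sup>2"
    using SI \<open>\<epsilon> > 0\<close> by (intro integral_Markov_inequality_measure[where A = "{}"]) (auto simp: square_integrable_def)
  also have "\<dots> \<le> \<delta> / \<epsilon>\<^sup>2" using ES' by (intro divide_right_mono) auto
  finally show ?thesis by (simp add: q_def)
qed

end

context brownian
begin

text \<open>A finite sum of rectangles \<open>\<zeta> j \<cdot> 1\<^bsub>(a j, b j]\<^esub>\<close>, with \<open>\<zeta> j\<close> known at time \<open>a j\<close> and no order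
  imposed on the intervals, is rewritten over the ordered list of all their endpoints. This allows
  the difference of two simple processes with unrelated partitions.\<close>

lemma rectangles_refine:
  fixes a b :: "'j \<Rightarrow> real"
  assumes J: "finite J" and T: "0 < T" and ab: "\<And>j. j \<in> J \<Longrightarrow> 0 \<le> a j" "\<And>j. j \<in> J \<Longrightarrow> a j \<le> b j" "\<And>j. j \<in> J \<Longrightarrow> b j \<le> T"
    and \<zeta>: "\<And>j. j \<in> J \<Longrightarrow> a j < b j \<Longrightarrow> \<zeta> j \<in> borel_measurable (F (a j))"
  obtains K c \<kappa> where "0 \<le> c 0" "\<And>i. i < K \<Longrightarrow> c i \<le> c (Suc i)" "\<And>i. i < K \<Longrightarrow> \<kappa> i \<in> borel_measurable (F (c i))"
    "\<And>\<omega>. (\<Sum>j\<in>J. \<zeta> j \<omega> * (W (b j) \<omega> - W (a j) \<omega>)) = (\<Sum>i<K. \<kappa> i \<omega> * (W (c (Suc i)) \<omega> - W (c i) \<omega>))"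
    "\<And>\<omega>. ennreal (\<Sum>i<K. (\<kappa> i \<omega>)\<^sup>2 * (c (Suc i) - c i)) \<le>
       (\<integral>\<^sup>+s\<in>{0..T}. ennreal ((\<Sum>j\<in>J. \<zeta> j \<omega> * indicator {a j<..b j} s)\<^sup>2) \<partial>lborel)"
proof -
  define D where "D = insert 0 (insert T (a ` J \<union> b ` J))"
  define cs where "cs = sorted_list_of_set D"
  define K where "K = length cs - 1"
  define c where "c i = cs ! i" for i
  \<comment> \<open>No endpoint lies strictly inside a cell and all rectangles are left-open and
    right-closed, so on a cell the step process is constant and equal to its value at the right end.
    A rectangle that is active there has started by \<open>c i\<close>, which gives
    measurability.\<close>
  define \<kappa> where "\<kappa> i \<omega> = (\<Sum>j\<in>J. \<zeta> j \<omega> * indicator {a j<..b j} (c (Suc i)))" for i \<omega>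
  have ab': "a j \<le> T" "0 \<le> b j" if "j \<in> J" for j using ab[OF that] by simp_all
  have D: "finite D" "D \<subseteq> {0..T}" using J T ab ab' by (auto simp: D_def)
  have set: "set cs = D" using D by (simp add: cs_def)
  then have "cs \<noteq> []" unfolding D_def by fastforce
  then have len: "length cs = Suc K" by (simp add: K_def)
  have strict: "sorted_wrt (<) cs" by (simp add: cs_def strict_sorted_iff)
  have lt: "c i < c j" if "i < j" "j \<le> K" for i j
    unfolding c_def using that len by (intro sorted_wrt_nth_less[OF strict]) auto
  have le: "c i \<le> c j" if "i \<le> j" "j \<le> K" for i j using lt[of i j] that by (cases "i = j") auto
  have lt_iff: "c i < c j \<longleftrightarrow> i < j" and le_iff: "c i \<le> c j \<longleftrightarrow> i \<le> j" if "i \<le> K" "j \<le> K" for i j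
  proof -
    have "i < j \<or> i = j \<or> j < i" by linarith
    then show "c i < c j \<longleftrightarrow> i < j" "c i \<le> c j \<longleftrightarrow> i \<le> j" using lt[of i j] lt[of j i] that by auto
  qed
  have mem: "c i \<in> D" if "i \<le> K" for i using that len set by (auto simp: c_def)
  have ex: "\<exists>i\<le>K. x = c i" if "x \<in> D" for x
    using that len unfolding set[symmetric] in_set_conv_nth c_def by (auto simp: less_Suc_eq_le)
  have pos: "\<And>i. i < K \<Longrightarrow> c i \<le> c (Suc i)" using le by simp
  have c0: "0 \<le> c 0" using mem[of 0] D by auto
  have split: "x < s \<longleftrightarrow> x < c (Suc i)" "s \<le> x \<longleftrightarrow> c (Suc i) \<le> x" if "x \<in> D" "i < K" "c i < s" "s \<le> c (Suc i)" for x s i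
  proof -
    obtain n where n: "n \<le> K" "x = c n" using ex[OF \<open>x \<in> D\<close>] by auto
    have "x \<le> c i \<or> c (Suc i) \<le> x" using le[of n i] le[of "Suc i" n] n that(2) by (cases "n \<le> i") auto
    then show "x < s \<longleftrightarrow> x < c (Suc i)" "s \<le> x \<longleftrightarrow> c (Suc i) \<le> x" using that by auto
  qed
  have tele: "(\<Sum>i<K. indicator {x<..y} (c (Suc i)) * (\<phi> (c (Suc i)) - \<phi> (c i))) = \<phi> y - \<phi> x"
    if xy: "x \<in> D" "y \<in> D" "x \<le> y" for x y and \<phi> :: "real \<Rightarrow> real"
  proof -
    obtain m n where mn: "m \<le> K" "x = c m" "n \<le> K" "y = c n" using ex[OF xy(1)] ex[OF xy(2)] by auto
    have "m \<le> n" using lt[of n m] mn xy(3) by (cases "m \<le> n") auto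
    have iff: "c (Suc i) \<in> {x<..y} \<longleftrightarrow> i \<in> {m..<n}" if "i < K" for i
      using that mn by (auto simp: lt_iff le_iff)
    have "(\<Sum>i<K. indicator {x<..y} (c (Suc i)) * (\<phi> (c (Suc i)) - \<phi> (c i))) = (\<Sum>i<K. if i \<in> {m..<n} then \<phi> (c (Suc i)) - \<phi> (c i) else 0)"
    proof (intro sum.cong refl)
      fix i assume "i \<in> {..<K}"
      then show "indicator {x<..y} (c (Suc i)) * (\<phi> (c (Suc i)) - \<phi> (c i)) = (if i \<in> {m..<n} then \<phi> (c (Suc i)) - \<phi> (c i) else 0)"
        using iff[of i] by (simp add: indicator_def)
    qed
    also have "\<dots> = (\<Sum>i\<in>{m..<n}. \<phi> (c (Suc i)) - \<phi> (c i))"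
    proof -
      have "{..<K} \<inter> {m..<n} = {m..<n}" using mn by auto
      then show ?thesis using sum.inter_restrict[of "{..<K}" "\<lambda>i. \<phi> (c (Suc i)) - \<phi> (c i)" "{m..<n}"] by simp
    qed
    also have "\<dots> = \<phi> y - \<phi> x" using sum_Suc_diff'[OF \<open>m \<le> n\<close>, of "\<lambda>i. \<phi> (c i)"] mn by simp
    finally show ?thesis .
  qed
  show ?thesis
  proof (rule that[OF c0 pos])
    fix i assume i: "i < K"
    show "\<kappa> i \<in> borel_measurable (F (c i))"
      unfolding \<kappa>_def[abs_def]
    proof (rule borel_measurable_sum)
      fix j assume j: "j \<in> J"
      show "(\<lambda>\<omega>. \<zeta> j \<omega> * indicator {a j<..b j} (c (Suc i))) \<in> borel_measurable (F (c i))"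
      proof (cases "c (Suc i) \<in> {a j<..b j}")
        case True
        have "a j \<in> D" using j by (auto simp: D_def)
        then obtain n where n: "n \<le> K" "a j = c n" using ex by auto
        have "n \<le> i" using le[of "Suc i" n] n True by (cases "n \<le> i") auto
        then have "a j \<le> c i" using le[of n i] n i by simp
        moreover have "\<zeta> j \<in> borel_measurable (F (a j))" using True by (intro \<zeta> j) auto
        ultimately show ?thesis using True by (simp add: F_mono)
      qed simp
    qed
  next
    fix \<omega>
    have "(\<Sum>j\<in>J. \<zeta> j \<omega> * (W (b j) \<omega> - W (a j) \<omega>)) =
        (\<Sum>j\<in>J. \<zeta> j \<omega> * (\<Sum>i<K. indicator {a j<..b j} (c (Suc i)) * (W (c (Suc i)) \<omega> - W (c i) \<omega>)))"
      using tele[of _ _ "\<lambda>t. W t \<omega>"] ab by (intro sum.cong refl) (auto simp: D_def)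
    also have "\<dots> = (\<Sum>i<K. \<kappa> i \<omega> * (W (c (Suc i)) \<omega> - W (c i) \<omega>))"
      unfolding \<kappa>_def sum_distrib_left sum_distrib_right mult.assoc by (rule sum.swap)
    finally show "(\<Sum>j\<in>J. \<zeta> j \<omega> * (W (b j) \<omega> - W (a j) \<omega>)) = (\<Sum>i<K. \<kappa> i \<omega> * (W (c (Suc i)) \<omega> - W (c i) \<omega>))" .
    let ?v = "\<lambda>s. \<Sum>j\<in>J. \<zeta> j \<omega> * indicator {a j<..b j} s"
    have "ennreal (\<Sum>i<K. (\<kappa> i \<omega>)\<^sup>2 * (c (Suc i) - c i)) = (\<Sum>i<K. ennreal ((\<kappa> i \<omega>)\<^sup>2) * emeasure lborel {c i<..c (Suc i)})"
      using pos by (subst sum_ennreal[symmetric]) (auto simp: ennreal_mult)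
    also have "\<dots> = (\<integral>\<^sup>+s. (\<Sum>i<K. ennreal ((\<kappa> i \<omega>)\<^sup>2) * indicator {c i<..c (Suc i)} s) \<partial>lborel)"
      by (subst nn_integral_sum) (simp_all add: nn_integral_cmult_indicator)
    also have "\<dots> \<le> (\<integral>\<^sup>+s\<in>{0..T}. ennreal ((?v s)\<^sup>2) \<partial>lborel)"
    proof (rule nn_integral_mono)
      fix s
      show "(\<Sum>i<K. ennreal ((\<kappa> i \<omega>)\<^sup>2) * indicator {c i<..c (Suc i)} s) \<le> ennreal ((?v s)\<^sup>2) * indicator {0..T} s"
      proof (cases "\<exists>i<K. s \<in> {c i<..c (Suc i)}")
        case True
        then obtain i where i: "i < K" "c i < s" "s \<le> c (Suc i)" by auto
        have uniq: "j = i" if j: "j < K" "s \<in> {c j<..c (Suc j)}" for j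
        proof -
          have "\<not> Suc j \<le> i" using le[of "Suc j" i] j i by auto
          moreover have "\<not> Suc i \<le> j" using le[of "Suc i" j] j i by auto
          ultimately show ?thesis by simp
        qed
        have "(\<Sum>i<K. ennreal ((\<kappa> i \<omega>)\<^sup>2) * indicator {c i<..c (Suc i)} s) = (\<Sum>j<K. if j = i then ennreal ((\<kappa> i \<omega>)\<^sup>2) else 0)"
        proof (intro sum.cong refl)
          fix j assume j: "j \<in> {..<K}"
          show "ennreal ((\<kappa> j \<omega>)\<^sup>2) * indicator {c j<..c (Suc j)} s = (if j = i then ennreal ((\<kappa> i \<omega>)\<^sup>2) else 0)"
          proof (cases "j = i")
            case True
            then show ?thesis using i by simp
          next
            case False
            then have "s \<notin> {c j<..c (Suc j)}" using uniq[of j] j by blast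
            then show ?thesis using False by simp
          qed
        qed
        also have "\<dots> = ennreal ((\<kappa> i \<omega>)\<^sup>2)" using i by simp
        also have "\<kappa> i \<omega> = ?v s"
          unfolding \<kappa>_def
        proof (intro sum.cong refl)
          fix j assume "j \<in> J"
          then have "a j \<in> D" "b j \<in> D" by (auto simp: D_def)
          then have "c (Suc i) \<in> {a j<..b j} \<longleftrightarrow> s \<in> {a j<..b j}"
            using split(1)[of "a j" i s] split(2)[of "b j" i s] i by auto
          then show "\<zeta> j \<omega> * indicator {a j<..b j} (c (Suc i)) = \<zeta> j \<omega> * indicator {a j<..b j} s"
            by (simp add: indicator_def)
        qed
        also have "ennreal ((?v s)\<^sup>2) \<le> ennreal ((?v s)\<^sup>2) * indicator {0..T} s"
          using mem[of i] mem[of "Suc i"] i D by (auto simp: indicator_def)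
        finally show ?thesis .
      next
        case False
        then have "(\<Sum>i<K. ennreal ((\<kappa> i \<omega>)\<^sup>2) * indicator {c i<..c (Suc i)} s) = (\<Sum>i<K. 0)"
          by (intro sum.cong refl) (simp add: indicator_def)
        then show ?thesis by simp
      qed
    qed
    finally show "ennreal (\<Sum>i<K. (\<kappa> i \<omega>)\<^sup>2 * (c (Suc i) - c i)) \<le> (\<integral>\<^sup>+s\<in>{0..T}. ennreal ((?v s)\<^sup>2) \<partial>lborel)" .
  qed
qed

section \<open>Adapted step processes and uniqueness of the Ito integral\<close>

definition adapted_step :: "nat \<Rightarrow> (nat \<Rightarrow> real) \<Rightarrow> (nat \<Rightarrow> 'a \<Rightarrow> real) \<Rightarrow> bool" where
  "adapted_step k p \<xi> \<longleftrightarrow> 0 \<le> p 0 \<and> (\<forall>i<k. p i \<le> p (Suc i)) \<and> (\<forall>i<k. \<xi> i \<in> borel_measurable (F (p i)))"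

text \<open>The weaker notion omits boundedness of the coefficients, so that \<open>sqrt X\<close>
  sampled on a grid qualifies directly, without truncation.\<close>

lemma simple_process_adapted_step: "simple_process F k p \<xi> \<Longrightarrow> adapted_step k p \<xi>"
  by (simp add: simple_process_def adapted_step_def)

lemma adapted_step_times:
  assumes "adapted_step k p \<xi>"
  shows "i \<le> k \<Longrightarrow> 0 \<le> p i"
proof (induction i)
  case (Suc i)
  then show ?case using assms unfolding adapted_step_def by (metis Suc_leD Suc_le_lessD order_trans)
qed (use assms in \<open>simp add: adapted_step_def\<close>)

lemma simple_ito_measurable:
  assumes "adapted_step k p \<xi>" "0 \<le> T"
  shows "simple_ito W k p \<xi> T \<in> borel_measurable M"
  unfolding simple_ito_def[abs_def]
proof (rule borel_measurable_sum)
  fix i assume i: "i \<in> {..<k}"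
  have "\<xi> i \<in> borel_measurable M" using assms i by (intro F_M[of _ "p i"]) (auto simp: adapted_step_def)
  moreover have "0 \<le> p i" "0 \<le> p (Suc i)" using i by (auto intro!: adapted_step_times[OF assms(1)])
  ultimately show "(\<lambda>\<omega>. \<xi> i \<omega> * (W (min T (p (Suc i))) \<omega> - W (min T (p i)) \<omega>)) \<in> borel_measurable M"
    using assms(2) by (intro borel_measurable_times borel_measurable_diff W_M) auto
qed

text \<open>Progressive measurability speaks about [0,T] and \<open>F T\<close>. Freezing time
  outside [0,T] gives a process on the whole line that is jointly measurable with respect to
  \<open>M\<close>, as Fubini arguments with Lebesgue measure require.\<close>

lemma progressive_clamp:
  assumes "progressive F H" "0 \<le> T"
  shows "(\<lambda>(s, \<omega>). H (max 0 (min T s)) \<omega>) \<in> borel_measurable (borel \<Otimes>\<^sub>M M)"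
proof -
  have H: "(\<lambda>(s, \<omega>). H s \<omega>) \<in> borel_measurable (restrict_space borel {0..T} \<Otimes>\<^sub>M F T)"
    using assms by (simp add: progressive_def)
  have id: "(\<lambda>\<omega>. \<omega>) \<in> measurable M (F T)"
    using sub[of T] by (auto simp: subalgebra_def measurable_def)
  have "(\<lambda>s. max 0 (min T s)) \<in> measurable borel (restrict_space borel {0..T})"
    using assms(2) by (intro measurable_restrict_space2) auto
  then have "(\<lambda>x. (max 0 (min T (fst x)), snd x)) \<in> measurable (borel \<Otimes>\<^sub>M M) (restrict_space borel {0..T} \<Otimes>\<^sub>M F T)"
    using id by (intro measurable_Pair measurable_compose[OF measurable_fst] measurable_compose[OF measurable_snd])
  from measurable_compose[OF this H] show ?thesis by (simp add: case_prod_unfold)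
qed

lemma simple_value_measurable:
  assumes "adapted_step k p \<xi>"
  shows "(\<lambda>(s, \<omega>). simple_value k p \<xi> s \<omega>) \<in> borel_measurable (borel \<Otimes>\<^sub>M M)"
  unfolding simple_value_def case_prod_unfold
proof (rule borel_measurable_sum)
  fix i assume "i \<in> {..<k}"
  then have [measurable]: "\<xi> i \<in> borel_measurable M" using assms by (intro F_M[of _ "p i"]) (auto simp: adapted_step_def)
  show "(\<lambda>x. \<xi> i (snd x) * indicator {p i<..p (Suc i)} (fst x)) \<in> borel_measurable (borel \<Otimes>\<^sub>M M)" by measurable
qed

lemma simple_value_error_measurable:
  assumes "adapted_step k p \<xi>" "progressive F H" "0 \<le> T"
  shows "(\<lambda>\<omega>. \<integral>\<^sup>+s\<in>{0..T}. ennreal ((simple_value k p \<xi> s \<omega> - H s \<omega>)\<^sup>2) \<partial>lborel) \<in> borel_measurable M"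
proof -
  have [measurable]: "(\<lambda>x. simple_value k p \<xi> (fst x) (snd x)) \<in> borel_measurable (borel \<Otimes>\<^sub>M M)"
    "(\<lambda>x. H (max 0 (min T (fst x))) (snd x)) \<in> borel_measurable (borel \<Otimes>\<^sub>M M)"
    using simple_value_measurable[OF assms(1)] progressive_clamp[OF assms(2,3)] by (simp_all add: case_prod_unfold)
  have "(\<lambda>x. ennreal ((simple_value k p \<xi> (fst x) (snd x) - H (max 0 (min T (fst x))) (snd x))\<^sup>2) * indicator {0..T} (fst x)) \<in> borel_measurable (lborel \<Otimes>\<^sub>M M)"
    by measurable
  then have "(\<lambda>(\<omega>, s). ennreal ((simple_value k p \<xi> s \<omega> - H (max 0 (min T s)) \<omega>)\<^sup>2) * indicator {0..T} s) \<in> borel_measurable (M \<Otimes>\<^sub>M lborel)"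
    using measurable_pair_swap_iff[of "\<lambda>(\<omega>, s). ennreal ((simple_value k p \<xi> s \<omega> - H (max 0 (min T s)) \<omega>)\<^sup>2) * indicator {0..T} s" M lborel borel]
    by (simp add: case_prod_unfold)
  then have "(\<lambda>\<omega>. \<integral>\<^sup>+s. ennreal ((simple_value k p \<xi> s \<omega> - H (max 0 (min T s)) \<omega>)\<^sup>2) * indicator {0..T} s \<partial>lborel) \<in> borel_measurable M"
    by (rule lborel.borel_measurable_nn_integral)
  also have "(\<lambda>\<omega>. \<integral>\<^sup>+s. ennreal ((simple_value k p \<xi> s \<omega> - H (max 0 (min T s)) \<omega>)\<^sup>2) * indicator {0..T} s \<partial>lborel) =
     (\<lambda>\<omega>. \<integral>\<^sup>+s\<in>{0..T}. ennreal ((simple_value k p \<xi> s \<omega> - H s \<omega>)\<^sup>2) \<partial>lborel)"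
    by (intro ext nn_integral_cong) (auto split: split_indicator)
  finally show ?thesis .
qed

text \<open>The two processes are merged over the disjoint sum of their index sets, the second with
  reversed sign. The integrand H enters through (x - y)^2 \<le> 2 (x - h)^2 + 2 (y - h)^2, and with
  two such terms the threshold \<open>\<delta>\<close> is distributed as \<open>\<delta> / 4\<close>
  to each.\<close>

lemma simple_ito_diff_prob_bound:
  assumes A: "adapted_step k p \<xi>" and B: "adapted_step k' p' \<xi>'" and H: "progressive F H" and T: "0 < T"
    and "\<delta> > 0" "\<epsilon> > 0"
  shows "prob {\<omega>\<in>space M. \<epsilon> < \<bar>simple_ito W k p \<xi> T \<omega> - simple_ito W k' p' \<xi>' T \<omega>\<bar>} \<le> \<delta> / \<epsilon>\<^sup>2 +
    (prob {\<omega>\<in>space M. ennreal (\<delta> / 4) < (\<integral>\<^sup>+s\<in>{0..T}. ennreal ((simple_value k p \<xi> s \<omega> - H s \<omega>)\<^sup>2) \<partial>lborel)} +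
     prob {\<omega>\<in>space M. ennreal (\<delta> / 4) < (\<integral>\<^sup>+s\<in>{0..T}. ennreal ((simple_value k' p' \<xi>' s \<omega> - H s \<omega>)\<^sup>2) \<partial>lborel)})"
proof -
  let ?J = "{..<k} <+> {..<k'}"
  define \<zeta> where "\<zeta> = case_sum \<xi> (\<lambda>i \<omega>. - \<xi>' i \<omega>)"
  define a where "a = case_sum (\<lambda>i. min T (p i)) (\<lambda>i. min T (p' i))"
  define b where "b = case_sum (\<lambda>i. min T (p (Suc i))) (\<lambda>i. min T (p' (Suc i)))"
  let ?q = "\<lambda>\<omega>. \<integral>\<^sup>+s\<in>{0..T}. ennreal ((\<Sum>j\<in>?J. \<zeta> j \<omega> * indicator {a j<..b j} s)\<^sup>2) \<partial>lborel"
  let ?A = "\<lambda>\<omega>. \<integral>\<^sup>+s\<in>{0..T}. ennreal ((simple_value k p \<xi> s \<omega> - H s \<omega>)\<^sup>2) \<partial>lborel"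
  let ?B = "\<lambda>\<omega>. \<integral>\<^sup>+s\<in>{0..T}. ennreal ((simple_value k' p' \<xi>' s \<omega> - H s \<omega>)\<^sup>2) \<partial>lborel"
  have [measurable]: "?A \<in> borel_measurable M" "?B \<in> borel_measurable M"
    using simple_value_error_measurable[OF A H] simple_value_error_measurable[OF B H] T by auto
  have J: "finite ?J" by simp
  \<comment> \<open>A rectangle that starts after \<open>T\<close> collapses to a point at
    \<open>T\<close>, where its coefficient need not be measurable yet. Measurability is therefore
    required only for rectangles of positive length.\<close>
  have ab: "0 \<le> a j" "a j \<le> b j" "b j \<le> T" "a j < b j \<Longrightarrow> \<zeta> j \<in> borel_measurable (F (a j))" if "j \<in> ?J" for j
    using that A B T adapted_step_times[OF A] adapted_step_times[OF B]
    by (auto simp: a_def b_def \<zeta>_def adapted_step_def min_le_iff_disj min_def split: if_splits)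
  obtain K c \<kappa> where c: "0 \<le> c 0" "\<And>i. i < K \<Longrightarrow> c i \<le> c (Suc i)" and \<kappa>: "\<And>i. i < K \<Longrightarrow> \<kappa> i \<in> borel_measurable (F (c i))"
    and S: "\<And>\<omega>. (\<Sum>j\<in>?J. \<zeta> j \<omega> * (W (b j) \<omega> - W (a j) \<omega>)) = (\<Sum>i<K. \<kappa> i \<omega> * (W (c (Suc i)) \<omega> - W (c i) \<omega>))"
    and q: "\<And>\<omega>. ennreal (\<Sum>i<K. (\<kappa> i \<omega>)\<^sup>2 * (c (Suc i) - c i)) \<le> ?q \<omega>"
    by (rule rectangles_refine[where a = a and b = b and \<zeta> = \<zeta>, OF J T ab]) (assumption | (rule that; assumption))+
  have ito: "simple_ito W k p \<xi> T \<omega> - simple_ito W k' p' \<xi>' T \<omega> = (\<Sum>i<K. \<kappa> i \<omega> * (W (c (Suc i)) \<omega> - W (c i) \<omega>))" for \<omega>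
    unfolding S[symmetric] by (simp add: sum.Plus simple_ito_def \<zeta>_def a_def b_def sum_negf)
  have val: "(\<Sum>j\<in>?J. \<zeta> j \<omega> * indicator {a j<..b j} s) = simple_value k p \<xi> s \<omega> - simple_value k' p' \<xi>' s \<omega>" if "s \<le> T" for s \<omega>
  proof -
    have ind: "indicator {min T x<..min T y} s = (indicator {x<..y} s :: real)" for x y
      using that by (auto simp: indicator_def)
    show ?thesis
      unfolding simple_value_def \<zeta>_def a_def b_def
      by (simp only: sum.Plus finite_lessThan o_def sum.case ind mult_minus_left sum_negf diff_conv_add_uminus)
  qed
  have qle: "?q \<omega> \<le> 2 * ?A \<omega> + 2 * ?B \<omega>" if "\<omega> \<in> space M" for \<omega>
  proof -
    have mA: "(\<lambda>s. ennreal ((simple_value k p \<xi> s \<omega> - H s \<omega>)\<^sup>2) * indicator {0..T} s) \<in> borel_measurable lborel"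
      and mB: "(\<lambda>s. ennreal ((simple_value k' p' \<xi>' s \<omega> - H s \<omega>)\<^sup>2) * indicator {0..T} s) \<in> borel_measurable lborel"
    proof -
      have [measurable]: "(\<lambda>s. H (max 0 (min T s)) \<omega>) \<in> borel_measurable borel"
        using measurable_compose[OF measurable_Pair2'[OF that] progressive_clamp[OF H less_imp_le[OF T]]] by simp
      have "(\<lambda>s. ennreal ((simple_value k p \<xi> s \<omega> - H s \<omega>)\<^sup>2) * indicator {0..T} s) = (\<lambda>s. ennreal ((simple_value k p \<xi> s \<omega> - H (max 0 (min T s)) \<omega>)\<^sup>2) * indicator {0..T} s)" for k p \<xi>
        by (auto split: split_indicator)
      moreover have "(\<lambda>s. ennreal ((simple_value k p \<xi> s \<omega> - H (max 0 (min T s)) \<omega>)\<^sup>2) * indicator {0..T} s) \<in> borel_measurable lborel" for k p \<xi>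
        unfolding simple_value_def by measurable
      ultimately show "(\<lambda>s. ennreal ((simple_value k p \<xi> s \<omega> - H s \<omega>)\<^sup>2) * indicator {0..T} s) \<in> borel_measurable lborel"
        "(\<lambda>s. ennreal ((simple_value k' p' \<xi>' s \<omega> - H s \<omega>)\<^sup>2) * indicator {0..T} s) \<in> borel_measurable lborel" by simp_all
    qed
    have "?q \<omega> \<le> (\<integral>\<^sup>+s. 2 * (ennreal ((simple_value k p \<xi> s \<omega> - H s \<omega>)\<^sup>2) * indicator {0..T} s) +
        2 * (ennreal ((simple_value k' p' \<xi>' s \<omega> - H s \<omega>)\<^sup>2) * indicator {0..T} s) \<partial>lborel)"
    proof (rule nn_integral_mono)
      fix s
      have le: "((x - y)\<^sup>2) \<le> 2 * (x - h)\<^sup>2 + 2 * (y - h)\<^sup>2" for x y h :: real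
        using zero_le_power2[of "x + y - 2 * h"] by (simp add: power2_eq_square algebra_simps)
      have sq: "ennreal ((x - y)\<^sup>2) \<le> 2 * ennreal ((x - h)\<^sup>2) + 2 * ennreal ((y - h)\<^sup>2)" for x y h :: real
        using ennreal_leI[OF le[of x y h]] by (simp add: ennreal_mult')
      show "ennreal ((\<Sum>j\<in>?J. \<zeta> j \<omega> * indicator {a j<..b j} s)\<^sup>2) * indicator {0..T} s \<le>
         2 * (ennreal ((simple_value k p \<xi> s \<omega> - H s \<omega>)\<^sup>2) * indicator {0..T} s) +
        2 * (ennreal ((simple_value k' p' \<xi>' s \<omega> - H s \<omega>)\<^sup>2) * indicator {0..T} s)"
      proof (cases "s \<in> {0..T}")
        case True
        then have "s \<le> T" by simp
        show ?thesis unfolding val[OF \<open>s \<le> T\<close>] using True sq by simp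
      qed simp
    qed
    also have "\<dots> = 2 * ?A \<omega> + 2 * ?B \<omega>"
      using mA mB by (simp add: nn_integral_add nn_integral_cmult)
    finally show ?thesis .
  qed
  have "prob {\<omega>\<in>space M. \<epsilon> < \<bar>simple_ito W k p \<xi> T \<omega> - simple_ito W k' p' \<xi>' T \<omega>\<bar>} \<le>
    \<delta> / \<epsilon>\<^sup>2 + prob {\<omega>\<in>space M. \<delta> < (\<Sum>i<K. (\<kappa> i \<omega>)\<^sup>2 * (c (Suc i) - c i))}"
    unfolding ito by (rule sum_prob_bound[OF c \<kappa> \<open>\<delta> > 0\<close> \<open>\<epsilon> > 0\<close>])
  also have "prob {\<omega>\<in>space M. \<delta> < (\<Sum>i<K. (\<kappa> i \<omega>)\<^sup>2 * (c (Suc i) - c i))} \<le>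
      prob ({\<omega>\<in>space M. ennreal (\<delta> / 4) < ?A \<omega>} \<union> {\<omega>\<in>space M. ennreal (\<delta> / 4) < ?B \<omega>})"
  proof (rule finite_measure_mono)
    show "{\<omega>\<in>space M. \<delta> < (\<Sum>i<K. (\<kappa> i \<omega>)\<^sup>2 * (c (Suc i) - c i))} \<subseteq> {\<omega>\<in>space M. ennreal (\<delta> / 4) < ?A \<omega>} \<union> {\<omega>\<in>space M. ennreal (\<delta> / 4) < ?B \<omega>}"
    proof (rule subsetI, rule ccontr)
      fix \<omega> assume mem: "\<omega> \<in> {\<omega>\<in>space M. \<delta> < (\<Sum>i<K. (\<kappa> i \<omega>)\<^sup>2 * (c (Suc i) - c i))}"
        and nmem: "\<omega> \<notin> {\<omega>\<in>space M. ennreal (\<delta> / 4) < ?A \<omega>} \<union> {\<omega>\<in>space M. ennreal (\<delta> / 4) < ?B \<omega>}"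
      from mem have \<omega>1: "\<omega> \<in> space M" "\<delta> < (\<Sum>i<K. (\<kappa> i \<omega>)\<^sup>2 * (c (Suc i) - c i))" by simp_all
      from nmem \<omega>1(1) have "\<not> ennreal (\<delta> / 4) < ?A \<omega>" "\<not> ennreal (\<delta> / 4) < ?B \<omega>" by blast+
      then have "?A \<omega> \<le> ennreal (\<delta> / 4)" "?B \<omega> \<le> ennreal (\<delta> / 4)" by (simp_all only: not_less)
      note \<omega> = \<omega>1 this
      have "ennreal \<delta> < ennreal (\<Sum>i<K. (\<kappa> i \<omega>)\<^sup>2 * (c (Suc i) - c i))" using \<omega>(2) \<open>\<delta> > 0\<close> by (simp add: ennreal_less_iff)
      also have "\<dots> \<le> 2 * ?A \<omega> + 2 * ?B \<omega>" using q[of \<omega>] qle[OF \<omega>(1)] by (rule order_trans)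
      also have "\<dots> \<le> 2 * ennreal (\<delta> / 4) + 2 * ennreal (\<delta> / 4)" using \<omega> by (intro add_mono mult_left_mono) auto
      also have "2 * ennreal (\<delta> / 4) = ennreal (\<delta> / 2)"
        using ennreal_mult'[of 2 "\<delta> / 4"] by simp
      also have "ennreal (\<delta> / 2) + ennreal (\<delta> / 2) = ennreal \<delta>"
        using \<open>\<delta> > 0\<close> by (subst ennreal_plus[symmetric]) auto
      finally show False by simp
    qed
  qed measurable
  also have "\<dots> \<le> prob {\<omega>\<in>space M. ennreal (\<delta> / 4) < ?A \<omega>} + prob {\<omega>\<in>space M. ennreal (\<delta> / 4) < ?B \<omega>}"
    by (intro measure_Un_le) measurable
  finally show ?thesis by simp
qed

lemma ito_integral_approximation:
  assumes ito: "has_ito_integral M F W H T I" and T: "0 < T"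
    and B: "\<And>n. adapted_step (k' n) (p' n) (\<xi>' n)"
    and Blim: "\<And>\<epsilon>. \<epsilon> > 0 \<Longrightarrow> (\<lambda>n. prob {\<omega>\<in>space M. ennreal \<epsilon> < (\<integral>\<^sup>+s\<in>{0..T}. ennreal ((simple_value (k' n) (p' n) (\<xi>' n) s \<omega> - H s \<omega>)\<^sup>2) \<partial>lborel)}) \<longlonglongrightarrow> 0"
  shows "conv_in_prob M (\<lambda>n. simple_ito W (k' n) (p' n) (\<xi>' n) T) I"
proof -
  obtain k p \<xi> where H: "progressive F H" and sp: "\<And>n. simple_process F (k n) (p n) (\<xi> n)"
    and Alim: "\<And>\<epsilon>. \<epsilon> > 0 \<Longrightarrow> (\<lambda>n. prob {\<omega>\<in>space M. ennreal \<epsilon> < (\<integral>\<^sup>+s\<in>{0..T}. ennreal ((simple_value (k n) (p n) (\<xi> n) s \<omega> - H s \<omega>)\<^sup>2) \<partial>lborel)}) \<longlonglongrightarrow> 0"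
    and conv: "conv_in_prob M (\<lambda>n. simple_ito W (k n) (p n) (\<xi> n) T) I"
    using ito unfolding has_ito_integral_def by blast
  have A: "adapted_step (k n) (p n) (\<xi> n)" for n by (rule simple_process_adapted_step[OF sp])
  have T0: "0 \<le> T" using T by simp
  note [measurable] = simple_ito_measurable[OF A T0] simple_ito_measurable[OF B T0]
  have [measurable]: "I \<in> borel_measurable M" using conv by (simp add: conv_in_prob_def)
  let ?D = "\<lambda>n \<omega>. simple_ito W (k n) (p n) (\<xi> n) T \<omega> - simple_ito W (k' n) (p' n) (\<xi>' n) T \<omega>"
  have "conv_in_prob M ?D (\<lambda>_. 0)"
    unfolding conv_in_prob_def
  proof (intro conjI allI impI)
    fix \<epsilon> :: real assume \<epsilon>: "\<epsilon> > 0"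
    let ?A = "\<lambda>\<delta> n. prob {\<omega>\<in>space M. ennreal \<delta> < (\<integral>\<^sup>+s\<in>{0..T}. ennreal ((simple_value (k n) (p n) (\<xi> n) s \<omega> - H s \<omega>)\<^sup>2) \<partial>lborel)}"
    let ?B = "\<lambda>\<delta> n. prob {\<omega>\<in>space M. ennreal \<delta> < (\<integral>\<^sup>+s\<in>{0..T}. ennreal ((simple_value (k' n) (p' n) (\<xi>' n) s \<omega> - H s \<omega>)\<^sup>2) \<partial>lborel)}"
    show "(\<lambda>n. prob {\<omega>\<in>space M. \<epsilon> < \<bar>?D n \<omega> - 0\<bar>}) \<longlonglongrightarrow> 0"
    proof (rule LIMSEQ_I)
      fix r :: real assume "r > 0"
      \<comment> \<open>This makes the Lenglart term equal to \<open>r / 2\<close> and leaves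
        \<open>r / 4\<close> for each of the two probabilities.\<close>
      define \<delta> where "\<delta> = r / 2 * \<epsilon>\<^sup>2"
      have \<delta>: "\<delta> > 0" "\<delta> / \<epsilon>\<^sup>2 = r / 2" using \<epsilon> \<open>r > 0\<close> by (auto simp: \<delta>_def)
      have lim: "?A (\<delta> / 4) \<longlonglongrightarrow> 0" "?B (\<delta> / 4) \<longlonglongrightarrow> 0" using \<delta> by (auto intro!: Alim Blim)
      have "\<forall>\<^sub>F n in sequentially. ?A (\<delta> / 4) n < r / 4 \<and> ?B (\<delta> / 4) n < r / 4"
        using \<open>r > 0\<close> by (intro eventually_conj order_tendstoD(2)[OF lim(1)] order_tendstoD(2)[OF lim(2)]) auto
      then obtain N where N: "\<And>n. n \<ge> N \<Longrightarrow> ?A (\<delta> / 4) n < r / 4 \<and> ?B (\<delta> / 4) n < r / 4"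
        by (auto simp: eventually_sequentially)
      show "\<exists>N. \<forall>n\<ge>N. norm (prob {\<omega>\<in>space M. \<epsilon> < \<bar>?D n \<omega> - 0\<bar>} - 0) < r"
      proof (intro exI[of _ N] allI impI)
        fix n assume n: "n \<ge> N"
        show "norm (prob {\<omega>\<in>space M. \<epsilon> < \<bar>?D n \<omega> - 0\<bar>} - 0) < r"
          using simple_ito_diff_prob_bound[OF A B H T \<delta>(1) \<epsilon>, of n n] N[OF n] \<delta>(2) by simp
      qed
    qed
  qed simp_all
  from conv_in_prob_diff[OF conv this] show ?thesis by simp
qed

end

section \<open>Fourth moments\<close>

context brownian
begin

text \<open>Induction over the independent increments with their first four moments; the Gaussian
  constant 3 reproduces itself because 3 q^2 + 6 q x^2 h + 3 x^4 h^2 = 3 (q + x^2 h)^2.\<close>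

lemma deterministic_sum_moments:
  fixes x :: "nat \<Rightarrow> real"
  assumes c: "0 \<le> c 0" "\<And>i. i < K \<Longrightarrow> c i \<le> c (Suc i)"
  defines "S \<equiv> \<lambda>k \<omega>. \<Sum>i<k. x i * (W (c (Suc i)) \<omega> - W (c i) \<omega>)" and "q \<equiv> \<lambda>k. \<Sum>i<k. (x i)\<^sup>2 * (c (Suc i) - c i)"
  shows "k \<le> K \<Longrightarrow> integrable M (\<lambda>\<omega>. S k \<omega> ^ 4) \<and> expectation (\<lambda>\<omega>. (S k \<omega>)\<^sup>2) = q k \<and> expectation (\<lambda>\<omega>. S k \<omega> ^ 4) = 3 * (q k)\<^sup>2"
proof (induction k)
  case 0
  show ?case by (simp add: S_def q_def)
next
  case (Suc k)
  let ?G = "\<lambda>\<omega>. W (c (Suc k)) \<omega> - W (c k) \<omega>" and ?h = "c (Suc k) - c k"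
  have IH: "integrable M (\<lambda>\<omega>. S k \<omega> ^ 4)" "expectation (\<lambda>\<omega>. (S k \<omega>)\<^sup>2) = q k" "expectation (\<lambda>\<omega>. S k \<omega> ^ 4) = 3 * (q k)\<^sup>2"
    using Suc by auto
  have ck: "0 \<le> c k" "c k \<le> c (Suc k)" using sum_measurable_F(1)[of c K "\<lambda>i _. x i" k] c Suc.prems by auto
  have SF: "S k \<in> borel_measurable (F (c k))"
    unfolding S_def using Suc.prems by (intro sum_measurable_F(2)[of c K "\<lambda>i _. x i"]) (use c in auto)
  have SM[measurable]: "S k \<in> borel_measurable M" by (rule F_M[OF SF])
  have pow: "\<bar>y\<bar> ^ j \<le> 1 + y ^ 4" if "j \<le> 4" for y :: real and j
  proof (cases "\<bar>y\<bar> \<le> 1")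
    case True
    have "\<bar>y\<bar> ^ j \<le> 1" using True by (intro power_le_one) auto
    then show ?thesis by (smt (verit) zero_le_even_power even_numeral)
  next
    case False
    then have "\<bar>y\<bar> ^ j \<le> \<bar>y\<bar> ^ 4" using that by (intro power_increasing) auto
    then show ?thesis by simp
  qed
  have Si: "integrable M (\<lambda>\<omega>. S k \<omega> ^ j)" if "j \<le> 4" for j
  proof (rule Bochner_Integration.integrable_bound[of M "\<lambda>\<omega>. 1 + S k \<omega> ^ 4"])
    show "AE \<omega> in M. norm (S k \<omega> ^ j) \<le> norm (1 + S k \<omega> ^ 4)"
      using pow[OF that] by (auto simp: power_abs intro!: AE_I2 order_trans[OF _ abs_ge_self])
  qed (use IH in auto)
  have p: "integrable M (\<lambda>\<omega>. S k \<omega> ^ j * ?G \<omega> ^ l)"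
    "expectation (\<lambda>\<omega>. S k \<omega> ^ j * ?G \<omega> ^ l) = expectation (\<lambda>\<omega>. S k \<omega> ^ j) * expectation (\<lambda>\<omega>. ?G \<omega> ^ l)" if "j \<le> 4" for j l
    using SF by (intro increment_product[OF ck _ Si[OF that]]; simp)+
  note mom = increment_moments(2-5)[OF ck]
  let ?x = "x k"
  have S1: "S (Suc k) \<omega> = S k \<omega> + ?x * ?G \<omega>" for \<omega> by (simp add: S_def)
  have q1: "q (Suc k) = q k + ?x\<^sup>2 * ?h" by (simp add: q_def)
  \<comment> \<open>Powers with exponent 0 and 1 are left unsimplified so that every summand has the
    product form treated in \<open>p\<close>.\<close>
  have "(s + y * g)\<^sup>2 = s ^ 2 * g ^ 0 + 2 * y * (s ^ 1 * g ^ 1) + y\<^sup>2 * (s ^ 0 * g ^ 2)" for s y g :: real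
    by (simp add: power2_eq_square algebra_simps)
  then have e2: "(S (Suc k) \<omega>)\<^sup>2 = S k \<omega> ^ 2 * ?G \<omega> ^ 0 + 2 * ?x * (S k \<omega> ^ 1 * ?G \<omega> ^ 1) + ?x\<^sup>2 * (S k \<omega> ^ 0 * ?G \<omega> ^ 2)" for \<omega>
    unfolding S1 by blast
  have "(s + y * g) ^ 4 = s ^ 4 * g ^ 0 + 4 * y * (s ^ 3 * g ^ 1) + 6 * y\<^sup>2 * (s ^ 2 * g ^ 2) + 4 * y ^ 3 * (s ^ 1 * g ^ 3) + y ^ 4 * (s ^ 0 * g ^ 4)" for s y g :: real
    by (simp add: power2_eq_square power3_eq_cube power4_eq_xxxx algebra_simps)
  then have e4: "S (Suc k) \<omega> ^ 4 = S k \<omega> ^ 4 * ?G \<omega> ^ 0 + 4 * ?x * (S k \<omega> ^ 3 * ?G \<omega> ^ 1) + 6 * ?x\<^sup>2 * (S k \<omega> ^ 2 * ?G \<omega> ^ 2)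
      + 4 * ?x ^ 3 * (S k \<omega> ^ 1 * ?G \<omega> ^ 3) + ?x ^ 4 * (S k \<omega> ^ 0 * ?G \<omega> ^ 4)" for \<omega>
    unfolding S1 by blast
  have i: "integrable M (\<lambda>\<omega>. y * (S k \<omega> ^ j * ?G \<omega> ^ l))" if "j \<le> 4" for j l y
    using p(1)[OF that] by (rule integrable_mult_right)
  have "integrable M (\<lambda>\<omega>. S (Suc k) \<omega> ^ 4)"
    unfolding e4 by (intro Bochner_Integration.integrable_add i p) auto
  moreover have "expectation (\<lambda>\<omega>. (S (Suc k) \<omega>)\<^sup>2) = expectation (\<lambda>\<omega>. S k \<omega> ^ 2 * ?G \<omega> ^ 0) + 2 * ?x * expectation (\<lambda>\<omega>. S k \<omega> ^ 1 * ?G \<omega> ^ 1) + ?x\<^sup>2 * expectation (\<lambda>\<omega>. S k \<omega> ^ 0 * ?G \<omega> ^ 2)"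
    unfolding e2 using p(1)[of 2 0] p(1)[of 1 1] p(1)[of 0 2] i[of 1 "2 * ?x" 1] i[of 0 "?x\<^sup>2" 2]
    by (simp del: power_0 power_one_right)
  then have "expectation (\<lambda>\<omega>. (S (Suc k) \<omega>)\<^sup>2) = q (Suc k)"
    using p(2)[of 2 0] p(2)[of 1 1] p(2)[of 0 2] mom IH by (simp add: q1 prob_space)
  moreover have "expectation (\<lambda>\<omega>. S (Suc k) \<omega> ^ 4) = expectation (\<lambda>\<omega>. S k \<omega> ^ 4 * ?G \<omega> ^ 0) + 4 * ?x * expectation (\<lambda>\<omega>. S k \<omega> ^ 3 * ?G \<omega> ^ 1)
     + 6 * ?x\<^sup>2 * expectation (\<lambda>\<omega>. S k \<omega> ^ 2 * ?G \<omega> ^ 2)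
      + 4 * ?x ^ 3 * expectation (\<lambda>\<omega>. S k \<omega> ^ 1 * ?G \<omega> ^ 3) + ?x ^ 4 * expectation (\<lambda>\<omega>. S k \<omega> ^ 0 * ?G \<omega> ^ 4)"
    unfolding e4 using p(1)[of 4 0] p(1)[of 3 1] p(1)[of 2 2] p(1)[of 1 3] p(1)[of 0 4]
    by (simp del: power_0 power_one_right)
  then have "expectation (\<lambda>\<omega>. S (Suc k) \<omega> ^ 4) = 3 * (q k)\<^sup>2 + 6 * ?x\<^sup>2 * (q k * ?h) + ?x ^ 4 * (3 * ?h\<^sup>2)"
    using p(2)[of 4 0] p(2)[of 3 1] p(2)[of 2 2] p(2)[of 1 3] p(2)[of 0 4] mom IH by (simp add: prob_space)
  then have "expectation (\<lambda>\<omega>. S (Suc k) \<omega> ^ 4) = 3 * (q (Suc k))\<^sup>2"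
    by (simp add: q1 power2_eq_square power4_eq_xxxx algebra_simps)
  ultimately show ?case by blast
qed

text \<open>Independence makes the joint law of \<open>p\<close> and the path of W a product. By
  Fubini the coefficients can be frozen, and the deterministic case applies. With nonnegative
  integrals no moments of the coefficients have to be known in advance.\<close>

lemma independent_sum_moments:
  assumes ind: "indep_var P p (path_space {0..}) (path_of {0..} W)"
    and \<xi>: "\<And>i. i < K \<Longrightarrow> \<exists>\<Phi>\<in>borel_measurable P. AE \<omega> in M. \<xi> i \<omega> = \<Phi> (p \<omega>)"
    and c: "0 \<le> c 0" "\<And>i. i < K \<Longrightarrow> c i \<le> c (Suc i)"
  shows "(\<integral>\<^sup>+\<omega>. ennreal ((\<Sum>i<K. \<xi> i \<omega> * (W (c (Suc i)) \<omega> - W (c i) \<omega>)) ^ 4) \<partial>M) =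
      (\<integral>\<^sup>+\<omega>. ennreal (3 * (\<Sum>i<K. (\<xi> i \<omega>)\<^sup>2 * (c (Suc i) - c i))\<^sup>2) \<partial>M)"
    and "(\<integral>\<^sup>+\<omega>. ennreal ((\<Sum>i<K. \<xi> i \<omega> * (W (c (Suc i)) \<omega> - W (c i) \<omega>))\<^sup>2) \<partial>M) =
      (\<integral>\<^sup>+\<omega>. ennreal (\<Sum>i<K. (\<xi> i \<omega>)\<^sup>2 * (c (Suc i) - c i)) \<partial>M)"
proof -
  let ?PS = "path_space {0..}" and ?w = "path_of {0..} W"
  have [measurable]: "p \<in> measurable M P" "?w \<in> measurable M ?PS"
    using ind by (auto intro: indep_var_rv1 indep_var_rv2)
  obtain \<Phi> where \<Phi>[measurable]: "\<And>i. i < K \<Longrightarrow> \<Phi> i \<in> borel_measurable P" and eq: "\<And>i. i < K \<Longrightarrow> AE \<omega> in M. \<xi> i \<omega> = \<Phi> i (p \<omega>)"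
    using \<xi> by metis
  have AE: "AE \<omega> in M. \<forall>i\<in>{..<K}. \<xi> i \<omega> = \<Phi> i (p \<omega>)" using eq by (intro AE_finite_allI) auto
  have cn: "0 \<le> c k" if "k \<le> K" for k using sum_measurable_F(1)[of c K "\<lambda>_ _. 0" k] c that by auto
  interpret PW: prob_space "distr M ?PS ?w" by (rule prob_space_distr) measurable
  let ?S = "\<lambda>x w. \<Sum>i<K. \<Phi> i x * (w (c (Suc i)) - w (c i))"
  have Sm: "(\<lambda>z. ?S (fst z) (snd z)) \<in> borel_measurable (P \<Otimes>\<^sub>M ?PS)"
  proof (rule borel_measurable_sum)
    fix i assume i: "i \<in> {..<K}"
    have [measurable]: "(\<lambda>w. w (c i)) \<in> borel_measurable ?PS" "(\<lambda>w. w (c (Suc i))) \<in> borel_measurable ?PS"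
      using cn[of i] cn[of "Suc i"] i by (auto intro!: measurable_component_singleton)
    have [measurable]: "\<Phi> i \<in> borel_measurable P" using i by simp
    show "(\<lambda>z. \<Phi> i (fst z) * (snd z (c (Suc i)) - snd z (c i))) \<in> borel_measurable (P \<Otimes>\<^sub>M ?PS)" by measurable
  qed
  have Sw: "?S x (?w \<omega>) = (\<Sum>i<K. \<Phi> i x * (W (c (Suc i)) \<omega> - W (c i) \<omega>))" for x \<omega>
    using cn by (intro sum.cong refl) (auto simp: path_of_def)
  have Fub: "(\<integral>\<^sup>+\<omega>. f (?S (p \<omega>) (?w \<omega>)) \<partial>M) = (\<integral>\<^sup>+\<omega>. (\<integral>\<^sup>+\<omega>'. f (?S (p \<omega>) (?w \<omega>')) \<partial>M) \<partial>M)"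
    if [measurable]: "f \<in> borel_measurable borel" for f :: "real \<Rightarrow> ennreal"
  proof -
    have fm[measurable]: "(\<lambda>z. f (?S (fst z) (snd z))) \<in> borel_measurable (P \<Otimes>\<^sub>M ?PS)"
      by (rule measurable_compose[OF Sm that])
    have fm': "(\<lambda>z. f (?S (fst z) (snd z))) \<in> borel_measurable (distr M P p \<Otimes>\<^sub>M distr M ?PS ?w)"
      using fm by (simp cong: measurable_cong_sets)
    have fx: "(\<lambda>w. f (?S x w)) \<in> borel_measurable ?PS" if "x \<in> space P" for x
      using measurable_compose[OF measurable_Pair1'[OF that] fm] by simp
    have "(\<integral>\<^sup>+\<omega>. f (?S (p \<omega>) (?w \<omega>)) \<partial>M) = (\<integral>\<^sup>+z. f (?S (fst z) (snd z)) \<partial>distr M (P \<Otimes>\<^sub>M ?PS) (\<lambda>\<omega>. (p \<omega>, ?w \<omega>)))"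
      by (subst nn_integral_distr) auto
    also have "\<dots> = (\<integral>\<^sup>+z. f (?S (fst z) (snd z)) \<partial>(distr M P p \<Otimes>\<^sub>M distr M ?PS ?w))"
      using ind unfolding indep_var_distribution_eq by simp
    also have "\<dots> = (\<integral>\<^sup>+x. \<integral>\<^sup>+w. f (?S x w) \<partial>distr M ?PS ?w \<partial>distr M P p)"
      by (subst PW.nn_integral_fst[OF fm', symmetric]) simp
    also have "\<dots> = (\<integral>\<^sup>+x. \<integral>\<^sup>+\<omega>'. f (?S x (?w \<omega>')) \<partial>M \<partial>distr M P p)"
      by (intro nn_integral_cong nn_integral_distr) (use fx in auto)
    also have "\<dots> = (\<integral>\<^sup>+\<omega>. (\<integral>\<^sup>+\<omega>'. f (?S (p \<omega>) (?w \<omega>')) \<partial>M) \<partial>M)"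
    proof -
      have "(\<lambda>x. \<integral>\<^sup>+w. f (?S x w) \<partial>distr M ?PS ?w) \<in> borel_measurable (distr M P p)"
        using PW.borel_measurable_nn_integral_fst[OF fm'] by simp
      then have "(\<lambda>x. \<integral>\<^sup>+w. f (?S x w) \<partial>distr M ?PS ?w) \<in> borel_measurable P" by simp
      then have "(\<lambda>x. \<integral>\<^sup>+\<omega>'. f (?S x (?w \<omega>')) \<partial>M) \<in> borel_measurable P"
        by (rule measurable_cong[THEN iffD1, rotated]) (intro nn_integral_distr, use fx in auto)
      then show ?thesis by (intro nn_integral_distr) simp_all
    qed
    finally show ?thesis .
  qed
  note det = deterministic_sum_moments[of c K, OF c order_refl]
  have det4: "(\<integral>\<^sup>+\<omega>'. ennreal ((?S x (?w \<omega>')) ^ 4) \<partial>M) = ennreal (3 * (\<Sum>i<K. (\<Phi> i x)\<^sup>2 * (c (Suc i) - c i))\<^sup>2)" for x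
    using det[of "\<lambda>i. \<Phi> i x"] unfolding Sw by (subst nn_integral_eq_integral) auto
  have det2: "(\<integral>\<^sup>+\<omega>'. ennreal ((?S x (?w \<omega>'))\<^sup>2) \<partial>M) = ennreal (\<Sum>i<K. (\<Phi> i x)\<^sup>2 * (c (Suc i) - c i))" for x
  proof -
    let ?T = "\<lambda>\<omega>. \<Sum>i<K. \<Phi> i x * (W (c (Suc i)) \<omega> - W (c i) \<omega>)"
    have [measurable]: "?T \<in> borel_measurable M"
      using F_M[OF sum_measurable_F(2)[of c K "\<lambda>i _. \<Phi> i x", OF c _ order_refl]] by simp
    have "square_integrable M (\<lambda>\<omega>. (?T \<omega>)\<^sup>2)" using det[of "\<lambda>i. \<Phi> i x"] by (simp add: square_integrable_def)
    then have "integrable M (\<lambda>\<omega>. (?T \<omega>)\<^sup>2)" by (rule square_integrable_imp_integrable)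
    then show ?thesis using det[of "\<lambda>i. \<Phi> i x"] unfolding Sw by (subst nn_integral_eq_integral) auto
  qed
  have tr: "(\<integral>\<^sup>+\<omega>. f (\<Sum>i<K. \<xi> i \<omega> * (W (c (Suc i)) \<omega> - W (c i) \<omega>)) \<partial>M) = (\<integral>\<^sup>+\<omega>. f (?S (p \<omega>) (?w \<omega>)) \<partial>M)" for f :: "real \<Rightarrow> ennreal"
    unfolding Sw using AE by (intro nn_integral_cong_AE) (auto elim!: eventually_mono)
  have tr2: "(\<integral>\<^sup>+\<omega>. f (\<Sum>i<K. (\<Phi> i (p \<omega>))\<^sup>2 * (c (Suc i) - c i)) \<partial>M) = (\<integral>\<^sup>+\<omega>. f (\<Sum>i<K. (\<xi> i \<omega>)\<^sup>2 * (c (Suc i) - c i)) \<partial>M)" for f :: "real \<Rightarrow> ennreal"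
    using AE by (intro nn_integral_cong_AE) (auto elim!: eventually_mono)
  show "(\<integral>\<^sup>+\<omega>. ennreal ((\<Sum>i<K. \<xi> i \<omega> * (W (c (Suc i)) \<omega> - W (c i) \<omega>)) ^ 4) \<partial>M) =
      (\<integral>\<^sup>+\<omega>. ennreal (3 * (\<Sum>i<K. (\<xi> i \<omega>)\<^sup>2 * (c (Suc i) - c i))\<^sup>2) \<partial>M)"
    using tr[of "\<lambda>y. ennreal (y ^ 4)"] Fub[of "\<lambda>y. ennreal (y ^ 4)"] tr2[of "\<lambda>y. ennreal (3 * y\<^sup>2)"] unfolding det4 by simp
  show "(\<integral>\<^sup>+\<omega>. ennreal ((\<Sum>i<K. \<xi> i \<omega> * (W (c (Suc i)) \<omega> - W (c i) \<omega>))\<^sup>2) \<partial>M) =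
      (\<integral>\<^sup>+\<omega>. ennreal (\<Sum>i<K. (\<xi> i \<omega>)\<^sup>2 * (c (Suc i) - c i)) \<partial>M)"
    using tr[of "\<lambda>y. ennreal (y\<^sup>2)"] Fub[of "\<lambda>y. ennreal (y\<^sup>2)"] tr2[of ennreal] unfolding det2 by simp
qed

end

section \<open>Integrated volatility\<close>

lemma integrable_indicator_Icc: "integrable lborel (indicator {a..b::real} :: real \<Rightarrow> real)"
  using emeasure_bounded_finite[of "{a..b}"] by (intro integrable_real_indicator) auto

lemma set_integrable_const_Icc: "set_integrable lborel {a..b} (\<lambda>_::real. k :: real)"
  using integrable_indicator_Icc[of a b] by (simp add: set_integrable_def)

lemma integral_square_le:
  fixes g :: "real \<Rightarrow> real"
  assumes [measurable]: "(\<lambda>u. indicator {a..b} u * g u) \<in> borel_measurable borel" and "a \<le> b"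
  shows "ennreal ((LBINT u:{a..b}. g u)\<^sup>2) \<le> ennreal (b - a) * (\<integral>\<^sup>+u\<in>{a..b}. ennreal ((g u)\<^sup>2) \<partial>lborel)"
proof (cases "a = b")
  \<comment> \<open>Both sides are 0 here. The case is split off because the infinite case below
    needs a nonzero factor \<open>b - a\<close>.\<close>
  case True
  have "(LBINT u:{a..b}. g u) = 0"
    unfolding set_lebesgue_integral_def
    by (rule integral_eq_zero_AE) (use AE_lborel_singleton[of a] True in \<open>auto elim!: eventually_mono\<close>)
  then show ?thesis by simp
next
  case False
  then have ab: "a < b" using \<open>a \<le> b\<close> by simp
  let ?g = "\<lambda>u. indicator {a..b} u * g u"
  have eq: "(\<integral>\<^sup>+u\<in>{a..b}. ennreal ((g u)\<^sup>2) \<partial>lborel) = (\<integral>\<^sup>+u. ennreal ((?g u)\<^sup>2) \<partial>lborel)"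
    by (intro nn_integral_cong) (auto split: split_indicator)
  show ?thesis
  proof (cases "(\<integral>\<^sup>+u. ennreal ((?g u)\<^sup>2) \<partial>lborel) = \<infinity>")
    case True
    then show ?thesis unfolding eq using ab by (simp add: ennreal_mult_top)
  next
    case False
    then have i: "integrable lborel (\<lambda>u. (?g u)\<^sup>2)"
      by (intro integrableI_bounded) (auto simp: less_top[symmetric])
    have i1: "integrable lborel (\<lambda>u. (indicator {a..b} u :: real)\<^sup>2)" "(LBINT u. (indicator {a..b} u :: real)\<^sup>2) = b - a"
    proof -
      have "(indicator {a..b} u :: real)\<^sup>2 = indicator {a..b} u" for u by (simp add: indicator_def)
      then show "integrable lborel (\<lambda>u. (indicator {a..b} u :: real)\<^sup>2)" "(LBINT u. (indicator {a..b} u :: real)\<^sup>2) = b - a"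
        using integrable_indicator_Icc[of a b] \<open>a \<le> b\<close> by simp_all
    qed
    have "(LBINT u:{a..b}. g u)\<^sup>2 = (LBINT u. indicator {a..b} u * ?g u)\<^sup>2"
    proof -
      have "indicator {a..b} u * ?g u = indicator {a..b} u *\<^sub>R g u" for u by (auto split: split_indicator)
      then show ?thesis by (simp only: set_lebesgue_integral_def)
    qed
    also have "\<dots> \<le> (b - a) * (LBINT u. (?g u)\<^sup>2)"
      using Cauchy_Schwarz_integral(3)[of "indicator {a..b}" lborel ?g] i i1 by simp
    finally have "ennreal ((LBINT u:{a..b}. g u)\<^sup>2) \<le> ennreal ((b - a) * (LBINT u. (?g u)\<^sup>2))" by (rule ennreal_leI)
    also have "\<dots> = ennreal (b - a) * ennreal (LBINT u. (?g u)\<^sup>2)" using ab by (intro ennreal_mult) auto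
    also have "ennreal (LBINT u. (?g u)\<^sup>2) = (\<integral>\<^sup>+u. ennreal ((?g u)\<^sup>2) \<partial>lborel)"
      using i by (intro nn_integral_eq_integral[symmetric]) auto
    finally show ?thesis unfolding eq .
  qed
qed

lemma (in prob_space) nn_integral_time_swap:
  assumes D: "(\<lambda>(s, \<omega>). D s \<omega>) \<in> borel_measurable (borel \<Otimes>\<^sub>M M)" and [measurable]: "A \<in> sets borel"
  shows "(\<integral>\<^sup>+\<omega>. (\<integral>\<^sup>+s\<in>A. ennreal (D s \<omega>) \<partial>lborel) \<partial>M) = (\<integral>\<^sup>+s\<in>A. (\<integral>\<^sup>+\<omega>. ennreal (D s \<omega>) \<partial>M) \<partial>lborel)"
proof -
  interpret pair_sigma_finite lborel M ..
  have [measurable]: "(\<lambda>z. D (fst z) (snd z)) \<in> borel_measurable (borel \<Otimes>\<^sub>M M)" using D by (simp add: case_prod_unfold)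
  have m: "(\<lambda>z. ennreal (D (fst z) (snd z)) * indicator A (fst z)) \<in> borel_measurable (lborel \<Otimes>\<^sub>M M)" by measurable
  have "(\<integral>\<^sup>+\<omega>. (\<integral>\<^sup>+s. ennreal (D s \<omega>) * indicator A s \<partial>lborel) \<partial>M) = (\<integral>\<^sup>+s. (\<integral>\<^sup>+\<omega>. ennreal (D s \<omega>) * indicator A s \<partial>M) \<partial>lborel)"
    using Fubini[OF m] by simp
  also have "\<dots> = (\<integral>\<^sup>+s\<in>A. (\<integral>\<^sup>+\<omega>. ennreal (D s \<omega>) \<partial>M) \<partial>lborel)"
    by (intro nn_integral_cong) (auto split: split_indicator)
  finally show ?thesis .
qed

lemma measurable_section:
  assumes "(\<lambda>(s, \<omega>). D s \<omega>) \<in> borel_measurable (borel \<Otimes>\<^sub>M M)" "\<omega> \<in> space M"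
  shows "(\<lambda>s. D s \<omega>) \<in> borel_measurable borel"
  using measurable_compose[OF measurable_Pair2'[OF assms(2)] assms(1)] by simp

lemma (in prob_space) time_integral_second_moment:
  assumes D: "(\<lambda>(s, \<omega>). D s \<omega>) \<in> borel_measurable (borel \<Otimes>\<^sub>M M)" and "a \<le> b" and "0 \<le> C"
    and bound: "\<And>s. a \<le> s \<Longrightarrow> s \<le> b \<Longrightarrow> (\<integral>\<^sup>+\<omega>. ennreal ((D s \<omega>)\<^sup>2) \<partial>M) \<le> ennreal C"
  shows "(\<integral>\<^sup>+\<omega>. ennreal ((LBINT s:{a..b}. D s \<omega>)\<^sup>2) \<partial>M) \<le> ennreal ((b - a)\<^sup>2 * C)"
proof -
  have [measurable]: "(\<lambda>z. D (fst z) (snd z)) \<in> borel_measurable (borel \<Otimes>\<^sub>M M)" using D by (simp add: case_prod_unfold)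
  have D2: "(\<lambda>(s, \<omega>). (D s \<omega>)\<^sup>2) \<in> borel_measurable (borel \<Otimes>\<^sub>M M)" unfolding case_prod_unfold by measurable
  have "(\<integral>\<^sup>+\<omega>. ennreal ((LBINT s:{a..b}. D s \<omega>)\<^sup>2) \<partial>M) \<le> (\<integral>\<^sup>+\<omega>. ennreal (b - a) * (\<integral>\<^sup>+s\<in>{a..b}. ennreal ((D s \<omega>)\<^sup>2) \<partial>lborel) \<partial>M)"
  proof (rule nn_integral_mono)
    fix \<omega> assume "\<omega> \<in> space M"
    then have [measurable]: "(\<lambda>s. D s \<omega>) \<in> borel_measurable borel" by (rule measurable_section[OF D])
    show "ennreal ((LBINT s:{a..b}. D s \<omega>)\<^sup>2) \<le> ennreal (b - a) * (\<integral>\<^sup>+s\<in>{a..b}. ennreal ((D s \<omega>)\<^sup>2) \<partial>lborel)"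
      by (rule integral_square_le) (use \<open>a \<le> b\<close> in auto)
  qed
  also have "\<dots> = ennreal (b - a) * (\<integral>\<^sup>+\<omega>. (\<integral>\<^sup>+s\<in>{a..b}. ennreal ((D s \<omega>)\<^sup>2) \<partial>lborel) \<partial>M)"
  proof (rule nn_integral_cmult)
    have "(\<lambda>(\<omega>, s). ennreal ((D s \<omega>)\<^sup>2) * indicator {a..b} s) \<in> borel_measurable (M \<Otimes>\<^sub>M lborel)"
      using measurable_pair_swap_iff[of "\<lambda>(\<omega>, s). ennreal ((D s \<omega>)\<^sup>2) * indicator {a..b} s" M lborel borel]
      by (simp add: case_prod_unfold)
    then show "(\<lambda>\<omega>. \<integral>\<^sup>+s\<in>{a..b}. ennreal ((D s \<omega>)\<^sup>2) \<partial>lborel) \<in> borel_measurable M"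
      by (rule lborel.borel_measurable_nn_integral)
  qed
  also have "\<dots> = ennreal (b - a) * (\<integral>\<^sup>+s\<in>{a..b}. (\<integral>\<^sup>+\<omega>. ennreal ((D s \<omega>)\<^sup>2) \<partial>M) \<partial>lborel)"
    by (subst nn_integral_time_swap[OF D2]) auto
  also have "\<dots> \<le> ennreal (b - a) * (\<integral>\<^sup>+s\<in>{a..b}. ennreal C \<partial>lborel)"
    using bound by (intro mult_left_mono nn_integral_mono) (auto split: split_indicator)
  also have "\<dots> = ennreal ((b - a)\<^sup>2 * C)"
    using \<open>a \<le> b\<close> \<open>0 \<le> C\<close> by (simp add: nn_integral_cmult_indicator ennreal_mult[symmetric] power2_eq_square mult_ac)
  finally show ?thesis .
qed

text \<open>The rest of the proof sees X only through its second-order structure, its sign, its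
  being a functional of a path \<open>p\<close> independent of W, and progressive measurability.
  Here \<open>c\<close> is the mean of X, later instantiated to 2 mu.\<close>

locale volatility = brownian M F W for M :: "'a measure" and F W +
  fixes X :: "real \<Rightarrow> 'a \<Rightarrow> real" and lam V c :: real and P :: "(real \<Rightarrow> real) measure" and p :: "'a \<Rightarrow> real \<Rightarrow> real"
  assumes lam: "lam > 0"
    and X_si: "square_integrable M (X t)" and X_nonneg: "AE \<omega> in M. 0 \<le> X t \<omega>"
    and X_mean: "expectation (X t) = c"
    and X_product: "expectation (\<lambda>\<omega>. X s \<omega> * X t \<omega>) = V * acf lam \<bar>s - t\<bar> + c\<^sup>2"
    and X_path: "\<exists>\<Phi>\<in>borel_measurable P. AE \<omega> in M. X t \<omega> = \<Phi> (p \<omega>)"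
    and ind: "indep_var P p (path_space {0..}) (path_of {0..} W)"
    and X_progressive: "progressive F X"
begin

lemma X_measurable [measurable]: "X t \<in> borel_measurable M"
  using X_si by (simp add: square_integrable_def)

lemma V_nonneg: "0 \<le> V"
proof -
  have "variance (X 0) = V"
    using X_product[of 0 0] X_mean[of 0] X_si[of 0]
      square_integrable_imp_integrable[OF X_si, of 0] square_integrableD(2)[OF X_si, of 0]
    by (subst variance_eq) (auto simp: acf_def power2_eq_square)
  moreover have "0 \<le> variance (X 0)" by simp
  ultimately show ?thesis by simp
qed

text \<open>The left side is 2 V (1 - r(|s - t|)), and \<open>acf_ge\<close> bounds 1 - r
  quadratically.\<close>

lemma X_diff_second_moment: "expectation (\<lambda>\<omega>. (X s \<omega> - X t \<omega>)\<^sup>2) \<le> 2 * V * (lam * (s - t))\<^sup>2"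
proof -
  have i: "integrable M (\<lambda>\<omega>. X s \<omega> * X t \<omega>)" for s t by (rule square_integrable_mult[OF X_si X_si])
  have "expectation (\<lambda>\<omega>. (X s \<omega> - X t \<omega>)\<^sup>2) = expectation (\<lambda>\<omega>. X s \<omega> * X s \<omega> + X t \<omega> * X t \<omega> - 2 * (X s \<omega> * X t \<omega>))"
    by (intro Bochner_Integration.integral_cong refl) (simp add: power2_eq_square algebra_simps)
  also have "\<dots> = 2 * V * (1 - acf lam \<bar>s - t\<bar>)"
    using i by (simp add: X_product) (simp add: acf_def algebra_simps)
  also have "\<dots> \<le> 2 * V * (lam * \<bar>s - t\<bar>)\<^sup>2"
    using acf_ge[OF lam, of "\<bar>s - t\<bar>"] V_nonneg by (intro mult_left_mono) auto
  finally show ?thesis by (simp add: power_mult_distrib)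
qed

lemma X_diff_first_moment: "expectation (\<lambda>\<omega>. \<bar>X s \<omega> - X t \<omega>\<bar>) \<le> sqrt (2 * V) * lam * \<bar>s - t\<bar>"
proof -
  have "expectation (\<lambda>\<omega>. \<bar>X s \<omega> - X t \<omega>\<bar>) \<le> sqrt (expectation (\<lambda>\<omega>. (X s \<omega> - X t \<omega>)\<^sup>2))"
    by (intro abs_expectation_le_sqrt square_integrable_diff X_si)
  also have "\<dots> \<le> sqrt (2 * V * (lam * (s - t))\<^sup>2)" by (intro real_sqrt_le_mono X_diff_second_moment)
  also have "\<dots> = sqrt (2 * V) * lam * \<bar>s - t\<bar>" using lam by (simp add: real_sqrt_mult abs_mult)
  finally show ?thesis .
qed

lemma X_adapted: "0 \<le> u \<Longrightarrow> X u \<in> borel_measurable (F u)"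
proof -
  assume u: "0 \<le> u"
  then have "(\<lambda>(s, \<omega>). X s \<omega>) \<in> borel_measurable (restrict_space borel {0..u} \<Otimes>\<^sub>M F u)"
    using X_progressive by (simp add: progressive_def)
  moreover have "u \<in> space (restrict_space borel {0..u})" using u by simp
  ultimately show ?thesis
    using measurable_compose[OF measurable_Pair1'[of u "restrict_space borel {0..u}" "F u"], of "\<lambda>(s, \<omega>). X s \<omega>" borel] by simp
qed

definition integrated :: "real \<Rightarrow> real \<Rightarrow> 'a \<Rightarrow> real" where
  "integrated a b \<omega> = (LBINT u:{a..b}. X u \<omega>)"

definition clamped :: "real \<Rightarrow> real \<Rightarrow> 'a \<Rightarrow> real" where
  "clamped T s = X (max 0 (min T s))"

lemma clamped_measurable: "0 \<le> T \<Longrightarrow> (\<lambda>(s, \<omega>). clamped T s \<omega>) \<in> borel_measurable (borel \<Otimes>\<^sub>M M)"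
  unfolding clamped_def by (rule progressive_clamp[OF X_progressive])

lemma integrated_clamped:
  assumes "0 \<le> a" "b \<le> T"
  shows "integrated a b \<omega> = (LBINT u:{a..b}. clamped T u \<omega>)"
  unfolding integrated_def clamped_def using assms by (intro set_lebesgue_integral_cong) auto

lemma X_second_moment: "(\<integral>\<^sup>+\<omega>. ennreal ((X s \<omega>)\<^sup>2) \<partial>M) = ennreal (V + c\<^sup>2)"
proof -
  have "(\<integral>\<^sup>+\<omega>. ennreal ((X s \<omega>)\<^sup>2) \<partial>M) = ennreal (expectation (\<lambda>\<omega>. (X s \<omega>)\<^sup>2))"
    using X_si[of s] by (intro nn_integral_eq_integral) (auto simp: square_integrable_def)
  also have "expectation (\<lambda>\<omega>. (X s \<omega>)\<^sup>2) = V + c\<^sup>2"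
    using X_product[of s s] by (simp add: acf_def power2_eq_square)
  finally show ?thesis .
qed

lemma integrated_square_integrable:
  assumes "0 \<le> a" "a \<le> b"
  shows "square_integrable M (integrated a b)"
proof -
  have b: "0 \<le> b" using assms by simp
  have eq: "integrated a b = (\<lambda>\<omega>. LBINT u:{a..b}. clamped b u \<omega>)"
    using integrated_clamped[OF assms(1) order_refl] by auto
  have [measurable]: "(\<lambda>z. clamped b (fst z) (snd z)) \<in> borel_measurable (borel \<Otimes>\<^sub>M M)"
    using clamped_measurable[OF b] by (simp add: case_prod_unfold)
  have "(\<lambda>(\<omega>, s). indicator {a..b} s *\<^sub>R clamped b s \<omega>) \<in> borel_measurable (M \<Otimes>\<^sub>M lborel)"
    using measurable_pair_swap_iff[of "\<lambda>(\<omega>, s). indicator {a..b} s *\<^sub>R clamped b s \<omega>" M lborel borel]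
    by (simp add: case_prod_unfold)
  then have m[measurable]: "integrated a b \<in> borel_measurable M"
    unfolding eq set_lebesgue_integral_def by (rule lborel.borel_measurable_lebesgue_integral)
  have "(\<integral>\<^sup>+\<omega>. ennreal ((integrated a b \<omega>)\<^sup>2) \<partial>M) \<le> ennreal ((b - a)\<^sup>2 * (V + c\<^sup>2))"
    unfolding eq using assms V_nonneg X_second_moment
    by (intro time_integral_second_moment[OF clamped_measurable[OF b]]) (auto simp: clamped_def)
  then show ?thesis
    unfolding square_integrable_def by (auto intro!: integrableI_bounded elim!: le_less_trans)
qed

text \<open>Fubini, justified by Cauchy-Schwarz: the second moment of X is constant in time, so the
  expectation of |J X u| is bounded uniformly in u. Choosing for \<open>J\<close> a constant, a
  value of X or another integral yields the means and all covariances.\<close>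

lemma integrated_product:
  assumes J: "square_integrable M J" and ab: "0 \<le> a" "a \<le> b"
  shows "expectation (\<lambda>\<omega>. J \<omega> * integrated a b \<omega>) = (LBINT u:{a..b}. expectation (\<lambda>\<omega>. J \<omega> * X u \<omega>))"
proof -
  note bml = borel_measurable_lebesgue_integral
  interpret pair_sigma_finite lborel M ..
  have b: "0 \<le> b" using ab by simp
  have [measurable]: "(\<lambda>z. clamped b (fst z) (snd z)) \<in> borel_measurable (borel \<Otimes>\<^sub>M M)"
    using clamped_measurable[OF b] by (simp add: case_prod_unfold)
  have [measurable]: "J \<in> borel_measurable M" using J by (simp add: square_integrable_def)
  let ?f = "\<lambda>u \<omega>. indicator {a..b} u * (J \<omega> * clamped b u \<omega>)"
  have i: "integrable M (\<lambda>\<omega>. J \<omega> * clamped b u \<omega>)" for u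
    unfolding clamped_def by (rule square_integrable_mult[OF J X_si])
  define C where "C = sqrt (expectation (\<lambda>\<omega>. (J \<omega>)\<^sup>2) * (V + c\<^sup>2))"
  have le: "expectation (\<lambda>\<omega>. \<bar>J \<omega> * clamped b u \<omega>\<bar>) \<le> C" for u
    unfolding C_def
  proof (rule real_le_rsqrt)
    have "(expectation (\<lambda>\<omega>. \<bar>J \<omega> * clamped b u \<omega>\<bar>))\<^sup>2 \<le> expectation (\<lambda>\<omega>. (J \<omega>)\<^sup>2) * expectation (\<lambda>\<omega>. (clamped b u \<omega>)\<^sup>2)"
      unfolding clamped_def using J X_si by (intro Cauchy_Schwarz_integral(2)) (auto simp: square_integrable_def)
    also have "expectation (\<lambda>\<omega>. (clamped b u \<omega>)\<^sup>2) = V + c\<^sup>2"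
      using X_product[of "max 0 (min b u)" "max 0 (min b u)"] by (simp add: clamped_def acf_def power2_eq_square)
    finally show "(expectation (\<lambda>\<omega>. \<bar>J \<omega> * clamped b u \<omega>\<bar>))\<^sup>2 \<le> expectation (\<lambda>\<omega>. (J \<omega>)\<^sup>2) * (V + c\<^sup>2)" .
  qed
  have int: "integrable (lborel \<Otimes>\<^sub>M M) (\<lambda>(u, \<omega>). ?f u \<omega>)"
  proof (rule Fubini_integrable)
    show m: "(\<lambda>(u, \<omega>). ?f u \<omega>) \<in> borel_measurable (lborel \<Otimes>\<^sub>M M)" unfolding case_prod_unfold by measurable
    show "AE u in lborel. integrable M (\<lambda>\<omega>. case (u, \<omega>) of (u, \<omega>) \<Rightarrow> ?f u \<omega>)" using i by simp
    have "integrable lborel (\<lambda>u. indicator {a..b} u * C)" using integrable_indicator_Icc[of a b] by simp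
    then show "integrable lborel (\<lambda>u. \<integral>\<omega>. norm (case (u, \<omega>) of (u, \<omega>) \<Rightarrow> ?f u \<omega>) \<partial>M)"
    proof (rule Bochner_Integration.integrable_bound)
      have "(\<lambda>(u, \<omega>). norm (?f u \<omega>)) \<in> borel_measurable (lborel \<Otimes>\<^sub>M M)" unfolding case_prod_unfold by measurable
      then show "(\<lambda>u. \<integral>\<omega>. norm (case (u, \<omega>) of (u, \<omega>) \<Rightarrow> ?f u \<omega>) \<partial>M) \<in> borel_measurable lborel"
        using bml[of "\<lambda>u \<omega>. norm (?f u \<omega>)" lborel] by simp
      show "AE u in lborel. norm (\<integral>\<omega>. norm (case (u, \<omega>) of (u, \<omega>) \<Rightarrow> ?f u \<omega>) \<partial>M) \<le> norm (indicator {a..b} u * C)"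
      proof (rule AE_I2)
        fix u
        have "0 \<le> expectation (\<lambda>\<omega>. \<bar>J \<omega> * clamped b u \<omega>\<bar>)" by simp
        then show "norm (\<integral>\<omega>. norm (case (u, \<omega>) of (u, \<omega>) \<Rightarrow> ?f u \<omega>) \<partial>M) \<le> norm (indicator {a..b} u * C)"
          using le[of u] by (auto split: split_indicator)
      qed
    qed
  qed
  have "expectation (\<lambda>\<omega>. J \<omega> * integrated a b \<omega>) = (\<integral>\<omega>. (\<integral>u. ?f u \<omega> \<partial>lborel) \<partial>M)"
    by (simp add: integrated_clamped[OF ab(1) order_refl] set_lebesgue_integral_def mult.left_commute[of _ "J _"])
  also have "\<dots> = (\<integral>u. (\<integral>\<omega>. ?f u \<omega> \<partial>M) \<partial>lborel)"
    using Fubini_integral[of "\<lambda>u \<omega>. ?f u \<omega>"] int by simp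
  also have "\<dots> = (LBINT u:{a..b}. expectation (\<lambda>\<omega>. J \<omega> * clamped b u \<omega>))"
    by (simp add: set_lebesgue_integral_def)
  also have "\<dots> = (LBINT u:{a..b}. expectation (\<lambda>\<omega>. J \<omega> * X u \<omega>))"
    using ab by (intro set_lebesgue_integral_cong) (auto simp: clamped_def)
  finally show ?thesis .
qed

lemma integrated_mean:
  assumes "0 \<le> a" "a \<le> b"
  shows "expectation (integrated a b) = c * (b - a)"
  using integrated_product[OF square_integrable_const[of 1] assms] assms
  by (simp add: X_mean set_lebesgue_integral_def)

text \<open>\<open>integrated_product\<close> is used for each of the two integrals in turn. The
  bound |r| \<le> 1, which follows from 1 + x \<le> exp x, makes the inner integral bounded and
  hence integrable in the outer variable.\<close>

lemma integrated_covariance: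
  assumes ab: "0 \<le> a" "a \<le> b" and de: "0 \<le> d" "d \<le> e"
  shows "expectation (\<lambda>\<omega>. integrated a b \<omega> * integrated d e \<omega>) =
    V * (LBINT v:{d..e}. LBINT u:{a..b}. acf lam \<bar>u - v\<bar>) + (c * (b - a)) * (c * (e - d))"
proof -
  have "expectation (\<lambda>\<omega>. integrated a b \<omega> * X v \<omega>) = V * (LBINT u:{a..b}. acf lam \<bar>u - v\<bar>) + c\<^sup>2 * (b - a)" for v
  proof -
    have "expectation (\<lambda>\<omega>. integrated a b \<omega> * X v \<omega>) = expectation (\<lambda>\<omega>. X v \<omega> * integrated a b \<omega>)" by (simp add: mult.commute)
    also have "\<dots> = (LBINT u:{a..b}. V * acf lam \<bar>u - v\<bar> + c\<^sup>2)"
      using integrated_product[OF X_si ab, of v] by (simp add: X_product abs_minus_commute)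
    also have "\<dots> = (LBINT u:{a..b}. V * acf lam \<bar>u - v\<bar>) + (LBINT u:{a..b}. c\<^sup>2)"
      by (intro set_integral_add set_integrable_mult_right set_integrable_acf_abs set_integrable_const_Icc)
    finally show ?thesis using ab by (simp add: set_lebesgue_integral_def)
  qed
  then have "expectation (\<lambda>\<omega>. integrated a b \<omega> * integrated d e \<omega>) =
     (LBINT v:{d..e}. V * (LBINT u:{a..b}. acf lam \<bar>u - v\<bar>) + c\<^sup>2 * (b - a))"
    using integrated_product[OF integrated_square_integrable[OF ab] de] by simp
  also have "\<dots> = (LBINT v:{d..e}. V * (LBINT u:{a..b}. acf lam \<bar>u - v\<bar>)) + (LBINT v:{d..e}. c\<^sup>2 * (b - a))"
  proof (intro set_integral_add set_integrable_mult_right)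
    have [measurable]: "(\<lambda>z. acf lam \<bar>fst z - snd z\<bar>) \<in> borel_measurable (borel \<Otimes>\<^sub>M borel)"
      unfolding acf_def by measurable
    have m: "(\<lambda>v. LBINT u:{a..b}. acf lam \<bar>u - v\<bar>) \<in> borel_measurable lborel"
      unfolding set_lebesgue_integral_def
      by (rule lborel.borel_measurable_lebesgue_integral) (simp add: case_prod_unfold acf_def, measurable)
    have le: "\<bar>acf lam \<bar>u - v\<bar>\<bar> \<le> 1" for u v
    proof -
      have "1 + lam * \<bar>u - v\<bar> \<le> exp (lam * \<bar>u - v\<bar>)" by (rule exp_ge_add_one_self)
      then have "(1 + lam * \<bar>u - v\<bar>) * exp (- (lam * \<bar>u - v\<bar>)) \<le> exp (lam * \<bar>u - v\<bar>) * exp (- (lam * \<bar>u - v\<bar>))"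
        by (intro mult_right_mono) auto
      then have "acf lam \<bar>u - v\<bar> \<le> 1" by (simp add: acf_def exp_minus_inverse algebra_simps)
      moreover have "0 \<le> acf lam \<bar>u - v\<bar>" using lam by (simp add: acf_def)
      ultimately show ?thesis by simp
    qed
    have bnd: "\<bar>LBINT u:{a..b}. acf lam \<bar>u - v\<bar>\<bar> \<le> b - a" for v
    proof -
      have "\<bar>LBINT u:{a..b}. acf lam \<bar>u - v\<bar>\<bar> \<le> (LBINT u. \<bar>indicator {a..b} u *\<^sub>R acf lam \<bar>u - v\<bar>\<bar>)"
        unfolding set_lebesgue_integral_def by (rule integral_abs_bound)
      also have "\<dots> \<le> (LBINT u. indicator {a..b} u)"
        using le set_integrable_acf_abs[of a b lam v] ab
        by (intro integral_mono) (auto simp: set_integrable_def split: split_indicator)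
      finally show ?thesis using ab by simp
    qed
    show "set_integrable lborel {d..e} (\<lambda>v. LBINT u:{a..b}. acf lam \<bar>u - v\<bar>)"
      unfolding set_integrable_def
    proof (rule Bochner_Integration.integrable_bound[of lborel "\<lambda>v. indicator {d..e} v * (b - a)"])
      show "AE v in lborel. norm (indicator {d..e} v *\<^sub>R (LBINT u:{a..b}. acf lam \<bar>u - v\<bar>)) \<le> norm (indicator {d..e} v * (b - a))"
        using bnd ab by (auto split: split_indicator)
    qed (use m integrable_indicator_Icc[of d e] in auto)
  qed (rule set_integrable_const_Icc)
  finally show ?thesis using de by (simp add: set_lebesgue_integral_def power2_eq_square mult_ac)
qed

text \<open>Since X is nonnegative with constant mean, the expected integral of |X| is finite.
  Pathwise linearity of the time integral depends on this, as a non-integrable path would get the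
  value 0.\<close>

lemma X_set_integrable: "0 \<le> a \<Longrightarrow> a \<le> b \<Longrightarrow> AE \<omega> in M. set_integrable lborel {a..b} (\<lambda>u. X u \<omega>)"
proof -
  assume ab: "0 \<le> a" "a \<le> b"
  then have b: "0 \<le> b" by simp
  have cm[measurable]: "(\<lambda>z. clamped b (fst z) (snd z)) \<in> borel_measurable (borel \<Otimes>\<^sub>M M)"
    using clamped_measurable[OF b] by (simp add: case_prod_unfold)
  have D: "(\<lambda>(s, \<omega>). \<bar>clamped b s \<omega>\<bar>) \<in> borel_measurable (borel \<Otimes>\<^sub>M M)" unfolding case_prod_unfold by measurable
  have "(\<integral>\<^sup>+\<omega>. (\<integral>\<^sup>+s\<in>{a..b}. ennreal \<bar>clamped b s \<omega>\<bar> \<partial>lborel) \<partial>M) = (\<integral>\<^sup>+s\<in>{a..b}. (\<integral>\<^sup>+\<omega>. ennreal \<bar>clamped b s \<omega>\<bar> \<partial>M) \<partial>lborel)"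
    by (rule nn_integral_time_swap[OF D]) simp
  also have "\<dots> = (\<integral>\<^sup>+s\<in>{a..b}. ennreal c \<partial>lborel)"
  proof (intro nn_integral_cong arg_cong2[where f = "(*)"] refl)
    fix s
    have "AE \<omega> in M. \<bar>clamped b s \<omega>\<bar> = clamped b s \<omega>" using X_nonneg[of "max 0 (min b s)"] by (auto simp: clamped_def elim!: eventually_mono)
    then have "(\<integral>\<^sup>+\<omega>. ennreal \<bar>clamped b s \<omega>\<bar> \<partial>M) = (\<integral>\<^sup>+\<omega>. ennreal (clamped b s \<omega>) \<partial>M)"
      by (intro nn_integral_cong_AE) (auto elim!: eventually_mono)
    also have "\<dots> = ennreal c"
      unfolding clamped_def using X_nonneg X_mean square_integrable_imp_integrable[OF X_si]
      by (subst nn_integral_eq_integral) auto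
    finally show "(\<integral>\<^sup>+\<omega>. ennreal \<bar>clamped b s \<omega>\<bar> \<partial>M) = ennreal c" .
  qed
  also have "\<dots> < \<infinity>" using ab by (simp add: nn_integral_cmult_indicator ennreal_mult_less_top)
  finally have fin: "(\<integral>\<^sup>+\<omega>. (\<integral>\<^sup>+s\<in>{a..b}. ennreal \<bar>clamped b s \<omega>\<bar> \<partial>lborel) \<partial>M) < \<infinity>" .
  have "(\<lambda>(\<omega>, s). ennreal \<bar>clamped b s \<omega>\<bar> * indicator {a..b} s) \<in> borel_measurable (M \<Otimes>\<^sub>M lborel)"
    using measurable_pair_swap_iff[of "\<lambda>(\<omega>, s). ennreal \<bar>clamped b s \<omega>\<bar> * indicator {a..b} s" M lborel borel]
    by (simp add: case_prod_unfold)
  then have "(\<lambda>\<omega>. \<integral>\<^sup>+s\<in>{a..b}. ennreal \<bar>clamped b s \<omega>\<bar> \<partial>lborel) \<in> borel_measurable M"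
    by (rule lborel.borel_measurable_nn_integral)
  then have "AE \<omega> in M. (\<integral>\<^sup>+s\<in>{a..b}. ennreal \<bar>clamped b s \<omega>\<bar> \<partial>lborel) \<noteq> \<infinity>"
    using fin by (intro nn_integral_PInf_AE) auto
  then show ?thesis
  proof (rule AE_mp, intro AE_I2 impI)
    fix \<omega> assume \<omega>: "\<omega> \<in> space M" and ne: "(\<integral>\<^sup>+s\<in>{a..b}. ennreal \<bar>clamped b s \<omega>\<bar> \<partial>lborel) \<noteq> \<infinity>"
    have [measurable]: "(\<lambda>s. clamped b s \<omega>) \<in> borel_measurable borel" by (rule measurable_section[OF clamped_measurable[OF b] \<omega>])
    have "integrable lborel (\<lambda>s. indicator {a..b} s *\<^sub>R clamped b s \<omega>)"
    proof (rule integrableI_bounded)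
      have "(\<integral>\<^sup>+s. ennreal (norm (indicator {a..b} s *\<^sub>R clamped b s \<omega>)) \<partial>lborel) = (\<integral>\<^sup>+s\<in>{a..b}. ennreal \<bar>clamped b s \<omega>\<bar> \<partial>lborel)"
        by (intro nn_integral_cong) (auto split: split_indicator)
      then show "(\<integral>\<^sup>+s. ennreal (norm (indicator {a..b} s *\<^sub>R clamped b s \<omega>)) \<partial>lborel) < \<infinity>"
        using ne by (simp add: less_top)
    qed measurable
    also have "(\<lambda>s. indicator {a..b} s *\<^sub>R clamped b s \<omega>) = (\<lambda>s. indicator {a..b} s *\<^sub>R X s \<omega>)"
      using ab by (auto simp: clamped_def split: split_indicator)
    finally show "set_integrable lborel {a..b} (\<lambda>u. X u \<omega>)" by (simp add: set_integrable_def)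
  qed
qed

text \<open>The error is the time integral of \<open>X a - X s\<close>; Cauchy-Schwarz in time
  reduces it to the mean-square Lipschitz bound.\<close>

lemma left_endpoint_error:
  assumes ab: "0 \<le> a" "a \<le> b"
  shows "expectation (\<lambda>\<omega>. ((b - a) * X a \<omega> - integrated a b \<omega>)\<^sup>2) \<le> (b - a)\<^sup>2 * (2 * V * (lam * (b - a))\<^sup>2)"
proof -
  have b: "0 \<le> b" using ab by simp
  have [measurable]: "(\<lambda>z. clamped b (fst z) (snd z)) \<in> borel_measurable (borel \<Otimes>\<^sub>M M)"
    using clamped_measurable[OF b] by (simp add: case_prod_unfold)
  have D: "(\<lambda>(s, \<omega>). X a \<omega> - clamped b s \<omega>) \<in> borel_measurable (borel \<Otimes>\<^sub>M M)" unfolding case_prod_unfold by measurable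
  have si: "square_integrable M (\<lambda>\<omega>. (b - a) * X a \<omega> - integrated a b \<omega>)"
    by (intro square_integrable_diff square_integrable_scale X_si integrated_square_integrable ab)
  have "AE \<omega> in M. (b - a) * X a \<omega> - integrated a b \<omega> = (LBINT s:{a..b}. X a \<omega> - clamped b s \<omega>)"
    using X_set_integrable[OF ab]
  proof eventually_elim
    case (elim \<omega>)
    have "set_integrable lborel {a..b} (\<lambda>s. clamped b s \<omega>)"
      using elim set_integrable_cong[of lborel lborel "{a..b}" "{a..b}" "\<lambda>s. clamped b s \<omega>" "\<lambda>s. X s \<omega>"] ab by (auto simp: clamped_def)
    then have "(LBINT s:{a..b}. X a \<omega> - clamped b s \<omega>) = (LBINT s:{a..b}. X a \<omega>) - (LBINT s:{a..b}. clamped b s \<omega>)"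
      by (intro set_integral_diff set_integrable_const_Icc)
    then show ?case using ab by (simp add: integrated_clamped[OF ab(1) order_refl] set_lebesgue_integral_def)
  qed
  then have "(\<integral>\<^sup>+\<omega>. ennreal (((b - a) * X a \<omega> - integrated a b \<omega>)\<^sup>2) \<partial>M) = (\<integral>\<^sup>+\<omega>. ennreal ((LBINT s:{a..b}. X a \<omega> - clamped b s \<omega>)\<^sup>2) \<partial>M)"
    by (intro nn_integral_cong_AE) (auto elim!: eventually_mono)
  also have "\<dots> \<le> ennreal ((b - a)\<^sup>2 * (2 * V * (lam * (b - a))\<^sup>2))"
  proof (rule time_integral_second_moment[OF D ab(2)])
    fix s assume s: "a \<le> s" "s \<le> b"
    have "(\<integral>\<^sup>+\<omega>. ennreal ((X a \<omega> - clamped b s \<omega>)\<^sup>2) \<partial>M) = ennreal (expectation (\<lambda>\<omega>. (X a \<omega> - X s \<omega>)\<^sup>2))"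
      using s ab square_integrable_diff[OF X_si X_si] by (subst nn_integral_eq_integral[symmetric]) (auto simp: clamped_def square_integrable_def)
    also have "\<dots> \<le> ennreal (2 * V * (lam * (b - a))\<^sup>2)"
    proof (intro ennreal_leI order_trans[OF X_diff_second_moment])
      have "(lam * (s - a))\<^sup>2 \<le> (lam * (b - a))\<^sup>2" using s lam by (intro power_mono mult_left_mono) auto
      then have "(lam * (a - s))\<^sup>2 \<le> (lam * (b - a))\<^sup>2" by (simp add: power_mult_distrib power2_commute)
      then show "2 * V * (lam * (a - s))\<^sup>2 \<le> 2 * V * (lam * (b - a))\<^sup>2" using V_nonneg by (intro mult_left_mono) auto
    qed
    finally show "(\<integral>\<^sup>+\<omega>. ennreal ((X a \<omega> - clamped b s \<omega>)\<^sup>2) \<partial>M) \<le> ennreal (2 * V * (lam * (b - a))\<^sup>2)" .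
  qed (use V_nonneg in auto)
  finally have "enn2real (\<integral>\<^sup>+\<omega>. ennreal (((b - a) * X a \<omega> - integrated a b \<omega>)\<^sup>2) \<partial>M) \<le> (b - a)\<^sup>2 * (2 * V * (lam * (b - a))\<^sup>2)"
    using V_nonneg by (intro enn2real_leI) auto
  then show ?thesis using si by (subst integral_eq_nn_integral) (auto simp: square_integrable_def)
qed

end

section \<open>Squared returns\<close>

text \<open>One factor |sqrt x - sqrt y| is enlarged to sqrt x + sqrt y. Errors in the coefficients
  of the Ito sums are thereby expressed through differences of X itself, whose moments are
  known.\<close>

lemma sqrt_diff_square_le:
  fixes x y :: real
  assumes "0 \<le> x" "0 \<le> y"
  shows "(sqrt x - sqrt y)\<^sup>2 \<le> \<bar>x - y\<bar>"
proof -
  have e: "(sqrt x - sqrt y) * (sqrt x + sqrt y) = x - y" using assms by (simp add: algebra_simps)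
  have "(sqrt x - sqrt y)\<^sup>2 = \<bar>sqrt x - sqrt y\<bar> * \<bar>sqrt x - sqrt y\<bar>" by (simp add: power2_eq_square)
  also have "\<dots> \<le> \<bar>sqrt x - sqrt y\<bar> * \<bar>sqrt x + sqrt y\<bar>" using assms by (intro mult_left_mono) (auto simp: abs_le_iff)
  also have "\<dots> = \<bar>x - y\<bar>" using e by (simp only: abs_mult[symmetric])
  finally show ?thesis .
qed

context volatility
begin

text \<open>Passes from nonnegative integrals to genuine expectations. The square integrable
  majorant \<open>R\<close> of the sum of weighted squares guarantees that the fourth moment is
  finite.\<close>

lemma weighted_sum_moments:
  assumes m[measurable]: "\<And>i. i < K \<Longrightarrow> \<xi> i \<in> borel_measurable M"
    and path: "\<And>i. i < K \<Longrightarrow> \<exists>\<Phi>\<in>borel_measurable P. AE \<omega> in M. \<xi> i \<omega> = \<Phi> (p \<omega>)"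
    and t: "0 \<le> t 0" "\<And>i. i < K \<Longrightarrow> t i \<le> t (Suc i)"
    and R: "square_integrable M R" "AE \<omega> in M. (\<Sum>i<K. (\<xi> i \<omega>)\<^sup>2 * (t (Suc i) - t i)) \<le> R \<omega>"
  defines "S \<equiv> \<lambda>\<omega>. \<Sum>i<K. \<xi> i \<omega> * (W (t (Suc i)) \<omega> - W (t i) \<omega>)"
  shows "S \<in> borel_measurable M" "integrable M (\<lambda>\<omega>. S \<omega> ^ 4)"
    "expectation (\<lambda>\<omega>. S \<omega> ^ 4) = 3 * expectation (\<lambda>\<omega>. (\<Sum>i<K. (\<xi> i \<omega>)\<^sup>2 * (t (Suc i) - t i))\<^sup>2)"
    "expectation (\<lambda>\<omega>. (S \<omega>)\<^sup>2) = expectation (\<lambda>\<omega>. \<Sum>i<K. (\<xi> i \<omega>)\<^sup>2 * (t (Suc i) - t i))"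
    "(\<integral>\<^sup>+\<omega>. ennreal (S \<omega> ^ 4) \<partial>M) \<le> ennreal (3 * expectation (\<lambda>\<omega>. (R \<omega>)\<^sup>2))"
proof -
  let ?q = "\<lambda>\<omega>. \<Sum>i<K. (\<xi> i \<omega>)\<^sup>2 * (t (Suc i) - t i)"
  have tn: "0 \<le> t k" if "k \<le> K" for k using sum_measurable_F(1)[of t K "\<lambda>_ _. 0" k] t that by auto
  show Sm[measurable]: "S \<in> borel_measurable M"
    unfolding S_def using m tn by (intro borel_measurable_sum borel_measurable_times borel_measurable_diff W_M) auto
  have qm[measurable]: "?q \<in> borel_measurable M" using m by (intro borel_measurable_sum) auto
  have qn: "0 \<le> ?q \<omega>" for \<omega> using t by (intro sum_nonneg) auto
  have sq: "square_integrable M ?q"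
    unfolding square_integrable_def
  proof (intro conjI qm Bochner_Integration.integrable_bound[OF square_integrableD(2)[OF R(1)]])
    show "AE \<omega> in M. norm ((?q \<omega>)\<^sup>2) \<le> norm ((R \<omega>)\<^sup>2)"
      using R(2) by eventually_elim (use qn in \<open>auto intro!: power_mono\<close>)
  qed measurable
  have "(\<integral>\<^sup>+\<omega>. ennreal (S \<omega> ^ 4) \<partial>M) = (\<integral>\<^sup>+\<omega>. ennreal (3 * (?q \<omega>)\<^sup>2) \<partial>M)"
    unfolding S_def by (rule independent_sum_moments(1)[OF ind path t])
  also have "\<dots> = ennreal (3 * expectation (\<lambda>\<omega>. (?q \<omega>)\<^sup>2))"
    using sq by (subst nn_integral_eq_integral) (auto simp: square_integrable_def)
  finally have n4: "(\<integral>\<^sup>+\<omega>. ennreal (S \<omega> ^ 4) \<partial>M) = ennreal (3 * expectation (\<lambda>\<omega>. (?q \<omega>)\<^sup>2))" .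
  show i4: "integrable M (\<lambda>\<omega>. S \<omega> ^ 4)" by (rule integrableI_bounded) (auto simp: n4)
  have "0 \<le> expectation (\<lambda>\<omega>. (?q \<omega>)\<^sup>2)" by simp
  then show "expectation (\<lambda>\<omega>. S \<omega> ^ 4) = 3 * expectation (\<lambda>\<omega>. (?q \<omega>)\<^sup>2)"
    by (subst integral_eq_nn_integral) (auto simp: n4)
  have "(\<integral>\<^sup>+\<omega>. ennreal ((S \<omega>)\<^sup>2) \<partial>M) = (\<integral>\<^sup>+\<omega>. ennreal (?q \<omega>) \<partial>M)"
    unfolding S_def by (rule independent_sum_moments(2)[OF ind path t])
  also have "\<dots> = ennreal (expectation ?q)"
    using square_integrable_imp_integrable[OF sq] qn by (intro nn_integral_eq_integral) auto
  finally show "expectation (\<lambda>\<omega>. (S \<omega>)\<^sup>2) = expectation ?q"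
    using qn by (subst integral_eq_nn_integral) (auto intro!: integral_nonneg_AE)
  have "expectation (\<lambda>\<omega>. (?q \<omega>)\<^sup>2) \<le> expectation (\<lambda>\<omega>. (R \<omega>)\<^sup>2)"
  proof (rule integral_mono_AE)
    show "AE \<omega> in M. (?q \<omega>)\<^sup>2 \<le> (R \<omega>)\<^sup>2" using R(2) by eventually_elim (use qn in \<open>auto intro!: power_mono\<close>)
  qed (use sq R(1) in \<open>auto simp: square_integrable_def\<close>)
  then show "(\<integral>\<^sup>+\<omega>. ennreal (S \<omega> ^ 4) \<partial>M) \<le> ennreal (3 * expectation (\<lambda>\<omega>. (R \<omega>)\<^sup>2))"
    unfolding n4 by (intro ennreal_leI) simp
qed

section \<open>Dyadic approximation of one return and of its integrated volatility\<close>

context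
  fixes \<Delta> :: real
  assumes \<Delta>: "\<Delta> > 0"
begin

text \<open>Dyadic division of \<open>\<Delta>\<close>: the grids are nested, and every multiple of
  \<open>\<Delta>\<close> is a grid point at each level.\<close>

definition mesh :: "nat \<Rightarrow> real" where "mesh j = \<Delta> / 2 ^ j"

definition grid :: "nat \<Rightarrow> nat \<Rightarrow> real" where "grid j i = real i * mesh j"

definition incr :: "nat \<Rightarrow> nat \<Rightarrow> 'a \<Rightarrow> real" where "incr j i \<omega> = W (grid j (Suc i)) \<omega> - W (grid j i) \<omega>"

definition block :: "nat \<Rightarrow> nat \<Rightarrow> nat set" where "block j n = {(n - 1) * 2 ^ j..<n * 2 ^ j}"

text \<open>Setting the coefficient to 0 outside the block, instead of restricting the sum, places
  all periods over one index range, so that a linear combination of the approximations of two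
  periods is again a single weighted sum.\<close>

definition weight :: "nat \<Rightarrow> nat \<Rightarrow> nat \<Rightarrow> 'a \<Rightarrow> real" where
  "weight j n i \<omega> = (if i \<in> block j n then sqrt (X (grid j i) \<omega>) else 0)"

definition approx :: "nat \<Rightarrow> nat \<Rightarrow> 'a \<Rightarrow> real" where
  "approx n j \<omega> = (\<Sum>i<n * 2 ^ j. weight j n i \<omega> * incr j i \<omega>)"

text \<open>Plays two roles: almost surely it is the sum of weighted squares belonging to
  \<open>approx n j\<close>, and it is the Riemann sum for the integrated volatility of the n-th
  period.\<close>

definition riemann :: "nat \<Rightarrow> nat \<Rightarrow> 'a \<Rightarrow> real" where
  "riemann n j \<omega> = (\<Sum>i\<in>block j n. X (grid j i) \<omega> * mesh j)"

lemma mesh_pos: "0 < mesh j" using \<Delta> by (simp add: mesh_def)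

lemma grid_simps: "grid j 0 = 0" "grid j (Suc i) - grid j i = mesh j" "grid j i \<le> grid j (Suc i)" "0 \<le> grid j i"
  "grid j (n * 2 ^ j) = real n * \<Delta>"
proof -
  show "grid j (Suc i) - grid j i = mesh j" by (simp add: grid_def algebra_simps)
  then show "grid j i \<le> grid j (Suc i)" using mesh_pos[of j] by linarith
  show "0 \<le> grid j i" using mesh_pos[of j] by (simp add: grid_def)
  show "grid j (n * 2 ^ j) = real n * \<Delta>" by (simp add: grid_def mesh_def)
qed (simp add: grid_def)

lemma block_facts: "finite (block j n)" "1 \<le> n \<Longrightarrow> card (block j n) = 2 ^ j" "n * 2 ^ j \<le> K \<Longrightarrow> block j n \<subseteq> {..<K}"
  "1 \<le> n \<Longrightarrow> n < m \<Longrightarrow> block j n \<inter> block j m = {}"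
proof -
  show "finite (block j n)" by (simp add: block_def)
  show "card (block j n) = 2 ^ j" if "1 \<le> n"
    using that by (simp add: block_def diff_mult_distrib[symmetric])
  show "block j n \<subseteq> {..<K}" if "n * 2 ^ j \<le> K" using that by (auto simp: block_def)
  show "block j n \<inter> block j m = {}" if "1 \<le> n" "n < m"
  proof -
    have "n * 2 ^ j \<le> (m - 1) * 2 ^ j" using that by (intro mult_le_mono1) simp
    then show ?thesis by (auto simp: block_def)
  qed
qed

lemma weight_measurable [measurable]: "weight j n i \<in> borel_measurable M"
  unfolding weight_def[abs_def] by measurable

lemma sqrt_path: "\<exists>\<Phi>\<in>borel_measurable P. AE \<omega> in M. sqrt (X t \<omega>) = \<Phi> (p \<omega>)"
proof -
  obtain \<Phi> where \<Phi>: "\<Phi> \<in> borel_measurable P" "AE \<omega> in M. X t \<omega> = \<Phi> (p \<omega>)" using X_path by blast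
  show ?thesis using \<Phi> by (intro bexI[of _ "\<lambda>x. sqrt (\<Phi> x)"]) (auto elim!: eventually_mono)
qed

lemma weight_path: "\<exists>\<Phi>\<in>borel_measurable P. AE \<omega> in M. weight j n i \<omega> = \<Phi> (p \<omega>)"
proof (cases "i \<in> block j n")
  case True
  then show ?thesis using sqrt_path[of "grid j i"] by (simp add: weight_def)
next
  case False
  then show ?thesis by (intro bexI[of _ "\<lambda>_. 0"]) (auto simp: weight_def)
qed

lemma path_linear:
  assumes "\<exists>\<Phi>\<in>borel_measurable P. AE \<omega> in M. f \<omega> = (\<Phi> (p \<omega>) :: real)" "\<exists>\<Phi>\<in>borel_measurable P. AE \<omega> in M. g \<omega> = \<Phi> (p \<omega>)"
  shows "\<exists>\<Phi>\<in>borel_measurable P. AE \<omega> in M. f \<omega> + k * g \<omega> = \<Phi> (p \<omega>)"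
proof -
  obtain \<Phi> \<Psi> where "\<Phi> \<in> borel_measurable P" "\<Psi> \<in> borel_measurable P" "AE \<omega> in M. f \<omega> = \<Phi> (p \<omega>)" "AE \<omega> in M. g \<omega> = \<Psi> (p \<omega>)"
    using assms by blast
  then show ?thesis by (intro bexI[of _ "\<lambda>x. \<Phi> x + k * \<Psi> x"]) (auto elim!: eventually_elim2)
qed

lemma X_all_nonneg: "AE \<omega> in M. \<forall>i. 0 \<le> X (grid j i) \<omega>"
  using X_nonneg by (simp add: AE_all_countable)

lemma riemann_square_integrable: "square_integrable M (riemann n j)"
  unfolding riemann_def[abs_def] mult.commute[of _ "mesh j"] by (intro square_integrable_sum square_integrable_scale X_si)

text \<open>Almost surely only, because \<open>(sqrt x)\<^sup>2 = x\<close> needs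
  \<open>x \<ge> 0\<close>.\<close>

lemma weight_square_sum:
  assumes K: "n * 2 ^ j \<le> K"
  shows "AE \<omega> in M. (\<Sum>i<K. (weight j n i \<omega>)\<^sup>2 * (grid j (Suc i) - grid j i)) = riemann n j \<omega>"
  using X_all_nonneg[of j]
proof eventually_elim
  case (elim \<omega>)
  have "(\<Sum>i<K. (weight j n i \<omega>)\<^sup>2 * (grid j (Suc i) - grid j i)) = (\<Sum>i\<in>block j n. (weight j n i \<omega>)\<^sup>2 * (grid j (Suc i) - grid j i))"
    using block_facts(3)[OF K] by (intro sum.mono_neutral_right) (auto simp: weight_def)
  also have "\<dots> = riemann n j \<omega>"
    unfolding riemann_def using elim by (intro sum.cong) (auto simp: weight_def grid_simps)
  finally show ?case .
qed

lemma approx_extend: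
  assumes "n * 2 ^ j \<le> K"
  shows "approx n j \<omega> = (\<Sum>i<K. weight j n i \<omega> * (W (grid j (Suc i)) \<omega> - W (grid j i) \<omega>))"
  unfolding approx_def incr_def using assms block_facts(3)[of n j "n * 2 ^ j"]
  by (intro sum.mono_neutral_left) (auto simp: weight_def)

lemma approx_moments:
  shows "approx n j \<in> borel_measurable M" "integrable M (\<lambda>\<omega>. approx n j \<omega> ^ 4)"
    "expectation (\<lambda>\<omega>. approx n j \<omega> ^ 4) = 3 * expectation (\<lambda>\<omega>. (riemann n j \<omega>)\<^sup>2)"
    "expectation (\<lambda>\<omega>. (approx n j \<omega>)\<^sup>2) = expectation (riemann n j)"
proof -
  have R: "AE \<omega> in M. (\<Sum>i<n * 2 ^ j. (weight j n i \<omega>)\<^sup>2 * (grid j (Suc i) - grid j i)) \<le> riemann n j \<omega>"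
    using weight_square_sum[of n j "n * 2 ^ j", OF order_refl] by eventually_elim simp
  note m = weighted_sum_moments[where t = "grid j" and K = "n * 2 ^ j" and \<xi> = "weight j n" and R = "riemann n j",
      OF weight_measurable weight_path grid_simps(4) grid_simps(3) riemann_square_integrable R]
  have e: "approx n j = (\<lambda>\<omega>. \<Sum>i<n * 2 ^ j. weight j n i \<omega> * (W (grid j (Suc i)) \<omega> - W (grid j i) \<omega>))"
    using approx_extend[OF order_refl] by auto
  show "approx n j \<in> borel_measurable M" "integrable M (\<lambda>\<omega>. approx n j \<omega> ^ 4)" unfolding e using m(1,2) by auto
  have [measurable]: "riemann n j \<in> borel_measurable M" using riemann_square_integrable by (simp add: square_integrable_def)
  have [measurable]: "(\<lambda>\<omega>. \<Sum>i<n * 2 ^ j. (weight j n i \<omega>)\<^sup>2 * (grid j (Suc i) - grid j i)) \<in> borel_measurable M" by measurable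
  show "expectation (\<lambda>\<omega>. approx n j \<omega> ^ 4) = 3 * expectation (\<lambda>\<omega>. (riemann n j \<omega>)\<^sup>2)"
    unfolding e m(3) using weight_square_sum[of n j "n * 2 ^ j", OF order_refl]
    by (intro arg_cong2[where f = "(*)"] refl integral_cong_AE) (auto elim!: eventually_mono)
  show "expectation (\<lambda>\<omega>. (approx n j \<omega>)\<^sup>2) = expectation (riemann n j)"
    unfolding e m(4) using weight_square_sum[of n j "n * 2 ^ j", OF order_refl] by (intro integral_cong_AE) auto
qed

text \<open>Polarization: \<open>12 a\<^sup>2 b\<^sup>2 = (a + b)^4 + (a - b)^4 - 2 a^4 - 2 b^4\<close>.\<close>

lemma approx_cross_moment:
  assumes nm: "1 \<le> n" "n < m"
  shows "expectation (\<lambda>\<omega>. (approx n j \<omega>)\<^sup>2 * (approx m j \<omega>)\<^sup>2) = expectation (\<lambda>\<omega>. riemann n j \<omega> * riemann m j \<omega>)"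
proof -
  let ?K = "m * 2 ^ j" and ?a = "approx n j" and ?b = "approx m j" and ?Q = "riemann n j" and ?R = "riemann m j"
  have K: "n * 2 ^ j \<le> ?K" using nm by simp
  have QR: "square_integrable M (\<lambda>\<omega>. ?Q \<omega> + ?R \<omega>)" by (intro square_integrable_add riemann_square_integrable)
  have iQ: "integrable M (\<lambda>\<omega>. (?Q \<omega>)\<^sup>2)" "integrable M (\<lambda>\<omega>. (?R \<omega>)\<^sup>2)" "integrable M (\<lambda>\<omega>. ?Q \<omega> * ?R \<omega>)"
    using riemann_square_integrable by (auto intro: square_integrable_mult square_integrableD)
  have [measurable]: "?Q \<in> borel_measurable M" "?R \<in> borel_measurable M" using riemann_square_integrable by (auto simp: square_integrable_def)
  \<comment> \<open>Used with \<open>k = 1\<close> and \<open>k = -1\<close>. The blocks are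
    disjoint, so no index carries both weights, and for either sign the sum of weighted squares is
    \<open>?Q + ?R\<close>.\<close>
  have pm: "integrable M (\<lambda>\<omega>. (?a \<omega> + k * ?b \<omega>) ^ 4)"
    "expectation (\<lambda>\<omega>. (?a \<omega> + k * ?b \<omega>) ^ 4) = 3 * expectation (\<lambda>\<omega>. (?Q \<omega> + ?R \<omega>)\<^sup>2)" if k: "k\<^sup>2 = 1" for k
  proof -
    let ?\<xi> = "\<lambda>i \<omega>. weight j n i \<omega> + k * weight j m i \<omega>"
    have "i \<notin> block j n \<or> i \<notin> block j m" for i using block_facts(4)[OF nm, of j] by blast
    then have sq: "(?\<xi> i \<omega>)\<^sup>2 = (weight j n i \<omega>)\<^sup>2 + (weight j m i \<omega>)\<^sup>2" for i \<omega>
      using k by (auto simp: weight_def power_mult_distrib)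
    have q: "AE \<omega> in M. (\<Sum>i<?K. (?\<xi> i \<omega>)\<^sup>2 * (grid j (Suc i) - grid j i)) = ?Q \<omega> + ?R \<omega>"
      using weight_square_sum[OF K] weight_square_sum[of m j ?K, OF order_refl]
      by eventually_elim (simp add: sq distrib_right sum.distrib)
    then have q': "AE \<omega> in M. (\<Sum>i<?K. (?\<xi> i \<omega>)\<^sup>2 * (grid j (Suc i) - grid j i)) \<le> ?Q \<omega> + ?R \<omega>" by eventually_elim simp
    have me: "?\<xi> i \<in> borel_measurable M" for i by measurable
    have e: "?a \<omega> + k * ?b \<omega> = (\<Sum>i<?K. ?\<xi> i \<omega> * (W (grid j (Suc i)) \<omega> - W (grid j i) \<omega>))" for \<omega>
      unfolding approx_extend[OF K] approx_extend[of m j ?K, OF order_refl]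
      by (simp add: sum_distrib_left sum.distrib distrib_right mult.assoc)
    note mm = weighted_sum_moments[where t = "grid j" and K = ?K and \<xi> = ?\<xi>, OF me path_linear[OF weight_path weight_path]
        grid_simps(4) grid_simps(3) QR q']
    show "integrable M (\<lambda>\<omega>. (?a \<omega> + k * ?b \<omega>) ^ 4)" unfolding e by (rule mm(2))
    have [measurable]: "(\<lambda>\<omega>. \<Sum>i<?K. (?\<xi> i \<omega>)\<^sup>2 * (grid j (Suc i) - grid j i)) \<in> borel_measurable M" by measurable
    show "expectation (\<lambda>\<omega>. (?a \<omega> + k * ?b \<omega>) ^ 4) = 3 * expectation (\<lambda>\<omega>. (?Q \<omega> + ?R \<omega>)\<^sup>2)"
      unfolding e mm(3) using q
      by (intro arg_cong2[where f = "(*)"] refl integral_cong_AE) (auto elim!: eventually_mono)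
  qed
  have pol: "x\<^sup>2 * y\<^sup>2 = ((x + 1 * y) ^ 4 + (x + (-1) * y) ^ 4 - 2 * x ^ 4 - 2 * y ^ 4) / 12" for x y :: real
    by (simp add: power2_eq_square power4_eq_xxxx algebra_simps)
  have "expectation (\<lambda>\<omega>. (?a \<omega>)\<^sup>2 * (?b \<omega>)\<^sup>2) =
     (expectation (\<lambda>\<omega>. (?a \<omega> + 1 * ?b \<omega>) ^ 4) + expectation (\<lambda>\<omega>. (?a \<omega> + (-1) * ?b \<omega>) ^ 4) - 2 * expectation (\<lambda>\<omega>. ?a \<omega> ^ 4) - 2 * expectation (\<lambda>\<omega>. ?b \<omega> ^ 4)) / 12"
    unfolding pol using pm(1)[of 1] pm(1)[of "-1"] approx_moments(2)[of n j] approx_moments(2)[of m j]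
    by (simp del: mult_minus1 mult_1 mult_1_left)
  also have "\<dots> = (6 * expectation (\<lambda>\<omega>. (?Q \<omega> + ?R \<omega>)\<^sup>2) - 6 * expectation (\<lambda>\<omega>. (?Q \<omega>)\<^sup>2) - 6 * expectation (\<lambda>\<omega>. (?R \<omega>)\<^sup>2)) / 12"
    using pm(2)[of 1] pm(2)[of "-1"] approx_moments(3)[of n j] approx_moments(3)[of m j] by simp
  also have "expectation (\<lambda>\<omega>. (?Q \<omega> + ?R \<omega>)\<^sup>2) = expectation (\<lambda>\<omega>. (?Q \<omega>)\<^sup>2 + (?R \<omega>)\<^sup>2 + 2 * (?Q \<omega> * ?R \<omega>))"
    by (simp add: power2_sum mult.assoc)
  also have "\<dots> = expectation (\<lambda>\<omega>. (?Q \<omega>)\<^sup>2) + expectation (\<lambda>\<omega>. (?R \<omega>)\<^sup>2) + 2 * expectation (\<lambda>\<omega>. ?Q \<omega> * ?R \<omega>)"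
    using iQ by simp
  finally show ?thesis by simp
qed

section \<open>Convergence of the dyadic approximations\<close>

lemma mesh_tendsto: "mesh \<longlonglongrightarrow> 0"
proof -
  have "(\<lambda>j. \<Delta> * (1/2) ^ j) \<longlonglongrightarrow> \<Delta> * 0" by (intro tendsto_mult tendsto_const LIMSEQ_power_zero) simp
  then show ?thesis by (simp add: mesh_def[abs_def] power_divide)
qed

lemma card_mesh: "real (2 ^ j) * mesh j = \<Delta>"
  by (simp add: mesh_def)

lemma refinement_factor:
  assumes "j \<le> l"
  shows "(0::nat) < 2 ^ (l - j)" "(2::nat) ^ l = 2 ^ j * 2 ^ (l - j)" "real (2 ^ (l - j)) * mesh l = mesh j"
proof -
  show e: "(2::nat) ^ l = 2 ^ j * 2 ^ (l - j)" using assms by (simp add: power_add[symmetric])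
  have "(2::real) ^ l = 2 ^ j * 2 ^ (l - j)" using assms by (simp add: power_add[symmetric])
  then show "real (2 ^ (l - j)) * mesh l = mesh j" by (simp add: mesh_def)
qed simp

lemma integrated_blocks:
  assumes "set_integrable lborel {0..grid j N} (\<lambda>u. X u \<omega>)" "m0 \<le> m" "m \<le> N"
  shows "integrated (grid j m0) (grid j m) \<omega> = (\<Sum>i\<in>{m0..<m}. integrated (grid j i) (grid j (Suc i)) \<omega>)"
  using assms(2,3)
proof (induction m rule: dec_induct)
  case base
  have "integrated (grid j m0) (grid j m0) \<omega> = 0"
    unfolding integrated_def set_lebesgue_integral_def
    by (rule integral_eq_zero_AE) (use AE_lborel_singleton[of "grid j m0"] in \<open>auto elim!: eventually_mono\<close>)
  then show ?case by simp
next
  case (step m)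
  have mono: "grid j i \<le> grid j i'" if "i \<le> i'" for i i'
    using that mesh_pos[of j] by (simp add: grid_def mult_right_mono)
  let ?a = "grid j m0" and ?b = "grid j m" and ?c = "grid j (Suc m)"
  have abc: "?a \<le> ?b" "?b \<le> ?c" "0 \<le> ?a" "?c \<le> grid j N"
    using step by (auto intro!: mono grid_simps)
  have si: "set_integrable lborel A (\<lambda>u. X u \<omega>)" if "A \<subseteq> {?a..?c}" "A \<in> sets borel" for A
    by (rule set_integrable_subset[OF assms(1)]) (use that abc in auto)
  have "integrated ?a ?c \<omega> = (LBINT u:{?a..?b} \<union> {?b<..?c}. X u \<omega>)"
    using abc by (simp add: integrated_def ivl_disj_un)
  also have "\<dots> = integrated ?a ?b \<omega> + (LBINT u:{?b<..?c}. X u \<omega>)"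
    unfolding integrated_def using abc by (intro set_integral_Un si) auto
  also have "(LBINT u:{?b<..?c}. X u \<omega>) = integrated ?b ?c \<omega>"
    unfolding integrated_def
  proof (rule set_integral_cong_set)
    show "AE x in lborel. (x \<in> {?b..?c}) = (x \<in> {?b<..?c})"
      using AE_lborel_singleton[of ?b] by eventually_elim auto
    have "set_integrable lborel {?b..?c} (\<lambda>u. X u \<omega>)" "set_integrable lborel {?b<..?c} (\<lambda>u. X u \<omega>)" using abc by (auto intro!: si)
    then show "set_borel_measurable lborel {?b..?c} (\<lambda>u. X u \<omega>)" "set_borel_measurable lborel {?b<..?c} (\<lambda>u. X u \<omega>)"
      by (auto simp: set_integrable_def set_borel_measurable_def)
  qed
  finally show ?case using step by simp
qed

text \<open>The error is a sum of \<open>2 ^ j\<close> cell errors. The square of the sum costs a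
  factor \<open>2 ^ j\<close> and summation over the cells another one; with the squared mesh they
  combine to \<open>\<Delta>\<^sup>2\<close>, and the squared mesh in the Lipschitz bound is left to
  tend to 0.\<close>

lemma riemann_l2:
  assumes n: "1 \<le> n"
  shows "l2_tendsto M (riemann n) (integrated ((real n - 1) * \<Delta>) (real n * \<Delta>))"
proof -
  let ?I = "integrated ((real n - 1) * \<Delta>) (real n * \<Delta>)"
  have n0: "0 \<le> (real n - 1) * \<Delta>" "(real n - 1) * \<Delta> \<le> real n * \<Delta>" using n \<Delta> by auto
  have sI: "square_integrable M ?I" by (rule integrated_square_integrable[OF n0])
  define d where "d j i \<omega> = mesh j * X (grid j i) \<omega> - integrated (grid j i) (grid j (Suc i)) \<omega>" for j i \<omega>
  have split: "AE \<omega> in M. riemann n j \<omega> - ?I \<omega> = (\<Sum>i\<in>block j n. d j i \<omega>)" for j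
  proof -
    have "AE \<omega> in M. set_integrable lborel {0..grid j (n * 2 ^ j)} (\<lambda>u. X u \<omega>)"
      by (intro X_set_integrable grid_simps order_refl)
    then show ?thesis
    proof eventually_elim
      case (elim \<omega>)
      have rn: "real (n - 1) = real n - 1" using n by (simp add: of_nat_diff)
      have le: "(n - 1) * 2 ^ j \<le> n * 2 ^ j" by (intro mult_le_mono1) simp
      have "?I \<omega> = (\<Sum>i\<in>block j n. integrated (grid j i) (grid j (Suc i)) \<omega>)"
        by (rule integrated_blocks[OF elim le order_refl, unfolded grid_simps(5) rn, folded block_def])
      then show ?case by (simp add: riemann_def d_def sum_subtractf mult.commute)
    qed
  qed
  have bound: "expectation (\<lambda>\<omega>. (riemann n j \<omega> - ?I \<omega>)\<^sup>2) \<le> \<Delta>\<^sup>2 * (2 * V * (lam * mesh j)\<^sup>2)" for j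
  proof -
    have sd: "square_integrable M (d j i)" for i
      unfolding d_def[abs_def] by (intro square_integrable_diff square_integrable_scale X_si integrated_square_integrable grid_simps)
    have "expectation (\<lambda>\<omega>. (riemann n j \<omega> - ?I \<omega>)\<^sup>2) = expectation (\<lambda>\<omega>. (\<Sum>i\<in>block j n. d j i \<omega>)\<^sup>2)"
    proof (rule integral_cong_AE)
      have [measurable]: "riemann n j \<in> borel_measurable M" "?I \<in> borel_measurable M" "\<And>i. d j i \<in> borel_measurable M"
        using riemann_square_integrable sI sd by (auto simp: square_integrable_def)
      show "(\<lambda>\<omega>. (riemann n j \<omega> - ?I \<omega>)\<^sup>2) \<in> borel_measurable M" "(\<lambda>\<omega>. (\<Sum>i\<in>block j n. d j i \<omega>)\<^sup>2) \<in> borel_measurable M" by measurable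
    qed (use split[of j] in \<open>auto elim!: eventually_mono\<close>)
    also have "\<dots> \<le> expectation (\<lambda>\<omega>. (\<Sum>i\<in>block j n. (d j i \<omega>)\<^sup>2) * real (2 ^ j))"
    proof (rule integral_mono)
      show "integrable M (\<lambda>\<omega>. (\<Sum>i\<in>block j n. d j i \<omega>)\<^sup>2)" by (intro square_integrableD(2) square_integrable_sum sd)
      show "integrable M (\<lambda>\<omega>. (\<Sum>i\<in>block j n. (d j i \<omega>)\<^sup>2) * real (2 ^ j))"
        by (intro integrable_mult_left Bochner_Integration.integrable_sum square_integrableD(2) sd)
      fix \<omega> show "(\<Sum>i\<in>block j n. d j i \<omega>)\<^sup>2 \<le> (\<Sum>i\<in>block j n. (d j i \<omega>)\<^sup>2) * real (2 ^ j)"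
        using sum_squared_le_sum_of_squares[of "\<lambda>i. d j i \<omega>" "block j n"] block_facts(2)[OF n, of j] by simp
    qed
    also have "\<dots> = (\<Sum>i\<in>block j n. expectation (\<lambda>\<omega>. (d j i \<omega>)\<^sup>2)) * real (2 ^ j)"
      using square_integrableD(2)[OF sd] by simp
    also have "\<dots> \<le> (\<Sum>i\<in>block j n. (mesh j)\<^sup>2 * (2 * V * (lam * mesh j)\<^sup>2)) * real (2 ^ j)"
    proof (intro mult_right_mono sum_mono)
      fix i show "expectation (\<lambda>\<omega>. (d j i \<omega>)\<^sup>2) \<le> (mesh j)\<^sup>2 * (2 * V * (lam * mesh j)\<^sup>2)"
        using left_endpoint_error[OF grid_simps(4) grid_simps(3), of j i] by (simp add: d_def grid_simps(2))
    qed simp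
    also have "\<dots> = (real (2 ^ j) * mesh j)\<^sup>2 * (2 * V * (lam * mesh j)\<^sup>2)"
      using block_facts(2)[OF n, of j] by (simp add: power2_eq_square)
    finally show ?thesis unfolding card_mesh .
  qed
  have "(\<lambda>j. expectation (\<lambda>\<omega>. (riemann n j \<omega> - ?I \<omega>)\<^sup>2)) \<longlonglongrightarrow> 0"
  proof (rule tendsto_sandwich[OF _ _ tendsto_const])
    have "(\<lambda>j. \<Delta>\<^sup>2 * (2 * V * (lam * mesh j)\<^sup>2)) \<longlonglongrightarrow> \<Delta>\<^sup>2 * (2 * V * (lam * 0)\<^sup>2)"
      by (intro tendsto_intros mesh_tendsto)
    then show "(\<lambda>j. \<Delta>\<^sup>2 * (2 * V * (lam * mesh j)\<^sup>2)) \<longlonglongrightarrow> 0" by simp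
  qed (use bound in auto)
  then show ?thesis using riemann_square_integrable sI by (simp add: l2_tendsto_def)
qed

text \<open>Cell \<open>i\<close> of the finer grid lies in cell \<open>i div k\<close> of the
  coarser one, and the fine Brownian increments telescope to the coarse increment.\<close>

lemma approx_refine:
  assumes jl: "j \<le> l"
  defines "k \<equiv> 2 ^ (l - j)"
  shows "approx n j \<omega> = (\<Sum>i<n * 2 ^ l. weight j n (i div k) \<omega> * incr l i \<omega>)"
proof -
  have k: "0 < k" "2 ^ l = 2 ^ j * k" "real k * mesh l = mesh j"
    using refinement_factor[OF jl] by (simp_all add: k_def)
  have gr: "grid l (m * k) = grid j m" for m using k(3) by (simp add: grid_def mult.assoc)
  have tele: "(\<Sum>i\<in>{m * k..<m * k + k}. incr l i \<omega>) = incr j m \<omega>" for m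
    unfolding incr_def using sum_Suc_diff'[of "m * k" "m * k + k" "\<lambda>i. W (grid l i) \<omega>"] gr[of m] gr[of "Suc m"]
    by (simp add: add.commute)
  have "(\<Sum>i<n * 2 ^ l. weight j n (i div k) \<omega> * incr l i \<omega>) = (\<Sum>i<(n * 2 ^ j) * k. weight j n (i div k) \<omega> * incr l i \<omega>)"
    by (simp add: k(2) mult.assoc)
  also have "\<dots> = (\<Sum>m<n * 2 ^ j. \<Sum>i\<in>{m * k..<m * k + k}. weight j n (i div k) \<omega> * incr l i \<omega>)"
    by (rule sum.nat_group[symmetric])
  also have "\<dots> = (\<Sum>m<n * 2 ^ j. \<Sum>i\<in>{m * k..<m * k + k}. weight j n m \<omega> * incr l i \<omega>)"
  proof (intro sum.cong refl)
    fix m i assume "i \<in> {m * k..<m * k + k}"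
    then have "i div k = m" using k(1) by (intro div_nat_eqI) (auto simp: mult.commute)
    then show "weight j n (i div k) \<omega> * incr l i \<omega> = weight j n m \<omega> * incr l i \<omega>" by simp
  qed
  also have "\<dots> = approx n j \<omega>" by (simp add: sum_distrib_left[symmetric] tele approx_def)
  finally show ?thesis by simp
qed

text \<open>On the finer grid the difference has coefficients sqrt X(coarse) - sqrt X(fine). Their
  squares are at most |X(coarse) - X(fine)|, so the fourth moment is bounded by 3 times the second
  moment of the sum \<open>R\<close>, which the mean-square Lipschitz bound controls.\<close>

lemma approx_Cauchy_le:
  assumes n: "1 \<le> n" and jl: "j \<le> l"
  shows "(\<integral>\<^sup>+\<omega>. ennreal ((approx n j \<omega> - approx n l \<omega>) ^ 4) \<partial>M) \<le> ennreal (3 * (\<Delta>\<^sup>2 * (2 * V * (lam * mesh j)\<^sup>2)))"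
proof -
  define k :: nat where "k = 2 ^ (l - j)"
  have k: "0 < k" "2 ^ l = 2 ^ j * k" "real k * mesh l = mesh j"
    using refinement_factor[OF jl] by (simp_all add: k_def)
  let ?K = "n * 2 ^ l"
  let ?\<xi> = "\<lambda>i \<omega>. weight j n (i div k) \<omega> + (-1) * weight l n i \<omega>"
  let ?D = "\<lambda>i \<omega>. X (grid j (i div k)) \<omega> - X (grid l i) \<omega>"
  define R where "R \<omega> = (\<Sum>i\<in>block l n. mesh l * \<bar>?D i \<omega>\<bar>)" for \<omega>
  have sD: "square_integrable M (?D i)" for i by (intro square_integrable_diff X_si)
  have sR: "square_integrable M R"
    unfolding R_def[abs_def]
  proof (intro square_integrable_sum square_integrable_scale)
    fix i show "square_integrable M (\<lambda>\<omega>. \<bar>?D i \<omega>\<bar>)" using sD[of i] by (simp add: square_integrable_def)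
  qed
  \<comment> \<open>The two weights vanish on the same indices, so every nonzero coefficient is a
    difference of two square roots and never a single one.\<close>
  have blk: "i div k \<in> block j n \<longleftrightarrow> i \<in> block l n" for i
  proof -
    have "(n - 1) * 2 ^ j \<le> i div k \<longleftrightarrow> (n - 1) * 2 ^ l \<le> i"
      using k(1) by (simp add: k(2) less_eq_div_iff_mult_less_eq mult.assoc)
    moreover have "i div k < n * 2 ^ j \<longleftrightarrow> i < n * 2 ^ l"
      using k(1) by (simp add: k(2) div_less_iff_less_mult mult.assoc)
    ultimately show ?thesis by (simp add: block_def)
  qed
  have "AE \<omega> in M. (\<Sum>i<?K. (?\<xi> i \<omega>)\<^sup>2 * (grid l (Suc i) - grid l i)) \<le> R \<omega>"
    using X_all_nonneg[of j] X_all_nonneg[of l]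
  proof eventually_elim
    case (elim \<omega>)
    have "(\<Sum>i<?K. (?\<xi> i \<omega>)\<^sup>2 * (grid l (Suc i) - grid l i)) = (\<Sum>i\<in>block l n. (?\<xi> i \<omega>)\<^sup>2 * (grid l (Suc i) - grid l i))"
      using block_facts(3)[of n l ?K] by (intro sum.mono_neutral_right) (auto simp: weight_def blk)
    also have "\<dots> \<le> R \<omega>"
      unfolding R_def
    proof (rule sum_mono)
      fix i assume i: "i \<in> block l n"
      have "(?\<xi> i \<omega>)\<^sup>2 \<le> \<bar>?D i \<omega>\<bar>"
        using i blk[of i] sqrt_diff_square_le[of "X (grid j (i div k)) \<omega>" "X (grid l i) \<omega>"] elim by (simp add: weight_def)
      then show "(?\<xi> i \<omega>)\<^sup>2 * (grid l (Suc i) - grid l i) \<le> mesh l * \<bar>?D i \<omega>\<bar>"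
        using mesh_pos[of l] by (simp add: grid_simps(2) mult.commute[of "mesh l"] mult_right_mono)
    qed
    finally show ?case .
  qed
  note mm = weighted_sum_moments(5)[where t = "grid l" and K = ?K and \<xi> = ?\<xi>, OF _ path_linear[OF weight_path weight_path]
        grid_simps(4) grid_simps(3) sR this]
  have "approx n j \<omega> - approx n l \<omega> = (\<Sum>i<?K. ?\<xi> i \<omega> * (W (grid l (Suc i)) \<omega> - W (grid l i) \<omega>))" for \<omega>
    unfolding approx_refine[OF jl, folded k_def] approx_def[of n l] incr_def
    by (simp add: sum_subtractf[symmetric] left_diff_distrib)
  then have "(\<integral>\<^sup>+\<omega>. ennreal ((approx n j \<omega> - approx n l \<omega>) ^ 4) \<partial>M) \<le> ennreal (3 * expectation (\<lambda>\<omega>. (R \<omega>)\<^sup>2))"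
    using mm by simp
  also have "expectation (\<lambda>\<omega>. (R \<omega>)\<^sup>2) \<le> \<Delta>\<^sup>2 * (2 * V * (lam * mesh j)\<^sup>2)"
  proof -
    have "expectation (\<lambda>\<omega>. (R \<omega>)\<^sup>2) \<le> expectation (\<lambda>\<omega>. (\<Sum>i\<in>block l n. (mesh l)\<^sup>2 * (?D i \<omega>)\<^sup>2) * real (2 ^ l))"
    proof (rule integral_mono)
      show "integrable M (\<lambda>\<omega>. (R \<omega>)\<^sup>2)" by (rule square_integrableD(2)[OF sR])
      show "integrable M (\<lambda>\<omega>. (\<Sum>i\<in>block l n. (mesh l)\<^sup>2 * (?D i \<omega>)\<^sup>2) * real (2 ^ l))"
        by (intro integrable_mult_left integrable_mult_right Bochner_Integration.integrable_sum square_integrableD(2) sD)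
      fix \<omega> show "(R \<omega>)\<^sup>2 \<le> (\<Sum>i\<in>block l n. (mesh l)\<^sup>2 * (?D i \<omega>)\<^sup>2) * real (2 ^ l)"
        using sum_squared_le_sum_of_squares[of "\<lambda>i. mesh l * \<bar>?D i \<omega>\<bar>" "block l n"] block_facts(2)[OF n, of l]
        by (simp add: R_def power_mult_distrib)
    qed
    also have "\<dots> = (\<Sum>i\<in>block l n. (mesh l)\<^sup>2 * expectation (\<lambda>\<omega>. (?D i \<omega>)\<^sup>2)) * real (2 ^ l)"
      using square_integrableD(2)[OF sD] by simp
    also have "\<dots> \<le> (\<Sum>i\<in>block l n. (mesh l)\<^sup>2 * (2 * V * (lam * mesh j)\<^sup>2)) * real (2 ^ l)"
    proof (intro mult_right_mono sum_mono mult_left_mono)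
      fix i
      have "\<bar>grid j (i div k) - grid l i\<bar> \<le> mesh j"
      proof -
        have "real i = real (i div k) * real k + real (i mod k)" by (metis div_mult_mod_eq of_nat_add of_nat_mult)
        then have "grid l i = grid j (i div k) + real (i mod k) * mesh l"
          using k(3) by (simp add: grid_def distrib_right mult.assoc)
        moreover have "real (i mod k) * mesh l \<le> real k * mesh l" using k(1) mesh_pos[of l] by (intro mult_right_mono) auto
        moreover have "0 \<le> real (i mod k) * mesh l" using mesh_pos[of l] by simp
        ultimately show ?thesis using k(3) by simp
      qed
      then have "\<bar>lam * (grid j (i div k) - grid l i)\<bar> \<le> lam * mesh j" using lam by (simp add: abs_mult)
      then have "(lam * (grid j (i div k) - grid l i))\<^sup>2 \<le> (lam * mesh j)\<^sup>2"
        using lam mesh_pos[of j] by (metis abs_le_square_iff abs_of_pos mult_pos_pos)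
      then show "expectation (\<lambda>\<omega>. (?D i \<omega>)\<^sup>2) \<le> 2 * V * (lam * mesh j)\<^sup>2"
        using V_nonneg by (intro order_trans[OF X_diff_second_moment] mult_left_mono) auto
    qed simp_all
    also have "\<dots> = (real (2 ^ l) * mesh l)\<^sup>2 * (2 * V * (lam * mesh j)\<^sup>2)"
      using block_facts(2)[OF n, of l] by (simp add: power2_eq_square)
    finally show ?thesis unfolding card_mesh .
  qed
  finally show ?thesis by (simp add: ennreal_leI)
qed

lemma approx_Cauchy:
  assumes n: "1 \<le> n" and "e > 0"
  shows "\<exists>N. \<forall>j\<ge>N. \<forall>l\<ge>N. (\<integral>\<^sup>+\<omega>. ennreal ((approx n j \<omega> - approx n l \<omega>) ^ 4) \<partial>M) \<le> ennreal e"
proof -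
  have "(\<lambda>j. 3 * (\<Delta>\<^sup>2 * (2 * V * (lam * mesh j)\<^sup>2))) \<longlonglongrightarrow> 3 * (\<Delta>\<^sup>2 * (2 * V * (lam * 0)\<^sup>2))"
    by (intro tendsto_intros mesh_tendsto)
  then have lim: "(\<lambda>j. 3 * (\<Delta>\<^sup>2 * (2 * V * (lam * mesh j)\<^sup>2))) \<longlonglongrightarrow> 0" by simp
  obtain N where N: "\<And>j. j \<ge> N \<Longrightarrow> 3 * (\<Delta>\<^sup>2 * (2 * V * (lam * mesh j)\<^sup>2)) < e"
    using order_tendstoD(2)[OF lim \<open>e > 0\<close>] by (auto simp: eventually_sequentially)
  have le: "(\<integral>\<^sup>+\<omega>. ennreal ((approx n j \<omega> - approx n l \<omega>) ^ 4) \<partial>M) \<le> ennreal e" if "N \<le> j" "j \<le> l" for j l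
    using N[OF that(1)] by (intro order_trans[OF approx_Cauchy_le[OF n that(2)]] ennreal_leI) simp
  have sym: "(x - y) ^ 4 = (y - x) ^ 4" for x y :: real by (simp add: power4_eq_xxxx algebra_simps)
  have "(\<integral>\<^sup>+\<omega>. ennreal ((approx n j \<omega> - approx n l \<omega>) ^ 4) \<partial>M) \<le> ennreal e" if "N \<le> j" "N \<le> l" for j l
  proof (cases "j \<le> l")
    case False
    then show ?thesis using le[of l j] that by (simp add: sym[of "approx n j _"])
  qed (use le that in auto)
  then show ?thesis by blast
qed

end

end

lemma (in prob_space) covar_eq:
  assumes U: "square_integrable M U" and V: "square_integrable M V"
  shows "covar M U V = expectation (\<lambda>\<omega>. U \<omega> * V \<omega>) - expectation U * expectation V"
proof -
  note i = square_integrable_imp_integrable[OF U] square_integrable_imp_integrable[OF V] square_integrable_mult[OF U V]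
  have "covar M U V = expectation (\<lambda>\<omega>. U \<omega> * V \<omega> - expectation V * U \<omega> - expectation U * V \<omega> + expectation U * expectation V)"
    unfolding covar_def mean_def by (intro Bochner_Integration.integral_cong refl) (simp add: algebra_simps)
  also have "\<dots> = expectation (\<lambda>\<omega>. U \<omega> * V \<omega>) - expectation V * expectation U - expectation U * expectation V + expectation U * expectation V"
    using i by (simp add: prob_space)
  finally show ?thesis by simp
qed

section \<open>From the Ito integral of the model to the dyadic approximations\<close>

context volatility
begin

context
  fixes \<Delta> :: real
  assumes \<Delta>: "\<Delta> > 0"
begin

text \<open>Unlike \<open>weight\<close>, not confined to one period: the model speaks of Ito
  integrals that start at time 0.\<close>

definition sqrt_grid :: "nat \<Rightarrow> nat \<Rightarrow> 'a \<Rightarrow> real" where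
  "sqrt_grid j i \<omega> = sqrt (X (grid \<Delta> j i) \<omega>)"

lemma sqrt_grid_adapted: "adapted_step (n * 2 ^ j) (grid \<Delta> j) (sqrt_grid j)"
  unfolding adapted_step_def
proof (intro conjI allI impI)
  fix i
  have [measurable]: "X (grid \<Delta> j i) \<in> borel_measurable (F (grid \<Delta> j i))" by (rule X_adapted[OF grid_simps(4)[OF \<Delta>]])
  show "sqrt_grid j i \<in> borel_measurable (F (grid \<Delta> j i))" unfolding sqrt_grid_def[abs_def] by measurable
qed (auto intro: grid_simps[OF \<Delta>])

lemma simple_value_grid:
  assumes s: "0 < s" "s \<le> real n * \<Delta>"
  obtains i where "grid \<Delta> j i < s" "s \<le> grid \<Delta> j (Suc i)" "\<And>\<omega>. simple_value (n * 2 ^ j) (grid \<Delta> j) (sqrt_grid j) s \<omega> = sqrt_grid j i \<omega>"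
proof -
  let ?h = "mesh \<Delta> j"
  have h: "0 < ?h" by (rule mesh_pos[OF \<Delta>])
  define y where "y = s / ?h"
  have y0: "0 < y" using s h by (simp add: y_def)
  have iff: "grid \<Delta> j i < s \<longleftrightarrow> real i < y" "s \<le> grid \<Delta> j i \<longleftrightarrow> y \<le> real i" for i
    using h by (auto simp: grid_def[OF \<Delta>] y_def pos_less_divide_eq pos_divide_le_eq)
  have yn: "y \<le> real (n * 2 ^ j)" using s(2) unfolding iff(2)[symmetric] by (simp only: grid_simps(5)[OF \<Delta>])
  \<comment> \<open>The ceiling minus 1, and not the floor, because the cells are left-open and
    right-closed.\<close>
  define i where "i = nat (\<lceil>y\<rceil> - 1)"
  have c1: "1 \<le> \<lceil>y\<rceil>" using y0 by simp
  have ri: "real i = of_int \<lceil>y\<rceil> - 1" using c1 by (simp add: i_def)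
  have iy: "real i < y" "y \<le> real (Suc i)" using ri by (simp_all, linarith+)
  have "i < n * 2 ^ j" using iy(1) yn by (metis less_le_trans of_nat_less_iff)
  have uniq: "grid \<Delta> j i' < s \<and> s \<le> grid \<Delta> j (Suc i') \<longleftrightarrow> i' = i" for i'
  proof
    assume "grid \<Delta> j i' < s \<and> s \<le> grid \<Delta> j (Suc i')"
    then have "real i' < real (Suc i)" "real i < real (Suc i')" using iy unfolding iff by linarith+
    then show "i' = i" unfolding of_nat_less_iff by simp
  qed (use iy in \<open>simp add: iff\<close>)
  have "simple_value (n * 2 ^ j) (grid \<Delta> j) (sqrt_grid j) s \<omega> = sqrt_grid j i \<omega>" for \<omega>
  proof -
    have "simple_value (n * 2 ^ j) (grid \<Delta> j) (sqrt_grid j) s \<omega> = (\<Sum>i'<n * 2 ^ j. if i' = i then sqrt_grid j i \<omega> else 0)"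
      unfolding simple_value_def
    proof (intro sum.cong refl)
      fix i'
      show "sqrt_grid j i' \<omega> * indicator {grid \<Delta> j i'<..grid \<Delta> j (Suc i')} s = (if i' = i then sqrt_grid j i \<omega> else 0)"
      proof (cases "i' = i")
        case False
        then have "s \<notin> {grid \<Delta> j i'<..grid \<Delta> j (Suc i')}" using uniq[of i'] by simp
        then show ?thesis using False by simp
      qed (use uniq[of i] in simp)
    qed
    then show ?thesis using \<open>i < n * 2 ^ j\<close> by simp
  qed
  moreover have "grid \<Delta> j i < s" "s \<le> grid \<Delta> j (Suc i)" using iy unfolding iff by auto
  ultimately show ?thesis by (intro that[of i])
qed

text \<open>After interchanging expectation and time integral, \<open>sqrt_diff_square_le\<close>
  reduces the error at each time to a first moment of a difference of X, which is of the order of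
  the mesh.\<close>

lemma sqrt_grid_error:
  assumes n: "1 \<le> n"
  defines "T \<equiv> real n * \<Delta>"
  shows "(\<integral>\<^sup>+\<omega>. (\<integral>\<^sup>+s\<in>{0..T}. ennreal ((simple_value (n * 2 ^ j) (grid \<Delta> j) (sqrt_grid j) s \<omega> - sqrt (X s \<omega>))\<^sup>2) \<partial>lborel) \<partial>M)
    \<le> ennreal (T * (sqrt (2 * V) * lam * mesh \<Delta> j))"
proof -
  have T: "0 \<le> T" using \<Delta> by (simp add: T_def)
  let ?v = "simple_value (n * 2 ^ j) (grid \<Delta> j) (sqrt_grid j)"
  let ?C = "sqrt (2 * V) * lam * mesh \<Delta> j"
  have C0: "0 \<le> ?C" using V_nonneg lam mesh_pos[OF \<Delta>, of j] by simp
  have [measurable]: "(\<lambda>z. clamped T (fst z) (snd z)) \<in> borel_measurable (borel \<Otimes>\<^sub>M M)"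
    "(\<lambda>z. ?v (fst z) (snd z)) \<in> borel_measurable (borel \<Otimes>\<^sub>M M)"
    using clamped_measurable[OF T] simple_value_measurable[OF sqrt_grid_adapted] by (simp_all add: case_prod_unfold)
  have D: "(\<lambda>(s, \<omega>). (?v s \<omega> - sqrt (clamped T s \<omega>))\<^sup>2) \<in> borel_measurable (borel \<Otimes>\<^sub>M M)"
    unfolding case_prod_unfold by measurable
  have "(\<integral>\<^sup>+\<omega>. (\<integral>\<^sup>+s\<in>{0..T}. ennreal ((?v s \<omega> - sqrt (X s \<omega>))\<^sup>2) \<partial>lborel) \<partial>M) =
    (\<integral>\<^sup>+\<omega>. (\<integral>\<^sup>+s\<in>{0..T}. ennreal ((?v s \<omega> - sqrt (clamped T s \<omega>))\<^sup>2) \<partial>lborel) \<partial>M)"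
    by (intro nn_integral_cong) (auto simp: clamped_def split: split_indicator)
  also have "\<dots> = (\<integral>\<^sup>+s\<in>{0..T}. (\<integral>\<^sup>+\<omega>. ennreal ((?v s \<omega> - sqrt (clamped T s \<omega>))\<^sup>2) \<partial>M) \<partial>lborel)"
    by (rule nn_integral_time_swap[OF D]) simp
  also have "\<dots> \<le> (\<integral>\<^sup>+s. ennreal ?C * indicator {0..T} s \<partial>lborel)"
  proof (rule nn_integral_mono_AE)
    \<comment> \<open>Time 0 is excluded as it belongs to no cell, so the step process is 0
      there.\<close>
    show "AE s in lborel. (\<integral>\<^sup>+\<omega>. ennreal ((?v s \<omega> - sqrt (clamped T s \<omega>))\<^sup>2) \<partial>M) * indicator {0..T} s \<le> ennreal ?C * indicator {0..T} s"
      using AE_lborel_singleton[of 0]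
    proof eventually_elim
      case (elim s)
      show ?case
      proof (cases "s \<in> {0..T}")
        case True
        then have s: "0 < s" "s \<le> real n * \<Delta>" "s \<le> T" using elim by (auto simp: T_def)
        obtain i where i: "grid \<Delta> j i < s" "s \<le> grid \<Delta> j (Suc i)" "\<And>\<omega>. ?v s \<omega> = sqrt_grid j i \<omega>"
          using simple_value_grid[OF s(1,2), of j] by metis
        let ?a = "grid \<Delta> j i"
        have "(\<integral>\<^sup>+\<omega>. ennreal ((?v s \<omega> - sqrt (clamped T s \<omega>))\<^sup>2) \<partial>M) \<le> (\<integral>\<^sup>+\<omega>. ennreal \<bar>X ?a \<omega> - X s \<omega>\<bar> \<partial>M)"
        proof (rule nn_integral_mono_AE)
          show "AE \<omega> in M. ennreal ((?v s \<omega> - sqrt (clamped T s \<omega>))\<^sup>2) \<le> ennreal \<bar>X ?a \<omega> - X s \<omega>\<bar>"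
            using X_nonneg[of ?a] X_nonneg[of s]
            by eventually_elim (use s in \<open>auto simp: i(3) sqrt_grid_def clamped_def intro!: ennreal_leI sqrt_diff_square_le\<close>)
        qed
        also have "\<dots> = ennreal (expectation (\<lambda>\<omega>. \<bar>X ?a \<omega> - X s \<omega>\<bar>))"
          using square_integrable_imp_integrable[OF square_integrable_diff[OF X_si X_si]] by (intro nn_integral_eq_integral) auto
        also have "\<dots> \<le> ennreal ?C"
        proof (intro ennreal_leI order_trans[OF X_diff_first_moment] mult_left_mono)
          show "\<bar>?a - s\<bar> \<le> mesh \<Delta> j" using i(1,2) grid_simps(2)[OF \<Delta>, of j i] by linarith
        qed (use V_nonneg lam in auto)
        finally show ?thesis using True by simp
      qed simp
    qed
  qed
  also have "\<dots> = ennreal (T * ?C)"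
  proof -
    have "(\<integral>\<^sup>+s. ennreal ?C * indicator {0..T} s \<partial>lborel) = ennreal ?C * ennreal T"
      using T by (subst nn_integral_cmult_indicator) auto
    also have "\<dots> = ennreal (?C * T)" by (rule ennreal_mult[OF C0 T, symmetric])
    finally show ?thesis by (simp only: mult.commute)
  qed
  finally show ?thesis .
qed

text \<open>Markov's inequality turns the expected error into convergence in probability, and
  \<open>ito_integral_approximation\<close> then admits the grid values of \<open>sqrt X\<close> as
  an approximating sequence.\<close>

lemma simple_ito_grid_conv:
  assumes n: "1 \<le> n" and ito: "has_ito_integral M F W (\<lambda>u \<omega>. sqrt (X u \<omega>)) (real n * \<Delta>) I"
  shows "conv_in_prob M (\<lambda>j. simple_ito W (n * 2 ^ j) (grid \<Delta> j) (sqrt_grid j) (real n * \<Delta>)) I"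
proof (rule ito_integral_approximation[OF ito])
  let ?T = "real n * \<Delta>"
  show T: "0 < ?T" using n \<Delta> by simp
  show "adapted_step (n * 2 ^ j) (grid \<Delta> j) (sqrt_grid j)" for j by (rule sqrt_grid_adapted)
  fix \<epsilon> :: real assume \<epsilon>: "\<epsilon> > 0"
  let ?E = "\<lambda>j \<omega>. \<integral>\<^sup>+s\<in>{0..?T}. ennreal ((simple_value (n * 2 ^ j) (grid \<Delta> j) (sqrt_grid j) s \<omega> - sqrt (X s \<omega>))\<^sup>2) \<partial>lborel"
  have H: "progressive F (\<lambda>u \<omega>. sqrt (X u \<omega>))" using ito by (simp add: has_ito_integral_def)
  have [measurable]: "?E j \<in> borel_measurable M" for j
    using T by (intro simple_value_error_measurable[OF sqrt_grid_adapted H]) auto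
  let ?b = "\<lambda>j. ?T * (sqrt (2 * V) * lam * mesh \<Delta> j)"
  have b0: "0 \<le> ?b j" for j using T V_nonneg lam mesh_pos[OF \<Delta>, of j] by simp
  have bound: "prob {\<omega>\<in>space M. ennreal \<epsilon> < ?E j \<omega>} \<le> ?b j / \<epsilon>" for j
  proof -
    have "ennreal \<epsilon> * emeasure M {\<omega>\<in>space M. ennreal \<epsilon> < ?E j \<omega>} = (\<integral>\<^sup>+\<omega>. ennreal \<epsilon> * indicator {\<omega>\<in>space M. ennreal \<epsilon> < ?E j \<omega>} \<omega> \<partial>M)"
      by (subst nn_integral_cmult_indicator) auto
    also have "\<dots> \<le> (\<integral>\<^sup>+\<omega>. ?E j \<omega> \<partial>M)"
      by (intro nn_integral_mono) (auto split: split_indicator)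
    also have "\<dots> \<le> ennreal (?b j)" by (rule sqrt_grid_error[OF n])
    finally have "ennreal (\<epsilon> * prob {\<omega>\<in>space M. ennreal \<epsilon> < ?E j \<omega>}) \<le> ennreal (?b j)"
      using \<epsilon> by (simp add: emeasure_eq_measure ennreal_mult)
    then have "\<epsilon> * prob {\<omega>\<in>space M. ennreal \<epsilon> < ?E j \<omega>} \<le> ?b j" using b0[of j] by simp
    then show ?thesis using \<epsilon> by (simp add: pos_le_divide_eq mult.commute)
  qed
  have "(\<lambda>j. ?b j / \<epsilon>) \<longlonglongrightarrow> ?T * (sqrt (2 * V) * lam * 0) / \<epsilon>"
    using \<epsilon> by (intro tendsto_intros mesh_tendsto[OF \<Delta>]) auto
  then have lim: "(\<lambda>j. ?b j / \<epsilon>) \<longlonglongrightarrow> 0" by simp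
  show "(\<lambda>j. prob {\<omega>\<in>space M. ennreal \<epsilon> < ?E j \<omega>}) \<longlonglongrightarrow> 0"
    by (rule tendsto_sandwich[OF _ _ tendsto_const lim]) (simp, intro always_eventually allI bound)
qed

lemma simple_ito_grid_eq:
  "simple_ito W (n * 2 ^ j) (grid \<Delta> j) (sqrt_grid j) (real n * \<Delta>) \<omega> = (\<Sum>i<n * 2 ^ j. sqrt_grid j i \<omega> * incr \<Delta> j i \<omega>)"
  unfolding simple_ito_def
proof (intro sum.cong refl)
  fix i assume i: "i \<in> {..<n * 2 ^ j}"
  have "grid \<Delta> j k \<le> grid \<Delta> j (n * 2 ^ j)" if "k \<le> n * 2 ^ j" for k
  proof -
    have "real k \<le> real (n * 2 ^ j)" using that by (simp only: of_nat_le_iff)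
    then show ?thesis using mesh_pos[OF \<Delta>, of j] unfolding grid_def[OF \<Delta>] by (intro mult_right_mono) auto
  qed
  from this[of i] this[of "Suc i"] i
  have "min (real n * \<Delta>) (grid \<Delta> j i) = grid \<Delta> j i" "min (real n * \<Delta>) (grid \<Delta> j (Suc i)) = grid \<Delta> j (Suc i)"
    unfolding grid_simps(5)[OF \<Delta>] by (auto simp: min_def)
  then show "sqrt_grid j i \<omega> * (W (min (real n * \<Delta>) (grid \<Delta> j (Suc i))) \<omega> - W (min (real n * \<Delta>) (grid \<Delta> j i)) \<omega>) = sqrt_grid j i \<omega> * incr \<Delta> j i \<omega>"
    by (simp add: incr_def[OF \<Delta>])
qed

text \<open>Integrals from 0 to both ends of the period are available; subtracting their sums leaves
  exactly the cells of the period.\<close>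

lemma approx_eq_diff:
  assumes n: "1 \<le> n"
  shows "approx \<Delta> n j \<omega> = (\<Sum>i<n * 2 ^ j. sqrt_grid j i \<omega> * incr \<Delta> j i \<omega>) - (\<Sum>i<(n - 1) * 2 ^ j. sqrt_grid j i \<omega> * incr \<Delta> j i \<omega>)"
proof -
  have "approx \<Delta> n j \<omega> = (\<Sum>i\<in>{(n - 1) * 2 ^ j..<n * 2 ^ j}. sqrt_grid j i \<omega> * incr \<Delta> j i \<omega>)"
    unfolding approx_def[OF \<Delta>] by (intro sum.mono_neutral_cong_right) (auto simp: weight_def[OF \<Delta>] block_def[OF \<Delta>] sqrt_grid_def)
  also have "\<dots> = (\<Sum>i<n * 2 ^ j. sqrt_grid j i \<omega> * incr \<Delta> j i \<omega>) - (\<Sum>i<(n - 1) * 2 ^ j. sqrt_grid j i \<omega> * incr \<Delta> j i \<omega>)"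
    unfolding lessThan_atLeast0 by (rule sum_diff_nat_ivl[symmetric]) (auto intro: mult_le_mono1)
  finally show ?thesis .
qed

context
  fixes Y :: "real \<Rightarrow> 'a \<Rightarrow> real"
  assumes Y: "stochastic_volatility_model M F W 0 0 X Y"
begin

definition price_change :: "nat \<Rightarrow> 'a \<Rightarrow> real" where
  "price_change n \<omega> = Y (real n * \<Delta>) \<omega> - Y ((real n - 1) * \<Delta>) \<omega>"

lemma Y_measurable: "0 \<le> t \<Longrightarrow> Y t \<in> borel_measurable M"
  using Y by (simp add: stochastic_volatility_model_def)

lemma partial_conv:
  "conv_in_prob M (\<lambda>j \<omega>. \<Sum>i<n * 2 ^ j. sqrt_grid j i \<omega> * incr \<Delta> j i \<omega>) (\<lambda>\<omega>. Y (real n * \<Delta>) \<omega> - Y 0 \<omega>)"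
proof (cases "n = 0")
  \<comment> \<open>Both the sums and their limit are 0 here. This case stands apart since the
    approximation result asks for a positive time horizon.\<close>
  case True
  then show ?thesis by (simp add: conv_in_prob_def)
next
  case False
  then have n: "1 \<le> n" "0 \<le> real n * \<Delta>" using \<Delta> by auto
  obtain I where I: "has_ito_integral M F W (\<lambda>u \<omega>. sqrt (X u \<omega>)) (real n * \<Delta>) I"
    and eq: "AE \<omega> in M. Y (real n * \<Delta>) \<omega> = Y 0 \<omega> + (LBINT u:{0..real n * \<Delta>}. 0 + 0 * X u \<omega>) + I \<omega>"
    using Y n(2) unfolding stochastic_volatility_model_def by blast
  have c: "conv_in_prob M (\<lambda>j \<omega>. \<Sum>i<n * 2 ^ j. sqrt_grid j i \<omega> * incr \<Delta> j i \<omega>) I"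
    using simple_ito_grid_conv[OF n(1) I] unfolding simple_ito_grid_eq[abs_def] .
  show ?thesis
  proof (rule conv_in_prob_cong_AE[OF c])
    show "\<And>j. (\<lambda>\<omega>. \<Sum>i<n * 2 ^ j. sqrt_grid j i \<omega> * incr \<Delta> j i \<omega>) \<in> borel_measurable M"
      using c by (simp add: conv_in_prob_def)
    show "(\<lambda>\<omega>. Y (real n * \<Delta>) \<omega> - Y 0 \<omega>) \<in> borel_measurable M"
      using n(2) by (intro borel_measurable_diff Y_measurable) auto
    show "AE \<omega> in M. Y (real n * \<Delta>) \<omega> - Y 0 \<omega> = I \<omega>"
      using eq by eventually_elim (simp add: set_lebesgue_integral_def)
  qed simp
qed

lemma price_change_square_l2:
  assumes n: "1 \<le> n"
  shows "l2_tendsto M (\<lambda>j \<omega>. (approx \<Delta> n j \<omega>)\<^sup>2) (\<lambda>\<omega>. (price_change n \<omega>)\<^sup>2)"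
proof (rule Cauchy_l4_imp_l2_tendsto_square[OF approx_moments(1,2)[OF \<Delta>] approx_Cauchy[OF \<Delta> n]])
  have "(\<lambda>j \<omega>. (\<Sum>i<n * 2 ^ j. sqrt_grid j i \<omega> * incr \<Delta> j i \<omega>) - (\<Sum>i<(n - 1) * 2 ^ j. sqrt_grid j i \<omega> * incr \<Delta> j i \<omega>)) = approx \<Delta> n"
    using approx_eq_diff[OF n] by (intro ext) simp
  moreover have "(\<lambda>\<omega>. (Y (real n * \<Delta>) \<omega> - Y 0 \<omega>) - (Y (real (n - 1) * \<Delta>) \<omega> - Y 0 \<omega>)) = price_change n"
    using n by (intro ext) (simp add: price_change_def of_nat_diff)
  ultimately show "conv_in_prob M (approx \<Delta> n) (price_change n)"
    using conv_in_prob_diff[OF partial_conv[of n] partial_conv[of "n - 1"]] by simp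
qed

section \<open>Moments of integrated volatility and of squared returns\<close>

abbreviation block_integral :: "nat \<Rightarrow> 'a \<Rightarrow> real" where
  "block_integral n \<equiv> integrated ((real n - 1) * \<Delta>) (real n * \<Delta>)"

lemma block_bounds: "1 \<le> n \<Longrightarrow> 0 \<le> (real n - 1) * \<Delta>" "(real n - 1) * \<Delta> \<le> real n * \<Delta>"
  using \<Delta> by auto

lemma block_integral_moments:
  assumes n: "1 \<le> n"
  shows "square_integrable M (block_integral n)" "expectation (block_integral n) = c * \<Delta>"
    "expectation (\<lambda>\<omega>. (block_integral n \<omega>)\<^sup>2) = 2 * V * acf_bar lam \<Delta> + (c * \<Delta>)\<^sup>2"
    "1 \<le> s \<Longrightarrow> expectation (\<lambda>\<omega>. block_integral n \<omega> * block_integral (n + s) \<omega>) = V * acf_diff lam \<Delta> s + (c * \<Delta>)\<^sup>2"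
proof -
  note b = block_bounds(1)[OF n] block_bounds(2)[of n]
  show "square_integrable M (block_integral n)" by (rule integrated_square_integrable[OF b(1,2)])
  have d: "real n * \<Delta> - (real n - 1) * \<Delta> = \<Delta>" for n by (simp add: algebra_simps)
  show "expectation (block_integral n) = c * \<Delta>" using integrated_mean[OF b(1,2)] by (simp add: d)
  show "expectation (\<lambda>\<omega>. (block_integral n \<omega>)\<^sup>2) = 2 * V * acf_bar lam \<Delta> + (c * \<Delta>)\<^sup>2"
    using integrated_covariance[OF b(1,2) b(1,2)] double_integral_acf_same[OF lam b(2)] acf_bar_eq[OF lam, of \<Delta>] \<Delta>
    by (simp add: d power2_eq_square)
  assume s: "1 \<le> s"
  have n': "1 \<le> n + s" using n by simp
  have le: "real n * \<Delta> \<le> (real (n + s) - 1) * \<Delta>" using s \<Delta> by (intro mult_right_mono) auto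
  have diffs: "real (n + s) * \<Delta> - (real n - 1) * \<Delta> = \<Delta> * (real s + 1)" "(real (n + s) - 1) * \<Delta> - (real n - 1) * \<Delta> = \<Delta> * real s"
    "real (n + s) * \<Delta> - real n * \<Delta> = \<Delta> * real s" "(real (n + s) - 1) * \<Delta> - real n * \<Delta> = \<Delta> * (real s - 1)"
    by (simp_all add: algebra_simps)
  show "expectation (\<lambda>\<omega>. block_integral n \<omega> * block_integral (n + s) \<omega>) = V * acf_diff lam \<Delta> s + (c * \<Delta>)\<^sup>2"
    unfolding integrated_covariance[OF b(1,2) block_bounds(1)[OF n'] block_bounds(2)]
      double_integral_acf_later[OF lam b(2) le block_bounds(2)] diffs d acf_diff_eq_acf_dint[OF lam \<Delta> s]
    by (simp add: power2_eq_square)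
qed

text \<open>Each identity holds at every level of the grid between \<open>approx\<close> and
  \<open>riemann\<close>. The squares of the former and the latter themselves converge in mean
  square, so expectations and expected products pass to the limit on both sides.\<close>

lemma price_change_square_moments:
  assumes n: "1 \<le> n"
  shows "square_integrable M (\<lambda>\<omega>. (price_change n \<omega>)\<^sup>2)" "expectation (\<lambda>\<omega>. (price_change n \<omega>)\<^sup>2) = c * \<Delta>"
    "expectation (\<lambda>\<omega>. (price_change n \<omega>)\<^sup>2 * (price_change n \<omega>)\<^sup>2) = 3 * (2 * V * acf_bar lam \<Delta> + (c * \<Delta>)\<^sup>2)"
    "1 \<le> s \<Longrightarrow> expectation (\<lambda>\<omega>. (price_change n \<omega>)\<^sup>2 * (price_change (n + s) \<omega>)\<^sup>2) = V * acf_diff lam \<Delta> s + (c * \<Delta>)\<^sup>2"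
proof -
  note l = price_change_square_l2[OF n] and R = riemann_l2[OF \<Delta> n] and B = block_integral_moments[OF n]
  show "square_integrable M (\<lambda>\<omega>. (price_change n \<omega>)\<^sup>2)" using l by (simp add: l2_tendsto_def)
  have "(\<lambda>j. expectation (\<lambda>\<omega>. (approx \<Delta> n j \<omega>)\<^sup>2)) \<longlonglongrightarrow> expectation (block_integral n)"
    unfolding approx_moments(4)[OF \<Delta>] by (rule l2_tendsto_mean[OF R])
  from LIMSEQ_unique[OF l2_tendsto_mean[OF l] this] show "expectation (\<lambda>\<omega>. (price_change n \<omega>)\<^sup>2) = c * \<Delta>" by (simp add: B)
  have "(\<lambda>j. 3 * expectation (\<lambda>\<omega>. riemann \<Delta> n j \<omega> * riemann \<Delta> n j \<omega>)) \<longlonglongrightarrow> 3 * expectation (\<lambda>\<omega>. block_integral n \<omega> * block_integral n \<omega>)"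
    by (intro tendsto_mult tendsto_const l2_tendsto_mult R)
  moreover have "3 * expectation (\<lambda>\<omega>. riemann \<Delta> n j \<omega> * riemann \<Delta> n j \<omega>) = expectation (\<lambda>\<omega>. (approx \<Delta> n j \<omega>)\<^sup>2 * (approx \<Delta> n j \<omega>)\<^sup>2)" for j
    using approx_moments(3)[OF \<Delta>, of n j] by (simp add: power2_eq_square power4_eq_xxxx mult.assoc)
  ultimately have "(\<lambda>j. expectation (\<lambda>\<omega>. (approx \<Delta> n j \<omega>)\<^sup>2 * (approx \<Delta> n j \<omega>)\<^sup>2)) \<longlonglongrightarrow> 3 * expectation (\<lambda>\<omega>. block_integral n \<omega> * block_integral n \<omega>)"
    by simp
  from LIMSEQ_unique[OF l2_tendsto_mult[OF l l] this]
  show "expectation (\<lambda>\<omega>. (price_change n \<omega>)\<^sup>2 * (price_change n \<omega>)\<^sup>2) = 3 * (2 * V * acf_bar lam \<Delta> + (c * \<Delta>)\<^sup>2)"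
    using B(3) by (simp add: power2_eq_square)
  assume s: "1 \<le> s"
  have n': "1 \<le> n + s" "n < n + s" using s by auto
  have "(\<lambda>j. expectation (\<lambda>\<omega>. (approx \<Delta> n j \<omega>)\<^sup>2 * (approx \<Delta> (n + s) j \<omega>)\<^sup>2)) \<longlonglongrightarrow> expectation (\<lambda>\<omega>. block_integral n \<omega> * block_integral (n + s) \<omega>)"
    unfolding approx_cross_moment[OF \<Delta> n n'(2)] by (rule l2_tendsto_mult[OF R riemann_l2[OF \<Delta> n'(1)]])
  from LIMSEQ_unique[OF l2_tendsto_mult[OF l price_change_square_l2[OF n'(1)]] this]
  show "expectation (\<lambda>\<omega>. (price_change n \<omega>)\<^sup>2 * (price_change (n + s) \<omega>)\<^sup>2) = V * acf_diff lam \<Delta> s + (c * \<Delta>)\<^sup>2"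
    using B(4)[OF s] by simp
qed

text \<open>A nonnegative variable with mean 0 vanishes almost surely, which contradicts the second
  moment \<open>V + c\<^sup>2\<close>. This makes the term with \<open>c\<^sup>2 / V\<close>
  strictly positive, and with it the variance of the squared returns.\<close>

lemma mean_pos: "V > 0 \<Longrightarrow> c > 0"
proof (rule ccontr)
  assume V: "V > 0" and "\<not> c > 0"
  have "0 \<le> expectation (X 0)" using X_nonneg by (intro integral_nonneg_AE)
  then have c: "c = 0" using \<open>\<not> c > 0\<close> X_mean[of 0] by simp
  then have "AE \<omega> in M. X 0 \<omega> = 0"
    using integral_nonneg_eq_0_iff_AE[OF square_integrable_imp_integrable[OF X_si] X_nonneg, of 0] X_mean[of 0] by simp
  then have "expectation (\<lambda>\<omega>. X 0 \<omega> * X 0 \<omega>) = expectation (\<lambda>_. 0)" by (intro integral_cong_AE) auto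
  then show False using X_product[of 0 0] V c by (simp add: acf_def)
qed

lemma block_integral_covariance:
  assumes n: "1 \<le> n" and s: "1 \<le> s"
  shows "has_covariance M (block_integral n) (block_integral (n + s)) (V * acf_diff lam \<Delta> s)"
proof -
  have n': "1 \<le> n + s" using n by simp
  show ?thesis
    unfolding has_covariance_def
    using covar_eq[OF block_integral_moments(1)[OF n] block_integral_moments(1)[OF n']] block_integral_moments(1,2)[OF n]
      block_integral_moments(1,2)[OF n'] block_integral_moments(4)[OF n s]
    by (simp add: power2_eq_square)
qed

lemma price_change_square_correlation:
  assumes n: "1 \<le> n" and s: "1 \<le> s" and V: "V > 0"
  shows "has_correlation M (\<lambda>\<omega>. (price_change n \<omega>)\<^sup>2) (\<lambda>\<omega>. (price_change (n + s) \<omega>)\<^sup>2)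
    (acf_diff lam \<Delta> s / (6 * acf_bar lam \<Delta> + 2 * \<Delta>\<^sup>2 * (c\<^sup>2 / V)))"
proof -
  let ?d = "6 * acf_bar lam \<Delta> + 2 * \<Delta>\<^sup>2 * (c\<^sup>2 / V)"
  \<comment> \<open>The sign is read off probabilistically:
    \<open>2 * V * acf_bar lam \<Delta>\<close> is the variance of an integrated volatility.\<close>
  have G: "0 \<le> acf_bar lam \<Delta>"
  proof -
    have "2 * V * acf_bar lam \<Delta> = variance (block_integral 1)"
      using block_integral_moments(1-3)[OF order_refl]
      by (subst variance_eq) (auto intro: square_integrable_imp_integrable square_integrableD)
    also have "0 \<le> variance (block_integral 1)" by simp
    finally show ?thesis using V by (simp add: zero_le_mult_iff)
  qed
  have "0 < c\<^sup>2 / V" using mean_pos[OF V] V by simp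
  then have "0 < 2 * \<Delta>\<^sup>2 * (c\<^sup>2 / V)" using \<Delta> by (intro mult_pos_pos) auto
  then have d: "0 < ?d" using G by (intro add_nonneg_pos) auto
  \<comment> \<open>Fourth moment minus squared mean: 3 (2 V rbar + (c Delta)^2) - (c Delta)^2, from
    which V is factored out. The covariance carries the factor V as well, so it cancels in the
    quotient.\<close>
  have var: "var M (\<lambda>\<omega>. (price_change n \<omega>)\<^sup>2) = V * ?d" if "1 \<le> n" for n
    unfolding covar_eq[OF price_change_square_moments(1)[OF that] price_change_square_moments(1)[OF that]] price_change_square_moments(2,3)[OF that]
    using V by (simp add: power2_eq_square field_simps)
  have n': "1 \<le> n + s" using n by simp
  have cov: "covar M (\<lambda>\<omega>. (price_change n \<omega>)\<^sup>2) (\<lambda>\<omega>. (price_change (n + s) \<omega>)\<^sup>2) = V * acf_diff lam \<Delta> s"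
    unfolding covar_eq[OF price_change_square_moments(1)[OF n] price_change_square_moments(1)[OF n']] price_change_square_moments(2)[OF n]
      price_change_square_moments(2)[OF n'] price_change_square_moments(4)[OF n s]
    by (simp add: power2_eq_square)
  have "sqrt ((V * ?d) * (V * ?d)) = V * ?d" using V d by simp
  then show ?thesis
    unfolding has_correlation_def var[OF n] var[OF n'] cov
    using price_change_square_moments(1)[OF n] price_change_square_moments(1)[OF n'] V d by simp
qed

end

end

end

text \<open>The mean of X is \<open>2 * \<mu>\<close>, hence \<open>(2 * \<mu>)\<^sup>2\<close> in
  the denominator. The correlation is asserted for \<open>V > 0\<close>, where the quotient by V is
  meaningful and the squared returns have positive variance.\<close>

theorem mainTheorem7:
  fixes M :: "'a measure" and F :: "real \<Rightarrow> 'a measure"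
    and L X W Y :: "real \<Rightarrow> 'a \<Rightarrow> real" and \<nu> :: "real measure"
    and lam \<Delta> \<mu> V :: real
  assumes "prob_space M"
    and "lam > 0" and "\<Delta> > 0"
    and "two_sided_levy_process M L"
    and "self_decomposable (distr M borel (L 1))"
    and "AE \<omega> in M. 0 \<le> L 1 \<omega>"
    and "positive_levy_cgf M (L 1) \<nu>"
    and "integrable M (L 1)" and "integrable M (\<lambda>\<omega>. (L 1 \<omega>)\<^sup>2)"
    and "\<mu> = mean M (L 1)" and "V = var M (L 1)"
    and "\<And>t. has_levy_integral M (\<lambda>u. L (lam * u)) (\<lambda>u. exp (- lam * \<bar>t - u\<bar>)) (X t)"
    and "filtration (space M) F" and "\<And>t. subalgebra M (F t)"
    and "brownian_motion M F W"
    and "prob_space.indep_var M (path_space UNIV) (path_of UNIV L) (path_space {0..}) (path_of {0..} W)"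
    and "progressive F X"
    and "stochastic_volatility_model M F W 0 0 X Y"
  shows "(\<forall>t\<ge>0. acf_bar lam t =
            1 / lam\<^sup>2 * (lam * t * exp (- lam * t) + 2 * lam * t + 3 * exp (- lam * t) - 3)) \<and>
         (\<forall>s\<ge>1. acf_diff lam \<Delta> s =
            1 / lam\<^sup>2 * exp (- lam * \<Delta> * real s) *
              ((lam * \<Delta> * real s + 3) * (exp (- lam * \<Delta>) + exp (lam * \<Delta>) - 2)
                + lam * \<Delta> * (exp (- lam * \<Delta>) - exp (lam * \<Delta>)))) \<and>
         (\<forall>n\<ge>1. \<forall>s\<ge>1. has_covariance M
            (\<lambda>\<omega>. LBINT u:{(real n - 1) * \<Delta>..real n * \<Delta>}. X u \<omega>)
            (\<lambda>\<omega>. LBINT u:{(real (n + s) - 1) * \<Delta>..real (n + s) * \<Delta>}. X u \<omega>)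
            (V * acf_diff lam \<Delta> s)) \<and>
         (V > 0 \<longrightarrow> (\<forall>n\<ge>1. \<forall>s\<ge>1. has_correlation M
            (\<lambda>\<omega>. (Y (real n * \<Delta>) \<omega> - Y ((real n - 1) * \<Delta>) \<omega>)\<^sup>2)
            (\<lambda>\<omega>. (Y (real (n + s) * \<Delta>) \<omega> - Y ((real (n + s) - 1) * \<Delta>) \<omega>)\<^sup>2)
            (acf_diff lam \<Delta> s / (6 * acf_bar lam \<Delta> + 2 * \<Delta>\<^sup>2 * ((2 * \<mu>)\<^sup>2 / V)))))"
proof -
  interpret prob_space M by fact
  have Lm: "L 1 \<in> borel_measurable M" using assms(4) by (simp add: two_sided_levy_process_def)
  have si: "square_integrable M (L 1)" using assms(9) Lm by (simp add: square_integrable_def)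
  have \<mu>: "expectation (L 1) = \<mu>" using assms(10) by (simp add: mean_def)
  have V: "expectation (\<lambda>\<omega>. (L 1 \<omega> - \<mu>)\<^sup>2) = V"
    using assms(11) unfolding covar_def mean_def \<mu> by (simp add: power2_eq_square)
  note ind = assms(16)
  note mom = moving_average_moments[OF assms(4) assms(6) si assms(2) assms(12) indep_var_rv1[OF ind], unfolded \<mu> V]
  interpret volatility M F W X lam V "2 * \<mu>" "path_space UNIV" "path_of UNIV L"
    by (rule volatility.intro[OF brownian.intro[OF prob_space_axioms brownian_axioms.intro] volatility_axioms.intro])
      (rule assms mom)+
  have 3: "has_covariance M
            (\<lambda>\<omega>. LBINT u:{(real n - 1) * \<Delta>..real n * \<Delta>}. X u \<omega>)
            (\<lambda>\<omega>. LBINT u:{(real (n + s) - 1) * \<Delta>..real (n + s) * \<Delta>}. X u \<omega>)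
            (V * acf_diff lam \<Delta> s)" if "1 \<le> n" "1 \<le> s" for n s
    using block_integral_covariance[OF assms(3) assms(18) that] unfolding integrated_def[abs_def] .
  have 4: "has_correlation M
            (\<lambda>\<omega>. (Y (real n * \<Delta>) \<omega> - Y ((real n - 1) * \<Delta>) \<omega>)\<^sup>2)
            (\<lambda>\<omega>. (Y (real (n + s) * \<Delta>) \<omega> - Y ((real (n + s) - 1) * \<Delta>) \<omega>)\<^sup>2)
            (acf_diff lam \<Delta> s / (6 * acf_bar lam \<Delta> + 2 * \<Delta>\<^sup>2 * ((2 * \<mu>)\<^sup>2 / V)))" if "1 \<le> n" "1 \<le> s" "V > 0" for n s
    using price_change_square_correlation[OF assms(3) assms(18) that] unfolding price_change_def[OF assms(3) assms(18), abs_def] .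
  have 1: "acf_bar lam t =
            1 / lam\<^sup>2 * (lam * t * exp (- lam * t) + 2 * lam * t + 3 * exp (- lam * t) - 3)" if "0 \<le> t" for t
    using acf_bar_eq[OF assms(2) that] unfolding acf_dint_def .
  note 2 = acf_diff_eq[OF assms(2,3)]
  show ?thesis
    using 1 2 3 4 by blast
qed

end
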